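(* Consider the one-dimensional wave equation $$ \begin{cases} z_{tt}(t,x)=z_{xx}(t,x)-a(x)\sigma(z_t(t,x)), & (t,x)\in\mathbb{R}_+\times[0,1],\\ z(t,0)=z(t,1)=0, & t\in\mathbb{R}_+,\\ z(0,x)=z_0(x),\quad z_t(0,x)=z_1(x), & x\in[0,1], \end{cases} \qquad (\mathrm{W}) $$ where $a:[0,1]\to\mathbb{R}_+$ is continuous, not identically zero, and bounded by a positive constant $a_\infty$, and $\sigma$ is a nonlinear damping function. Suppose moreover that $\sigma$ and $a$ are continuously differentiable, that there exists a positive constant $a_1$ such that $|a'(x)|\le a_1$ for a.e. $x\in[0,1]$, and that $\sigma$ is linearly bounded, i.e., there exists a positive constant $m$ such that $|\sigma(s)|\le m|s|$ for all $s\in\mathbb{R}$. Let $R>0$. Then there exist two positive constants $K:=K(R)$ and $\beta:=\beta(R)$ such that, for all initial conditions $(z_0,z_1)\in D_\infty(0,1)$ satisfying $$z_0'(x)=z_1'(x)=0 \ \text{ for } x\in\{0,1\},\qquad \|(z_0,z_1)\|_{D_\infty(0,1)}\le R,$$ the solution of (W) satisfies $$\|(z(t,\cdot),z_t(t,\cdot))\|_{H_\infty(0,1)}\le Ke^{-\beta t}\|(z_0,z_1)\|_{D_2(0,1)},\quad\forall t\ge 0.$$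
   Context: A function $\sigma:\mathbb{R}\to\mathbb{R}$ is called a nonlinear damping function if: (1) it is locally Lipschitz and odd; (2) $\sigma(s)s>0$ for every $s\in\mathbb{R}\setminus\{0\}$; (3) $\sigma$ is differentiable at $0$ with $\sigma'(0)=C_1$ for some $C_1>0$. For $p\in[2,\infty]$, $H_p(0,1):=W_0^{1,p}(0,1)\times L^p(0,1)$ and $D_p(0,1):=\left(W^{2,p}(0,1)\cap W_0^{1,p}(0,1)\right)\times W_0^{1,p}(0,1)$, where $W^{1,p}_0(0,1)$ consists of the functions in $W^{1,p}(0,1)$ vanishing at $0$ and $1$. Norms: $\|(f,g)\|_{H_p(0,1)}:=\|f'\|_{L^p(0,1)}+\|g\|_{L^p(0,1)}$ and $\|(f,g)\|_{D_p(0,1)}:=\|f''\|_{L^p(0,1)}+\|g'\|_{L^p(0,1)}$. The solution of (W) for $(z_0,z_1)\in D_\infty(0,1)\subset H_\infty(0,1)$ is the unique solution in $L^\infty(\mathbb{R}_+;W^{1,\infty}(0,1))\cap W^{1,\infty}(\mathbb{R}_+;L^\infty(0,1))$. Since $z_1\in W^{1,\infty}_0(0,1)$ only, the condition on $z_1'$ at the endpoints is understood as requiring that $z_1'$ has a trace (limit) there equal to $0$. *)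

theory Defs
  imports "HOL-Probability.Essential_Supremum" "HOL-Analysis.Analysis"
begin

section \<open>Damping functions\<close>

definition nonlinear_damping :: "(real \<Rightarrow> real) \<Rightarrow> bool" where
  "nonlinear_damping \<sigma> \<longleftrightarrow>
     (\<forall>s. \<exists>r>0. \<exists>L. L-lipschitz_on (cball s r) \<sigma>) \<and>
     (\<forall>s. \<sigma> (- s) = - \<sigma> s) \<and>
     (\<forall>s. s \<noteq> 0 \<longrightarrow> \<sigma> s * s > 0) \<and>
     (\<exists>C1>0. (\<sigma> has_real_derivative C1) (at 0))"


section \<open>Lebesgue and Sobolev spaces on the unit interval\<close>

abbreviation I01 :: "real measure" where
  "I01 \<equiv> lebesgue_on {0<..<1}"

text \<open>Elements of the spaces below are honest functions, not classes modulo null sets; only their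
  values on the open unit interval matter (and, for \<open>W10\<close>, on the closed one).\<close>

definition Lp :: "ennreal \<Rightarrow> (real \<Rightarrow> real) set" where
  "Lp p = {f \<in> borel_measurable I01.
     if p = \<infinity> then \<exists>C. AE x in I01. \<bar>f x\<bar> \<le> C
     else integrable I01 (\<lambda>x. \<bar>f x\<bar> powr enn2real p)}"

definition Lp_norm :: "ennreal \<Rightarrow> (real \<Rightarrow> real) \<Rightarrow> real" where
  "Lp_norm p f =
     (if p = \<infinity> then real_of_ereal (esssup I01 (\<lambda>x. ereal \<bar>f x\<bar>))
      else (LINT x|I01. \<bar>f x\<bar> powr enn2real p) powr (1 / enn2real p))"

text \<open>\<open>\<phi>\<close> is a \<open>C\<^sup>1\<close> function with derivative \<open>\<phi>'\<close> and with compact support in \<open>S\<close>.\<close>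

definition test_fun :: "real set \<Rightarrow> (real \<Rightarrow> real) \<Rightarrow> (real \<Rightarrow> real) \<Rightarrow> bool" where
  "test_fun S \<phi> \<phi>' \<longleftrightarrow>
     (\<forall>x. (\<phi> has_real_derivative \<phi>' x) (at x)) \<and> continuous_on UNIV \<phi>' \<and>
     (\<exists>K. compact K \<and> K \<subseteq> S \<and> (\<forall>x. x \<notin> K \<longrightarrow> \<phi> x = 0))"

definition is_weak_deriv :: "(real \<Rightarrow> real) \<Rightarrow> (real \<Rightarrow> real) \<Rightarrow> bool" where
  "is_weak_deriv f g \<longleftrightarrow> f \<in> Lp 1 \<and> g \<in> Lp 1 \<and>
     (\<forall>\<phi> \<phi>'. test_fun {0<..<1} \<phi> \<phi>' \<longrightarrow>
        (LINT x|I01. f x * \<phi>' x) = - (LINT x|I01. g x * \<phi> x))"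

text \<open>The weak derivative is unique up to null sets; \<open>wderiv f\<close> is some representative of it.\<close>

definition wderiv :: "(real \<Rightarrow> real) \<Rightarrow> real \<Rightarrow> real" where
  "wderiv f = (SOME g. is_weak_deriv f g)"

definition W1 :: "ennreal \<Rightarrow> (real \<Rightarrow> real) set" where
  "W1 p = {f \<in> Lp p. \<exists>g \<in> Lp p. is_weak_deriv f g}"

definition W2 :: "ennreal \<Rightarrow> (real \<Rightarrow> real) set" where
  "W2 p = {f \<in> W1 p. wderiv f \<in> W1 p}"

text \<open>To give a meaning to the boundary values, elements of \<open>W10\<close> are required to be the
  continuous representative on the closed interval.\<close>

definition W10 :: "ennreal \<Rightarrow> (real \<Rightarrow> real) set" where
  "W10 p = {f \<in> W1 p. continuous_on {0..1} f \<and> f 0 = 0 \<and> f 1 = 0}"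

definition H_space :: "ennreal \<Rightarrow> ((real \<Rightarrow> real) \<times> (real \<Rightarrow> real)) set" where
  "H_space p = W10 p \<times> Lp p"

definition D_space :: "ennreal \<Rightarrow> ((real \<Rightarrow> real) \<times> (real \<Rightarrow> real)) set" where
  "D_space p = (W2 p \<inter> W10 p) \<times> W10 p"

definition H_norm :: "ennreal \<Rightarrow> (real \<Rightarrow> real) \<times> (real \<Rightarrow> real) \<Rightarrow> real" where
  "H_norm p = (\<lambda>(f, g). Lp_norm p (wderiv f) + Lp_norm p g)"

definition D_norm :: "ennreal \<Rightarrow> (real \<Rightarrow> real) \<times> (real \<Rightarrow> real) \<Rightarrow> real" where
  "D_norm p = (\<lambda>(f, g). Lp_norm p (wderiv (wderiv f)) + Lp_norm p (wderiv g))"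

text \<open>Trace at \<open>x\<close> of a function defined up to null sets in the unit interval: its essential limit
  at \<open>x\<close>. For \<open>x\<close> an endpoint this is a one-sided limit.\<close>

definition has_trace :: "(real \<Rightarrow> real) \<Rightarrow> real \<Rightarrow> real \<Rightarrow> bool" where
  "has_trace f x c \<longleftrightarrow>
     (\<forall>\<epsilon>>0. \<exists>\<delta>>0. AE y in I01. \<bar>y - x\<bar> < \<delta> \<longrightarrow> \<bar>f y - c\<bar> < \<epsilon>)"


section \<open>The damped wave equation\<close>

text \<open>Functions of time and space are curried, time first.\<close>

abbreviation Q01 :: "(real \<times> real) measure" where
  "Q01 \<equiv> lebesgue_on ({0<..} \<times> {0<..<1})"

text \<open>\<open>L\<^sup>\<infinity>(\<real>\<^sub>+; L\<^sup>\<infinity>(0,1))\<close>, identified with \<open>L\<^sup>\<infinity>(\<real>\<^sub>+ \<times> (0,1))\<close>.\<close>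

definition Linf_Linf :: "(real \<Rightarrow> real \<Rightarrow> real) \<Rightarrow> bool" where
  "Linf_Linf w \<longleftrightarrow> (\<lambda>(t, x). w t x) \<in> borel_measurable Q01 \<and>
     (\<exists>C. AE (t, x) in Q01. \<bar>w t x\<bar> \<le> C)"

text \<open>\<open>z\<close> belongs to \<open>L\<^sup>\<infinity>(\<real>\<^sub>+; W\<^sup>1\<^sup>,\<^sup>\<infinity>(0,1))\<close>, with weak space derivative \<open>zx\<close>.\<close>

definition Linf_W1inf :: "(real \<Rightarrow> real \<Rightarrow> real) \<Rightarrow> (real \<Rightarrow> real \<Rightarrow> real) \<Rightarrow> bool" where
  "Linf_W1inf z zx \<longleftrightarrow> Linf_Linf z \<and> Linf_Linf zx \<and>
     (AE t in lebesgue_on {0<..}. is_weak_deriv (z t) (zx t))"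

text \<open>\<open>z\<close> belongs to \<open>W\<^sup>1\<^sup>,\<^sup>\<infinity>(\<real>\<^sub>+; L\<^sup>\<infinity>(0,1))\<close>, with weak time derivative \<open>zt\<close>. The integrals in time
  are equal as elements of \<open>L\<^sup>\<infinity>(0,1)\<close>, that is, for almost every \<open>x\<close>.\<close>

definition W1inf_Linf :: "(real \<Rightarrow> real \<Rightarrow> real) \<Rightarrow> (real \<Rightarrow> real \<Rightarrow> real) \<Rightarrow> bool" where
  "W1inf_Linf z zt \<longleftrightarrow> Linf_Linf z \<and> Linf_Linf zt \<and>
     (\<forall>\<theta> \<theta>'. test_fun {0<..} \<theta> \<theta>' \<longrightarrow>
        (AE x in I01. (LINT t|lebesgue_on {0<..}. \<theta>' t * z t x)
                      = - (LINT t|lebesgue_on {0<..}. \<theta> t * zt t x)))"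

text \<open>\<open>C\<^sup>1\<close> functions of \<open>(t, x)\<close> with partial derivatives \<open>\<phi>t\<close>, \<open>\<phi>x\<close>; restricted to nonnegative times
  they are the \<open>C\<^sup>1\<close> functions with compact support in \<open>[0,\<infinity>) \<times> (0,1)\<close>, so they need not vanish
  at time 0.\<close>

definition space_time_test_fun ::
    "(real \<Rightarrow> real \<Rightarrow> real) \<Rightarrow> (real \<Rightarrow> real \<Rightarrow> real) \<Rightarrow> (real \<Rightarrow> real \<Rightarrow> real) \<Rightarrow> bool" where
  "space_time_test_fun \<phi> \<phi>t \<phi>x \<longleftrightarrow>
     (\<forall>t x. ((\<lambda>s. \<phi> s x) has_real_derivative \<phi>t t x) (at t)) \<and>
     (\<forall>t x. ((\<lambda>y. \<phi> t y) has_real_derivative \<phi>x t x) (at x)) \<and>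
     continuous_on UNIV (\<lambda>(t, x). \<phi>t t x) \<and>
     continuous_on UNIV (\<lambda>(t, x). \<phi>x t x) \<and>
     (\<exists>K. compact K \<and> K \<subseteq> UNIV \<times> {0<..<1} \<and> (\<forall>t x. (t, x) \<notin> K \<longrightarrow> \<phi> t x = 0))"

text \<open>Weak solutions of \<open>z\<^sub>t\<^sub>t = z\<^sub>x\<^sub>x - a(x) \<sigma>(z\<^sub>t)\<close> with Dirichlet boundary conditions, in the class
  \<open>L\<^sup>\<infinity>(\<real>\<^sub>+; W\<^sup>1\<^sup>,\<^sup>\<infinity>(0,1)) \<inter> W\<^sup>1\<^sup>,\<^sup>\<infinity>(\<real>\<^sub>+; L\<^sup>\<infinity>(0,1))\<close>. An element of this class has a (Lipschitz) continuous
  representative, and \<open>z\<close> is required to be that one; this makes the boundary values and the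
  values at time 0 meaningful. The initial velocity enters through the boundary term at time 0
  produced by integrating by parts against a test function.\<close>

definition wave_solution ::
    "(real \<Rightarrow> real) \<Rightarrow> (real \<Rightarrow> real) \<Rightarrow> (real \<Rightarrow> real) \<Rightarrow> (real \<Rightarrow> real) \<Rightarrow>
      (real \<Rightarrow> real \<Rightarrow> real) \<Rightarrow> bool" where
  "wave_solution a \<sigma> z0 z1 z \<longleftrightarrow>
     continuous_on ({0..} \<times> {0..1}) (\<lambda>(t, x). z t x) \<and>
     (\<forall>t\<ge>0. z t 0 = 0 \<and> z t 1 = 0) \<and>
     (\<forall>x\<in>{0..1}. z 0 x = z0 x) \<and>
     (\<exists>zx zt. Linf_W1inf z zx \<and> W1inf_Linf z zt \<and>
        (\<forall>\<phi> \<phi>t \<phi>x. space_time_test_fun \<phi> \<phi>t \<phi>x \<longrightarrow>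
           (LINT (t, x)|Q01. zt t x * \<phi>t t x - zx t x * \<phi>x t x - a x * \<sigma> (zt t x) * \<phi> t x)
           + (LINT x|I01. z1 x * \<phi> 0 x) = 0))"

text \<open>\<open>g\<close> is the value at the single time \<open>t \<ge> 0\<close> of \<open>z\<^sub>t\<close>: the derivative of \<open>s \<mapsto> z(s, \<cdot>)\<close> as a curve
  in \<open>L\<^sup>\<infinity>(0,1)\<close> (one-sided if \<open>t = 0\<close>). It is unique up to null sets.\<close>

definition has_time_deriv :: "(real \<Rightarrow> real \<Rightarrow> real) \<Rightarrow> real \<Rightarrow> (real \<Rightarrow> real) \<Rightarrow> bool" where
  "has_time_deriv z t g \<longleftrightarrow> g \<in> Lp \<infinity> \<and>
     ((\<lambda>s. Lp_norm \<infinity> (\<lambda>x. (z s x - z t x) / (s - t) - g x)) \<longlongrightarrow> 0) (at t within {0..})"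

end

theory Submission imports Defs begin

text \<open>
  On \<open>[0,1]\<close> put \<open>r(t, y) = z\<^sub>x(t, y) + z\<^sub>t(t, y)\<close> and \<open>r(t, -y) = z\<^sub>x(t, y) - z\<^sub>t(t, y)\<close>. The Dirichlet
  conditions make \<open>r\<close> a function on the circle of length 2, on which the wave equation becomes the single
  transport equation \<open>r\<^sub>t - r\<^sub>y = - b(y) \<sigma>((r(t, y) - r(t, -y)) / 2)\<close>, where \<open>b\<close> is the even periodic
  extension of \<open>a\<close>. Moreover \<open>r(t, \<cdot>)\<close> has mean zero, since \<open>z\<close> vanishes at both endpoints.

  Decay. Because \<open>\<sigma>(d)\<close> has the sign of \<open>d\<close>, the damping pulls \<open>r(t, y)\<close> and \<open>r(t, -y)\<close> towards each other,
  so a bound \<open>\<bar>r\<bar> \<le> B\<close> persists (\<open>damped_transport_bounded\<close>). In particular, for data of size at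
  most \<open>R\<close> only the values of \<open>\<sigma>\<close> on \<open>[-R, R]\<close> matter, and there \<open>c \<bar>d\<bar> \<le> \<bar>\<sigma>(d)\<bar> \<le> m \<bar>d\<bar>\<close> with \<open>c > 0\<close>. Hence
  \<open>r + B \<ge> 0\<close> satisfies a linear differential inequality with an exchange term: where \<open>b\<close> is bounded
  below, mass is moved from \<open>-y\<close> to \<open>y\<close>. In time 4 every characteristic passes through this region and collects
  there a share of the mass of an arc of fixed length (\<open>damped_transport_minorize\<close>); after finitely many such steps
  \<open>r + B\<close> is bounded below on the whole circle by a fixed fraction of its mean, which is \<open>B\<close>
  (\<open>damped_transport_contract\<close>). With the same argument for \<open>-r\<close>, the supremum of \<open>\<bar>r\<bar>\<close> shrinks by a
  fixed factor over a fixed time, so it decays exponentially (\<open>damped_transport_decay\<close>).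

  Identification. The decay is proved for a continuous solution \<open>r\<close>, constructed by a fixed point argument
  (\<open>damped_transport_exists\<close>), whereas the theorem is about an arbitrary weak solution \<open>z\<close>. Testing the weak
  equation with products \<open>\<theta>(t) sin(k \<pi> x)\<close> shows that each sine coefficient of \<open>z\<^sub>t\<close> is given by the
  variation of constants formula with the source \<open>- a \<sigma>(z\<^sub>t)\<close> (\<open>velocity_coefficient\<close>). The function
  \<open>(r(t, x) - r(t, -x)) / 2\<close> obeys the same formula with its own source, so by completeness of the sines and a
  Gronwall argument in \<open>L\<^sup>1(0,1)\<close> the two agree (\<open>gap_zero\<close>). Integration in time and space then
  expresses \<open>z\<close> through \<open>r\<close> (\<open>z_eq\<close>, \<open>z_space\<close>), and the norm of the state at time \<open>t\<close> is at most twice the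
  supremum of \<open>\<bar>r(t, \<cdot>)\<bar>\<close>.

  The norm of the data in \<open>D\<^sub>2\<close> enters because the initial values \<open>z\<^sub>0'\<close> and \<open>z\<^sub>1\<close> are continuous and each has
  a zero, so that their suprema are bounded by the \<open>L\<^sup>1\<close> norms of their derivatives (\<open>initial_data\<close>).
\<close>

section \<open>Decay for a damped transport equation with reflection\<close>

text \<open>\<open>r\<close> is a continuous solution, 2-periodic in \<open>y\<close>, of
  \<open>r\<^sub>t - r\<^sub>y = - b(y) s((r(t, y) - r(t, -y)) / 2)\<close> for \<open>t \<ge> 0\<close>. Since \<open>r\<close> need not be differentiable in \<open>t\<close> and \<open>y\<close>
  separately, the equation is required along the characteristics \<open>y = \<xi> - t\<close> only.\<close>

definition damped_transport ::
    "(real \<Rightarrow> real) \<Rightarrow> (real \<Rightarrow> real) \<Rightarrow> (real \<Rightarrow> real \<Rightarrow> real) \<Rightarrow> bool" where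
  "damped_transport b s r \<longleftrightarrow>
     continuous_on ({0..} \<times> UNIV) (\<lambda>(t, y). r t y) \<and>
     (\<forall>t\<ge>0. \<forall>y. r t (y + 2) = r t y) \<and>
     (\<forall>t\<ge>0. \<forall>\<xi>. ((\<lambda>t. r t (\<xi> - t)) has_real_derivative
        - b (\<xi> - t) * s ((r t (\<xi> - t) - r t (t - \<xi>)) / 2)) (at t within {0..}))"

text \<open>On \<open>D\<close>, the graph of \<open>s\<close> lies between the lines of slopes \<open>c\<close> and \<open>m\<close> through the origin.\<close>

definition sector_on :: "real set \<Rightarrow> real \<Rightarrow> real \<Rightarrow> (real \<Rightarrow> real) \<Rightarrow> bool" where
  "sector_on D c m s \<longleftrightarrow> (\<forall>d\<in>D. (0 \<le> d \<longrightarrow> c * d \<le> s d \<and> s d \<le> m * d) \<and>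
                                 (d \<le> 0 \<longrightarrow> m * d \<le> s d \<and> s d \<le> c * d))"

lemma periodic_int:
  fixes f :: "real \<Rightarrow> 'a"
  assumes "\<And>y. f (y + 2) = f y"
  shows "f (y + 2 * of_int k) = f y"
proof (induction k rule: int_induct[where k = 0])
  case (step1 i)
  then show ?case using assms[of "y + 2 * of_int i"] by (simp add: algebra_simps)
next
  case (step2 i)
  then show ?case using assms[of "y + 2 * of_int (i - 1)"] by (simp add: algebra_simps)
qed simp

lemma periodic_representative:
  fixes y p :: real
  obtains k :: int where "y + 2 * of_int k \<in> {p..p+2}"
proof -
  have "y + 2 * of_int \<lceil>(p - y) / 2\<rceil> \<in> {p..p+2}"
  proof -
    obtain n where n: "n = real_of_int \<lceil>(p - y) / 2\<rceil>" by blast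
    have "(p - y) / 2 \<le> n" "n - 1 < (p - y) / 2"
      unfolding n by linarith+
    then show ?thesis unfolding n[symmetric] by (auto simp: field_simps)
  qed
  then show ?thesis by (rule that)
qed

lemma damped_transportD:
  assumes "damped_transport b s r"
  shows "continuous_on ({0..} \<times> UNIV) (\<lambda>(t, y). r t y)"
    and "0 \<le> t \<Longrightarrow> r t (y + 2) = r t y"
    and "0 \<le> t \<Longrightarrow> ((\<lambda>t. r t (\<xi> - t)) has_real_derivative
        - b (\<xi> - t) * s ((r t (\<xi> - t) - r t (t - \<xi>)) / 2)) (at t within {0..})"
  using assms by (auto simp: damped_transport_def)

lemma damped_transport_shift:
  assumes "damped_transport b s r" "0 \<le> T"
  shows "damped_transport b s (\<lambda>t. r (T + t))"
proof -
  have "continuous_on ({0..} \<times> UNIV) ((\<lambda>(t, y). r t y) \<circ> (\<lambda>(t, y). (T + t, y)))"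
    using assms(2)
    by (intro continuous_on_compose continuous_on_subset[OF damped_transportD(1)[OF assms(1)]])
      (auto simp: split_beta intro!: continuous_intros)
  moreover have "((\<lambda>t. r (T + t) (\<xi> - t)) has_real_derivative
        - b (\<xi> - t) * s ((r (T + t) (\<xi> - t) - r (T + t) (t - \<xi>)) / 2)) (at t within {0..})"
    if "0 \<le> t" for t \<xi>
  proof -
    have "(((\<lambda>t. r t ((\<xi> + T) - t)) \<circ> (\<lambda>t. T + t)) has_real_derivative
        (- b ((\<xi> + T) - (T + t)) * s ((r (T + t) ((\<xi> + T) - (T + t)) - r (T + t) ((T + t) - (\<xi> + T))) / 2)) * 1)
        (at t within {0..})"
    proof (rule DERIV_image_chain)
      show "((+) T has_real_derivative 1) (at t within {0..})"
        by (auto intro!: derivative_eq_intros)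
      show "((\<lambda>t. r t (\<xi> + T - t)) has_real_derivative
           - b (\<xi> + T - (T + t)) * s ((r (T + t) (\<xi> + T - (T + t)) - r (T + t) (T + t - (\<xi> + T))) / 2))
           (at (T + t) within (+) T ` {0..})"
        by (rule DERIV_subset[OF damped_transportD(3)[OF assms(1)]]) (use assms that in auto)
    qed
    then show ?thesis by (simp add: o_def algebra_simps)
  qed
  ultimately show ?thesis
    using damped_transportD(2)[OF assms(1)] assms(2)
    unfolding damped_transport_def o_def split_beta by auto
qed

lemma damped_transport_uminus:
  assumes "damped_transport b s r" "\<And>d. s (- d) = - s d"
  shows "damped_transport b s (\<lambda>t y. - r t y)"
proof -
  have "((\<lambda>t. - r t (\<xi> - t)) has_real_derivative
        - b (\<xi> - t) * s ((- r t (\<xi> - t) - - r t (t - \<xi>)) / 2)) (at t within {0..})"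
    if "0 \<le> t" for t \<xi>
  proof -
    have "s ((- r t (\<xi> - t) - - r t (t - \<xi>)) / 2) = - s ((r t (\<xi> - t) - r t (t - \<xi>)) / 2)"
      using assms(2)[of "(r t (\<xi> - t) - r t (t - \<xi>)) / 2"]
      by (metis (no_types, opaque_lifting) minus_diff_eq minus_diff_minus minus_divide_left)
    then show ?thesis
      using DERIV_minus[OF damped_transportD(3)[OF assms(1) that, of \<xi>]] by simp
  qed
  then show ?thesis using damped_transportD[OF assms(1)]
    by (auto simp: damped_transport_def split_beta intro!: continuous_intros)
qed

text \<open>With \<open>p\<close> and \<open>q\<close> the values of \<open>r + B \<ge> 0\<close> at a point and at its mirror image, the damping term is bounded
  below by a linear loss proportional to \<open>p\<close> and a linear gain proportional to \<open>q\<close>.\<close>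

lemma sector_damping_ineq:
  fixes b A c m p q :: real
  assumes "0 \<le> b" "b \<le> A" "0 \<le> c" "c \<le> m" "sector_on D c m s" "(p - q) / 2 \<in> D" "0 \<le> p" "0 \<le> q"
  shows "- (A * m / 2) * p + c / 2 * b * q \<le> - b * s ((p - q) / 2)"
proof -
  have bA: "b * m * p \<le> A * m * p" using assms by (intro mult_right_mono) auto
  have sec: "(0 \<le> (p - q) / 2 \<longrightarrow> s ((p - q) / 2) \<le> m * ((p - q) / 2)) \<and>
      ((p - q) / 2 \<le> 0 \<longrightarrow> s ((p - q) / 2) \<le> c * ((p - q) / 2))"
    using assms(5,6) unfolding sector_on_def by blast
  show ?thesis
  proof (cases "q \<le> p")
    case True
    have "b * s ((p - q) / 2) \<le> b * (m * ((p - q) / 2))"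
      using assms(1) sec True by (intro mult_left_mono) auto
    moreover have "c * b * q \<le> m * b * q" using assms by (intro mult_right_mono) auto
    ultimately show ?thesis using bA by (simp add: field_simps)
  next
    case False
    have "b * s ((p - q) / 2) \<le> b * (c * ((p - q) / 2))"
      using assms(1) sec False by (intro mult_left_mono) auto
    moreover have "c * b * p \<le> m * b * p" using assms by (intro mult_right_mono) auto
    ultimately show ?thesis using bA by (simp add: field_simps)
  qed
qed

lemma nonneg_deriv_imp_le:
  fixes f f' :: "real \<Rightarrow> real"
  assumes "0 \<le> t" "\<And>s. 0 \<le> s \<Longrightarrow> s \<le> t \<Longrightarrow> (f has_real_derivative f' s) (at s within {0..})"
    and "\<And>s. 0 \<le> s \<Longrightarrow> s \<le> t \<Longrightarrow> 0 \<le> f' s"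
  shows "f 0 \<le> f t"
proof -
  have "\<exists>y. (f has_real_derivative y) (at s) \<and> 0 \<le> y" if "0 < s" "s < t" for s
  proof -
    have "at s within {0..} = at s" using that by (intro at_within_interior) auto
    with assms(2)[of s] assms(3)[of s] that show ?thesis by auto
  qed
  moreover have "continuous_on {0..t} f"
    by (rule DERIV_continuous_on[where D = f'], rule DERIV_subset[OF assms(2)]) auto
  ultimately show ?thesis
    by (intro DERIV_nonneg_imp_increasing_open[of 0 t f]) (use assms(1) in auto)
qed

text \<open>Maximum principle: the negative part of \<open>r\<close> does not grow. Its proof takes the minimum of \<open>r\<close> over
  a time interval and follows the characteristic that ends there.\<close>

lemma damped_transport_ge:
  assumes r: "damped_transport b s r" and b: "\<And>y. 0 \<le> b y" "\<And>y. b y \<le> A"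
    and s: "sector_on UNIV 0 m s" and m: "0 \<le> m"
    and r0: "\<And>y. - B \<le> r 0 y" and t: "0 \<le> t"
  shows "- B \<le> r t y"
proof (rule ccontr)
  assume neg: "\<not> - B \<le> r t y"
  have "compact ({0..t} \<times> {-1..1::real})" by (intro compact_Times) auto
  moreover have "continuous_on ({0..t} \<times> {-1..1}) (\<lambda>(t, y). r t y)"
    by (rule continuous_on_subset[OF damped_transportD(1)[OF r]]) auto
  ultimately obtain \<tau> y0 where y0: "\<tau> \<in> {0..t}" "y0 \<in> {-1..1}"
    and min: "\<And>t' y'. t' \<in> {0..t} \<Longrightarrow> y' \<in> {-1..1} \<Longrightarrow> r \<tau> y0 \<le> r t' y'"
    using continuous_attains_inf[of "{0..t} \<times> {-1..1::real}" "\<lambda>(t, y). r t y"] t by auto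
  define \<nu> where "\<nu> = r \<tau> y0"
  have ge: "\<nu> \<le> r t' y'" if "t' \<in> {0..t}" for t' y'
  proof -
    obtain k where k: "y' + 2 * of_int k \<in> {-1..-1+2}" by (rule periodic_representative)
    have "r t' (y' + 2 * of_int k) = r t' y'"
      using that by (intro periodic_int damped_transportD(2)[OF r]) auto
    with min[OF that, of "y' + 2 * of_int k"] k show ?thesis by (simp add: \<nu>_def)
  qed
  have "\<nu> < - B" using ge[of t y] neg t by auto
  define Q where "Q = A * m / 2"
  define \<xi> where "\<xi> = y0 + \<tau>"
  define v where "v = (\<lambda>t. r t (\<xi> - t))"
  let ?d = "\<lambda>t. - b (\<xi> - t) * s ((r t (\<xi> - t) - r t (t - \<xi>)) / 2)"
  have "exp (Q * 0) * (v 0 - \<nu>) \<le> exp (Q * \<tau>) * (v \<tau> - \<nu>)"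
  proof (rule nonneg_deriv_imp_le)
    fix t' assume t': "0 \<le> t'" "t' \<le> \<tau>"
    have "(v has_real_derivative ?d t') (at t' within {0..})"
      unfolding v_def by (rule damped_transportD(3)[OF r t'(1)])
    then show "((\<lambda>t. exp (Q * t) * (v t - \<nu>)) has_real_derivative
        exp (Q * t') * (Q * (v t' - \<nu>) + ?d t')) (at t' within {0..})"
      by (auto intro!: derivative_eq_intros simp: algebra_simps)
    have "- (A * m / 2) * (v t' - \<nu>) + 0 / 2 * b (\<xi> - t') * (r t' (t' - \<xi>) - \<nu>)
        \<le> - b (\<xi> - t') * s (((v t' - \<nu>) - (r t' (t' - \<xi>) - \<nu>)) / 2)"
      using b s m ge[of t'] t' y0(1) by (intro sector_damping_ineq[where D = UNIV]) (auto simp: v_def)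
    then have "0 \<le> Q * (v t' - \<nu>) + ?d t'" by (simp add: Q_def v_def)
    then show "0 \<le> exp (Q * t') * (Q * (v t' - \<nu>) + ?d t')" by simp
  qed (use y0 in auto)
  moreover have "v \<tau> = \<nu>" by (simp add: v_def \<xi>_def \<nu>_def)
  moreover have "\<nu> < v 0" using r0[of "\<xi>"] \<open>\<nu> < - B\<close> by (simp add: v_def)
  ultimately show False by simp
qed

lemma damped_transport_bounded:
  assumes r: "damped_transport b s r" and b: "\<And>y. 0 \<le> b y" "\<And>y. b y \<le> A"
    and s: "sector_on UNIV 0 m s" "\<And>d. s (- d) = - s d" and m: "0 \<le> m"
    and r0: "\<And>y. \<bar>r 0 y\<bar> \<le> B" and t: "0 \<le> t"
  shows "\<bar>r t y\<bar> \<le> B"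
proof -
  have "- B \<le> r t y"
    by (rule damped_transport_ge[OF r b s(1) m _ t]) (use r0 in \<open>auto simp: abs_le_iff minus_le_iff\<close>)
  moreover have "- B \<le> - r t y"
    by (rule damped_transport_ge[OF damped_transport_uminus[OF r s(2)] b s(1) m _ t])
      (use r0 in \<open>auto simp: abs_le_iff minus_le_iff\<close>)
  ultimately show ?thesis by auto
qed

text \<open>Along the characteristic that ends at \<open>(T, y)\<close>, the gain at time \<open>\<tau>\<close> comes from the mirror image
  \<open>\<tau> - y - T\<close> of the current point, and what is found there has been transported from \<open>2\<tau> - y - T\<close> at time 0.\<close>

lemma damped_transport_lower:
  assumes r: "damped_transport b s r" and b: "\<And>y. 0 \<le> b y" "\<And>y. b y \<le> A" "continuous_on UNIV b"
    and s: "sector_on {-R..R} c m s" and c: "0 \<le> c" "c \<le> m"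
    and rb: "\<And>t y. 0 \<le> t \<Longrightarrow> \<bar>r t y\<bar> \<le> B" and B: "B \<le> R" and T: "0 \<le> T"
  shows "c / 2 * integral {0..T} (\<lambda>\<tau>. b (y + T - \<tau>) * (r 0 (2 * \<tau> - y - T) + B))
    \<le> exp (A * m / 2 * T) * (r T y + B)"
proof -
  define Q where "Q = A * m / 2"
  have Q0: "0 \<le> Q" using b(1)[of 0] b(2)[of 0] c by (simp add: Q_def)
  have rng: "(r t y1 - r t y2) / 2 \<in> {-R..R}" if "0 \<le> t" for t y1 y2
    using rb[OF that, of y1] rb[OF that, of y2] B by auto
  let ?d = "\<lambda>\<xi> t. - b (\<xi> - t) * s ((r t (\<xi> - t) - r t (t - \<xi>)) / 2)"
  have der: "((\<lambda>t. exp (Q * t) * (r t (\<xi> - t) + B)) has_real_derivative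
        exp (Q * t) * (Q * (r t (\<xi> - t) + B) + ?d \<xi> t)) (at t within {0..})" if "0 \<le> t" for t \<xi>
    using damped_transportD(3)[OF r that, of \<xi>]
    by (auto intro!: derivative_eq_intros simp: algebra_simps)
  have ineq: "c / 2 * b (\<xi> - t) * (r t (t - \<xi>) + B) \<le> Q * (r t (\<xi> - t) + B) + ?d \<xi> t"
    if "0 \<le> t" for t \<xi>
  proof -
    have "- (A * m / 2) * (r t (\<xi> - t) + B) + c / 2 * b (\<xi> - t) * (r t (t - \<xi>) + B)
        \<le> - b (\<xi> - t) * s (((r t (\<xi> - t) + B) - (r t (t - \<xi>) + B)) / 2)"
      using b s c rb[OF that, of "\<xi> - t"] rb[OF that, of "t - \<xi>"] rng[OF that]
      by (intro sector_damping_ineq[where D = "{-R..R}"]) auto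
    then show ?thesis by (simp add: Q_def)
  qed
  have nonneg: "0 \<le> c / 2 * b (\<xi> - t) * (r t (t - \<xi>) + B)" if "0 \<le> t" for t \<xi>
    using b c rb[OF that, of "t - \<xi>"] by (intro mult_nonneg_nonneg) auto
  have transport: "r 0 \<xi> + B \<le> exp (Q * \<tau>) * (r \<tau> (\<xi> - \<tau>) + B)" if "0 \<le> \<tau>" for \<tau> \<xi>
  proof -
    have "exp (Q * 0) * (r 0 (\<xi> - 0) + B) \<le> exp (Q * \<tau>) * (r \<tau> (\<xi> - \<tau>) + B)"
    proof (rule nonneg_deriv_imp_le[OF that])
      fix t :: real assume t: "0 \<le> t"
      show "((\<lambda>t. exp (Q * t) * (r t (\<xi> - t) + B)) has_real_derivative
        exp (Q * t) * (Q * (r t (\<xi> - t) + B) + ?d \<xi> t)) (at t within {0..})"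
        by (rule der[OF t])
      show "0 \<le> exp (Q * t) * (Q * (r t (\<xi> - t) + B) + ?d \<xi> t)"
        using ineq[OF t, of \<xi>] nonneg[OF t, of \<xi>] by (intro mult_nonneg_nonneg) auto
    qed
    then show ?thesis by simp
  qed
  define \<xi> where "\<xi> = y + T"
  define g where "g = (\<lambda>\<tau>. b (\<xi> - \<tau>) * (r 0 (2 * \<tau> - \<xi>) + B))"
  have r0cont: "continuous_on UNIV (r 0)"
  proof -
    have "continuous_on UNIV ((\<lambda>(t, y). r t y) \<circ> Pair 0)"
      by (intro continuous_on_compose continuous_on_subset[OF damped_transportD(1)[OF r]])
        (auto intro!: continuous_intros)
    then show ?thesis by (simp add: o_def)
  qed
  have gcont: "continuous_on UNIV g"
    unfolding g_def
    by (intro continuous_intros continuous_on_compose2[OF b(3)] continuous_on_compose2[OF r0cont]) auto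
  define G where "G = (\<lambda>\<tau>. integral {0..\<tau>} g)"
  have G: "(G has_real_derivative g t) (at t within {0..})" if "0 \<le> t" for t
  proof -
    have "(G has_real_derivative g t) (at t within {0..t + 1})"
      unfolding G_def
      by (rule integral_has_real_derivative[OF continuous_on_subset[OF gcont]]) (use that in auto)
    moreover have "at t within {0..t + 1} = at t within {0..}"
      by (rule at_within_nhd[of _ "{..<t + 1}"]) auto
    ultimately show ?thesis by simp
  qed
  have "exp (Q * 0) * (r 0 (\<xi> - 0) + B) - c / 2 * G 0
      \<le> exp (Q * T) * (r T (\<xi> - T) + B) - c / 2 * G T"
  proof (rule nonneg_deriv_imp_le[OF T])
    fix t :: real assume t: "0 \<le> t"
    show "((\<lambda>t. exp (Q * t) * (r t (\<xi> - t) + B) - c / 2 * G t) has_real_derivative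
        exp (Q * t) * (Q * (r t (\<xi> - t) + B) + ?d \<xi> t) - c / 2 * g t) (at t within {0..})"
      by (rule DERIV_diff[OF der[OF t] DERIV_cmult[OF G[OF t]]])
    have "r 0 (2 * t - \<xi>) + B \<le> exp (Q * t) * (r t (t - \<xi>) + B)"
      using transport[OF t, of "2 * t - \<xi>"] by simp
    then have "c / 2 * b (\<xi> - t) * (r 0 (2 * t - \<xi>) + B)
        \<le> c / 2 * b (\<xi> - t) * (exp (Q * t) * (r t (t - \<xi>) + B))"
      using b c by (intro mult_left_mono) auto
    also have "\<dots> = exp (Q * t) * (c / 2 * b (\<xi> - t) * (r t (t - \<xi>) + B))" by simp
    also have "\<dots> \<le> exp (Q * t) * (Q * (r t (\<xi> - t) + B) + ?d \<xi> t)"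
      by (intro mult_left_mono ineq[OF t]) auto
    finally show "0 \<le> exp (Q * t) * (Q * (r t (\<xi> - t) + B) + ?d \<xi> t) - c / 2 * g t"
      by (simp add: g_def)
  qed
  moreover have "0 \<le> r 0 \<xi> + B" using rb[of 0 \<xi>] by auto
  ultimately have "c / 2 * G T \<le> exp (Q * T) * (r T y + B)"
    by (simp add: G_def \<xi>_def)
  then show ?thesis
    by (simp add: G_def g_def \<xi>_def Q_def algebra_simps)
qed

lemma damped_transport_continuous:
  assumes "damped_transport b s r" "0 \<le> t"
  shows "continuous_on UNIV (r t)"
proof -
  have "continuous_on UNIV ((\<lambda>(t, y). r t y) \<circ> Pair t)"
    by (intro continuous_on_compose continuous_on_subset[OF damped_transportD(1)[OF assms(1)]])
      (use assms(2) in \<open>auto intro!: continuous_intros\<close>)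
  then show ?thesis by (simp add: o_def)
qed

text \<open>The value at time 4 dominates the mass that \<open>r 0 + B\<close> gives to any part of the interval
  \<open>[y - 2\<beta>, y - 2\<alpha>]\<close>: these are the points whose mass is exchanged, while inside the region
  \<open>[\<alpha>, \<beta>]\<close> of effective damping, with the characteristic ending at \<open>y\<close>. Time 4 is two full turns, which leaves
  room for one complete passage through the region.\<close>

lemma damped_transport_minorize:
  fixes \<alpha> \<beta> :: real
  assumes r: "damped_transport b s r" and b: "\<And>y. 0 \<le> b y" "\<And>y. b y \<le> A" "continuous_on UNIV b"
      "\<And>y. b (y + 2) = b y"
    and a0: "0 \<le> a0" "\<And>y. y \<in> {\<alpha>..\<beta>} \<Longrightarrow> a0 \<le> b y" and \<beta>: "\<beta> \<le> \<alpha> + 2"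
    and s: "sector_on {-R..R} c m s" and c: "0 \<le> c" "c \<le> m"
    and rb: "\<And>t y. 0 \<le> t \<Longrightarrow> \<bar>r t y\<bar> \<le> B" and B: "B \<le> R"
    and pq: "y - 2 * \<beta> \<le> p" "p \<le> q" "q \<le> y - 2 * \<alpha>"
  shows "exp (- 2 * A * m) * c * a0 / 4 * integral {p..q} (\<lambda>\<zeta>. r 0 \<zeta> + B) \<le> r 4 y + B"
proof -
  have r0cont: "continuous_on UNIV (r 0)" by (rule damped_transport_continuous[OF r]) simp
  obtain k where k: "\<alpha> + 2 * of_int k \<in> {y..y+2}" by (rule periodic_representative)
  \<comment> \<open>At time \<open>h \<zeta>\<close> the mirror image of the characteristic through \<open>(4, y)\<close> meets, modulo 2, the one that starts at \<open>\<zeta>\<close>.\<close>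
  define h where "h = (\<lambda>\<zeta>. (\<zeta> + y + 8 - 4 * of_int k) / 2)"
  have h_in: "h \<zeta> \<in> {0..4}" if "\<zeta> \<in> {p..q}" for \<zeta>
    using that k pq \<beta> by (auto simp: h_def field_simps)
  have b_h: "a0 \<le> b (y + 4 - h \<zeta>)" if "\<zeta> \<in> {p..q}" for \<zeta>
  proof -
    have "b ((y - \<zeta>) / 2 + 2 * of_int k) = b ((y - \<zeta>) / 2)"
      by (rule periodic_int) (rule b(4))
    moreover have "y + 4 - h \<zeta> = (y - \<zeta>) / 2 + 2 * of_int k" by (simp add: h_def field_simps)
    ultimately have "b (y + 4 - h \<zeta>) = b ((y - \<zeta>) / 2)" by simp
    moreover have "(y - \<zeta>) / 2 \<in> {\<alpha>..\<beta>}" using that pq by auto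
    ultimately show ?thesis using a0(2) by simp
  qed
  define g where "g = (\<lambda>\<tau>. b (y + 4 - \<tau>) * (r 0 (2 * \<tau> - y - 4) + B))"
  have gcont: "continuous_on S g" for S
    unfolding g_def
    by (intro continuous_intros continuous_on_compose2[OF b(3)] continuous_on_compose2[OF r0cont]) auto
  have w0: "0 \<le> r 0 \<zeta> + B" for \<zeta> using rb[of 0 \<zeta>] by auto
  have g0: "0 \<le> g \<tau>" for \<tau> using b w0 by (simp add: g_def)
  have "integral {p..q} (\<lambda>\<zeta>. a0 / 2 * (r 0 \<zeta> + B)) \<le> integral {p..q} (\<lambda>\<zeta>. (1 / 2) *\<^sub>R g (h \<zeta>))"
  proof (rule integral_le)
    show "(\<lambda>\<zeta>. a0 / 2 * (r 0 \<zeta> + B)) integrable_on {p..q}"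
      by (intro integrable_continuous_interval continuous_intros continuous_on_subset[OF r0cont]) auto
    show "(\<lambda>\<zeta>. (1 / 2) *\<^sub>R g (h \<zeta>)) integrable_on {p..q}"
      by (intro integrable_continuous_interval continuous_intros continuous_on_compose2[OF gcont[of UNIV]])
        (auto simp: h_def intro!: continuous_intros)
    fix \<zeta> assume \<zeta>: "\<zeta> \<in> {p..q}"
    have "r 0 (\<zeta> + 2 * of_int (2 - 2 * k)) = r 0 \<zeta>"
      by (rule periodic_int) (rule damped_transportD(2)[OF r], simp)
    moreover have "2 * h \<zeta> - y - 4 = \<zeta> + 2 * of_int (2 - 2 * k)" by (simp add: h_def field_simps)
    ultimately have "r 0 (2 * h \<zeta> - y - 4) = r 0 \<zeta>" by (simp only:)
    then have "g (h \<zeta>) = b (y + 4 - h \<zeta>) * (r 0 \<zeta> + B)" by (simp add: g_def)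
    then show "a0 / 2 * (r 0 \<zeta> + B) \<le> (1 / 2) *\<^sub>R g (h \<zeta>)"
      using mult_right_mono[OF b_h[OF \<zeta>] w0[of \<zeta>]] by simp
  qed
  also have "\<dots> = integral {h p..h q} g"
  proof (rule integral_unique, rule has_integral_substitution)
    show "h ` {p..q} \<subseteq> {0..4}" using h_in by auto
    show "(h has_field_derivative 1 / 2) (at x within {p..q})" for x
      unfolding h_def by (auto intro!: derivative_eq_intros)
  qed (use pq gcont in \<open>auto simp: h_def\<close>)
  also have "\<dots> \<le> integral {0..4} g"
  proof (rule integral_subset_le)
    show "{h p..h q} \<subseteq> {0..4}" using h_in[of p] h_in[of q] pq by auto
  qed (auto intro!: g0 integrable_continuous_interval gcont)
  finally have "a0 / 2 * integral {p..q} (\<lambda>\<zeta>. r 0 \<zeta> + B) \<le> integral {0..4} g" by simp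
  then have "c / 2 * (a0 / 2 * integral {p..q} (\<lambda>\<zeta>. r 0 \<zeta> + B)) \<le> c / 2 * integral {0..4} g"
    by (rule mult_left_mono) (use c in auto)
  also have "\<dots> \<le> exp (A * m / 2 * 4) * (r 4 y + B)"
    unfolding g_def by (rule damped_transport_lower[OF r b(1-3) s c rb B]) auto
  finally have "exp (- 2 * A * m) * (c / 2 * (a0 / 2 * integral {p..q} (\<lambda>\<zeta>. r 0 \<zeta> + B)))
    \<le> exp (- 2 * A * m) * (exp (A * m / 2 * 4) * (r 4 y + B))"
    by (rule mult_left_mono) auto
  also have "\<dots> = r 4 y + B" by (simp add: mult.assoc[symmetric] exp_add[symmetric])
  finally show ?thesis by (simp add: mult.assoc)
qed

text \<open>A lower bound for \<open>r + B\<close> on an arc becomes, at time 4, a lower bound on an arc that is longer by \<open>\<beta> - \<alpha>\<close>.\<close>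

lemma damped_transport_spread:
  fixes \<alpha> \<beta> :: real
  assumes r: "damped_transport b s r" and b: "\<And>y. 0 \<le> b y" "\<And>y. b y \<le> A" "continuous_on UNIV b"
      "\<And>y. b (y + 2) = b y"
    and a0: "0 \<le> a0" "\<And>y. y \<in> {\<alpha>..\<beta>} \<Longrightarrow> a0 \<le> b y" and \<beta>: "\<alpha> \<le> \<beta>" "\<beta> \<le> \<alpha> + 2"
    and s: "sector_on {-R..R} c m s" and c: "0 \<le> c" "c \<le> m"
    and rb: "\<And>t y. 0 \<le> t \<Longrightarrow> \<bar>r t y\<bar> \<le> B" and B: "B \<le> R"
    and \<delta>: "0 \<le> \<delta>" "\<And>y. y \<in> {p..p + L} \<Longrightarrow> \<delta> \<le> r 0 y + B" and L: "\<beta> - \<alpha> \<le> L"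
  shows "\<exists>p'. \<forall>y\<in>{p'..p' + (L + (\<beta> - \<alpha>))}.
    exp (- 2 * A * m) * c * a0 / 4 * ((\<beta> - \<alpha>) / 2) * \<delta> \<le> r 4 y + B"
proof (intro exI ballI)
  let ?p' = "p + 2 * \<alpha> + (\<beta> - \<alpha>) / 2"
  let ?C = "exp (- 2 * A * m) * c * a0 / 4"
  fix y assume y: "y \<in> {?p'..?p' + (L + (\<beta> - \<alpha>))}"
  define p1 where "p1 = max p (y - 2 * \<beta>)"
  define q1 where "q1 = min (p + L) (y - 2 * \<alpha>)"
  have len: "(\<beta> - \<alpha>) / 2 \<le> q1 - p1"
    using y L \<beta> by (auto simp: p1_def q1_def max_def min_def field_simps)
  have r0cont: "continuous_on UNIV (r 0)" by (rule damped_transport_continuous[OF r]) simp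
  have "(\<beta> - \<alpha>) / 2 * \<delta> \<le> (q1 - p1) * \<delta>" by (rule mult_right_mono[OF len \<delta>(1)])
  also have "\<dots> = integral {p1..q1} (\<lambda>_. \<delta>)" using len \<beta> by simp
  also have "\<dots> \<le> integral {p1..q1} (\<lambda>\<zeta>. r 0 \<zeta> + B)"
  proof (rule integral_le)
    show "(\<lambda>\<zeta>. r 0 \<zeta> + B) integrable_on {p1..q1}"
      by (intro integrable_continuous_interval continuous_intros continuous_on_subset[OF r0cont]) auto
  qed (auto intro!: \<delta> simp: p1_def q1_def)
  finally have "?C * ((\<beta> - \<alpha>) / 2 * \<delta>) \<le> ?C * integral {p1..q1} (\<lambda>\<zeta>. r 0 \<zeta> + B)"
    by (rule mult_left_mono) (use c a0 in auto)
  also have "\<dots> \<le> r 4 y + B"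
  proof (rule damped_transport_minorize[OF r b a0 \<beta>(2) s c rb B])
    show "p1 \<le> q1" using len \<beta> by simp
  qed (auto simp: p1_def q1_def)
  finally show "?C * ((\<beta> - \<alpha>) / 2) * \<delta> \<le> r 4 y + B" by (simp only: mult.assoc)
qed

text \<open>As \<open>r\<close> has mean zero, \<open>r + B\<close> has mass \<open>2B\<close> on the circle. One of \<open>n\<close> arcs of length \<open>\<beta> - \<alpha>\<close> covering
  the circle carries a share \<open>2B / n\<close> of it, and \<open>n\<close> spreading steps turn this into a bound on the whole circle.\<close>

lemma damped_transport_contract:
  fixes \<alpha> \<beta> :: real
  assumes r: "damped_transport b s r" and b: "\<And>y. 0 \<le> b y" "\<And>y. b y \<le> A" "continuous_on UNIV b"
      "\<And>y. b (y + 2) = b y"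
    and a0: "0 \<le> a0" "\<And>y. y \<in> {\<alpha>..\<beta>} \<Longrightarrow> a0 \<le> b y" and \<beta>: "\<alpha> < \<beta>" "\<beta> \<le> \<alpha> + 2"
    and s: "sector_on {-R..R} c m s" and c: "0 \<le> c" "c \<le> m"
    and rb: "\<And>t y. 0 \<le> t \<Longrightarrow> \<bar>r t y\<bar> \<le> B" and B: "B \<le> R"
    and mean: "integral {-1..1} (r 0) = 0" and n: "0 < n" "2 \<le> n * (\<beta> - \<alpha>)"
    and \<kappa>: "\<kappa> = exp (- 2 * A * m) * c * a0 / 4"
  shows "(\<kappa> * ((\<beta> - \<alpha>) / 2)) ^ n * (\<kappa> * (2 * B / n)) \<le> r (4 * real (Suc n)) y + B"
proof -
  define l where "l = \<beta> - \<alpha>"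
  have l: "0 < l" "2 \<le> n * l" using \<beta> n by (auto simp: l_def)
  have B0: "0 \<le> B" using rb[of 0 0] by auto
  have \<kappa>0: "0 \<le> \<kappa>" using c a0 by (simp add: \<kappa>)
  have r0cont: "continuous_on UNIV (r 0)" by (rule damped_transport_continuous[OF r]) simp
  let ?w = "\<lambda>\<zeta>. r 0 \<zeta> + B"
  have int: "?w integrable_on {u..v}" for u v
    by (intro integrable_continuous_interval continuous_intros continuous_on_subset[OF r0cont]) auto
  have w0: "0 \<le> ?w \<zeta>" for \<zeta> using rb[of 0 \<zeta>] by auto
  \<comment> \<open>Some arc of length \<open>\<beta> - \<alpha>\<close> carries its share of the total mass.\<close>
  have "\<exists>p::real. 2 * B / n \<le> integral {p..p + l} ?w"
  proof (rule ccontr)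
    assume "\<not> ?thesis"
    then have small: "integral {p..p + l} ?w < 2 * B / n" for p :: real by (auto simp: not_le)
    have part: "integral {-1..-1 + real k * l} ?w \<le> k * (2 * B / n)" for k :: nat
    proof (induction k)
      case (Suc k)
      have "integral {-1..-1 + real k * l} ?w + integral {-1 + real k * l..-1 + real (Suc k) * l} ?w
          = integral {-1..-1 + real (Suc k) * l} ?w"
        by (rule Henstock_Kurzweil_Integration.integral_combine[OF _ _ int]) (use l in \<open>auto simp: field_simps\<close>)
      moreover have "integral {-1 + real k * l..-1 + real (Suc k) * l} ?w < 2 * B / n"
        using small[of "-1 + real k * l"] by (simp add: algebra_simps)
      moreover have "real (Suc k) * (2 * B / n) = k * (2 * B / n) + 2 * B / n" by (simp add: add_divide_distrib distrib_right)
      ultimately show ?case using Suc by linarith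
    qed simp
    have strict: "integral {-1..-1 + real n * l} ?w < 2 * B"
    proof -
      obtain k where k: "n = Suc k" using n(1) by (cases n) auto
      have "integral {-1..-1 + real k * l} ?w + integral {-1 + real k * l..-1 + real (Suc k) * l} ?w
          = integral {-1..-1 + real (Suc k) * l} ?w"
        by (rule Henstock_Kurzweil_Integration.integral_combine[OF _ _ int]) (use l in \<open>auto simp: field_simps\<close>)
      moreover have "integral {-1 + real k * l..-1 + real (Suc k) * l} ?w < 2 * B / n"
        using small[of "-1 + real k * l"] by (simp add: algebra_simps)
      ultimately have "integral {-1..-1 + real n * l} ?w < k * (2 * B / n) + 2 * B / n"
        using part[of k] k by simp
      also have "\<dots> = (real k + 1) * (2 * B / n)" by (simp only: distrib_right mult_1)
      also have "real k + 1 = real n" by (simp add: k)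
      also have "real n * (2 * B / n) = 2 * B" using n(1) by simp
      finally show ?thesis .
    qed
    have "integral {-1..1} ?w = 2 * B"
    proof -
      have "integral {-1..1} ?w = integral {-1..1} (r 0) + integral {-1..1::real} (\<lambda>_. B)"
        using Henstock_Kurzweil_Integration.integral_add[of "r 0" "{-1..1}" "\<lambda>_. B"]
          integrable_continuous_interval[OF continuous_on_subset[OF r0cont], of "-1" 1]
          integrable_const_ivl[of B "-1" "1::real"] by simp
      then show ?thesis using mean by simp
    qed
    moreover have "integral {-1..1} ?w \<le> integral {-1..-1 + real n * l} ?w"
      by (rule integral_subset_le) (use l int w0 in auto)
    ultimately show False using strict by simp
  qed
  then obtain p :: real where p: "2 * B / n \<le> integral {p..p + l} ?w" by blast
  have spread: "\<exists>p'. \<forall>y\<in>{p'..p' + real (Suc k) * l}.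
      (\<kappa> * (l / 2)) ^ k * (\<kappa> * (2 * B / n)) \<le> r (4 * real (Suc k)) y + B" for k
  proof (induction k)
    case 0
    show ?case
    proof (intro exI ballI)
      fix y assume y: "y \<in> {p + l + 2 * \<alpha>..p + l + 2 * \<alpha> + real (Suc 0) * l}"
      have "\<kappa> * (2 * B / n) \<le> \<kappa> * integral {p..p + l} ?w"
        by (rule mult_left_mono[OF p \<kappa>0])
      also have "\<dots> \<le> r 4 y + B" unfolding \<kappa>
        by (rule damped_transport_minorize[OF r b a0 \<beta>(2) s c rb B]) (use y l in \<open>auto simp: l_def\<close>)
      finally show "(\<kappa> * (l / 2)) ^ 0 * (\<kappa> * (2 * B / n)) \<le> r (4 * real (Suc 0)) y + B" by simp
    qed
  next
    case (Suc k)
    let ?\<delta> = "(\<kappa> * (l / 2)) ^ k * (\<kappa> * (2 * B / n))"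
    from Suc obtain p' where p': "\<forall>y\<in>{p'..p' + real (Suc k) * l}. ?\<delta> \<le> r (4 * real (Suc k)) y + B"
      by blast
    let ?r = "\<lambda>t. r (4 * real (Suc k) + t)"
    have "\<exists>p'. \<forall>y\<in>{p'..p' + (real (Suc k) * l + (\<beta> - \<alpha>))}.
      exp (- 2 * A * m) * c * a0 / 4 * ((\<beta> - \<alpha>) / 2) * ?\<delta> \<le> ?r 4 y + B"
    proof (rule damped_transport_spread[OF damped_transport_shift[OF r] b a0 _ _ s c _ B])
      show "0 \<le> ?\<delta>" using \<kappa>0 l B0 by simp
      show "?\<delta> \<le> r (4 * real (Suc k) + 0) y + B" if "y \<in> {p'..p' + real (Suc k) * l}" for y
        using p' that by simp
      have "1 * l \<le> real (Suc k) * l" using l by (intro mult_right_mono) auto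
      then show "\<beta> - \<alpha> \<le> real (Suc k) * l" by (simp only: l_def mult_1)
    qed (use \<beta> rb in auto)
    moreover have "exp (- 2 * A * m) * c * a0 / 4 * ((\<beta> - \<alpha>) / 2) * ?\<delta>
        = (\<kappa> * (l / 2)) ^ Suc k * (\<kappa> * (2 * B / n))" by (simp add: \<kappa> l_def)
    moreover have "real (Suc k) * l + (\<beta> - \<alpha>) = real (Suc (Suc k)) * l" by (simp add: l_def algebra_simps)
    moreover have "4 * real (Suc k) + 4 = 4 * real (Suc (Suc k))" by simp
    ultimately show ?case by (simp only:)
  qed
  obtain p' where p': "\<forall>y\<in>{p'..p' + real (Suc n) * l}.
      (\<kappa> * (l / 2)) ^ n * (\<kappa> * (2 * B / n)) \<le> r (4 * real (Suc n)) y + B"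
    using spread by blast
  obtain k where k: "y + 2 * of_int k \<in> {p'..p' + 2}" by (rule periodic_representative)
  have "r (4 * real (Suc n)) (y + 2 * of_int k) = r (4 * real (Suc n)) y"
    by (intro periodic_int damped_transportD(2)[OF r]) auto
  moreover have "y + 2 * of_int k \<in> {p'..p' + real (Suc n) * l}" using k l by (auto simp: algebra_simps)
  ultimately have "(\<kappa> * (l / 2)) ^ n * (\<kappa> * (2 * B / n)) \<le> r (4 * real (Suc n)) y + B"
    using bspec[OF p', of "y + 2 * of_int k"] by (simp only:)
  then show ?thesis by (simp only: l_def)
qed

text \<open>The constants do not depend on the nonlinearity \<open>s\<close>, on the solution \<open>r\<close>, nor on the bound \<open>B \<le> R\<close> of the
  initial values.\<close>

proposition damped_transport_decay:
  fixes b :: "real \<Rightarrow> real" and \<alpha> \<beta> :: real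
  assumes b: "\<And>y. 0 \<le> b y" "\<And>y. b y \<le> A" "continuous_on UNIV b" "\<And>y. b (y + 2) = b y"
    and a0: "0 < a0" "\<And>y. y \<in> {\<alpha>..\<beta>} \<Longrightarrow> a0 \<le> b y" and \<beta>: "\<alpha> < \<beta>" "\<beta> \<le> \<alpha> + 2"
    and c: "0 < c" "c \<le> m"
  obtains K \<gamma> where "0 < K" "0 < \<gamma>"
    "\<And>r s B t y. \<lbrakk>damped_transport b s r; \<And>d. s (- d) = - s d; sector_on UNIV 0 m s; sector_on {-R..R} c m s;
      \<And>t. 0 \<le> t \<Longrightarrow> integral {-1..1} (r t) = 0; \<And>y. \<bar>r 0 y\<bar> \<le> B; B \<le> R; 0 \<le> t\<rbrakk>
      \<Longrightarrow> \<bar>r t y\<bar> \<le> K * exp (- \<gamma> * t) * B"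
proof -
  obtain n :: nat where n: "2 / (\<beta> - \<alpha>) < n" using reals_Archimedean2 by blast
  have "0 < 2 / (\<beta> - \<alpha>)" using \<beta> by simp
  with n have n0: "0 < real n" by linarith
  have n2: "2 \<le> n * (\<beta> - \<alpha>)" using n \<beta> by (simp add: field_simps)
  define \<kappa> where "\<kappa> = exp (- 2 * A * m) * c * a0 / 4"
  have \<kappa>0: "0 < \<kappa>" using c a0 by (simp add: \<kappa>_def)
  define \<epsilon> where "\<epsilon> = min (1 / 2) ((\<kappa> * ((\<beta> - \<alpha>) / 2)) ^ n * (\<kappa> * (2 / n)))"
  have \<epsilon>: "0 < \<epsilon>" "\<epsilon> \<le> 1 / 2" using \<kappa>0 \<beta> n0 unfolding \<epsilon>_def by (simp, intro min.cobounded1)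
  define \<tau> where "\<tau> = 4 * real (Suc n)"
  have \<tau>: "0 < \<tau>" by (simp add: \<tau>_def)
  define \<gamma> where "\<gamma> = - ln (1 - \<epsilon>) / \<tau>"
  have "ln (1 - \<epsilon>) < 0" using \<epsilon> by (intro ln_less_zero) auto
  then have \<gamma>: "0 < \<gamma>" using \<tau> by (simp add: \<gamma>_def divide_neg_pos)
  have exp_\<gamma>: "(1 - \<epsilon>) ^ k = exp (- \<gamma> * (k * \<tau>))" for k :: nat
  proof -
    have "- \<gamma> * (k * \<tau>) = k * ln (1 - \<epsilon>)" using \<tau> by (simp add: \<gamma>_def)
    then show ?thesis using \<epsilon> by (simp add: exp_of_nat_mult)
  qed
  show ?thesis
  proof
    show "0 < inverse (1 - \<epsilon>)" using \<epsilon> by simp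
    show "0 < \<gamma>" by (rule \<gamma>)
    fix r s B and t y :: real
    assume r: "damped_transport b s r" and odd: "\<And>d. s (- d) = - s d"
      and sec: "sector_on UNIV 0 m s" "sector_on {-R..R} c m s"
      and mean: "\<And>t. 0 \<le> t \<Longrightarrow> integral {-1..1} (r t) = 0"
      and r0: "\<And>y. \<bar>r 0 y\<bar> \<le> B" and B: "B \<le> R" and t: "0 \<le> t"
    have B0: "0 \<le> B" using r0[of 0] by auto
    have m0: "0 \<le> m" using c by simp
    \<comment> \<open>Applied below both to a time shift of \<open>r\<close> and to its negative.\<close>
    have half: "- ((1 - \<epsilon>) * B) \<le> r \<tau> y"
      if r: "damped_transport b s r" and rb: "\<And>y. \<bar>r 0 y\<bar> \<le> B" and B: "B \<le> R" "0 \<le> B"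
        and mean: "integral {-1..1} (r 0) = 0" for r y B
    proof -
      have rb': "\<bar>r t y\<bar> \<le> B" if "0 \<le> t" for t y
        by (rule damped_transport_bounded[OF r b(1,2) sec(1) odd m0 rb that])
      have "\<epsilon> * B \<le> (\<kappa> * ((\<beta> - \<alpha>) / 2)) ^ n * (\<kappa> * (2 / n)) * B"
        using B(2) by (intro mult_right_mono) (auto simp: \<epsilon>_def)
      also have "\<dots> = (\<kappa> * ((\<beta> - \<alpha>) / 2)) ^ n * (\<kappa> * (2 * B / n))" by simp
      also have "\<dots> \<le> r \<tau> y + B"
        unfolding \<tau>_def
        by (rule damped_transport_contract[OF r b _ a0(2) \<beta> sec(2) _ c(2) rb' B(1) mean _ n2 \<kappa>_def])
          (use a0 c n0 in auto)
      finally show ?thesis by (simp add: algebra_simps)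
    qed
    have step: "\<bar>r (k * \<tau>) y\<bar> \<le> (1 - \<epsilon>) ^ k * B" for k :: nat and y
    proof (induction k arbitrary: y)
      case 0
      then show ?case using r0 by simp
    next
      case (Suc k)
      let ?r = "\<lambda>t. r (k * \<tau> + t)" and ?B = "(1 - \<epsilon>) ^ k * B"
      have k0: "0 \<le> k * \<tau>" using \<tau> by simp
      have "(1 - \<epsilon>) ^ k \<le> 1" using \<epsilon> by (intro power_le_one) auto
      then have B': "?B \<le> B" "0 \<le> ?B" using B0 \<epsilon> by (auto intro: mult_left_le_one_le)
      have "- ((1 - \<epsilon>) * ?B) \<le> ?r \<tau> y"
        by (rule half[OF damped_transport_shift[OF r k0]]) (use Suc mean[OF k0] B' B in auto)
      moreover have "- ((1 - \<epsilon>) * ?B) \<le> - ?r \<tau> y"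
      proof (rule half[OF damped_transport_uminus[OF damped_transport_shift[OF r k0] odd]])
        show "integral {-1..1} (\<lambda>y. - ?r 0 y) = 0" using mean[OF k0] by simp
      qed (use Suc B' B in auto)
      ultimately show ?case by (simp add: abs_le_iff algebra_simps)
    qed
    define k where "k = nat \<lfloor>t / \<tau>\<rfloor>"
    have "0 \<le> t / \<tau>" using t \<tau> by simp
    then have k: "k \<le> t / \<tau>" "t / \<tau> < Suc k" unfolding k_def by linarith+
    have k': "k * \<tau> \<le> t" "t \<le> Suc k * \<tau>" using k \<tau> by (auto simp: field_simps)
    have "\<bar>r (k * \<tau> + (t - k * \<tau>)) y\<bar> \<le> (1 - \<epsilon>) ^ k * B"
      by (rule damped_transport_bounded[OF damped_transport_shift[OF r] b(1,2) sec(1) odd m0])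
        (use step k' \<tau> in auto)
    also have "\<dots> = inverse (1 - \<epsilon>) * exp (- \<gamma> * (Suc k * \<tau>)) * B"
      unfolding exp_\<gamma>[symmetric] using \<epsilon> by simp
    also have "\<dots> \<le> inverse (1 - \<epsilon>) * exp (- \<gamma> * t) * B"
      using k'(2) \<gamma> \<epsilon> B0 by (intro mult_right_mono mult_left_mono) auto
    finally show "\<bar>r t y\<bar> \<le> inverse (1 - \<epsilon>) * exp (- \<gamma> * t) * B" by simp
  qed
qed

section \<open>Existence for the transport equation\<close>

lemma continuous_on_integral_upto:
  fixes g :: "real \<Rightarrow> real \<Rightarrow> real"
  assumes g: "continuous_on UNIV (\<lambda>(\<tau>, \<xi>). g \<tau> \<xi>)"
  shows "continuous_on UNIV (\<lambda>(t, \<xi>). integral {0..max 0 t} (\<lambda>\<tau>. g \<tau> \<xi>))"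
proof -
  have eq: "integral {0..max 0 t} (\<lambda>\<tau>. g \<tau> \<xi>)
      = integral (cbox 0 1) (\<lambda>\<tau>. max 0 t * g (max 0 t * \<tau>) \<xi>)" for t \<xi>
  proof -
    let ?T = "max 0 t"
    have "((\<lambda>\<tau>. ?T *\<^sub>R g (?T * \<tau>) \<xi>) has_integral integral {?T * 0..?T * 1} (\<lambda>\<tau>. g \<tau> \<xi>)) {0..1}"
    proof (rule has_integral_substitution)
      show "(*) ?T ` {0..1} \<subseteq> {0..?T}" by (auto intro!: mult_left_le)
      show "continuous_on {0..?T} (\<lambda>\<tau>. g \<tau> \<xi>)"
        by (rule continuous_on_compose2[OF g, of _ "\<lambda>\<tau>. (\<tau>, \<xi>)", simplified]) (auto intro!: continuous_intros)
      show "((*) ?T has_field_derivative ?T) (at x within {0..1})" for x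
        by (auto intro!: derivative_eq_intros)
    qed auto
    from integral_unique[OF this] show ?thesis by simp
  qed
  have "continuous_on UNIV (\<lambda>p::real\<times>real. integral (cbox 0 1)
      (\<lambda>\<tau>. max 0 (fst p) * g (max 0 (fst p) * \<tau>) (snd p)))"
  proof (rule integral_continuous_on_param)
    have "continuous_on (UNIV \<times> cbox 0 1) (\<lambda>q::(real\<times>real)\<times>real.
        max 0 (fst (fst q)) * (\<lambda>(\<tau>, \<xi>). g \<tau> \<xi>) (max 0 (fst (fst q)) * snd q, snd (fst q)))"
      by (intro continuous_intros continuous_on_compose2[OF g]) auto
    then show "continuous_on (UNIV \<times> cbox 0 1) (\<lambda>(p::real\<times>real, \<tau>).
        max 0 (fst p) * g (max 0 (fst p) * \<tau>) (snd p))"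
      by (simp add: split_beta)
  qed
  then show ?thesis by (simp add: eq split_beta)
qed

text \<open>The exponential weight makes the integral operator a contraction with factor one half.\<close>

lemma weighted_integral_bound:
  fixes h1 h2 :: "real \<Rightarrow> real"
  assumes t: "0 \<le> t" and h: "continuous_on {0..t} h1" "continuous_on {0..t} h2"
    and le: "\<And>\<tau>. 0 \<le> \<tau> \<Longrightarrow> \<tau> \<le> t \<Longrightarrow> \<bar>h1 \<tau> - h2 \<tau>\<bar> \<le> C * exp (l * \<tau>) * M"
    and C: "0 \<le> C" "2 * C \<le> l" "0 < l" and M: "0 \<le> M"
  shows "exp (- l * t) * \<bar>integral {0..t} h1 - integral {0..t} h2\<bar> \<le> M / 2"
proof -
  have exp_int: "((\<lambda>\<tau>. C * exp (l * \<tau>) * M) has_integral C * M / l * exp (l * t) - C * M / l * exp (l * 0)) {0..t}"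
    by (rule fundamental_theorem_of_calculus[OF t])
      (auto intro!: derivative_eq_intros simp: has_real_derivative_iff_has_vector_derivative[symmetric] C less_imp_neq[THEN not_sym])
  have "integral {0..t} h1 - integral {0..t} h2 = integral {0..t} (\<lambda>\<tau>. h1 \<tau> - h2 \<tau>)"
    by (rule Henstock_Kurzweil_Integration.integral_diff[symmetric]) (auto intro!: integrable_continuous_interval h)
  also have "norm \<dots> \<le> integral {0..t} (\<lambda>\<tau>. C * exp (l * \<tau>) * M)"
    by (rule integral_norm_bound_integral)
      (auto intro!: integrable_continuous_interval continuous_intros h le)
  also have "\<dots> \<le> C * M / l * exp (l * t)"
    using integral_unique[OF exp_int] C M by simp
  finally have "\<bar>integral {0..t} h1 - integral {0..t} h2\<bar> \<le> C * M / l * exp (l * t)" by simp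
  then have "exp (- l * t) * \<bar>integral {0..t} h1 - integral {0..t} h2\<bar> \<le> exp (- l * t) * (C * M / l * exp (l * t))"
    by (rule mult_left_mono) auto
  also have "\<dots> = C / l * M" by (simp add: exp_minus field_simps)
  also have "\<dots> \<le> 1 / 2 * M" using C M by (intro mult_right_mono) (auto simp: field_simps)
  finally show ?thesis by simp
qed

text \<open>Banach's fixed point theorem in the space of bounded continuous functions of \<open>(t, \<xi>)\<close>, where \<open>\<xi> = y + t\<close> is
  constant along characteristics. The unknown is \<open>U(t, \<xi>) = exp (- l t) r(t, \<xi> - t)\<close>; with these coordinates the
  mirror image of \<open>(\<tau>, \<xi>)\<close> is \<open>(\<tau>, 2\<tau> - \<xi>)\<close>.\<close>

proposition damped_transport_exists:
  assumes b: "continuous_on UNIV b" "\<And>y. \<bar>b y\<bar> \<le> A" "\<And>y. b (y + 2) = b y"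
    and s: "L-lipschitz_on UNIV s" "s 0 = 0"
    and r0: "continuous_on UNIV r0" "\<And>y. \<bar>r0 y\<bar> \<le> B" "\<And>y. r0 (y + 2) = r0 y"
  obtains r where "damped_transport b s r" "r 0 = r0"
proof -
  have A0: "0 \<le> A" using b(2)[of 0] by linarith
  have L0: "0 \<le> L" using s(1) by (rule lipschitz_on_nonneg)
  have B0: "0 \<le> B" using r0(2)[of 0] by linarith
  have slip: "\<bar>s x - s y\<bar> \<le> L * \<bar>x - y\<bar>" for x y
    using lipschitz_onD[OF s(1), of x y] by (simp add: dist_real_def)
  have scont: "continuous_on UNIV s" by (rule lipschitz_on_continuous_on[OF s(1)])
  define C where "C = A * L"
  define l where "l = 2 * C + 1"
  have "0 \<le> C" using A0 L0 by (simp add: C_def)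
  then have C: "0 \<le> C" "2 * C \<le> l" "0 < l" by (auto simp: l_def)
  define N :: "(real \<times> real \<Rightarrow> real) \<Rightarrow> real \<Rightarrow> real \<Rightarrow> real" where
    "N = (\<lambda>U \<tau> \<xi>. b (\<xi> - \<tau>) * s (exp (l * \<tau>) * (U (\<tau>, \<xi>) - U (\<tau>, 2 * \<tau> - \<xi>)) / 2))"
  define F :: "(real \<times> real \<Rightarrow> real) \<Rightarrow> real \<times> real \<Rightarrow> real" where
    "F = (\<lambda>U (t, \<xi>). exp (- l * max 0 t) * (r0 \<xi> - integral {0..max 0 t} (\<lambda>\<tau>. N U \<tau> \<xi>)))"
  have Ncont: "continuous_on UNIV (\<lambda>(\<tau>, \<xi>). N U \<tau> \<xi>)" if "continuous_on UNIV U" for U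
    unfolding N_def split_beta
    by (intro continuous_intros continuous_on_compose2[OF b(1)] continuous_on_compose2[OF scont]
        continuous_on_compose2[OF that]) auto
  have Ncont1: "continuous_on S (\<lambda>\<tau>. N U \<tau> \<xi>)" if "continuous_on UNIV U" for U S \<xi>
  proof -
    have "continuous_on S (\<lambda>\<tau>. (\<tau>, \<xi>))" by (intro continuous_intros)
    from continuous_on_compose2[OF Ncont[OF that] this] show ?thesis by simp
  qed
  have Fcont: "continuous_on UNIV (F U)" if "continuous_on UNIV U" for U
    using continuous_on_integral_upto[OF Ncont[OF that]]
    unfolding F_def split_beta
    by (intro continuous_intros continuous_on_compose2[OF r0(1)]) auto
  have Ndiff: "\<bar>N U \<tau> \<xi> - N V \<tau> \<xi>'\<bar> \<le> C * exp (l * \<tau>) * M"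
    if "\<bar>U (\<tau>, \<xi>) - V (\<tau>, \<xi>')\<bar> \<le> M" "\<bar>U (\<tau>, 2 * \<tau> - \<xi>) - V (\<tau>, 2 * \<tau> - \<xi>')\<bar> \<le> M"
      "b (\<xi> - \<tau>) = b (\<xi>' - \<tau>)" for U V \<tau> \<xi> \<xi>' M
  proof -
    let ?d = "\<lambda>U \<xi>. exp (l * \<tau>) * (U (\<tau>, \<xi>) - U (\<tau>, 2 * \<tau> - \<xi>)) / 2"
    have "\<bar>N U \<tau> \<xi> - N V \<tau> \<xi>'\<bar> = \<bar>b (\<xi>' - \<tau>)\<bar> * \<bar>s (?d U \<xi>) - s (?d V \<xi>')\<bar>"
      unfolding N_def that(3) abs_mult[symmetric] right_diff_distrib ..
    also have "\<dots> \<le> A * (L * \<bar>?d U \<xi> - ?d V \<xi>'\<bar>)"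
      by (intro mult_mono b slip) (use A0 in auto)
    also have "\<bar>?d U \<xi> - ?d V \<xi>'\<bar> = exp (l * \<tau>) *
        (\<bar>(U (\<tau>, \<xi>) - V (\<tau>, \<xi>')) - (U (\<tau>, 2 * \<tau> - \<xi>) - V (\<tau>, 2 * \<tau> - \<xi>'))\<bar> / 2)"
    proof -
      have "?d U \<xi> - ?d V \<xi>' = exp (l * \<tau>) *
        (((U (\<tau>, \<xi>) - V (\<tau>, \<xi>')) - (U (\<tau>, 2 * \<tau> - \<xi>) - V (\<tau>, 2 * \<tau> - \<xi>'))) / 2)"
        by (simp add: field_simps)
      then show ?thesis by (simp only: abs_mult abs_exp_cancel abs_divide abs_numeral)
    qed
    also have "A * (L * \<dots>) \<le> A * (L * (exp (l * \<tau>) * M))"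
      using that A0 L0 by (intro mult_left_mono) auto
    finally show ?thesis by (simp add: C_def mult_ac)
  qed
  \<comment> \<open>Two different points \<open>\<xi>\<close> and \<open>\<xi>'\<close> are allowed so that the estimate also yields the periodicity of the fixed point.\<close>
  have Fdiff: "\<bar>F U (t, \<xi>) - F V (t, \<xi>')\<bar> \<le> M / 2"
    if "continuous_on UNIV U" "continuous_on UNIV V" "r0 \<xi> = r0 \<xi>'"
      "\<And>\<tau>. b (\<xi> - \<tau>) = b (\<xi>' - \<tau>)" "\<And>\<tau>. \<bar>U (\<tau>, \<xi>) - V (\<tau>, \<xi>')\<bar> \<le> M"
      "\<And>\<tau>. \<bar>U (\<tau>, 2 * \<tau> - \<xi>) - V (\<tau>, 2 * \<tau> - \<xi>')\<bar> \<le> M" for U V t \<xi> \<xi>' M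
  proof -
    let ?t = "max 0 t"
    have M: "0 \<le> M" using that(5)[of 0] by linarith
    have "\<bar>F U (t, \<xi>) - F V (t, \<xi>')\<bar>
        = exp (- l * ?t) * \<bar>integral {0..?t} (\<lambda>\<tau>. N U \<tau> \<xi>) - integral {0..?t} (\<lambda>\<tau>. N V \<tau> \<xi>')\<bar>"
      unfolding F_def split_conv right_diff_distrib[symmetric] abs_mult that(3) by simp
    also have "\<dots> \<le> M / 2"
      by (rule weighted_integral_bound[OF _ Ncont1[OF that(1)] Ncont1[OF that(2)] Ndiff C M]) (use that in auto)
    finally show ?thesis .
  qed
  have Fb: "F U \<in> bcontfun" if U: "U \<in> bcontfun" for U
  proof -
    have cU: "continuous_on UNIV U" using U by (simp add: bcontfun_def)
    obtain M where M: "\<And>x. \<bar>U x\<bar> \<le> M" using U by (auto simp: bcontfun_def bounded_iff)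
    have "\<bar>F U (t, \<xi>)\<bar> \<le> B + M" for t \<xi>
    proof -
      have N0: "N (\<lambda>_. 0) \<tau> \<xi> = 0" for \<tau> by (simp add: N_def s)
      have "\<bar>F U (t, \<xi>) - F (\<lambda>_. 0) (t, \<xi>)\<bar> \<le> M / 2"
        by (rule Fdiff[OF cU]) (use M in auto)
      moreover have "\<bar>F (\<lambda>_. 0) (t, \<xi>)\<bar> \<le> B"
      proof -
        have "\<bar>F (\<lambda>_. 0) (t, \<xi>)\<bar> = exp (- l * max 0 t) * \<bar>r0 \<xi>\<bar>" by (simp add: F_def N0 abs_mult)
        also have "\<dots> \<le> 1 * B" using C by (intro mult_mono r0) auto
        finally show ?thesis by simp
      qed
      moreover have "0 \<le> M" using M[of "(0, 0)"] by linarith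
      ultimately show ?thesis by linarith
    qed
    then show ?thesis using Fcont[OF cU] by (auto simp: bcontfun_def bounded_iff)
  qed
  define G :: "((real \<times> real) \<Rightarrow>\<^sub>C real) \<Rightarrow> ((real \<times> real) \<Rightarrow>\<^sub>C real)" where "G = (\<lambda>U. Bcontfun (F U))"
  have G: "apply_bcontfun (G U) = F U" for U
    unfolding G_def by (rule Bcontfun_inverse[OF Fb[OF apply_bcontfun]])
  have "\<exists>!U. G U = U"
  proof (rule banach_fix_type[of "1/2"], simp, simp, intro allI)
    fix U V
    have "dist (G U x) (G V x) \<le> 1 / 2 * dist U V" for x
    proof (cases x)
      case (Pair t \<xi>)
      have *: "\<bar>U x - V x\<bar> \<le> dist U V" for x using dist_bounded[of U x V] by (simp add: dist_real_def)
      have "\<bar>F U (t, \<xi>) - F V (t, \<xi>)\<bar> \<le> dist U V / 2"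
        by (rule Fdiff) (use * in auto)
      then show ?thesis by (simp add: Pair G dist_real_def)
    qed
    then show "dist (G U) (G V) \<le> 1 / 2 * dist U V" by (rule dist_bound)
  qed
  then obtain U where "G U = U" by blast
  then have U: "F U x = U x" for x by (metis G)
  have Ucont: "continuous_on S (apply_bcontfun U)" for S by simp
  have Uper: "U (t, \<xi> + 2) = U (t, \<xi>)" for t \<xi>
  proof -
    have bd: "bdd_above (range (\<lambda>(t, \<xi>). \<bar>U (t, \<xi> + 2) - U (t, \<xi>)\<bar>))"
    proof -
      obtain M where M: "\<And>x. \<bar>U x\<bar> \<le> M" using bounded_apply_bcontfun[of U] by (auto simp: bounded_iff)
      have "\<bar>U (t, \<xi> + 2) - U (t, \<xi>)\<bar> \<le> M + M" for t \<xi>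
        using M[of "(t, \<xi> + 2)"] M[of "(t, \<xi>)"] by linarith
      then show ?thesis by (intro bdd_aboveI2[of _ _ "M + M"]) (simp only: split_paired_all split_conv)
    qed
    define M where "M = (SUP (t, \<xi>). \<bar>U (t, \<xi> + 2) - U (t, \<xi>)\<bar>)"
    have M: "\<bar>U (t, \<xi> + 2) - U (t, \<xi>)\<bar> \<le> M" for t \<xi>
      unfolding M_def using cSUP_upper[OF UNIV_I bd, of "(t, \<xi>)"] by (simp only: split_conv)
    have "\<bar>U (t, \<xi> + 2) - U (t, \<xi>)\<bar> \<le> M / 2" for t \<xi>
    proof -
      have "\<bar>F U (t, \<xi> + 2) - F U (t, \<xi>)\<bar> \<le> M / 2"
      proof (rule Fdiff)
        show "b (\<xi> + 2 - \<tau>) = b (\<xi> - \<tau>)" for \<tau> using b(3)[of "\<xi> - \<tau>"] by (simp add: algebra_simps)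
        show "\<bar>U (\<tau>, 2 * \<tau> - (\<xi> + 2)) - U (\<tau>, 2 * \<tau> - \<xi>)\<bar> \<le> M" for \<tau>
        proof -
          have "2 * \<tau> - \<xi> = 2 * \<tau> - (\<xi> + 2) + 2" by simp
          then show ?thesis using M[of \<tau> "2 * \<tau> - (\<xi> + 2)"] by (metis abs_minus_commute)
        qed
        show "r0 (\<xi> + 2) = r0 \<xi>" by (rule r0(3))
      qed (rule Ucont Ucont M)+
      then show ?thesis by (simp only: U)
    qed
    then have "(case p of (t, \<xi>) \<Rightarrow> \<bar>U (t, \<xi> + 2) - U (t, \<xi>)\<bar>) \<le> M / 2" for p
      by (cases p) (simp only: split_conv)
    then have "(SUP (t, \<xi>). \<bar>U (t, \<xi> + 2) - U (t, \<xi>)\<bar>) \<le> M / 2"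
      by (intro cSUP_least UNIV_not_empty)
    then have "M \<le> M / 2" unfolding M_def .
    with M[of t \<xi>] show ?thesis by linarith
  qed
  define r where "r = (\<lambda>t y. exp (l * t) * U (t, y + t))"
  have r_eq: "r t (\<xi> - t) = r0 \<xi> - integral {0..t} (\<lambda>\<tau>. N U \<tau> \<xi>)" if "0 \<le> t" for t \<xi>
  proof -
    have "exp (- l * t) * (r0 \<xi> - integral {0..t} (\<lambda>\<tau>. N U \<tau> \<xi>)) = U (t, \<xi>)"
      using U[of "(t, \<xi>)"] that by (simp only: F_def split_conv max_absorb2)
    then have "exp (l * t) * U (t, \<xi>)
        = exp (l * t) * exp (- l * t) * (r0 \<xi> - integral {0..t} (\<lambda>\<tau>. N U \<tau> \<xi>))" by simp
    also have "exp (l * t) * exp (- l * t) = 1" by (simp add: exp_add[symmetric])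
    finally show ?thesis by (simp add: r_def)
  qed
  have "damped_transport b s r"
    unfolding damped_transport_def
  proof (intro conjI allI impI)
    show "continuous_on ({0..} \<times> UNIV) (\<lambda>(t, y). r t y)"
      unfolding r_def split_beta by (intro continuous_intros continuous_on_compose2[OF Ucont[of UNIV]]) auto
    show "r t (y + 2) = r t y" for t y using Uper[of t "y + t"] by (simp add: r_def algebra_simps)
    fix t \<xi> :: real assume t: "0 \<le> t"
    have "((\<lambda>t. integral {0..t} (\<lambda>\<tau>. N U \<tau> \<xi>)) has_real_derivative N U t \<xi>) (at t within {0..t + 1})"
      by (rule integral_has_real_derivative[OF Ncont1]) (use t in auto)
    moreover have "at t within {0..t + 1} = at t within {0..}"
      by (rule at_within_nhd[of _ "{..<t + 1}"]) auto
    ultimately have "((\<lambda>t. r0 \<xi> - integral {0..t} (\<lambda>\<tau>. N U \<tau> \<xi>)) has_real_derivative 0 - N U t \<xi>) (at t within {0..})"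
      by (intro DERIV_diff) auto
    then have "((\<lambda>t. r t (\<xi> - t)) has_real_derivative 0 - N U t \<xi>) (at t within {0..})"
      by (rule has_field_derivative_transform_within[of _ _ _ _ 1]) (use t r_eq in auto)
    then show "((\<lambda>t. r t (\<xi> - t)) has_real_derivative
        - b (\<xi> - t) * s ((r t (\<xi> - t) - r t (t - \<xi>)) / 2)) (at t within {0..})"
      unfolding N_def r_def by (simp only: right_diff_distrib[symmetric] diff_add_cancel mult_2
          add_diff_eq diff_0 mult_minus_left diff_add_eq)
  qed
  moreover have "r 0 = r0"
  proof
    show "r 0 y = r0 y" for y using r_eq[of 0 y] by simp
  qed
  ultimately show ?thesis by (rule that)
qed

section \<open>Lebesgue integrals over intervals\<close>

lemma AE_lebesgue_on_iff:
  assumes "S \<in> sets borel"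
  shows "(AE x in lebesgue_on S. P x) \<longleftrightarrow> (AE x in lborel. x \<in> S \<longrightarrow> P x)"
  using assms by (subst AE_restrict_space_iff) (auto simp: AE_completion_iff)

lemma borel_representative:
  fixes f :: "'a::euclidean_space \<Rightarrow> real"
  assumes "f \<in> borel_measurable (lebesgue_on S)" and S: "S \<in> sets borel"
  obtains g where "g \<in> borel_measurable borel" "AE x in lborel. x \<in> S \<longrightarrow> f x = g x" "\<And>x. x \<notin> S \<Longrightarrow> g x = 0"
proof -
  have "(\<lambda>x. if x \<in> S then f x else 0) \<in> borel_measurable lebesgue"
    by (rule borel_measurable_if_I[OF assms(1)]) (use S in auto)
  then obtain g where g: "g \<in> borel_measurable lborel" "AE x in lborel. (if x \<in> S then f x else 0) = g x"
    using completion_ex_borel_measurable_real by blast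
  show ?thesis
  proof (rule that)
    show "(\<lambda>x. indicator S x * g x) \<in> borel_measurable borel"
      using S g(1) by measurable
    show "AE x in lborel. x \<in> S \<longrightarrow> f x = indicator S x * g x"
      using g(2) by eventually_elim auto
  qed auto
qed

lemma bounded_borel_representative:
  fixes f :: "'a::euclidean_space \<Rightarrow> real"
  assumes f: "f \<in> borel_measurable (lebesgue_on S)" and S: "S \<in> sets borel"
    and bd: "AE x in lebesgue_on S. \<bar>f x\<bar> \<le> C" and C: "0 \<le> C"
  obtains g where "g \<in> borel_measurable borel" "AE x in lborel. x \<in> S \<longrightarrow> f x = g x" "\<And>x. x \<notin> S \<Longrightarrow> g x = 0"
    "\<And>x. \<bar>g x\<bar> \<le> C"
proof -
  obtain g where g: "g \<in> borel_measurable borel" "AE x in lborel. x \<in> S \<longrightarrow> f x = g x" "\<And>x. x \<notin> S \<Longrightarrow> g x = 0"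
    using borel_representative[OF f S] by blast
  show ?thesis
  proof (rule that)
    show "(\<lambda>x. max (- C) (min C (g x))) \<in> borel_measurable borel" using g(1) by measurable
    show "AE x in lborel. x \<in> S \<longrightarrow> f x = max (- C) (min C (g x))"
      using g(2) bd[unfolded AE_lebesgue_on_iff[OF S]] by eventually_elim auto
  qed (use g(3) C in auto)
qed

lemma
  fixes f g :: "'a::euclidean_space \<Rightarrow> real"
  assumes f: "f \<in> borel_measurable (lebesgue_on S)" and S: "S \<in> sets borel"
    and g: "g \<in> borel_measurable borel" and eq: "AE x in lborel. x \<in> S \<longrightarrow> f x = g x"
  shows integral_lebesgue_on_representative: "(LINT x|lebesgue_on S. f x) = (LBINT x:S. g x)"
    and integrable_lebesgue_on_representative: "integrable (lebesgue_on S) f \<longleftrightarrow> set_integrable lborel S g"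
proof -
  have g': "g \<in> borel_measurable (lebesgue_on S)"
    using g by (intro measurable_restrict_space1 measurable_completion) auto
  have ae: "AE x in lebesgue_on S. f x = g x" using eq AE_lebesgue_on_iff[OF S] by simp
  have m: "(\<lambda>x. indicat_real S x *\<^sub>R g x) \<in> borel_measurable lborel" using g S by measurable
  have "(LINT x|lebesgue_on S. f x) = (LINT x|lebesgue_on S. g x)"
    by (rule integral_cong_AE[OF f g' ae])
  also have "\<dots> = (LINT x|lebesgue. indicat_real S x *\<^sub>R g x)"
    by (rule integral_restrict_space) (use S in auto)
  also have "\<dots> = (LBINT x:S. g x)"
    unfolding set_lebesgue_integral_def by (rule integral_completion[OF m])
  finally show "(LINT x|lebesgue_on S. f x) = (LBINT x:S. g x)" .
  have "integrable (lebesgue_on S) f \<longleftrightarrow> integrable (lebesgue_on S) g"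
    by (rule integrable_cong_AE[OF f g' ae])
  also have "\<dots> \<longleftrightarrow> integrable lebesgue (\<lambda>x. indicat_real S x *\<^sub>R g x)"
    by (rule integrable_restrict_space) (use S in auto)
  also have "\<dots> \<longleftrightarrow> set_integrable lborel S g"
    unfolding set_integrable_def by (rule integrable_completion[OF m])
  finally show "integrable (lebesgue_on S) f \<longleftrightarrow> set_integrable lborel S g" .
qed

lemma AE_zero_if_interval_integrals_zero:
  fixes D :: "real \<Rightarrow> real"
  assumes int: "integrable lborel D" and out: "\<And>x. x \<notin> {l..u} \<Longrightarrow> D x = 0"
    and zero: "\<And>c d. l \<le> c \<Longrightarrow> c \<le> d \<Longrightarrow> d \<le> u \<Longrightarrow> (LBINT x:{c..d}. D x) = 0"
  shows "AE x in lborel. D x = 0"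
proof (rule sigma_finite_measure.density_zero[OF lborel.sigma_finite_measure_axioms int])
  fix A :: "real set" assume "A \<in> sets lborel"
  then have A: "A \<in> sigma_sets UNIV (range (\<lambda>(a, b). {a..b::real}))"
    by (simp add: borel_eq_atLeastAtMost)
  have box: "(LBINT x:{c..d}. D x) = 0" for c d
  proof (cases "max c l \<le> min d u")
    case True
    have "(LBINT x:{c..d}. D x) = (LBINT x:{max c l..min d u}. D x)"
      unfolding set_lebesgue_integral_def
      by (rule Bochner_Integration.integral_cong) (use out in \<open>auto simp: indicator_def max_def min_def\<close>)
    also have "\<dots> = 0" using True by (intro zero) auto
    finally show ?thesis .
  next
    case False
    have "(LBINT x:{c..d}. D x) = integral\<^sup>L lborel (\<lambda>_::real. 0)"
      unfolding set_lebesgue_integral_def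
      by (rule Bochner_Integration.integral_cong) (use out False in \<open>auto simp: indicator_def max_def min_def split: if_splits\<close>)
    then show ?thesis by simp
  qed
  have all: "(\<integral>x. D x \<partial>lborel) = 0"
  proof -
    have "(\<integral>x. D x \<partial>lborel) = (LBINT x:{l..u}. D x)"
      unfolding set_lebesgue_integral_def
      by (rule Bochner_Integration.integral_cong) (use out in \<open>auto simp: indicator_def\<close>)
    then show ?thesis by (simp add: box)
  qed
  have si: "set_integrable lborel B D" if "B \<in> sets borel" for B
    using int that unfolding set_integrable_def by (intro integrable_mult_indicator) auto
  show "(LBINT x:A. D x) = 0"
  proof (rule sigma_sets_induct_disjoint[OF _ _ A])
    show "Int_stable (range (\<lambda>(a, b). {a..b::real}))"
      by (auto simp: Int_stable_def Int_atLeastAtMost)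
    fix B assume "B \<in> range (\<lambda>(a, b). {a..b::real})"
    then show "(LBINT x:B. D x) = 0" using box by auto
  next
    show "(LBINT x:{}. D x) = 0" by (simp add: set_lebesgue_integral_def)
  next
    fix B assume B: "B \<in> sigma_sets UNIV (range (\<lambda>(a, b). {a..b::real}))" "(LBINT x:B. D x) = 0"
    then have Bb: "B \<in> sets borel" by (simp add: borel_eq_atLeastAtMost)
    have "(LBINT x:(UNIV - B) \<union> B. D x) = (LBINT x:UNIV - B. D x) + (LBINT x:B. D x)"
      by (rule set_integral_Un) (use Bb si in auto)
    moreover have "(UNIV - B) \<union> B = UNIV" by auto
    ultimately show "(LBINT x:UNIV - B. D x) = 0" using all B(2) by (simp add: set_lebesgue_integral_def)
  next
    fix B :: "nat \<Rightarrow> real set" assume B: "disjoint_family B"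
      "range B \<subseteq> sigma_sets UNIV (range (\<lambda>(a, b). {a..b::real}))" "\<And>i. (LBINT x:B i. D x) = 0"
    then have Bb: "B i \<in> sets borel" for i by (auto simp: borel_eq_atLeastAtMost)
    have "(LBINT x:(\<Union>i. B i). D x) = (\<Sum>i. LBINT x:B i. D x)"
      by (rule lebesgue_integral_countable_add) (use Bb si B(1) in \<open>auto simp: disjoint_family_on_def\<close>)
    then show "(LBINT x:\<Union>(range B). D x) = 0" by (simp add: B(3))
  qed auto
qed

lemma integrable_pair_mult:
  fixes F G :: "real \<Rightarrow> real"
  assumes F: "integrable lborel F" and G: "integrable lborel G"
  shows "integrable (lborel \<Otimes>\<^sub>M lborel) (\<lambda>(x, y). F x * G y)"
proof -
  note [measurable] = borel_measurable_integrable[OF F] borel_measurable_integrable[OF G]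
  show ?thesis
  proof (rule lborel_pair.Fubini_integrable)
    have "integrable lborel (\<lambda>x. \<bar>F x\<bar> * (\<integral>y. \<bar>G y\<bar> \<partial>lborel))"
      using F by (intro integrable_mult_left integrable_abs)
    then show "integrable lborel (\<lambda>x. \<integral>y. norm (case (x, y) of (x, y) \<Rightarrow> F x * G y) \<partial>lborel)"
      by (simp add: abs_mult)
  qed (use G in auto)
qed

lemma integral_triangle_swap:
  fixes F G :: "real \<Rightarrow> real"
  assumes F: "integrable lborel F" and G: "integrable lborel G"
  shows "(\<integral>x. F x * (LBINT y:{..x}. G y) \<partial>lborel) = (\<integral>y. G y * (LBINT x:{y..}. F x) \<partial>lborel)"
proof -
  note [measurable] = borel_measurable_integrable[OF F] borel_measurable_integrable[OF G]
  let ?H = "\<lambda>x y. if y \<le> x then F x * G y else 0"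
  have H: "integrable (lborel \<Otimes>\<^sub>M lborel) (\<lambda>(x, y). ?H x y)"
    by (rule Bochner_Integration.integrable_bound[OF integrable_pair_mult[OF F G]]) auto
  have H1: "F x * (LBINT y:{..x}. G y) = (\<integral>y. ?H x y \<partial>lborel)" for x
  proof -
    have "(\<integral>y. ?H x y \<partial>lborel) = (\<integral>y. F x * (indicat_real {..x} y *\<^sub>R G y) \<partial>lborel)"
      by (rule Bochner_Integration.integral_cong) auto
    then show ?thesis by (simp only: set_lebesgue_integral_def integral_mult_right_zero)
  qed
  have H2: "G y * (LBINT x:{y..}. F x) = (\<integral>x. ?H x y \<partial>lborel)" for y
  proof -
    have "(\<integral>x. ?H x y \<partial>lborel) = (\<integral>x. G y * (indicat_real {y..} x *\<^sub>R F x) \<partial>lborel)"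
      by (rule Bochner_Integration.integral_cong) auto
    then show ?thesis by (simp only: set_lebesgue_integral_def integral_mult_right_zero)
  qed
  have "(\<integral>x. F x * (LBINT y:{..x}. G y) \<partial>lborel) = (\<integral>x. \<integral>y. ?H x y \<partial>lborel \<partial>lborel)"
    by (simp only: H1)
  also have "\<dots> = (\<integral>y. \<integral>x. ?H x y \<partial>lborel \<partial>lborel)"
    by (rule lborel_pair.Fubini_integral[symmetric, OF H])
  also have "\<dots> = (\<integral>y. G y * (LBINT x:{y..}. F x) \<partial>lborel)"
    by (simp only: H2)
  finally show ?thesis .
qed

lemma set_integral_continuous_eq_integral:
  fixes f :: "real \<Rightarrow> real"
  assumes "continuous_on {a..b} f"
  shows "set_integrable lborel {a..b} f" "(LBINT x:{a..b}. f x) = integral {a..b} f"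
  using borel_integrable_atLeastAtMost'[OF assms] set_borel_integral_eq_integral(2) by auto

lemma set_integral_by_parts:
  fixes f G G' :: "real \<Rightarrow> real"
  assumes f: "set_integrable lborel {a..b} f"
    and G: "\<And>x. x \<in> {a..b} \<Longrightarrow> (G has_real_derivative G' x) (at x within {a..b})" "continuous_on {a..b} G'"
  shows "(LBINT x:{a..b}. (LBINT y:{a..x}. f y) * G' x) = (LBINT y:{a..b}. f y * (G b - G y))"
proof -
  let ?F = "\<lambda>x. indicat_real {a..b} x * G' x" and ?f = "\<lambda>y. indicat_real {a..b} y * f y"
  have F: "integrable lborel ?F"
    using set_integral_continuous_eq_integral(1)[OF G(2)] by (simp add: set_integrable_def)
  have f': "integrable lborel ?f" using f by (simp add: set_integrable_def)
  have "(LBINT x:{a..b}. (LBINT y:{a..x}. f y) * G' x) = (\<integral>x. ?F x * (LBINT y:{..x}. ?f y) \<partial>lborel)"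
    unfolding set_lebesgue_integral_def
    by (intro Bochner_Integration.integral_cong refl)
      (auto simp: indicator_def intro!: Bochner_Integration.integral_cong)
  also have "\<dots> = (\<integral>y. ?f y * (LBINT x:{y..}. ?F x) \<partial>lborel)"
    by (rule integral_triangle_swap[OF F f'])
  also have "\<dots> = (LBINT y:{a..b}. f y * (G b - G y))"
    unfolding set_lebesgue_integral_def[of lborel "{a..b}"]
  proof (intro Bochner_Integration.integral_cong refl)
    fix y
    show "?f y * (LBINT x:{y..}. ?F x) = indicat_real {a..b} y *\<^sub>R (f y * (G b - G y))"
    proof (cases "y \<in> {a..b}")
      case True
      have "(LBINT x:{y..}. ?F x) = (LBINT x:{y..b}. G' x)"
        unfolding set_lebesgue_integral_def
        by (rule Bochner_Integration.integral_cong) (use True in \<open>auto simp: indicator_def\<close>)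
      also have "\<dots> = integral {y..b} G'"
        by (rule set_integral_continuous_eq_integral(2)) (use True in \<open>auto intro: continuous_on_subset[OF G(2)]\<close>)
      also have "\<dots> = G b - G y"
      proof (rule integral_unique, rule fundamental_theorem_of_calculus)
        fix x assume "x \<in> {y..b}"
        with True have "(G has_real_derivative G' x) (at x within {y..b})"
          by (intro DERIV_subset[OF G(1)]) auto
        then show "(G has_vector_derivative G' x) (at x within {y..b})"
          by (simp add: has_real_derivative_iff_has_vector_derivative)
      qed (use True in auto)
      finally show ?thesis using True by simp
    qed simp
  qed
  finally show ?thesis .
qed

section \<open>Test functions and the lemma of du Bois-Reymond\<close>

text \<open>Trapezoid on \<open>[c, d]\<close> with slopes \<open>n\<close> and \<open>- n\<close>, cut off at height 1; it tends to the indicator of the open interval.\<close>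

definition hat :: "real \<Rightarrow> real \<Rightarrow> real \<Rightarrow> real \<Rightarrow> real" where
  "hat c d n x = min 1 (n * max 0 (min (x - c) (d - x)))"

lemma hat_continuous: "continuous_on S (hat c d n)"
  unfolding hat_def by (intro continuous_intros)

lemma hat_outside:
  assumes "x \<notin> {c<..<d}" shows "hat c d n x = 0"
proof -
  have "min (x - c) (d - x) \<le> 0" using assms by auto
  then show ?thesis by (simp add: hat_def max_absorb1)
qed

lemma hat_range: "0 \<le> n \<Longrightarrow> hat c d n x \<in> {0..1}"
  by (auto simp: hat_def)

lemma hat_tendsto: "(\<lambda>n. hat c d (real n) x) \<longlonglongrightarrow> indicator {c<..<d} x"
proof (cases "x \<in> {c<..<d}")
  case True
  define e where "e = max 0 (min (x - c) (d - x))"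
  have e: "0 < e" using True by (auto simp: e_def)
  obtain N :: nat where N: "1 / e < N" using reals_Archimedean2 by blast
  have "hat c d (real n) x = 1" if "N \<le> n" for n
  proof -
    have "1 / e \<le> real n" using N that by linarith
    then show ?thesis using e unfolding hat_def e_def[symmetric] by (simp add: field_simps)
  qed
  then have "eventually (\<lambda>n. hat c d (real n) x = 1) sequentially"
    unfolding eventually_sequentially by blast
  then show ?thesis using True by (simp add: tendsto_eventually)
next
  case False
  then show ?thesis by (simp add: hat_outside)
qed

text \<open>A continuous function with compact support and mean zero is the derivative of a test function.\<close>

lemma test_fun_exists:
  fixes g :: "real \<Rightarrow> real"
  assumes g: "continuous_on UNIV g" "\<And>x. x \<notin> {a..b} \<Longrightarrow> g x = 0" and "integral {a..b} g = 0"
    and ab: "a \<le> b" "{a..b} \<subseteq> S"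
  obtains \<phi> where "test_fun S \<phi> g"
proof
  let ?\<phi> = "\<lambda>x. integral {a - 1..x} g"
  have low: "?\<phi> x = 0" if "x \<le> a" for x
  proof -
    have ga: "g y = 0" if "y \<le> a" for y
    proof (cases "y < a")
      case False
      have "(g \<longlongrightarrow> g a) (at_left a)"
        using g(1) by (auto simp: continuous_on_def intro: tendsto_mono[OF at_le])
      moreover have "(g \<longlongrightarrow> 0) (at_left a)"
      proof (rule tendsto_eventually)
        have "eventually (\<lambda>x. x < a) (at_left a)" by (simp add: eventually_at_filter)
        then show "eventually (\<lambda>x. g x = 0) (at_left a)" by eventually_elim (rule g(2), simp)
      qed
      ultimately have "g a = 0" using tendsto_unique[OF trivial_limit_at_left_real] by blast
      then show ?thesis using False that by simp
    qed (use g(2) in auto)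
    have "integral {a - 1..x} g = integral {a - 1..x} (\<lambda>_. 0)"
      by (rule integral_cong) (use that ga in auto)
    then show ?thesis by simp
  qed
  have high: "?\<phi> x = 0" if "b < x" for x
  proof -
    have int: "g integrable_on {u..v}" for u v
      by (intro integrable_continuous_interval continuous_on_subset[OF g(1)]) auto
    have "integral {a - 1..x} g = integral {a..b} g"
    proof -
      have "integral {a - 1..x} g = integral {a - 1..a} g + integral {a..x} g"
        by (rule Henstock_Kurzweil_Integration.integral_combine[symmetric, OF _ _ int]) (use ab that in auto)
      moreover have "integral {a..x} g = integral {a..b} g + integral {b..x} g"
        by (rule Henstock_Kurzweil_Integration.integral_combine[symmetric, OF _ _ int]) (use ab that in auto)
      moreover have "integral {b..x} g = integral {b..x} (\<lambda>_. 0)"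
        by (rule integral_spike[of "{b}"]) (use g(2) in auto)
      ultimately show ?thesis using low[of a] by simp
    qed
    then show ?thesis using assms(3) by simp
  qed
  show "test_fun S ?\<phi> g"
    unfolding test_fun_def
  proof (intro conjI allI impI exI[of _ "{a..b}"])
    fix x show "(?\<phi> has_real_derivative g x) (at x)"
    proof (cases "x < a")
      case True
      have "((\<lambda>_. 0) has_real_derivative g x) (at x)" using g(2)[of x] True by auto
      then show ?thesis
        by (rule has_field_derivative_transform_within[of _ _ _ _ "a - x"])
          (use True low in \<open>auto simp: dist_real_def\<close>)
    next
      case False
      have "(?\<phi> has_real_derivative g x) (at x within {a - 1..x + 1})"
        by (rule integral_has_real_derivative[OF continuous_on_subset[OF g(1)]]) (use False in auto)
      moreover have "at x within {a - 1..x + 1} = at x"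
        by (rule at_within_interior) (use False in auto)
      ultimately show ?thesis by simp
    qed
  next
    show "integral {a - 1..x} g = 0" if "x \<notin> {a..b}" for x :: real using that low[of x] high[of x] by auto
  qed (use g ab in auto)
qed

lemma AE_subintervals:
  fixes S :: "real set"
  assumes S: "open S" and ae: "\<And>c d. {c..d} \<subseteq> S \<Longrightarrow> AE x in lborel. x \<in> {c..d} \<longrightarrow> P x"
  shows "AE x in lborel. x \<in> S \<longrightarrow> P x"
proof -
  have "AE x in lborel. \<forall>p\<in>\<rat> \<times> \<rat>. {fst p..snd p} \<subseteq> S \<longrightarrow> x \<in> {fst p..snd p} \<longrightarrow> P x"
  proof -
    have c: "countable ((\<rat> :: real set) \<times> (\<rat> :: real set))" by (intro countable_SIGMA countable_rat)
    have "AE x in lborel. {fst p..snd p} \<subseteq> S \<longrightarrow> x \<in> {fst p..snd p} \<longrightarrow> P x" for p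
      using ae[of "fst p" "snd p"] by (cases "{fst p..snd p} \<subseteq> S") auto
    then show ?thesis by (intro AE_ball_countable[OF c, THEN iffD2] ballI)
  qed
  then show ?thesis
  proof eventually_elim
    case (elim x)
    show ?case
    proof
      assume "x \<in> S"
      then obtain e where e: "0 < e" "\<And>y. \<bar>y - x\<bar> < e \<Longrightarrow> y \<in> S"
        using S by (auto simp: open_dist dist_real_def)
      obtain c where c: "c \<in> \<rat>" "x - e < c" "c < x" using Rats_dense_in_real[of "x - e" x] e by auto
      obtain d where d: "d \<in> \<rat>" "x < d" "d < x + e" using Rats_dense_in_real[of x "x + e"] e by auto
      have "{c..d} \<subseteq> S" using c d by (auto intro!: e(2))
      then show "P x" using elim c d by force
    qed
  qed
qed

text \<open>A locally integrable function that annihilates the derivatives of all test functions is constant almost everywhere.\<close>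

lemma du_Bois_Reymond:
  fixes D :: "real \<Rightarrow> real"
  assumes S: "open S" "convex S" and D: "D \<in> borel_measurable borel"
    and int: "\<And>c d. {c..d} \<subseteq> S \<Longrightarrow> set_integrable lborel {c..d} D"
    and zero: "\<And>\<phi> \<phi>'. test_fun S \<phi> \<phi>' \<Longrightarrow> (LBINT x:S. D x * \<phi>' x) = 0"
  shows "\<exists>\<kappa>. AE x in lborel. x \<in> S \<longrightarrow> D x = \<kappa>"
proof (cases "S = {}")
  case False
  have Sb: "S \<in> sets borel" using S by simp
  note [measurable] = D Sb
  obtain c0 d0 where c0: "c0 < d0" "{c0..d0} \<subseteq> S"
  proof -
    obtain x where "x \<in> S" using False by auto
    then obtain e where e: "0 < e" "\<And>y. \<bar>y - x\<bar> < e \<Longrightarrow> y \<in> S"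
      using S by (auto simp: open_dist dist_real_def)
    show ?thesis
      by (rule that[of "x" "x + e / 2"]) (use e in \<open>auto intro!: e(2)\<close>)
  qed
  define g0 where "g0 = hat c0 d0 1"
  define I0 where "I0 = integral {c0..d0} g0"
  have I0: "0 < I0"
  proof -
    have g0c: "continuous_on {c0..d0} g0" unfolding g0_def by (rule hat_continuous)
    have ge: "0 \<le> g0 x" for x using hat_range[of 1] by (auto simp: g0_def)
    have "I0 \<noteq> 0"
    proof
      assume "I0 = 0"
      then have "(g0 has_integral 0) (cbox c0 d0)"
        unfolding I0_def using integrable_integral[OF integrable_continuous_interval[OF g0c]] by simp
      then have "g0 ((c0 + d0) / 2) = 0"
        by (intro has_integral_0_cbox_imp_0[of c0 d0 g0]) (use g0c ge c0 in auto)
      then show False using c0 by (auto simp: g0_def hat_def min_def max_def split: if_splits)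
    qed
    moreover have "0 \<le> I0" unfolding I0_def by (intro integral_nonneg integrable_continuous_interval g0c ge)
    ultimately show ?thesis by simp
  qed
  define \<kappa> where "\<kappa> = (LBINT x:S. D x * g0 x) / I0"
  have Dint: "set_integrable lborel S (\<lambda>x. D x * g x)"
    if g: "continuous_on UNIV g" "\<And>x. x \<notin> {c..d} \<Longrightarrow> g x = 0" and cd: "{c..d} \<subseteq> S" for g c d
  proof -
    have [measurable]: "g \<in> borel_measurable borel" using g(1) by (rule borel_measurable_continuous_onI)
    have "bounded (g ` {c..d})"
      by (intro compact_imp_bounded compact_continuous_image continuous_on_subset[OF g(1)]) auto
    then obtain M where "\<forall>y\<in>g ` {c..d}. norm y \<le> M" unfolding bounded_iff by blast
    then have M: "\<bar>g x\<bar> \<le> M" if "x \<in> {c..d}" for x using that by auto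
    have "integrable lborel (\<lambda>x. M * (indicat_real {c..d} x *\<^sub>R D x))"
      using int[OF cd] unfolding set_integrable_def by (rule integrable_mult_right)
    then show ?thesis
      unfolding set_integrable_def
    proof (rule Bochner_Integration.integrable_bound)
      have "\<bar>D x * g x\<bar> \<le> \<bar>M * D x\<bar>" if "x \<in> {c..d}" for x
        using mult_right_mono[OF M[OF that], of "\<bar>D x\<bar>"] M[OF that] by (simp add: abs_mult mult.commute)
      then show "AE x in lborel. norm (indicat_real S x *\<^sub>R (D x * g x)) \<le> norm (M * (indicat_real {c..d} x *\<^sub>R D x))"
        using g(2) by (auto simp: indicator_def)
    qed measurable
  qed
  have key: "(LBINT x:S. D x * g x) = \<kappa> * integral {c..d} g"
    if g: "continuous_on UNIV g" "\<And>x. x \<notin> {c..d} \<Longrightarrow> g x = 0" and cd: "{c..d} \<subseteq> S" "c \<le> d" for g c d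
  proof -
    define I where "I = integral {c..d} g"
    define h where "h = (\<lambda>x. g x - I / I0 * g0 x)"
    let ?a = "min c c0" and ?b = "max d d0"
    have sub: "{?a..?b} \<subseteq> S"
    proof -
      have "?a \<in> S" "?b \<in> S" using cd c0 by (auto simp: min_def max_def)
      then have "closed_segment ?a ?b \<subseteq> S" by (intro closed_segment_subset S(2)) auto
      moreover have "?a \<le> ?b" using cd c0 by auto
      ultimately show ?thesis by (simp add: closed_segment_eq_real_ivl)
    qed
    have g0c: "continuous_on UNIV g0" unfolding g0_def by (rule hat_continuous)
    have g0o: "g0 x = 0" if "x \<notin> {c0..d0}" for x using that unfolding g0_def by (intro hat_outside) auto
    have ints: "f integrable_on {u..v}" if "continuous_on UNIV f" for f :: "real \<Rightarrow> real" and u v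
      by (intro integrable_continuous_interval continuous_on_subset[OF that]) auto
    have ext: "integral {?a..?b} f = integral {u..v} f"
      if "\<And>x. x \<notin> {u..v} \<Longrightarrow> f x = 0" "{u..v} \<subseteq> {?a..?b}" for f :: "real \<Rightarrow> real" and u v
    proof -
      have "integral {?a..?b} (\<lambda>x. if x \<in> {u..v} then f x else 0) = integral {u..v} f"
        using that(2) by (simp only: integral_restrict_Int inf.absorb1)
      moreover have "(\<lambda>x. if x \<in> {u..v} then f x else 0) = f" using that(1) by auto
      ultimately show ?thesis by simp
    qed
    have "integral {?a..?b} h = integral {?a..?b} g - I / I0 * integral {?a..?b} g0"
    proof -
      have "(\<lambda>x. I / I0 * g0 x) integrable_on {?a..?b}" by (rule ints) (intro continuous_intros g0c)
      then show ?thesis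
        unfolding h_def by (simp add: Henstock_Kurzweil_Integration.integral_diff[OF ints[OF g(1)]])
    qed
    also have "\<dots> = 0"
      using ext[OF g(2)] ext[OF g0o] I0 by (simp add: I_def I0_def)
    finally have h0: "integral {?a..?b} h = 0" .
    have hc: "continuous_on UNIV h" unfolding h_def by (intro continuous_intros g g0c)
    have ho: "h x = 0" if "x \<notin> {?a..?b}" for x
    proof -
      have "g x = 0" "g0 x = 0" using that by (auto intro!: g(2) g0o)
      then show ?thesis by (simp add: h_def)
    qed
    have ab: "?a \<le> ?b" using cd c0 by auto
    obtain \<phi> where "test_fun S \<phi> h" by (rule test_fun_exists[OF hc ho h0 ab sub])
    from zero[OF this] have "0 = (LBINT x:S. D x * g x - I / I0 * (D x * g0 x))"
      by (simp add: h_def algebra_simps)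
    also have "\<dots> = (LBINT x:S. D x * g x) - I / I0 * (LBINT x:S. D x * g0 x)"
      using Dint[OF g cd(1)] Dint[OF g0c g0o c0(2)]
      by (subst set_integral_diff) (auto simp: set_integral_mult_right)
    finally show ?thesis by (simp add: \<kappa>_def I_def)
  qed
  have interval: "(LBINT x:{c..d}. D x - \<kappa>) = 0" if cd: "{c..d} \<subseteq> S" "c \<le> d" for c d
  proof -
    have Dk: "set_integrable lborel {c..d} (\<lambda>x. D x - \<kappa>)"
      by (intro set_integral_diff(1) int[OF cd(1)] set_integral_continuous_eq_integral(1) continuous_intros)
    have van: "(\<integral>x. indicat_real {c..d} x * (D x - \<kappa>) * hat c d (real n) x \<partial>lborel) = 0" for n
    proof -
      let ?g = "hat c d (real n)"
      have out: "?g x = 0" if "x \<notin> {c..d}" for x using that by (intro hat_outside) auto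
      have 1: "set_integrable lborel {c..d} (\<lambda>x. D x * ?g x)"
        by (rule set_integrable_subset[OF Dint[OF hat_continuous out cd(1)]]) (use cd in auto)
      have 2: "set_integrable lborel {c..d} (\<lambda>x. \<kappa> * ?g x)"
        by (intro set_integral_continuous_eq_integral(1) continuous_intros hat_continuous)
      have "(LBINT x:{c..d}. D x * ?g x) = (LBINT x:S. D x * ?g x)"
        unfolding set_lebesgue_integral_def
        by (rule Bochner_Integration.integral_cong) (use cd out in \<open>auto simp: indicator_def\<close>)
      also have "\<dots> = \<kappa> * integral {c..d} ?g" by (rule key[OF hat_continuous out cd])
      also have "\<dots> = (LBINT x:{c..d}. \<kappa> * ?g x)"
        by (subst set_integral_continuous_eq_integral(2)) (auto intro!: continuous_intros hat_continuous)
      finally have "(LBINT x:{c..d}. D x * ?g x - \<kappa> * ?g x) = 0"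
        using set_integral_diff(2)[OF 1 2] by simp
      then show ?thesis by (simp add: set_lebesgue_integral_def algebra_simps)
    qed
    have "(\<lambda>n. \<integral>x. indicat_real {c..d} x * (D x - \<kappa>) * hat c d (real n) x \<partial>lborel)
        \<longlonglongrightarrow> (\<integral>x. indicat_real {c..d} x * (D x - \<kappa>) * indicator {c<..<d} x \<partial>lborel)"
    proof (rule integral_dominated_convergence)
      show "integrable lborel (\<lambda>x. indicat_real {c..d} x * \<bar>D x - \<kappa>\<bar>)"
        using integrable_abs[OF Dk[unfolded set_integrable_def]] by (simp add: abs_mult)
      have "hat c d (real n) \<in> borel_measurable borel" for n
        by (intro borel_measurable_continuous_onI hat_continuous)
      then show "(\<lambda>x. indicat_real {c..d} x * (D x - \<kappa>) * hat c d (real n) x) \<in> borel_measurable lborel" for n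
        by measurable
      show "AE x in lborel. (\<lambda>n. indicat_real {c..d} x * (D x - \<kappa>) * hat c d (real n) x)
          \<longlonglongrightarrow> indicat_real {c..d} x * (D x - \<kappa>) * indicator {c<..<d} x"
        by (intro AE_I2 tendsto_intros hat_tendsto)
      have "\<bar>hat c d (real n) x\<bar> \<le> 1" for n x using hat_range[of "real n" c d x] by auto
      then show "AE x in lborel. norm (indicat_real {c..d} x * (D x - \<kappa>) * hat c d (real n) x)
          \<le> indicat_real {c..d} x * \<bar>D x - \<kappa>\<bar>" for n
        by (intro AE_I2) (auto simp: abs_mult indicator_def intro: mult_left_le)
    qed measurable
    then have "(\<integral>x. indicat_real {c..d} x * (D x - \<kappa>) * indicator {c<..<d} x \<partial>lborel) = 0"
      by (simp add: van LIMSEQ_const_iff)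
    moreover have "(LBINT x:{c..d}. D x - \<kappa>) = (\<integral>x. indicat_real {c..d} x * (D x - \<kappa>) * indicator {c<..<d} x \<partial>lborel)"
      unfolding set_lebesgue_integral_def
    proof (rule integral_cong_AE)
      show "AE x in lborel. indicat_real {c..d} x *\<^sub>R (D x - \<kappa>) = indicat_real {c..d} x * (D x - \<kappa>) * indicator {c<..<d} x"
        using AE_lborel_singleton[of c] AE_lborel_singleton[of d] by eventually_elim (auto simp: indicator_def)
    qed measurable
    ultimately show ?thesis by simp
  qed
  have "AE x in lborel. x \<in> {c..d} \<longrightarrow> D x = \<kappa>" if cd: "{c..d} \<subseteq> S" for c d
  proof (cases "c \<le> d")
    case True
    let ?D = "\<lambda>x. indicat_real {c..d} x * (D x - \<kappa>)"
    have "set_integrable lborel {c..d} (\<lambda>x. D x - \<kappa>)"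
      by (intro set_integral_diff(1) int[OF cd] set_integral_continuous_eq_integral(1) continuous_intros)
    then have "integrable lborel ?D" by (simp add: set_integrable_def)
    then have "AE x in lborel. ?D x = 0"
    proof (rule AE_zero_if_interval_integrals_zero[of _ c d])
      fix c' d' assume c': "c \<le> c'" "c' \<le> d'" "d' \<le> d"
      have "(LBINT x:{c'..d'}. ?D x) = (LBINT x:{c'..d'}. D x - \<kappa>)"
        unfolding set_lebesgue_integral_def
        by (rule Bochner_Integration.integral_cong) (use c' in \<open>auto simp: indicator_def\<close>)
      also have "\<dots> = 0" by (rule interval) (use c' cd in auto)
      finally show "(LBINT x:{c'..d'}. ?D x) = 0" .
    qed auto
    then show ?thesis by eventually_elim auto
  qed auto
  then have "AE x in lborel. x \<in> S \<longrightarrow> D x = \<kappa>" by (rule AE_subintervals[OF S(1)])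
  then show ?thesis by blast
qed auto

section \<open>Weak derivatives on the unit interval\<close>

text \<open>Two continuous functions that agree almost everywhere on the open interval agree on the closed one.\<close>

lemma continuous_AE_eq:
  fixes f g :: "real \<Rightarrow> real"
  assumes f: "continuous_on {a..b} f" and g: "continuous_on {a..b} g" and "a < b"
    and ae: "AE x in lborel. x \<in> {a<..<b} \<longrightarrow> f x = g x" and x: "x \<in> {a..b}"
  shows "f x = g x"
proof -
  define h where "h = (\<lambda>x. f x - g x)"
  have h: "continuous_on {a..b} h" unfolding h_def by (intro continuous_intros f g)
  let ?S = "{a<..<b} \<inter> h -` (- {0})"
  have S: "open ?S"
    by (rule continuous_open_preimage[OF continuous_on_subset[OF h]]) auto
  have "AE x in lborel. x \<notin> ?S" using ae by eventually_elim (auto simp: h_def)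
  then have "?S \<in> null_sets lborel" using S AE_iff_null_sets[of ?S lborel] by auto
  then have "negligible ?S" by (simp add: negligible_iff_null_sets null_sets_completionI)
  then have "?S = {}" using S open_not_negligible by blast
  then have "h y = 0" if "y \<in> {a<..<b}" for y using that by auto
  moreover have "closure {a<..<b} = {a..b}" using \<open>a < b\<close> by simp
  ultimately have "h x = 0"
    using continuous_constant_on_closure[of "{a<..<b}" h 0 x] h x by auto
  then show ?thesis by (simp add: h_def)
qed

lemma set_integral_Icc_Ioo:
  fixes f :: "real \<Rightarrow> real"
  shows "(LBINT x:{a..b}. f x) = (LBINT x:{a<..<b}. f x)"
  by (rule set_integral_discrete_difference[where X = "{a, b}"]) auto

lemma set_integrable_Icc_Ioo:
  fixes f :: "real \<Rightarrow> real"
  shows "set_integrable lborel {a..b} f \<longleftrightarrow> set_integrable lborel {a<..<b} f"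
  unfolding set_integrable_def
  by (rule integrable_discrete_difference[where X = "{a, b}"]) (auto simp: indicator_def)

lemma continuous_on_set_integral_upto:
  fixes f :: "real \<Rightarrow> real"
  assumes "set_integrable lborel {a..b} f"
  shows "continuous_on {a..b} (\<lambda>x. LBINT y:{a..x}. f y)"
proof -
  have "continuous_on {a..b} (\<lambda>x. integral {a..x} f)"
    by (rule indefinite_integral_continuous_1[OF set_borel_integral_eq_integral(1)[OF assms]])
  moreover have "(LBINT y:{a..x}. f y) = integral {a..x} f" if "x \<in> {a..b}" for x
    by (rule set_borel_integral_eq_integral(2), rule set_integrable_subset[OF assms]) (use that in auto)
  ultimately show ?thesis by (rule continuous_on_eq[OF _ sym])
qed

lemma set_integral_upto_diff:
  fixes f :: "real \<Rightarrow> real"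
  assumes f: "set_integrable lborel {a..b} f" and "a \<le> x" "x \<le> y" "y \<le> b"
  shows "(LBINT t:{a..y}. f t) - (LBINT t:{a..x}. f t) = (LBINT t:{x..y}. f t)"
proof -
  have sub: "set_integrable lborel {u..v} f" if "a \<le> u" "v \<le> b" for u v
    by (rule set_integrable_subset[OF f]) (use that in auto)
  have eq: "(LBINT t:{u..v}. f t) = integral {u..v} f" if "a \<le> u" "v \<le> b" for u v
    by (rule set_borel_integral_eq_integral(2)[OF sub[OF that]])
  have "integral {a..x} f + integral {x..y} f = integral {a..y} f"
    by (rule Henstock_Kurzweil_Integration.integral_combine)
      (use assms set_borel_integral_eq_integral(1)[OF sub] in auto)
  then show ?thesis using assms by (simp add: eq)
qed

lemma AE_eq_if_primitives_eq:
  fixes f g :: "real \<Rightarrow> real"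
  assumes f: "set_integrable lborel {a..b} f" and g: "set_integrable lborel {a..b} g"
    and eq: "\<And>x. x \<in> {a..b} \<Longrightarrow> (LBINT y:{a..x}. f y) = (LBINT y:{a..x}. g y)"
  shows "AE x in lborel. x \<in> {a..b} \<longrightarrow> f x = g x"
proof -
  let ?D = "\<lambda>x. indicat_real {a..b} x * (f x - g x)"
  have "integrable lborel ?D"
    using set_integral_diff(1)[OF f g] by (simp add: set_integrable_def)
  then have "AE x in lborel. ?D x = 0"
  proof (rule AE_zero_if_interval_integrals_zero[of _ a b])
    fix c d assume cd: "a \<le> c" "c \<le> d" "d \<le> b"
    have "(LBINT x:{c..d}. ?D x) = (LBINT x:{c..d}. f x - g x)"
      unfolding set_lebesgue_integral_def
      by (rule Bochner_Integration.integral_cong) (use cd in \<open>auto simp: indicator_def\<close>)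
    also have "\<dots> = (LBINT x:{c..d}. f x) - (LBINT x:{c..d}. g x)"
      by (rule set_integral_diff(2)) (use cd in \<open>auto intro: set_integrable_subset[OF f] set_integrable_subset[OF g]\<close>)
    also have "\<dots> = 0"
      using set_integral_upto_diff[OF f cd] set_integral_upto_diff[OF g cd] eq[of c] eq[of d] cd by auto
    finally show "(LBINT x:{c..d}. ?D x) = 0" .
  qed auto
  then show ?thesis by eventually_elim auto
qed

lemma Lp_1_iff: "f \<in> Lp 1 \<longleftrightarrow> f \<in> borel_measurable I01 \<and> integrable I01 f"
proof -
  have ne: "(1::ennreal) \<noteq> \<infinity>" by simp
  have eq: "(\<lambda>x. \<bar>f x\<bar> powr enn2real 1) = (\<lambda>x. norm (f x))"
    unfolding enn2real_1 real_norm_def by (simp only: powr_one abs_ge_zero)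
  have "f \<in> Lp 1 \<longleftrightarrow> f \<in> borel_measurable I01 \<and> integrable I01 (\<lambda>x. norm (f x))"
    unfolding Lp_def mem_Collect_eq if_not_P[OF ne] eq by (rule refl)
  also have "\<dots> \<longleftrightarrow> f \<in> borel_measurable I01 \<and> integrable I01 f"
  proof
    assume *: "f \<in> borel_measurable I01 \<and> integrable I01 (\<lambda>x. norm (f x))"
    show "f \<in> borel_measurable I01 \<and> integrable I01 f"
      by (rule conjI[OF conjunct1[OF *] integrable_norm_cancel[OF conjunct2[OF *] conjunct1[OF *]]])
  next
    assume *: "f \<in> borel_measurable I01 \<and> integrable I01 f"
    show "f \<in> borel_measurable I01 \<and> integrable I01 (\<lambda>x. norm (f x))"
      by (rule conjI[OF conjunct1[OF *] integrable_norm[OF conjunct2[OF *]]])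
  qed
  finally show ?thesis .
qed

lemma test_fun_outside:
  assumes "test_fun S \<phi> \<phi>'" "x \<notin> S" shows "\<phi> x = 0"
  using assms by (auto simp: test_fun_def)

lemma test_funD:
  assumes "test_fun S \<phi> \<phi>'"
  shows "(\<phi> has_real_derivative \<phi>' x) (at x within A)" "continuous_on A \<phi>'" "continuous_on A \<phi>"
proof -
  have d: "(\<phi> has_real_derivative \<phi>' x) (at x)" for x using assms by (auto simp: test_fun_def)
  then show "(\<phi> has_real_derivative \<phi>' x) (at x within A)" by (rule has_field_derivative_at_within)
  show "continuous_on A \<phi>'" using assms by (auto simp: test_fun_def intro: continuous_on_subset)
  show "continuous_on A \<phi>" by (intro continuous_at_imp_continuous_on ballI DERIV_isCont[OF d])
qed

text \<open>A function with a weak derivative is almost everywhere a primitive of it.\<close>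

lemma weak_deriv_primitive:
  assumes "is_weak_deriv f g"
  obtains g1 c where "g1 \<in> borel_measurable borel" "set_integrable lborel {0..1} g1"
    "AE x in lborel. x \<in> {0<..<1} \<longrightarrow> g x = g1 x"
    "AE x in lborel. x \<in> {0<..<1} \<longrightarrow> f x = c + (LBINT y:{0..x}. g1 y)"
proof -
  have f: "f \<in> borel_measurable I01" "integrable I01 f" and g: "g \<in> borel_measurable I01" "integrable I01 g"
    using assms unfolding is_weak_deriv_def Lp_1_iff by blast+
  have S: "{0<..<1::real} \<in> sets borel" by simp
  obtain f1 where f1: "f1 \<in> borel_measurable borel" "AE x in lborel. x \<in> {0<..<1} \<longrightarrow> f x = f1 x"
    by (rule borel_representative[OF f(1) S])
  obtain g1 where g1: "g1 \<in> borel_measurable borel" "AE x in lborel. x \<in> {0<..<1} \<longrightarrow> g x = g1 x"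
    by (rule borel_representative[OF g(1) S])
  note [measurable] = f1(1) g1(1)
  have fi: "set_integrable lborel {0..1} f1"
    using f(2) integrable_lebesgue_on_representative[OF f(1) S f1] by (simp add: set_integrable_Icc_Ioo)
  have gi: "set_integrable lborel {0..1} g1"
    using g(2) integrable_lebesgue_on_representative[OF g(1) S g1] by (simp add: set_integrable_Icc_Ioo)
  define P where "P = (\<lambda>x. LBINT y:{0..x}. g1 y)"
  have Pm[measurable]: "P \<in> borel_measurable borel"
  proof -
    have "P = (\<lambda>x. \<integral>y. (if 0 \<le> y \<and> y \<le> x then g1 y else 0) \<partial>lborel)"
      unfolding P_def set_lebesgue_integral_def
      by (intro ext Bochner_Integration.integral_cong) (auto simp: indicator_def)
    then show ?thesis by simp
  qed
  have Pc: "continuous_on {0..1} P" unfolding P_def by (rule continuous_on_set_integral_upto[OF gi])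
  have Di: "set_integrable lborel {0..1} (\<lambda>x. f1 x - P x)"
    by (intro set_integral_diff(1) fi set_integral_continuous_eq_integral(1) Pc)
  have mult: "set_integrable lborel {0..1} (\<lambda>x. u x * \<psi> x)"
    if u: "set_integrable lborel {0..1} u" "u \<in> borel_measurable borel" and \<psi>: "continuous_on UNIV \<psi>"
    for u \<psi> :: "real \<Rightarrow> real"
  proof -
    have [measurable]: "u \<in> borel_measurable borel" "\<psi> \<in> borel_measurable borel"
      using u \<psi> by (auto intro: borel_measurable_continuous_onI)
    have "bounded (\<psi> ` {0..1})"
      by (intro compact_imp_bounded compact_continuous_image continuous_on_subset[OF \<psi>]) auto
    then obtain M where "\<forall>y\<in>\<psi> ` {0..1}. norm y \<le> M" unfolding bounded_iff by blast
    then have M: "\<bar>\<psi> x\<bar> \<le> M" if "x \<in> {0..1}" for x using that by auto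
    have "set_integrable lborel {0..1} (\<lambda>x. M * u x)" using u(1) by (rule set_integrable_mult_right)
    then show ?thesis
    proof (rule set_integrable_bound)
      have "\<bar>u x * \<psi> x\<bar> \<le> \<bar>M * u x\<bar>" if "x \<in> {0..1}" for x
        using mult_right_mono[OF M[OF that], of "\<bar>u x\<bar>"] M[OF that] by (simp add: abs_mult mult.commute)
      then show "AE x in lborel. x \<in> {0..1} \<longrightarrow> norm (u x * \<psi> x) \<le> norm (M * u x)" by auto
    qed (auto simp: set_borel_measurable_def)
  qed
  have "\<exists>\<kappa>. AE x in lborel. x \<in> {0<..<1} \<longrightarrow> f1 x - P x = \<kappa>"
  proof (rule du_Bois_Reymond)
    show "set_integrable lborel {c..d} (\<lambda>x. f1 x - P x)" if "{c..d} \<subseteq> {0<..<1}" for c d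
      by (rule set_integrable_subset[OF Di]) (use that in auto)
    fix \<phi> \<phi>' :: "real \<Rightarrow> real" assume \<phi>: "test_fun {0<..<1} \<phi> \<phi>'"
    note [measurable] = borel_measurable_continuous_onI[OF test_funD(2)[OF \<phi>]]
      borel_measurable_continuous_onI[OF test_funD(3)[OF \<phi>]]
    have m: "\<phi>' \<in> borel_measurable (lebesgue_on S)" "\<phi> \<in> borel_measurable (lebesgue_on S)" for S
      by (intro measurable_restrict_space1 measurable_completion; simp)+
    have A: "(LINT x|I01. f x * \<phi>' x) = (LBINT x:{0<..<1}. f1 x * \<phi>' x)"
    proof (rule integral_lebesgue_on_representative)
      show "AE x in lborel. x \<in> {0<..<1} \<longrightarrow> f x * \<phi>' x = f1 x * \<phi>' x"
        using f1(2) by eventually_elim auto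
    qed (rule borel_measurable_times[OF f(1) m(1)], simp_all)
    have B: "(LINT x|I01. g x * \<phi> x) = (LBINT x:{0<..<1}. g1 x * \<phi> x)"
    proof (rule integral_lebesgue_on_representative)
      show "AE x in lborel. x \<in> {0<..<1} \<longrightarrow> g x * \<phi> x = g1 x * \<phi> x"
        using g1(2) by eventually_elim auto
    qed (rule borel_measurable_times[OF g(1) m(2)], simp_all)
    have "\<forall>\<phi> \<phi>'. test_fun {0<..<1} \<phi> \<phi>' \<longrightarrow> (LINT x|I01. f x * \<phi>' x) = - (LINT x|I01. g x * \<phi> x)"
      using assms unfolding is_weak_deriv_def by (elim conjE)
    then have "(LINT x|I01. f x * \<phi>' x) = - (LINT x|I01. g x * \<phi> x)" using \<phi> by blast
    then have "(LBINT x:{0..1}. f1 x * \<phi>' x) = - (LBINT x:{0..1}. g1 x * \<phi> x)"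
      unfolding set_integral_Icc_Ioo A B .
    also have "\<dots> = (LBINT y:{0..1}. g1 y * (\<phi> 1 - \<phi> y))"
      using test_fun_outside[OF \<phi>, of 1] by (simp add: set_lebesgue_integral_def)
    also have "\<dots> = (LBINT x:{0..1}. P x * \<phi>' x)"
      unfolding P_def
      by (rule set_integral_by_parts[symmetric, OF gi]) (use test_funD[OF \<phi>] in auto)
    finally have "(LBINT x:{0..1}. f1 x * \<phi>' x) = (LBINT x:{0..1}. P x * \<phi>' x)" .
    moreover have "(LBINT x:{0..1}. f1 x * \<phi>' x - P x * \<phi>' x)
        = (LBINT x:{0..1}. f1 x * \<phi>' x) - (LBINT x:{0..1}. P x * \<phi>' x)"
      by (rule set_integral_diff(2)[OF mult[OF fi f1(1) test_funD(2)[OF \<phi>]]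
            mult[OF set_integral_continuous_eq_integral(1)[OF Pc] Pm test_funD(2)[OF \<phi>]]])
    ultimately show "(LBINT x:{0<..<1}. (f1 x - P x) * \<phi>' x) = 0"
      by (simp add: set_integral_Icc_Ioo[symmetric] left_diff_distrib)
  qed auto
  then obtain c where c: "AE x in lborel. x \<in> {0<..<1} \<longrightarrow> f1 x - P x = c" by blast
  show ?thesis
  proof (rule that[OF g1(1) gi g1(2)])
    show "AE x in lborel. x \<in> {0<..<1} \<longrightarrow> f x = c + (LBINT y:{0..x}. g1 y)"
      using c f1(2) by eventually_elim (auto simp: P_def)
  qed
qed

lemma weak_deriv_continuous_primitive:
  assumes "is_weak_deriv f g" and f: "continuous_on {0..1} f"
  obtains g1 where "g1 \<in> borel_measurable borel" "set_integrable lborel {0..1} g1"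
    "AE x in lborel. x \<in> {0<..<1} \<longrightarrow> g x = g1 x"
    "\<And>x. x \<in> {0..1} \<Longrightarrow> f x = f 0 + (LBINT y:{0..x}. g1 y)"
proof -
  obtain g1 c where g1: "g1 \<in> borel_measurable borel" "set_integrable lborel {0..1} g1"
    "AE x in lborel. x \<in> {0<..<1} \<longrightarrow> g x = g1 x"
    and ae: "AE x in lborel. x \<in> {0<..<1} \<longrightarrow> f x = c + (LBINT y:{0..x}. g1 y)"
    using weak_deriv_primitive[OF assms(1)] by blast
  have eq: "f x = c + (LBINT y:{0..x}. g1 y)" if "x \<in> {0..1}" for x
    by (rule continuous_AE_eq[OF f _ _ ae that])
      (auto intro!: continuous_intros continuous_on_set_integral_upto g1(2))
  have "(LBINT y:{0..0}. g1 y) = 0"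
    using set_integral_Icc_Ioo[of 0 0 g1] by (simp add: set_lebesgue_integral_def)
  then have "f 0 = c" using eq[of 0] by simp
  then show ?thesis using eq by (intro that[OF g1]) auto
qed

lemma weak_deriv_unique:
  assumes "is_weak_deriv f g" "is_weak_deriv f h"
  shows "AE x in lborel. x \<in> {0<..<1} \<longrightarrow> g x = h x"
proof -
  obtain g1 c where g1: "g1 \<in> borel_measurable borel" "set_integrable lborel {0..1} g1"
    "AE x in lborel. x \<in> {0<..<1} \<longrightarrow> g x = g1 x"
    and gae: "AE x in lborel. x \<in> {0<..<1} \<longrightarrow> f x = c + (LBINT y:{0..x}. g1 y)"
    using weak_deriv_primitive[OF assms(1)] by blast
  obtain h1 d where h1: "h1 \<in> borel_measurable borel" "set_integrable lborel {0..1} h1"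
    "AE x in lborel. x \<in> {0<..<1} \<longrightarrow> h x = h1 x"
    and hae: "AE x in lborel. x \<in> {0<..<1} \<longrightarrow> f x = d + (LBINT y:{0..x}. h1 y)"
    using weak_deriv_primitive[OF assms(2)] by blast
  have ae: "AE x in lborel. x \<in> {0<..<1} \<longrightarrow> c + (LBINT y:{0..x}. g1 y) = d + (LBINT y:{0..x}. h1 y)"
    using gae hae by eventually_elim auto
  have eq: "c + (LBINT y:{0..x}. g1 y) = d + (LBINT y:{0..x}. h1 y)" if "x \<in> {0..1}" for x
    by (rule continuous_AE_eq[OF _ _ _ ae that])
      (auto intro!: continuous_intros continuous_on_set_integral_upto g1(2) h1(2))
  have "(LBINT y:{0..0}. u y) = 0" for u :: "real \<Rightarrow> real"
    using set_integral_Icc_Ioo[of 0 0 u] by (simp add: set_lebesgue_integral_def)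
  then have "c = d" using eq[of 0] by simp
  have "AE x in lborel. x \<in> {0..1} \<longrightarrow> g1 x = h1 x"
    by (rule AE_eq_if_primitives_eq[OF g1(2) h1(2)]) (use eq \<open>c = d\<close> in auto)
  then show ?thesis using g1(3) h1(3) by eventually_elim auto
qed

lemma weak_deriv_wderiv: "is_weak_deriv f g \<Longrightarrow> is_weak_deriv f (wderiv f)"
  unfolding wderiv_def by (rule someI[of "is_weak_deriv f" g])

lemma continuous_I01:
  fixes h :: "real \<Rightarrow> real"
  assumes h: "continuous_on {0..1} h"
  shows "h \<in> borel_measurable I01" "integrable I01 h" "(LINT x|I01. h x) = integral {0..1} h"
proof -
  let ?g = "\<lambda>x. indicat_real {0..1} x *\<^sub>R h x"
  note hi = set_integral_continuous_eq_integral[OF h]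
  show m: "h \<in> borel_measurable I01"
    by (rule continuous_imp_measurable_on_sets_lebesgue[OF continuous_on_subset[OF h]]) auto
  have g: "?g \<in> borel_measurable borel"
    using borel_measurable_integrable[OF hi(1)[unfolded set_integrable_def]] by simp
  have ae: "AE x in lborel. x \<in> {0<..<1} \<longrightarrow> h x = ?g x" by auto
  have S: "{0<..<1::real} \<in> sets borel" by simp
  have eq: "(LBINT x:{0..1}. ?g x) = (LBINT x:{0..1}. h x)"
    unfolding set_lebesgue_integral_def by (rule Bochner_Integration.integral_cong) (auto simp: indicator_def)
  have si: "set_integrable lborel {0..1} ?g"
    unfolding set_integrable_def
    by (rule Bochner_Integration.integrable_cong[THEN iffD1, OF refl _ hi(1)[unfolded set_integrable_def]])
      (auto simp: indicator_def)
  show "integrable I01 h"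
    using integrable_lebesgue_on_representative[OF m S g ae] si by (simp add: set_integrable_Icc_Ioo)
  show "(LINT x|I01. h x) = integral {0..1} h"
    using integral_lebesgue_on_representative[OF m S g ae] eq hi(2) by (simp add: set_integral_Icc_Ioo)
qed

lemma weak_derivI:
  assumes g: "continuous_on {0..1} g" and f: "\<And>x. x \<in> {0..1} \<Longrightarrow> f x = f 0 + integral {0..x} g"
  shows "is_weak_deriv f g"
proof -
  have fd: "(f has_real_derivative g x) (at x within {0..1})" if "x \<in> {0..1}" for x
  proof -
    have "((\<lambda>x. f 0 + integral {0..x} g) has_real_derivative g x) (at x within {0..1})"
      using DERIV_add[OF DERIV_const integral_has_real_derivative[OF g that]] by simp
    then show ?thesis
      by (rule has_field_derivative_transform_within[of _ _ _ _ 1]) (auto simp only: f[symmetric] intro: that)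
  qed
  have fc: "continuous_on {0..1} f" by (rule DERIV_continuous_on[OF fd])
  have int: "h \<in> Lp 1" if h: "continuous_on {0..1} h" for h :: "real \<Rightarrow> real"
    using continuous_I01(1,2)[OF h] by (simp only: Lp_1_iff)
  show ?thesis
    unfolding is_weak_deriv_def
  proof (intro conjI allI impI int fc g)
    fix \<phi> \<phi>' :: "real \<Rightarrow> real" assume \<phi>: "test_fun {0<..<1} \<phi> \<phi>'"
    note c = fc g test_funD(2,3)[OF \<phi>, of "{0..1}"]
    have "((\<lambda>x. g x * \<phi> x + f x * \<phi>' x) has_integral f 1 * \<phi> 1 - f 0 * \<phi> 0) {0..1}"
    proof (rule fundamental_theorem_of_calculus)
      fix x :: real assume "x \<in> {0..1}"
      then have "((\<lambda>x. f x * \<phi> x) has_real_derivative g x * \<phi> x + f x * \<phi>' x) (at x within {0..1})"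
        using DERIV_mult[OF fd test_funD(1)[OF \<phi>, of x "{0..1}"]] by (simp add: algebra_simps)
      then show "((\<lambda>x. f x * \<phi> x) has_vector_derivative g x * \<phi> x + f x * \<phi>' x) (at x within {0..1})"
        by (simp add: has_real_derivative_iff_has_vector_derivative)
    qed simp
    then have "integral {0..1} (\<lambda>x. g x * \<phi> x + f x * \<phi>' x) = 0"
      using test_fun_outside[OF \<phi>] by (simp add: integral_unique)
    also have "integral {0..1} (\<lambda>x. g x * \<phi> x + f x * \<phi>' x)
        = integral {0..1} (\<lambda>x. g x * \<phi> x) + integral {0..1} (\<lambda>x. f x * \<phi>' x)"
      by (rule Henstock_Kurzweil_Integration.integral_add) (auto intro!: integrable_continuous_interval continuous_intros c)
    finally show "(LINT x|I01. f x * \<phi>' x) = - (LINT x|I01. g x * \<phi> x)"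
      using continuous_I01(3)[OF continuous_on_mult[OF c(1) c(3)]]
        continuous_I01(3)[OF continuous_on_mult[OF c(2) c(4)]] by simp
  qed
qed

section \<open>Bounds on the initial data\<close>

lemma Lp_inf_iff: "f \<in> Lp \<infinity> \<longleftrightarrow> f \<in> borel_measurable I01 \<and> (\<exists>C. AE x in I01. \<bar>f x\<bar> \<le> C)"
  unfolding Lp_def mem_Collect_eq if_P[OF refl] by (rule refl)

lemma AE_I01_False: "\<not> (AE x in I01. False)"
proof
  assume "AE x in I01. False"
  then have "AE x in lborel. x \<notin> {0<..<1::real}" by (subst (asm) AE_lebesgue_on_iff) auto
  then have "{0<..<1::real} \<in> null_sets lborel" by (subst (asm) AE_iff_null_sets[symmetric]) auto
  then have "emeasure lborel {0<..<1::real} = 0" by (rule null_setsD1)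
  then show False by (subst (asm) emeasure_lborel_Ioo) auto
qed

lemma Lp_norm_inf:
  assumes "f \<in> Lp \<infinity>"
  shows "0 \<le> Lp_norm \<infinity> f" "AE x in I01. \<bar>f x\<bar> \<le> Lp_norm \<infinity> f"
    "\<And>B. AE x in I01. \<bar>f x\<bar> \<le> B \<Longrightarrow> Lp_norm \<infinity> f \<le> B"
proof -
  obtain C where C: "AE x in I01. \<bar>f x\<bar> \<le> C" and m: "f \<in> borel_measurable I01"
    using assms unfolding Lp_inf_iff by blast
  let ?e = "esssup I01 (\<lambda>x. ereal \<bar>f x\<bar>)"
  have m': "(\<lambda>x. ereal \<bar>f x\<bar>) \<in> borel_measurable I01" using m by measurable
  have le: "?e \<le> ereal B" if "AE x in I01. \<bar>f x\<bar> \<le> B" for B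
    by (rule esssup_I[OF m']) (use that in simp)
  have ae: "AE x in I01. ereal \<bar>f x\<bar> \<le> ?e" by (rule esssup_AE)
  have ge: "0 \<le> ?e"
  proof (rule ccontr)
    assume "\<not> 0 \<le> ?e"
    then have neg: "?e < 0" by simp
    have "AE x in I01. False" using ae
    proof eventually_elim
      case (elim x)
      have "0 \<le> ereal \<bar>f x\<bar>" by simp
      also note elim
      also note neg
      finally show False by simp
    qed
    with AE_I01_False show False by contradiction
  qed
  have eq: "Lp_norm \<infinity> f = real_of_ereal ?e" by (simp add: Lp_norm_def)
  have fin: "ereal (Lp_norm \<infinity> f) = ?e"
    unfolding eq using ge le[OF C] by (cases ?e) auto
  show "0 \<le> Lp_norm \<infinity> f" unfolding eq using ge by (rule real_of_ereal_pos)
  show "AE x in I01. \<bar>f x\<bar> \<le> Lp_norm \<infinity> f"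
    using ae unfolding fin[symmetric] by simp
  show "Lp_norm \<infinity> f \<le> B" if "AE x in I01. \<bar>f x\<bar> \<le> B" for B
    using le[OF that] unfolding fin[symmetric] by simp
qed

text \<open>On the unit interval the \<open>L\<^sup>1\<close> norm is at most the \<open>L\<^sup>2\<close> and the \<open>L\<^sup>\<infinity>\<close> norm.\<close>

lemma L1_le_Lp_norm:
  assumes h: "h \<in> Lp \<infinity>" and g: "g \<in> borel_measurable borel" "set_integrable lborel {0..1} g"
    and eq: "AE x in lborel. x \<in> {0<..<1} \<longrightarrow> h x = g x"
  shows "(LBINT x:{0..1}. \<bar>g x\<bar>) \<le> Lp_norm \<infinity> h" "(LBINT x:{0..1}. \<bar>g x\<bar>) \<le> Lp_norm 2 h"
proof -
  have S: "{0<..<1::real} \<in> sets borel" by simp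
  note [measurable] = g(1)
  let ?N = "Lp_norm \<infinity> h" and ?I = "LBINT x:{0..1}. \<bar>g x\<bar>"
  have N: "AE x in lborel. x \<in> {0<..<1} \<longrightarrow> \<bar>g x\<bar> \<le> ?N"
    using Lp_norm_inf(2)[OF h] eq unfolding AE_lebesgue_on_iff[OF S]
    by eventually_elim auto
  have abs: "set_integrable lborel {0..1} (\<lambda>x. \<bar>g x\<bar>)" using g(2) by (rule set_integrable_abs)
  have const: "set_integrable lborel {0..1::real} (\<lambda>x. c :: real)" "(LBINT x:{0..1::real}. (c :: real)) = c" for c
    by (auto simp: set_integral_continuous_eq_integral)
  have "?I = (LBINT x:{0<..<1}. \<bar>g x\<bar>)" by (rule set_integral_Icc_Ioo)
  also have "\<dots> \<le> (LBINT x:{0<..<1::real}. ?N)"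
    unfolding set_lebesgue_integral_def
  proof (rule integral_mono_AE)
    show "integrable lborel (\<lambda>x. indicat_real {0<..<1} x *\<^sub>R \<bar>g x\<bar>)"
      using abs unfolding set_integrable_Icc_Ioo unfolding set_integrable_def .
    show "integrable lborel (\<lambda>x. indicat_real {0<..<1::real} x *\<^sub>R ?N)"
      using const(1)[of ?N] unfolding set_integrable_Icc_Ioo unfolding set_integrable_def .
    show "AE x in lborel. indicat_real {0<..<1} x *\<^sub>R \<bar>g x\<bar> \<le> indicat_real {0<..<1} x *\<^sub>R ?N"
      using N by eventually_elim (auto simp: indicator_def)
  qed
  also have "\<dots> = ?N" unfolding set_integral_Icc_Ioo[symmetric] by (rule const(2))
  finally show "?I \<le> ?N" .
  have sq: "set_integrable lborel {0..1} (\<lambda>x. \<bar>g x\<bar>\<^sup>2)"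
  proof -
    have "integrable lborel (\<lambda>x. indicat_real {0<..<1} x *\<^sub>R \<bar>g x\<bar>\<^sup>2)"
    proof (rule Bochner_Integration.integrable_bound)
      show "integrable lborel (\<lambda>x. indicat_real {0<..<1::real} x *\<^sub>R ?N\<^sup>2)"
        using const(1)[of "?N\<^sup>2"] unfolding set_integrable_Icc_Ioo unfolding set_integrable_def .
      show "AE x in lborel. norm (indicat_real {0<..<1} x *\<^sub>R \<bar>g x\<bar>\<^sup>2) \<le> norm (indicat_real {0<..<1} x *\<^sub>R ?N\<^sup>2)"
        using N by eventually_elim (auto simp: indicator_def abs_le_square_iff[symmetric])
    qed measurable
    then show ?thesis unfolding set_integrable_Icc_Ioo by (simp add: set_integrable_def)
  qed
  have "0 \<le> (LBINT x:{0..1}. (\<bar>g x\<bar> - ?I)\<^sup>2)"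
    unfolding set_lebesgue_integral_def by (rule Bochner_Integration.integral_nonneg) (auto simp: indicator_def)
  also have "\<dots> = (LBINT x:{0..1}. (\<bar>g x\<bar>\<^sup>2 - 2 * ?I * \<bar>g x\<bar>) + ?I\<^sup>2)"
    by (simp add: power2_diff algebra_simps)
  also have "\<dots> = (LBINT x:{0..1}. \<bar>g x\<bar>\<^sup>2 - 2 * ?I * \<bar>g x\<bar>) + (LBINT x:{0..1::real}. ?I\<^sup>2)"
    by (rule set_integral_add(2)[OF set_integral_diff(1)[OF sq set_integrable_mult_right[OF abs]] const(1)])
  also have "(LBINT x:{0..1}. \<bar>g x\<bar>\<^sup>2 - 2 * ?I * \<bar>g x\<bar>) = (LBINT x:{0..1}. \<bar>g x\<bar>\<^sup>2) - (LBINT x:{0..1}. 2 * ?I * \<bar>g x\<bar>)"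
    by (rule set_integral_diff(2)[OF sq set_integrable_mult_right[OF abs]])
  also have "(LBINT x:{0..1}. 2 * ?I * \<bar>g x\<bar>) = 2 * ?I * ?I" by (rule set_integral_mult_right)
  also have "(LBINT x:{0..1::real}. ?I\<^sup>2) = ?I\<^sup>2" by (rule const(2))
  finally have CS: "?I\<^sup>2 \<le> (LBINT x:{0..1}. \<bar>g x\<bar>\<^sup>2)" by (simp add: power2_eq_square)
  have I0: "0 \<le> ?I"
    unfolding set_lebesgue_integral_def by (rule Bochner_Integration.integral_nonneg) (auto simp: indicator_def)
  have two: "enn2real 2 = 2"
    using enn2real_ennreal[of 2] by simp
  have ne: "(2::ennreal) \<noteq> \<infinity>" by simp
  have hm: "h \<in> borel_measurable I01" using h unfolding Lp_inf_iff by blast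
  have pw: "\<bar>x\<bar> powr 2 = \<bar>x\<bar>\<^sup>2" for x :: real by simp
  have "(LINT x|I01. \<bar>h x\<bar>\<^sup>2) = (LBINT x:{0<..<1}. \<bar>g x\<bar>\<^sup>2)"
  proof (rule integral_lebesgue_on_representative)
    show "AE x in lborel. x \<in> {0<..<1} \<longrightarrow> \<bar>h x\<bar>\<^sup>2 = \<bar>g x\<bar>\<^sup>2" using eq by eventually_elim auto
    show "(\<lambda>x. \<bar>h x\<bar>\<^sup>2) \<in> borel_measurable I01" using hm by measurable
  qed (simp, measurable)
  then have "Lp_norm 2 h = (LBINT x:{0..1}. \<bar>g x\<bar>\<^sup>2) powr (1 / 2)"
    unfolding Lp_norm_def if_not_P[OF ne] two pw set_integral_Icc_Ioo by simp
  also have "\<dots> = sqrt (LBINT x:{0..1}. \<bar>g x\<bar>\<^sup>2)"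
    by (rule powr_half_sqrt, rule order_trans[OF zero_le_power2 CS])
  also have "?I \<le> \<dots>" using CS I0 by (intro real_le_rsqrt)
  finally show "?I \<le> Lp_norm 2 h" .
qed

lemma W1_inf_wderiv:
  assumes "f \<in> W1 \<infinity>"
  shows "is_weak_deriv f (wderiv f)" "wderiv f \<in> Lp \<infinity>"
proof -
  obtain g where g: "g \<in> Lp \<infinity>" "is_weak_deriv f g" using assms unfolding W1_def by blast
  show w: "is_weak_deriv f (wderiv f)" by (rule weak_deriv_wderiv[OF g(2)])
  have S: "{0<..<1::real} \<in> sets borel" by simp
  obtain C where C: "AE x in I01. \<bar>g x\<bar> \<le> C" using g(1) unfolding Lp_inf_iff by blast
  have "AE x in I01. \<bar>wderiv f x\<bar> \<le> C"
    using C weak_deriv_unique[OF g(2) w] unfolding AE_lebesgue_on_iff[OF S] by eventually_elim auto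
  moreover have "wderiv f \<in> borel_measurable I01"
    using w unfolding is_weak_deriv_def Lp_1_iff by blast
  ultimately show "wderiv f \<in> Lp \<infinity>" unfolding Lp_inf_iff by blast
qed

lemma abs_set_integral_sub_le:
  fixes g :: "real \<Rightarrow> real"
  assumes g: "set_integrable lborel {0..1} g" and xy: "0 \<le> x" "y \<le> 1"
  shows "\<bar>LBINT t:{x..y}. g t\<bar> \<le> (LBINT t:{0..1}. \<bar>g t\<bar>)"
proof -
  have "\<bar>LBINT t:{x..y}. g t\<bar> \<le> (LBINT t:{x..y}. \<bar>g t\<bar>)"
    using set_integral_norm_bound[OF set_integrable_subset[OF g], of "{x..y}"] xy by auto
  also have "\<dots> \<le> (LBINT t:{0..1}. \<bar>g t\<bar>)"
    unfolding set_lebesgue_integral_def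
  proof (rule integral_mono)
    have ab: "set_integrable lborel {0..1} (\<lambda>x. \<bar>g x\<bar>)" using g by (rule set_integrable_abs)
    show "integrable lborel (\<lambda>t. indicat_real {0..1} t *\<^sub>R \<bar>g t\<bar>)" using ab by (simp add: set_integrable_def)
    have "set_integrable lborel {x..y} (\<lambda>x. \<bar>g x\<bar>)" by (rule set_integrable_subset[OF ab]) (use xy in auto)
    then show "integrable lborel (\<lambda>t. indicat_real {x..y} t *\<^sub>R \<bar>g t\<bar>)" by (simp add: set_integrable_def)
  qed (use xy in \<open>auto simp: indicator_def\<close>)
  finally show ?thesis .
qed

text \<open>Here \<open>p0\<close> is the continuous representative of \<open>z\<^sub>0'\<close>. It has a zero because its integral \<open>z\<^sub>0(1) - z\<^sub>0(0)\<close>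
  vanishes, and so it is bounded by the \<open>L\<^sup>1\<close> norm of \<open>z\<^sub>0''\<close>.\<close>

lemma initial_data:
  assumes D: "(z0, z1) \<in> D_space \<infinity>"
  obtains p0 where "continuous_on {0..1} p0" "\<And>x. x \<in> {0..1} \<Longrightarrow> z0 x = integral {0..x} p0"
    "continuous_on {0..1} z1" "z1 0 = 0" "z1 1 = 0"
    "\<And>x y. x \<in> {0..1} \<Longrightarrow> y \<in> {0..1} \<Longrightarrow> \<bar>p0 x\<bar> + \<bar>z1 y\<bar> \<le> D_norm \<infinity> (z0, z1)"
    "\<And>x y. x \<in> {0..1} \<Longrightarrow> y \<in> {0..1} \<Longrightarrow> \<bar>p0 x\<bar> + \<bar>z1 y\<bar> \<le> D_norm 2 (z0, z1)"
proof -
  have z0: "z0 \<in> W1 \<infinity>" "wderiv z0 \<in> W1 \<infinity>" "continuous_on {0..1} z0" "z0 0 = 0" "z0 1 = 0"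
    and z1: "z1 \<in> W1 \<infinity>" "continuous_on {0..1} z1" "z1 0 = 0" "z1 1 = 0"
    using D unfolding D_space_def W2_def W10_def by blast+
  obtain g1 where g1: "g1 \<in> borel_measurable borel" "set_integrable lborel {0..1} g1"
    "AE x in lborel. x \<in> {0<..<1} \<longrightarrow> wderiv z1 x = g1 x"
    "\<And>x. x \<in> {0..1} \<Longrightarrow> z1 x = z1 0 + (LBINT y:{0..x}. g1 y)"
    using weak_deriv_continuous_primitive[OF W1_inf_wderiv(1)[OF z1(1)] z1(2)] by blast
  obtain g2 c where g2: "g2 \<in> borel_measurable borel" "set_integrable lborel {0..1} g2"
    "AE x in lborel. x \<in> {0<..<1} \<longrightarrow> wderiv (wderiv z0) x = g2 x"
    and p: "AE x in lborel. x \<in> {0<..<1} \<longrightarrow> wderiv z0 x = c + (LBINT y:{0..x}. g2 y)"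
    using weak_deriv_primitive[OF W1_inf_wderiv(1)[OF z0(2)]] by blast
  obtain g0 where g0: "g0 \<in> borel_measurable borel" "set_integrable lborel {0..1} g0"
    "AE x in lborel. x \<in> {0<..<1} \<longrightarrow> wderiv z0 x = g0 x"
    "\<And>x. x \<in> {0..1} \<Longrightarrow> z0 x = z0 0 + (LBINT y:{0..x}. g0 y)"
    using weak_deriv_continuous_primitive[OF W1_inf_wderiv(1)[OF z0(1)] z0(3)] by blast
  define p0 where "p0 = (\<lambda>x. c + (LBINT y:{0..x}. g2 y))"
  have p0c: "continuous_on {0..1} p0"
    unfolding p0_def by (intro continuous_intros continuous_on_set_integral_upto g2(2))
  have ae: "AE x in lborel. x \<in> {0<..<1} \<longrightarrow> g0 x = p0 x"
    using p g0(3) by eventually_elim (auto simp: p0_def)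
  have z0p: "z0 x = integral {0..x} p0" if x: "x \<in> {0..1}" for x
  proof -
    have ps: "set_integrable lborel {0..x} p0" and pe: "(LBINT y:{0..x}. p0 y) = integral {0..x} p0"
      using set_integral_continuous_eq_integral[OF continuous_on_subset[OF p0c], of 0 x] x by auto
    have gs: "set_integrable lborel {0..x} g0" by (rule set_integrable_subset[OF g0(2)]) (use x in auto)
    have "(LBINT y:{0..x}. g0 y) = (LBINT y:{0..x}. p0 y)"
      unfolding set_integral_Icc_Ioo unfolding set_lebesgue_integral_def
    proof (rule integral_cong_AE)
      show "(\<lambda>y. indicat_real {0<..<x} y *\<^sub>R g0 y) \<in> borel_measurable lborel"
        using gs unfolding set_integrable_Icc_Ioo unfolding set_integrable_def by (rule borel_measurable_integrable)
      show "(\<lambda>y. indicat_real {0<..<x} y *\<^sub>R p0 y) \<in> borel_measurable lborel"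
        using ps unfolding set_integrable_Icc_Ioo unfolding set_integrable_def by (rule borel_measurable_integrable)
      show "AE y in lborel. indicat_real {0<..<x} y *\<^sub>R g0 y = indicat_real {0<..<x} y *\<^sub>R p0 y"
        using ae by eventually_elim (use x in \<open>auto simp: indicator_def\<close>)
    qed
    then show ?thesis using g0(4)[OF x] z0(4) pe by simp
  qed
  let ?N1 = "LBINT t:{0..1}. \<bar>g1 t\<bar>" and ?N2 = "LBINT t:{0..1}. \<bar>g2 t\<bar>"
  have z1b: "\<bar>z1 x\<bar> \<le> ?N1" if "x \<in> {0..1}" for x
    using abs_set_integral_sub_le[OF g1(2), of 0 x] g1(4)[OF that] z1(3) that by simp
  have "\<exists>\<xi>\<in>{0..1}. p0 \<xi> = 0"
  proof (rule ccontr)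
    assume "\<not> ?thesis"
    then have nz: "p0 x \<noteq> 0" if "x \<in> {0..1}" for x using that by blast
    have "(\<forall>x\<in>{0..1}. 0 < p0 x) \<or> (\<forall>x\<in>{0..1}. p0 x < 0)"
    proof (rule ccontr)
      assume "\<not> ?thesis"
      then obtain x y where xy: "x \<in> {0..1}" "y \<in> {0..1}" "p0 x < 0" "0 < p0 y"
        using nz by (metis linorder_neqE_linordered_idom)
      have "connected (p0 ` {0..1})" by (intro connected_continuous_image p0c) simp
      then have "0 \<in> p0 ` {0..1}"
        using connectedD_interval[of "p0 ` {0..1}" "p0 x" "p0 y" 0] xy by auto
      with nz show False by auto
    qed
    moreover have False if s: "\<forall>x\<in>{0..1}. 0 < s * p0 x" for s :: real
    proof -
      have sc: "continuous_on {0..1} (\<lambda>x. s * p0 x)" by (intro continuous_intros p0c)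
      have i0: "integral {0..1} p0 = 0" using z0p[of 1] z0(5) by simp
      have "((\<lambda>x. s * p0 x) has_integral s * integral {0..1} p0) {0..1}"
        by (intro has_integral_mult_right integrable_integral integrable_continuous_interval p0c)
      then have "((\<lambda>x. s * p0 x) has_integral 0) (cbox 0 1)" by (simp add: i0)
      then have "s * p0 0 = 0"
        by (intro has_integral_0_cbox_imp_0[of 0 1 "\<lambda>x. s * p0 x"]) (use sc s in \<open>auto intro: less_imp_le\<close>)
      with s show False by (auto dest: bspec[of _ _ 0])
    qed
    from this[of 1] this[of "-1"] have "\<not> (\<forall>x\<in>{0..1}. 0 < p0 x)" "\<not> (\<forall>x\<in>{0..1}. p0 x < 0)" by auto
    ultimately show False by blast
  qed
  then obtain \<xi> where \<xi>: "\<xi> \<in> {0..1}" "p0 \<xi> = 0" by blast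
  have p0b: "\<bar>p0 x\<bar> \<le> ?N2" if x: "x \<in> {0..1}" for x
  proof (cases "\<xi> \<le> x")
    case True
    have "p0 x = (LBINT t:{\<xi>..x}. g2 t)"
      using set_integral_upto_diff[OF g2(2), of \<xi> x] \<xi> x True by (simp add: p0_def)
    then show ?thesis using abs_set_integral_sub_le[OF g2(2), of \<xi> x] \<xi> x by simp
  next
    case False
    have "- p0 x = (LBINT t:{x..\<xi>}. g2 t)"
      using set_integral_upto_diff[OF g2(2), of x \<xi>] \<xi> x False by (simp add: p0_def)
    then have "\<bar>p0 x\<bar> = \<bar>LBINT t:{x..\<xi>}. g2 t\<bar>" by simp
    then show ?thesis using abs_set_integral_sub_le[OF g2(2), of x \<xi>] \<xi> x by simp
  qed
  have L1: "wderiv z1 \<in> Lp \<infinity>" by (rule W1_inf_wderiv(2)[OF z1(1)])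
  have L2: "wderiv (wderiv z0) \<in> Lp \<infinity>" by (rule W1_inf_wderiv(2)[OF z0(2)])
  show ?thesis
  proof (rule that[OF p0c z0p z1(2-4)])
    fix x y :: real assume xy: "x \<in> {0..1}" "y \<in> {0..1}"
    show "\<bar>p0 x\<bar> + \<bar>z1 y\<bar> \<le> D_norm \<infinity> (z0, z1)"
      unfolding D_norm_def split_conv
      using add_mono[OF order_trans[OF p0b[OF xy(1)] L1_le_Lp_norm(1)[OF L2 g2(1-3)]]
          order_trans[OF z1b[OF xy(2)] L1_le_Lp_norm(1)[OF L1 g1(1-3)]]] .
    show "\<bar>p0 x\<bar> + \<bar>z1 y\<bar> \<le> D_norm 2 (z0, z1)"
      unfolding D_norm_def split_conv
      using add_mono[OF order_trans[OF p0b[OF xy(1)] L1_le_Lp_norm(2)[OF L2 g2(1-3)]]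
          order_trans[OF z1b[OF xy(2)] L1_le_Lp_norm(2)[OF L1 g1(1-3)]]] .
  qed
qed

section \<open>Completeness of the trigonometric systems\<close>

lemma cos_power_moments:
  fixes H :: "real \<Rightarrow> real"
  assumes H: "continuous_on {0..1} H"
    and mom: "\<And>k. integral {0..1} (\<lambda>x. H x * cos (real k * pi * x)) = 0"
  shows "integral {0..1} (\<lambda>x. H x * cos (pi * x) ^ n * cos (real k * pi * x)) = 0"
proof (induction n arbitrary: k)
  case 0
  then show ?case using mom by simp
next
  case (Suc n)
  let ?I = "\<lambda>k x. H x * cos (pi * x) ^ n * cos (real k * pi * x)"
  have int: "?I k integrable_on {0..1}" for k
    by (intro integrable_continuous_interval continuous_intros H)
  have eq: "H x * cos (pi * x) ^ Suc n * cos (real k * pi * x)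
      = (?I (Suc k) x + ?I (if k = 0 then 1 else k - 1) x) * (1 / 2)" for x
  proof (cases k)
    case 0
    then show ?thesis by (simp add: algebra_simps)
  next
    case (Suc j)
    have "cos (real (Suc k) * pi * x) + cos (real j * pi * x) = 2 * (cos (pi * x) * cos (real k * pi * x))"
    proof -
      have "real (Suc k) * pi * x = real k * pi * x + pi * x" "real j * pi * x = real k * pi * x - pi * x"
        by (simp_all add: Suc algebra_simps)
      then show ?thesis by (simp only: cos_add cos_diff) simp
    qed
    then have "cos (pi * x) * cos (real k * pi * x) = (cos (real (Suc k) * pi * x) + cos (real j * pi * x)) * (1 / 2)"
      by simp
    moreover have "H x * cos (pi * x) ^ Suc n * cos (real k * pi * x)
        = H x * cos (pi * x) ^ n * (cos (pi * x) * cos (real k * pi * x))" by simp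
    ultimately have "H x * cos (pi * x) ^ Suc n * cos (real k * pi * x)
        = H x * cos (pi * x) ^ n * ((cos (real (Suc k) * pi * x) + cos (real j * pi * x)) * (1 / 2))" by simp
    also have "\<dots> = (?I (Suc k) x + ?I j x) * (1 / 2)" by (simp only: distrib_left distrib_right mult.assoc)
    finally show ?thesis using Suc by simp
  qed
  have "integral {0..1} (\<lambda>x. (?I (Suc k) x + ?I (if k = 0 then 1 else k - 1) x) * (1 / 2))
      = (integral {0..1} (?I (Suc k)) + integral {0..1} (?I (if k = 0 then 1 else k - 1))) * (1 / 2)"
    by (simp only: integral_mult_left Henstock_Kurzweil_Integration.integral_add[OF int int])
  also have "\<dots> = 0" using Suc.IH[of "Suc k"] Suc.IH[of "if k = 0 then 1 else k - 1"] by (simp only: add_0 mult_zero_left)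
  finally show ?case unfolding eq .
qed

text \<open>By induction all powers of \<open>cos (\<pi> x)\<close> are orthogonal to \<open>H\<close>, and these are dense by the Weierstrass theorem.\<close>

lemma cosine_complete:
  fixes H :: "real \<Rightarrow> real"
  assumes H: "continuous_on {0..1} H"
    and mom: "\<And>k. integral {0..1} (\<lambda>x. H x * cos (real k * pi * x)) = 0"
    and x: "x \<in> {0..1}"
  shows "H x = 0"
proof -
  have ints: "f integrable_on {0..1}" if "continuous_on {0..1} f" for f :: "real \<Rightarrow> real"
    using that by (rule integrable_continuous_interval)
  have poly: "integral {0..1} (\<lambda>x. H x * q (cos (pi * x))) = 0" if "real_polynomial_function q" for q
  proof -
    obtain c n where q: "q = (\<lambda>x. \<Sum>i\<le>n. c i * x ^ i)"
      using \<open>real_polynomial_function q\<close> unfolding real_polynomial_function_iff_sum by blast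
    have mom': "integral {0..1} (\<lambda>x. H x * cos (pi * x) ^ i) = 0" for i
      using cos_power_moments[OF H mom, of i 0] by simp
    have "integral {0..1} (\<lambda>x. H x * q (cos (pi * x))) = integral {0..1} (\<lambda>x. \<Sum>i\<le>n. c i * (H x * cos (pi * x) ^ i))"
      by (simp add: q sum_distrib_left mult_ac)
    also have "\<dots> = (\<Sum>i\<le>n. integral {0..1} (\<lambda>x. c i * (H x * cos (pi * x) ^ i)))"
      by (rule integral_sum) (auto intro!: ints continuous_intros H)
    also have "\<dots> = 0" by (simp add: mom')
    finally show ?thesis .
  qed
  obtain M where M: "0 < M" "\<And>x. x \<in> {0..1} \<Longrightarrow> \<bar>H x\<bar> \<le> M"
  proof -
    have "bounded (H ` {0..1})" by (intro compact_imp_bounded compact_continuous_image H) auto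
    then obtain M where "0 < M" "\<forall>y\<in>H ` {0..1}. norm y \<le> M" unfolding bounded_pos by blast
    then show ?thesis by (intro that[of M]) auto
  qed
  have sq: "integral {0..1} (\<lambda>x. H x * H x) \<le> e * M" if "0 < e" for e
  proof -
    have "continuous_on {-1..1} (\<lambda>c. H (arccos c / pi))"
      by (rule continuous_on_compose2[OF H]) (auto intro!: continuous_intros simp: arccos_lbound arccos_ubound)
    then obtain q where q: "real_polynomial_function q" "\<And>c. c \<in> {-1..1} \<Longrightarrow> \<bar>H (arccos c / pi) - q c\<bar> < e"
      using Stone_Weierstrass_real_polynomial_function[OF compact_Icc _ \<open>0 < e\<close>] by blast
    have qc: "continuous_on UNIV q" using q(1) by (intro continuous_on_polymonial_function) (auto simp: real_polynomial_function_eq)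
    have qc': "continuous_on {0..1} (\<lambda>x. q (cos (pi * x)))"
      by (rule continuous_on_compose2[OF qc]) (auto intro!: continuous_intros)
    have le: "H x * H x \<le> H x * q (cos (pi * x)) + e * M" if "x \<in> {0..1}" for x
    proof -
      have "arccos (cos (pi * x)) = pi * x" using that by (intro arccos_cos) (auto simp: mult_left_le)
      then have "\<bar>H x - q (cos (pi * x))\<bar> \<le> e" using q(2)[of "cos (pi * x)"] by simp
      then have "\<bar>H x * (H x - q (cos (pi * x)))\<bar> \<le> M * e"
        unfolding abs_mult using M(2)[OF that] M(1) by (intro mult_mono) auto
      then show ?thesis by (simp add: algebra_simps abs_le_iff)
    qed
    have "integral {0..1} (\<lambda>x. H x * H x) \<le> integral {0..1} (\<lambda>x. H x * q (cos (pi * x)) + e * M)"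
      by (rule integral_le) (auto intro!: ints continuous_intros H qc' le)
    also have "\<dots> = integral {0..1} (\<lambda>x. H x * q (cos (pi * x))) + integral {0..1::real} (\<lambda>x. e * M)"
      by (rule Henstock_Kurzweil_Integration.integral_add) (auto intro!: ints continuous_intros H qc')
    finally show ?thesis by (simp add: poly[OF q(1)])
  qed
  have "integral {0..1} (\<lambda>x. H x * H x) \<le> 0"
  proof (rule field_le_epsilon)
    fix e :: real assume "0 < e"
    then show "integral {0..1} (\<lambda>x. H x * H x) \<le> 0 + e" using sq[of "e / M"] M by simp
  qed
  moreover have "0 \<le> integral {0..1} (\<lambda>x. H x * H x)"
    by (intro integral_nonneg ints continuous_intros H) auto
  ultimately have "integral {0..1} (\<lambda>x. H x * H x) = 0" by simp
  then have "((\<lambda>x. H x * H x) has_integral 0) (cbox 0 1)"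
    using integrable_integral[OF ints[of "\<lambda>x. H x * H x"]] by (auto intro!: continuous_intros H)
  then have "H x * H x = 0"
    by (intro has_integral_0_cbox_imp_0[of 0 1 "\<lambda>x. H x * H x"]) (use x in \<open>auto intro!: continuous_intros H\<close>)
  then show ?thesis by simp
qed

text \<open>Integration by parts turns the sine moments of \<open>g\<close> into cosine moments of its primitive, which is continuous.\<close>

lemma sine_complete:
  fixes g :: "real \<Rightarrow> real"
  assumes g: "set_integrable lborel {0..1} g"
    and mom: "\<And>k. (LBINT x:{0..1}. g x * sin (real (Suc k) * pi * x)) = 0"
  shows "AE x in lborel. x \<in> {0..1} \<longrightarrow> g x = 0"
proof -
  define G where "G = (\<lambda>x. LBINT y:{0..x}. g y)"
  have Gc: "continuous_on {0..1} G" unfolding G_def by (rule continuous_on_set_integral_upto[OF g])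
  define m where "m = integral {0..1} G"
  have cosint: "integral {0..1} (\<lambda>x. cos (real (Suc k) * pi * x)) = 0" for k
  proof -
    let ?w = "real (Suc k) * pi"
    have "((\<lambda>x. cos (?w * x)) has_integral sin (?w * 1) / ?w - sin (?w * 0) / ?w) {0..1}"
      by (rule fundamental_theorem_of_calculus)
        (auto intro!: derivative_eq_intros simp: has_real_derivative_iff_has_vector_derivative[symmetric])
    moreover have "sin ?w = 0" by (rule sin_npi)
    ultimately show ?thesis by (simp add: integral_unique)
  qed
  have Gcos: "integral {0..1} (\<lambda>x. G x * cos (real (Suc k) * pi * x)) = 0" for k
  proof -
    let ?w = "real (Suc k) * pi"
    have w: "?w \<noteq> 0" by simp
    have s1: "sin ?w = 0" by (rule sin_npi)
    have "(LBINT x:{0..1}. G x * (?w * cos (?w * x))) = (LBINT y:{0..1}. g y * (sin (?w * 1) - sin (?w * y)))"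
      unfolding G_def by (rule set_integral_by_parts[OF g]) (auto intro!: derivative_eq_intros continuous_intros)
    also have "\<dots> = - (LBINT y:{0..1}. g y * sin (?w * y))"
      using s1 by (simp add: set_lebesgue_integral_def)
    also have "\<dots> = 0" using mom[of k] by simp
    also have "(LBINT x:{0..1}. G x * (?w * cos (?w * x))) = integral {0..1} (\<lambda>x. G x * (?w * cos (?w * x)))"
      by (intro set_integral_continuous_eq_integral(2) continuous_intros Gc)
    also have "\<dots> = ?w * integral {0..1} (\<lambda>x. G x * cos (?w * x))"
    proof -
      have "(\<lambda>x. G x * (?w * cos (?w * x))) = (\<lambda>x. ?w * (G x * cos (?w * x)))" by auto
      then show ?thesis by (simp only: integral_mult_right)
    qed
    finally show ?thesis using w by simp
  qed
  have const: "G x - m = 0" if "x \<in> {0..1}" for x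
  proof (rule cosine_complete[OF _ _ that])
    show "continuous_on {0..1} (\<lambda>x. G x - m)" by (intro continuous_intros Gc)
    fix k :: nat
    have "integral {0..1} (\<lambda>x. (G x - m) * cos (real k * pi * x))
        = integral {0..1} (\<lambda>x. G x * cos (real k * pi * x) - m * cos (real k * pi * x))"
      by (simp only: left_diff_distrib)
    also have "\<dots> = integral {0..1} (\<lambda>x. G x * cos (real k * pi * x)) - integral {0..1} (\<lambda>x. m * cos (real k * pi * x))"
      by (rule Henstock_Kurzweil_Integration.integral_diff)
        (auto intro!: integrable_continuous_interval continuous_intros Gc)
    also have "\<dots> = 0"
    proof (cases k)
      case 0
      then show ?thesis by (simp add: m_def)
    next
      case (Suc j)
      then show ?thesis using Gcos[of j] cosint[of j] by simp
    qed
    finally show "integral {0..1} (\<lambda>x. (G x - m) * cos (real k * pi * x)) = 0" .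
  qed
  have "G 0 = 0"
    unfolding G_def using set_integral_Icc_Ioo[of 0 0 g] by (simp add: set_lebesgue_integral_def)
  then have "m = 0" using const[of 0] by simp
  show ?thesis
  proof (rule AE_eq_if_primitives_eq[OF g])
    show "set_integrable lborel {0..1::real} (\<lambda>_. 0 :: real)" by (simp add: set_integrable_def)
    show "(LBINT y:{0..x}. g y) = (LBINT y:{0..x}. 0)" if "x \<in> {0..1}" for x
      using const[OF that] \<open>m = 0\<close> by (simp add: G_def set_lebesgue_integral_def)
  qed
qed

text \<open>A boundedly convergent approximation by test functions of a function that vanishes at 0 and 1 with continuous derivative \<open>g\<close>.\<close>

lemma test_fun_approximation:
  fixes g :: "real \<Rightarrow> real"
  assumes g: "continuous_on UNIV g" and zero: "integral {0..1} g = 0"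
  obtains \<psi> \<psi>' M where "\<And>n::nat. test_fun {0<..<1} (\<psi> n) (\<psi>' n)"
    "\<And>n x. x \<in> {0..1} \<Longrightarrow> \<bar>\<psi> n x\<bar> \<le> M" "\<And>n x. x \<in> {0..1} \<Longrightarrow> \<bar>\<psi>' n x\<bar> \<le> M"
    "\<And>x. x \<in> {0..1} \<Longrightarrow> (\<lambda>n. \<psi> n x) \<longlonglongrightarrow> integral {0..x} g"
    "\<And>x. x \<in> {0<..<1} \<Longrightarrow> (\<lambda>n. \<psi>' n x) \<longlonglongrightarrow> g x"
proof -
  define e where "e = (\<lambda>n. 1 / real (n + 3))"
  have e: "0 < e n" "e n < 1 - e n" for n by (auto simp: e_def field_simps)
  have e0: "e \<longlonglongrightarrow> 0" unfolding e_def by (intro LIMSEQ_ignore_initial_segment lim_1_over_n)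
  \<comment> \<open>The cutoffs \<open>\<eta> n\<close> are supported in \<open>[e n, 1 - e n]\<close>; subtracting the right multiple of \<open>\<eta> n\<close> keeps the mean zero.\<close>
  define \<eta> where "\<eta> = (\<lambda>n x. min 1 (max 0 (min ((x - e n) / e n) ((1 - e n - x) / e n))))"
  have \<eta>c: "continuous_on S (\<eta> n)" for S n unfolding \<eta>_def using e(1)[of n] by (intro continuous_intros) auto
  have \<eta>01: "0 \<le> \<eta> n x" "\<eta> n x \<le> 1" for n x by (auto simp: \<eta>_def)
  have \<eta>out: "\<eta> n x = 0" if "x \<notin> {e n..1 - e n}" for n x
  proof -
    have "min ((x - e n) / e n) ((1 - e n - x) / e n) \<le> 0"
      using that e(1)[of n] by (auto simp: min_le_iff_disj divide_le_0_iff)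
    then show ?thesis by (simp add: \<eta>_def max_absorb1)
  qed
  have \<eta>lim: "(\<lambda>n. \<eta> n x) \<longlonglongrightarrow> 1" if x: "x \<in> {0<..<1}" for x
  proof (rule tendsto_eventually)
    have "eventually (\<lambda>n. e n < min x (1 - x) / 2) sequentially"
      by (rule order_tendstoD(2)[OF e0]) (use x in auto)
    then show "eventually (\<lambda>n. \<eta> n x = 1) sequentially"
    proof eventually_elim
      case (elim n)
      then have "1 \<le> (x - e n) / e n" "1 \<le> (1 - e n - x) / e n"
        using e(1)[of n] by (auto simp: field_simps)
      then show ?case by (simp add: \<eta>_def)
    qed
  qed
  obtain M where M: "0 < M" "\<And>x. x \<in> {0..1} \<Longrightarrow> \<bar>g x\<bar> \<le> M"
  proof -
    have "bounded (g ` {0..1})"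
      by (intro compact_imp_bounded compact_continuous_image continuous_on_subset[OF g]) auto
    then obtain M where "0 < M" "\<forall>y\<in>g ` {0..1}. norm y \<le> M" unfolding bounded_pos by blast
    then show ?thesis by (intro that[of M]) auto
  qed
  have gc: "continuous_on S g" for S by (rule continuous_on_subset[OF g]) auto
  have ints: "f integrable_on {u..v}" if "continuous_on UNIV f" for f :: "real \<Rightarrow> real" and u v
    by (intro integrable_continuous_interval continuous_on_subset[OF that]) auto
  define I where "I = (\<lambda>n. integral {0..1} (\<lambda>x. \<eta> n x * g x))"
  define J where "J = (\<lambda>n. integral {0..1} (\<eta> n))"
  have dom: "(\<lambda>n. integral {0..x} (\<lambda>x. \<eta> n x * f x)) \<longlonglongrightarrow> integral {0..x} f"
    if f: "continuous_on UNIV f" and x: "x \<in> {0..1}" for f :: "real \<Rightarrow> real" and x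
  proof -
    have fc: "continuous_on S f" for S by (rule continuous_on_subset[OF f]) auto
    have [measurable]: "f \<in> borel_measurable borel" "\<eta> n \<in> borel_measurable borel" for n
      by (intro borel_measurable_continuous_onI f \<eta>c)+
    have "(\<lambda>n. \<integral>y. indicat_real {0..x} y *\<^sub>R (\<eta> n y * f y) \<partial>lborel)
        \<longlonglongrightarrow> (\<integral>y. indicat_real {0..x} y *\<^sub>R f y \<partial>lborel)"
    proof (rule integral_dominated_convergence)
      show "integrable lborel (\<lambda>y. indicat_real {0..x} y *\<^sub>R \<bar>f y\<bar>)"
        by (rule borel_integrable_compact) (auto intro!: continuous_intros fc)
      show "AE y in lborel. (\<lambda>n. indicat_real {0..x} y *\<^sub>R (\<eta> n y * f y)) \<longlonglongrightarrow> indicat_real {0..x} y *\<^sub>R f y"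
        using AE_lborel_singleton[of 0] AE_lborel_singleton[of 1]
      proof eventually_elim
        case (elim y)
        show ?case
        proof (cases "y \<in> {0..x}")
          case True
          then have "(\<lambda>n. \<eta> n y) \<longlonglongrightarrow> 1" using elim x by (intro \<eta>lim) auto
          then have "(\<lambda>n. \<eta> n y * f y) \<longlonglongrightarrow> 1 * f y" by (intro tendsto_intros)
          then show ?thesis using True by simp
        qed simp
      qed
      show "AE y in lborel. norm (indicat_real {0..x} y *\<^sub>R (\<eta> n y * f y)) \<le> indicat_real {0..x} y *\<^sub>R \<bar>f y\<bar>" for n
        using \<eta>01[of n] by (auto simp: indicator_def abs_mult mult_left_le_one_le)
    qed measurable
    moreover have "(\<integral>y. indicat_real {0..x} y *\<^sub>R h y \<partial>lborel) = integral {0..x} h" if "continuous_on UNIV h" for h :: "real \<Rightarrow> real"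
      using set_integral_continuous_eq_integral(2)[OF continuous_on_subset[OF that], of 0 x]
      by (simp add: set_lebesgue_integral_def)
    ultimately show ?thesis by (simp add: f continuous_on_mult \<eta>c)
  qed
  have I0: "I \<longlonglongrightarrow> 0" unfolding I_def using dom[OF g, of 1] zero by simp
  have J1: "J \<longlonglongrightarrow> 1" unfolding J_def using dom[of "\<lambda>_. 1" 1] by simp
  have Jpos: "1 / 4 \<le> J n" if "n \<ge> 5" for n
  proof -
    have "integral {1/4..3/4::real} (\<lambda>_. 1 / 2) \<le> integral {1/4..3/4} (\<eta> n)"
    proof (rule integral_le)
      fix x :: real assume x: "x \<in> {1/4..3/4}"
      have "e n \<le> 1 / 8" using that by (auto simp: e_def field_simps)
      then have "1 \<le> (x - e n) / e n" "1 \<le> (1 - e n - x) / e n"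
        using e(1)[of n] x by (auto simp: field_simps)
      then show "1 / 2 \<le> \<eta> n x" by (simp add: \<eta>_def)
    qed (auto intro!: ints \<eta>c)
    also have "\<dots> \<le> J n" unfolding J_def
      by (rule integral_subset_le) (auto intro!: ints \<eta>c \<eta>01)
    finally show ?thesis by simp
  qed
  have Ib: "\<bar>I n\<bar> \<le> M" for n
  proof -
    have "\<bar>\<eta> n x * g x\<bar> \<le> M" if "x \<in> {0..1}" for x
      using mult_mono[OF \<eta>01(2)[of n x] M(2)[OF that]] \<eta>01(1)[of n x] by (simp add: abs_mult)
    then have "norm (integral {0..1} (\<lambda>x. \<eta> n x * g x)) \<le> integral {0..1::real} (\<lambda>x. M)"
      by (intro integral_norm_bound_integral) (auto intro!: ints continuous_intros \<eta>c gc)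
    then show ?thesis by (simp add: I_def)
  qed
  define h where "h = (\<lambda>n x. \<eta> (n + 5) x * (g x - I (n + 5) / J (n + 5)))"
  have hc: "continuous_on S (h n)" for S n
    unfolding h_def by (intro continuous_on_mult continuous_on_diff continuous_on_const \<eta>c gc)
  have hb: "\<bar>h n x\<bar> \<le> 5 * M" if "x \<in> {0..1}" for n x
  proof -
    have J: "1 / 4 \<le> J (n + 5)" by (rule Jpos) simp
    have "\<bar>I (n + 5) / J (n + 5)\<bar> \<le> M / (1 / 4)"
      unfolding abs_divide using Ib[of "n + 5"] J M(1) by (intro frac_le) auto
    then have "\<bar>I (n + 5) / J (n + 5)\<bar> \<le> 4 * M" by simp
    then have "\<bar>g x - I (n + 5) / J (n + 5)\<bar> \<le> 5 * M"
      using M(2)[OF that] abs_triangle_ineq4[of "g x" "I (n + 5) / J (n + 5)"] by linarith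
    then have "\<bar>\<eta> (n + 5) x\<bar> * \<bar>g x - I (n + 5) / J (n + 5)\<bar> \<le> 1 * (5 * M)"
      using \<eta>01[of "n + 5" x] by (intro mult_mono) auto
    then show ?thesis by (simp add: h_def abs_mult)
  qed
  have hint: "integral {0..x} (h n)
      = integral {0..x} (\<lambda>y. \<eta> (n + 5) y * g y) - I (n + 5) / J (n + 5) * integral {0..x} (\<lambda>y. \<eta> (n + 5) y * 1)" for n x
  proof -
    have "h n = (\<lambda>y. \<eta> (n + 5) y * g y - I (n + 5) / J (n + 5) * (\<eta> (n + 5) y * 1))"
      by (auto simp: h_def right_diff_distrib mult.commute)
    moreover have "integral {0..x} (\<lambda>y. \<eta> (n + 5) y * g y - c * (\<eta> (n + 5) y * 1))
      = integral {0..x} (\<lambda>y. \<eta> (n + 5) y * g y) - integral {0..x} (\<lambda>y. c * (\<eta> (n + 5) y * 1))" for c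
      by (rule Henstock_Kurzweil_Integration.integral_diff) (auto intro!: ints continuous_intros \<eta>c gc)
    ultimately show ?thesis by (simp only: integral_mult_right)
  qed
  have hint1: "integral {0..1} (h n) = 0" for n
  proof -
    have "1 / 4 \<le> J (n + 5)" by (rule Jpos) simp
    then have "J (n + 5) \<noteq> 0" by linarith
    moreover have "integral {0..1} (\<lambda>y. \<eta> (n + 5) y * g y) = I (n + 5)"
      "integral {0..1} (\<lambda>y. \<eta> (n + 5) y * 1) = J (n + 5)" by (simp_all add: I_def J_def)
    ultimately show ?thesis using hint[of 1 n] by simp
  qed
  have "\<exists>\<phi>. test_fun {0<..<1} \<phi> (h n)" for n
  proof -
    let ?e = "e (n + 5)"
    have out: "h n x = 0" if "x \<notin> {?e..1 - ?e}" for x using \<eta>out[OF that] by (simp add: h_def)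
    have "integral {0..1} (\<lambda>x. if x \<in> {?e..1 - ?e} then h n x else 0) = integral {?e..1 - ?e} (h n)"
      using e[of "n + 5"] by (simp only: integral_restrict_Int) (rule arg_cong[where f = "\<lambda>S. integral S (h n)"], auto)
    moreover have "(\<lambda>x. if x \<in> {?e..1 - ?e} then h n x else 0) = h n" using out by auto
    ultimately have "integral {?e..1 - ?e} (h n) = 0" using hint1 by simp
    moreover have "{?e..1 - ?e} \<subseteq> {0<..<1}" using e[of "n + 5"] by auto
    ultimately show ?thesis
      using test_fun_exists[OF hc out] e(2)[of "n + 5"] less_imp_le by metis
  qed
  then obtain \<psi> where \<psi>: "test_fun {0<..<1} (\<psi> n) (h n)" for n by metis
  have \<psi>eq: "\<psi> n x = integral {0..x} (h n)" if "x \<in> {0..1}" for n x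
  proof -
    have "(h n has_integral \<psi> n x - \<psi> n 0) {0..x}"
      by (rule fundamental_theorem_of_calculus)
        (use that test_funD(1)[OF \<psi>] in \<open>auto simp: has_real_derivative_iff_has_vector_derivative[symmetric]\<close>)
    then show ?thesis using test_fun_outside[OF \<psi>, of 0] by (simp add: integral_unique)
  qed
  have quot: "(\<lambda>n. I (n + 5) / J (n + 5)) \<longlonglongrightarrow> 0"
    using tendsto_divide[OF LIMSEQ_ignore_initial_segment[OF I0, of 5] LIMSEQ_ignore_initial_segment[OF J1, of 5]] by simp
  show ?thesis
  proof (rule that[of \<psi> h "5 * M"])
    show "test_fun {0<..<1} (\<psi> n) (h n)" for n by (rule \<psi>)
    show "\<bar>h n x\<bar> \<le> 5 * M" if "x \<in> {0..1}" for n x by (rule hb[OF that])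
    show "\<bar>\<psi> n x\<bar> \<le> 5 * M" if x: "x \<in> {0..1}" for n x
    proof -
      have "norm (integral {0..x} (h n)) \<le> integral {0..x} (\<lambda>_. 5 * M)"
        by (rule integral_norm_bound_integral) (use x hb in \<open>auto intro!: ints hc\<close>)
      also have "\<dots> \<le> 5 * M" using x M(1) by (simp add: mult_left_le_one_le)
      finally show ?thesis by (simp add: \<psi>eq[OF x])
    qed
    show "(\<lambda>n. \<psi> n x) \<longlonglongrightarrow> integral {0..x} g" if x: "x \<in> {0..1}" for x
    proof -
      have "(\<lambda>n. integral {0..x} (\<lambda>y. \<eta> (n + 5) y * g y)
          - I (n + 5) / J (n + 5) * integral {0..x} (\<lambda>y. \<eta> (n + 5) y * 1))
          \<longlonglongrightarrow> integral {0..x} g - 0 * integral {0..x} (\<lambda>_. 1)"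
        by (intro tendsto_intros quot LIMSEQ_ignore_initial_segment[OF dom[OF g x]]
            LIMSEQ_ignore_initial_segment[OF dom[OF continuous_on_const x]])
      then show ?thesis by (simp only: \<psi>eq[OF x] hint) simp
    qed
    show "(\<lambda>n. h n x) \<longlonglongrightarrow> g x" if x: "x \<in> {0<..<1}" for x
    proof -
      have "(\<lambda>n. h n x) \<longlonglongrightarrow> 1 * (g x - 0)"
        unfolding h_def by (intro tendsto_intros quot LIMSEQ_ignore_initial_segment[OF \<eta>lim[OF x]])
      then show ?thesis by simp
    qed
  qed
qed

section \<open>Space-time integrals and products of test functions\<close>

lemma LINT_lborel_pair:
  fixes F :: "real \<times> real \<Rightarrow> real"
  assumes "integrable lborel F"
  shows "(\<integral>p. F p \<partial>lborel) = (\<integral>t. \<integral>x. F (t, x) \<partial>lborel \<partial>lborel)"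
    and "integrable lborel (\<lambda>t. \<integral>x. F (t, x) \<partial>lborel)"
    and "(\<integral>t. \<integral>x. F (t, x) \<partial>lborel \<partial>lborel) = (\<integral>x. \<integral>t. F (t, x) \<partial>lborel \<partial>lborel)"
proof -
  have F: "integrable (lborel \<Otimes>\<^sub>M lborel) F" using assms by (simp only: lborel_prod)
  have F': "integrable (lborel \<Otimes>\<^sub>M lborel) (\<lambda>(t, x). F (t, x))" using F by (simp add: split_def)
  show "(\<integral>p. F p \<partial>lborel) = (\<integral>t. \<integral>x. F (t, x) \<partial>lborel \<partial>lborel)"
    using lborel_pair.integral_fst'[OF F] by (simp only: lborel_prod)
  show "integrable lborel (\<lambda>t. \<integral>x. F (t, x) \<partial>lborel)"
    by (rule lborel_pair.integrable_fst'[OF F])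
  show "(\<integral>t. \<integral>x. F (t, x) \<partial>lborel \<partial>lborel) = (\<integral>x. \<integral>t. F (t, x) \<partial>lborel \<partial>lborel)"
    by (rule lborel_pair.Fubini_integral[symmetric, OF F'])
qed

lemma bounded_box_integrable:
  fixes F :: "real \<times> real \<Rightarrow> real"
  assumes F: "F \<in> borel_measurable borel" and b: "\<And>p. \<bar>F p\<bar> \<le> C"
    and out: "\<And>t x. t \<notin> {a..b} \<or> x \<notin> {c..d} \<Longrightarrow> F (t, x) = 0"
  shows "integrable lborel F"
proof -
  have "integrable lborel (\<lambda>p. indicat_real (cbox (a, c) (b, d)) p *\<^sub>R C)"
    by (rule borel_integrable_compact) auto
  then show ?thesis
  proof (rule Bochner_Integration.integrable_bound)
    have "\<bar>F p\<bar> \<le> \<bar>indicat_real (cbox (a, c) (b, d)) p * C\<bar>" for p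
      using out[of "fst p" "snd p"] b[of p] by (cases p) (auto simp: indicator_def cbox_Pair_eq)
    then show "AE p in lborel. norm (F p) \<le> norm (indicat_real (cbox (a, c) (b, d)) p *\<^sub>R C)" by simp
  qed (use F in simp)
qed

lemma test_fun_mult:
  assumes \<phi>: "test_fun S \<phi> \<phi>'" and g: "\<And>x. (g has_real_derivative g' x) (at x)" "continuous_on UNIV g'"
  shows "test_fun S (\<lambda>x. \<phi> x * g x) (\<lambda>x. \<phi>' x * g x + \<phi> x * g' x)"
proof -
  have gc: "continuous_on UNIV g" by (intro continuous_at_imp_continuous_on ballI DERIV_isCont[OF g(1)])
  obtain K where "compact K" "K \<subseteq> S" "\<forall>x. x \<notin> K \<longrightarrow> \<phi> x = 0"
    using \<phi> unfolding test_fun_def by blast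
  moreover have "((\<lambda>x. \<phi> x * g x) has_real_derivative \<phi>' x * g x + \<phi> x * g' x) (at x)" for x
    using DERIV_mult[OF test_funD(1)[OF \<phi>] g(1), of x] by (simp add: algebra_simps)
  moreover have "continuous_on UNIV (\<lambda>x. \<phi>' x * g x + \<phi> x * g' x)"
    by (intro continuous_intros test_funD(2,3)[OF \<phi>] gc g)
  ultimately show ?thesis unfolding test_fun_def by (intro conjI allI exI[of _ K]) auto
qed

lemma test_fun_deriv_outside:
  assumes \<phi>: "test_fun S \<phi> \<phi>'" and K: "closed K" "\<And>x. x \<notin> K \<Longrightarrow> \<phi> x = 0" and x: "x \<notin> K"
  shows "\<phi>' x = 0"
proof -
  have "((\<lambda>_. 0) has_real_derivative \<phi>' x) (at x)"
  proof (rule has_field_derivative_transform_within_open)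
    show "(\<phi> has_real_derivative \<phi>' x) (at x)" by (rule test_funD(1)[OF \<phi>])
    show "open (- K)" "x \<in> - K" using K x by auto
    show "\<phi> y = 0" if "y \<in> - K" for y using K(2) that by simp
  qed
  then show ?thesis using DERIV_unique DERIV_const by blast
qed

text \<open>Outside \<open>[-T, T]\<close> a test function and its derivative vanish, and both are bounded.\<close>

lemma test_fun_support:
  assumes \<phi>: "test_fun S \<phi> \<phi>'"
  obtains T M where "0 < T" "\<And>x. \<bar>x\<bar> \<ge> T \<Longrightarrow> \<phi> x = 0 \<and> \<phi>' x = 0" "\<And>x. \<bar>\<phi> x\<bar> \<le> M \<and> \<bar>\<phi>' x\<bar> \<le> M"
proof -
  obtain K where K: "compact K" "\<And>x. x \<notin> K \<Longrightarrow> \<phi> x = 0"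
    using \<phi> unfolding test_fun_def by blast
  have K': "\<phi>' x = 0" if "x \<notin> K" for x
    by (rule test_fun_deriv_outside[OF \<phi> compact_imp_closed[OF K(1)] K(2) that])
  obtain B where B: "0 < B" "\<And>x. x \<in> K \<Longrightarrow> \<bar>x\<bar> \<le> B"
    using compact_imp_bounded[OF K(1)] unfolding bounded_pos by auto
  have "bounded (\<phi> ` K)" "bounded (\<phi>' ` K)"
    by (intro compact_imp_bounded compact_continuous_image K(1) test_funD[OF \<phi>])+
  then obtain M1 M2 where M: "\<And>x. x \<in> K \<Longrightarrow> \<bar>\<phi> x\<bar> \<le> M1" "\<And>x. x \<in> K \<Longrightarrow> \<bar>\<phi>' x\<bar> \<le> M2" "0 < M1" "0 < M2"
    unfolding bounded_pos by auto
  show ?thesis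
  proof (rule that)
    show "0 < B + 1" using B by simp
    fix x
    show "\<phi> x = 0 \<and> \<phi>' x = 0" if "B + 1 \<le> \<bar>x\<bar>"
    proof -
      have "x \<notin> K" using B(2)[of x] that by auto
      then show ?thesis using K(2) K' by blast
    qed
    show "\<bar>\<phi> x\<bar> \<le> M1 + M2 \<and> \<bar>\<phi>' x\<bar> \<le> M1 + M2"
      using M(1)[of x] M(2)[of x] M(3,4) K(2)[of x] K'[of x] by (cases "x \<in> K") auto
  qed
qed

lemma space_time_test_fun_product:
  assumes \<theta>: "test_fun UNIV \<theta> \<theta>'" and \<psi>: "test_fun {0<..<1} \<psi> \<psi>'"
  shows "space_time_test_fun (\<lambda>t x. \<theta> t * \<psi> x) (\<lambda>t x. \<theta>' t * \<psi> x) (\<lambda>t x. \<theta> t * \<psi>' x)"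
proof -
  obtain K1 where K1: "compact K1" "\<And>x. x \<notin> K1 \<Longrightarrow> \<theta> x = 0" using \<theta> unfolding test_fun_def by blast
  obtain K2 where K2: "compact K2" "K2 \<subseteq> {0<..<1}" "\<And>x. x \<notin> K2 \<Longrightarrow> \<psi> x = 0"
    using \<psi> unfolding test_fun_def by blast
  note c = continuous_on_compose2[OF test_funD(2)[OF \<theta>, of UNIV]] continuous_on_compose2[OF test_funD(3)[OF \<theta>, of UNIV]]
    continuous_on_compose2[OF test_funD(2)[OF \<psi>, of UNIV]] continuous_on_compose2[OF test_funD(3)[OF \<psi>, of UNIV]]
  show ?thesis
    unfolding space_time_test_fun_def split_beta
  proof (intro conjI allI exI[of _ "K1 \<times> K2"] impI)
    show "((\<lambda>s. \<theta> s * \<psi> x) has_real_derivative \<theta>' t * \<psi> x) (at t)" for t x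
      by (rule DERIV_cmult_right[OF test_funD(1)[OF \<theta>]])
    show "((\<lambda>y. \<theta> t * \<psi> y) has_real_derivative \<theta> t * \<psi>' x) (at x)" for t x
      by (rule DERIV_cmult[OF test_funD(1)[OF \<psi>]])
    show "continuous_on UNIV (\<lambda>p. \<theta>' (fst p) * \<psi> (snd p))"
      by (intro continuous_intros c) auto
    show "continuous_on UNIV (\<lambda>p. \<theta> (fst p) * \<psi>' (snd p))"
      by (intro continuous_intros c) auto
    show "compact (K1 \<times> K2)" by (intro compact_Times K1 K2)
    show "K1 \<times> K2 \<subseteq> UNIV \<times> {0<..<1}" using K2 by auto
    show "\<theta> t * \<psi> x = 0" if "(t, x) \<notin> K1 \<times> K2" for t x using that K1(2) K2(3) by auto
  qed
qed

section \<open>Sine coefficients of a weak solution\<close>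

lemma set_integral_eq_integral_if:
  fixes f :: "real \<Rightarrow> real"
  shows "(LBINT x:S. f x) = (\<integral>x. (if x \<in> S then f x else 0) \<partial>lborel)"
  unfolding set_lebesgue_integral_def by (rule Bochner_Integration.integral_cong) auto

lemma abs_set_integral_le:
  fixes f :: "real \<Rightarrow> real"
  assumes f: "f \<in> borel_measurable borel" and b: "\<And>x. x \<in> {a..b} \<Longrightarrow> \<bar>f x\<bar> \<le> C" and ab: "a \<le> b"
  shows "set_integrable lborel {a..b} f" "\<bar>LBINT x:{a..b}. f x\<bar> \<le> C * (b - a)"
proof -
  have C: "0 \<le> C" using b[of a] ab by auto
  have c: "set_integrable lborel {a..b} (\<lambda>x. C)" "(LBINT x:{a..b}. C) = C * (b - a)"
    using ab by (auto simp: set_integral_continuous_eq_integral)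
  show i: "set_integrable lborel {a..b} f"
    by (rule set_integrable_bound[OF c(1)]) (use f b C in \<open>auto simp: set_borel_measurable_def\<close>)
  have "\<bar>LBINT x:{a..b}. f x\<bar> \<le> (LBINT x:{a..b}. \<bar>f x\<bar>)"
    using set_integral_norm_bound[OF i] by simp
  also have "\<dots> \<le> (LBINT x:{a..b}. C)"
    by (rule set_integral_mono[OF set_integrable_abs[OF i] c(1)]) (rule b)
  finally show "\<bar>LBINT x:{a..b}. f x\<bar> \<le> C * (b - a)" by (simp only: c(2))
qed

lemma borel_measurable_partial_integral:
  fixes g :: "real \<Rightarrow> real \<Rightarrow> real"
  assumes "(\<lambda>(t, x). g t x) \<in> borel_measurable borel"
  shows "(\<lambda>t. LBINT x:{a..b}. g t x) \<in> borel_measurable borel"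
proof -
  have "(\<lambda>(t, x). g t x) \<in> borel_measurable (borel \<Otimes>\<^sub>M borel)" using assms by (simp only: borel_prod)
  then have [measurable]: "(\<lambda>(t, x). g t x) \<in> borel_measurable (borel \<Otimes>\<^sub>M lborel)" by simp
  show ?thesis unfolding set_integral_eq_integral_if by measurable
qed

lemma borel_measurable_set_integral_upto:
  fixes f :: "real \<Rightarrow> real"
  assumes [measurable]: "f \<in> borel_measurable borel"
  shows "(\<lambda>t. LBINT s:{a..t}. f s) \<in> borel_measurable borel"
  unfolding set_integral_eq_integral_if atLeastAtMost_iff by measurable

lemma borel_measurable_section:
  fixes g :: "real \<Rightarrow> real \<Rightarrow> real"
  assumes "(\<lambda>(t, x). g t x) \<in> borel_measurable borel"
  shows "g t \<in> borel_measurable borel" "(\<lambda>t. g t x) \<in> borel_measurable borel"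
proof -
  have m: "(\<lambda>p. g (fst p) (snd p)) \<in> borel_measurable borel" using assms by (simp only: split_beta')
  have "(\<lambda>x. (t, x)) \<in> borel_measurable borel" "(\<lambda>t. (t, x)) \<in> borel_measurable borel"
    by (intro borel_measurable_continuous_onI continuous_intros)+
  from measurable_compose[OF this(1) m] measurable_compose[OF this(2) m]
  show "g t \<in> borel_measurable borel" "(\<lambda>t. g t x) \<in> borel_measurable borel" by simp_all
qed

lemma LBINT_rectangle_swap:
  fixes g :: "real \<Rightarrow> real \<Rightarrow> real"
  assumes g: "(\<lambda>(t, x). g t x) \<in> borel_measurable borel"
    and b: "\<And>t x. t \<in> {a..b} \<Longrightarrow> x \<in> {c..d} \<Longrightarrow> \<bar>g t x\<bar> \<le> C"
  shows "(LBINT t:{a..b}. LBINT x:{c..d}. g t x) = (LBINT x:{c..d}. LBINT t:{a..b}. g t x)"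
proof -
  let ?F = "\<lambda>p. indicat_real {a..b} (fst p) * indicat_real {c..d} (snd p) * g (fst p) (snd p)"
  have m: "(\<lambda>p. g (fst p) (snd p)) \<in> borel_measurable borel" using g by (simp only: split_beta')
  have [measurable]: "fst \<in> borel_measurable (borel :: (real \<times> real) measure)" "snd \<in> borel_measurable (borel :: (real \<times> real) measure)"
    by (intro borel_measurable_continuous_onI continuous_intros)+
  have F: "integrable lborel ?F"
  proof (rule bounded_box_integrable)
    show "?F \<in> borel_measurable borel" using m by measurable
    have "\<bar>g (fst p) (snd p)\<bar> \<le> \<bar>C\<bar>" if "fst p \<in> {a..b}" "snd p \<in> {c..d}" for p
      using b[OF that] by linarith
    then show "\<bar>?F p\<bar> \<le> \<bar>C\<bar>" for p by (simp add: indicator_def)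
    show "?F (t, x) = 0" if "t \<notin> {a..b} \<or> x \<notin> {c..d}" for t x using that by auto
  qed
  have "(\<integral>t. \<integral>x. ?F (t, x) \<partial>lborel \<partial>lborel) = (LBINT t:{a..b}. LBINT x:{c..d}. g t x)"
    unfolding set_lebesgue_integral_def
    by (rule Bochner_Integration.integral_cong) (simp_all add: mult.assoc)
  moreover have "(\<integral>x. \<integral>t. ?F (t, x) \<partial>lborel \<partial>lborel) = (LBINT x:{c..d}. LBINT t:{a..b}. g t x)"
  proof -
    have "(\<integral>t. ?F (t, x) \<partial>lborel) = indicat_real {c..d} x *\<^sub>R (LBINT t:{a..b}. g t x)" for x
    proof -
      have "(\<lambda>t. ?F (t, x)) = (\<lambda>t. indicat_real {c..d} x * (indicat_real {a..b} t *\<^sub>R g t x))" by auto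
      then show ?thesis by (simp only: set_lebesgue_integral_def integral_mult_right_zero real_scaleR_def)
    qed
    then show ?thesis by (simp only: set_lebesgue_integral_def[of lborel "{c..d}"])
  qed
  ultimately show ?thesis using LINT_lborel_pair(3)[OF F] by simp
qed

text \<open>A weak solution \<open>z\<close> of \<open>z\<^sub>t\<^sub>t = z\<^sub>x\<^sub>x + f\<close> with initial velocity \<open>z1\<close>. Here \<open>W\<close> and \<open>X\<close> stand for \<open>z\<^sub>t\<close> and \<open>z\<^sub>x\<close>;
  all three functions that are defined only almost everywhere are represented by bounded Borel functions on the
  plane, and \<open>z\<close> is extended continuously to the plane. Only test functions of product form are used.\<close>

locale weak_wave =
  fixes z W X f :: "real \<Rightarrow> real \<Rightarrow> real" and z1 :: "real \<Rightarrow> real" and C :: real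
  assumes z_cont: "continuous_on UNIV (\<lambda>(t, x). z t x)"
    and z_bdry: "\<And>t. z t 0 = 0" "\<And>t. z t 1 = 0"
    and z1_cont: "continuous_on {0..1} z1"
    and W_borel: "(\<lambda>(t, x). W t x) \<in> borel_measurable borel"
    and X_borel: "(\<lambda>(t, x). X t x) \<in> borel_measurable borel"
    and f_borel: "(\<lambda>(t, x). f t x) \<in> borel_measurable borel"
    and bounds: "\<And>t x. \<bar>W t x\<bar> \<le> C" "\<And>t x. \<bar>X t x\<bar> \<le> C" "\<And>t x. \<bar>f t x\<bar> \<le> C"
    and space_deriv: "AE t in lborel. 0 < t \<longrightarrow> (\<forall>x\<in>{0..1}. z t x = (LBINT y:{0..x}. X t y))"
    and time_deriv: "\<And>\<theta> \<theta>'. test_fun {0<..} \<theta> \<theta>' \<Longrightarrow> AE x in lborel. x \<in> {0<..<1} \<longrightarrow>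
       (LBINT t:{0<..}. \<theta>' t * z t x) = - (LBINT t:{0<..}. \<theta> t * W t x)"
    and weak_eq: "\<And>\<theta> \<theta>' \<psi> \<psi>'. test_fun UNIV \<theta> \<theta>' \<Longrightarrow> test_fun {0<..<1} \<psi> \<psi>' \<Longrightarrow>
       (\<integral>p. indicator ({0<..} \<times> {0<..<1}) p * (W (fst p) (snd p) * (\<theta>' (fst p) * \<psi> (snd p))
          - X (fst p) (snd p) * (\<theta> (fst p) * \<psi>' (snd p)) + f (fst p) (snd p) * (\<theta> (fst p) * \<psi> (snd p))) \<partial>lborel)
       + (LBINT x:{0<..<1}. z1 x * (\<theta> 0 * \<psi> x)) = 0"
begin

lemma C_nonneg: "0 \<le> C" using bounds(1)[of 0 0] by linarith

text \<open>The frequencies \<open>\<omega> k\<close>, starting from \<open>\<pi>\<close> at \<open>k = 0\<close>, the sine coefficients of \<open>W\<close>, \<open>f\<close>, \<open>z\<close> and \<open>z1\<close>,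
  and the cosine coefficients \<open>Xc\<close> of \<open>X\<close>.\<close>

definition \<omega> :: "nat \<Rightarrow> real" where "\<omega> k = real (Suc k) * pi"
definition Ws :: "nat \<Rightarrow> real \<Rightarrow> real" where "Ws k t = (LBINT x:{0..1}. W t x * sin (\<omega> k * x))"
definition Xc :: "nat \<Rightarrow> real \<Rightarrow> real" where "Xc k t = (LBINT x:{0..1}. X t x * cos (\<omega> k * x))"
definition fs :: "nat \<Rightarrow> real \<Rightarrow> real" where "fs k t = (LBINT x:{0..1}. f t x * sin (\<omega> k * x))"
definition zs :: "nat \<Rightarrow> real \<Rightarrow> real" where "zs k t = (LBINT x:{0..1}. z t x * sin (\<omega> k * x))"
definition z1s :: "nat \<Rightarrow> real" where "z1s k = (LBINT x:{0..1}. z1 x * sin (\<omega> k * x))"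

lemma \<omega>_nonzero: "\<omega> k \<noteq> 0" and sin_\<omega>: "sin (\<omega> k) = 0"
  unfolding \<omega>_def by (simp, rule sin_npi)

lemma borel_pair_mult:
  fixes g :: "real \<Rightarrow> real \<Rightarrow> real" and u :: "real \<Rightarrow> real"
  assumes "(\<lambda>(t, x). g t x) \<in> borel_measurable borel" "continuous_on UNIV u"
  shows "(\<lambda>(t, x). g t x * u (x::real)) \<in> borel_measurable (borel :: (real \<times> real) measure)"
proof -
  have [measurable]: "(\<lambda>p. g (fst p) (snd p)) \<in> borel_measurable borel" using assms(1) by (simp only: split_beta')
  have "continuous_on UNIV (\<lambda>p::real \<times> real. u (snd p))"
    by (rule continuous_on_compose2[OF assms(2)]) (auto intro!: continuous_intros)
  then have [measurable]: "(\<lambda>p::real \<times> real. u (snd p)) \<in> borel_measurable borel"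
    by (rule borel_measurable_continuous_onI)
  show ?thesis unfolding split_beta' by measurable
qed

lemma coefficient_bound:
  fixes g :: "real \<Rightarrow> real \<Rightarrow> real" and u :: "real \<Rightarrow> real"
  assumes g: "(\<lambda>(t, x). g t x) \<in> borel_measurable borel" "\<And>t x. \<bar>g t x\<bar> \<le> C"
    and u: "continuous_on UNIV u" "\<And>x::real. \<bar>u x\<bar> \<le> 1"
  shows "(\<lambda>t. LBINT x:{0..1}. g t x * u x) \<in> borel_measurable borel"
    "\<bar>LBINT x:{0..1}. g t x * u x\<bar> \<le> C"
proof -
  note m = borel_pair_mult[OF g(1) u(1)]
  show "(\<lambda>t. LBINT x:{0..1}. g t x * u x) \<in> borel_measurable borel"
    by (rule borel_measurable_partial_integral[OF m])
  have "\<bar>LBINT x:{0..1}. g t x * u x\<bar> \<le> C * (1 - 0)"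
  proof (rule abs_set_integral_le(2))
    show "(\<lambda>x. g t x * u x) \<in> borel_measurable borel" by (rule borel_measurable_section(1)[OF m])
    have "\<bar>g t x\<bar> * \<bar>u x\<bar> \<le> C * 1" for x using g(2) u(2) C_nonneg by (intro mult_mono) auto
    then show "\<bar>g t x * u x\<bar> \<le> C" for x by (simp add: abs_mult)
  qed auto
  then show "\<bar>LBINT x:{0..1}. g t x * u x\<bar> \<le> C" by simp
qed

lemma Ws_borel: "Ws k \<in> borel_measurable borel" and Ws_bound: "\<bar>Ws k t\<bar> \<le> C"
  and fs_borel: "fs k \<in> borel_measurable borel" and fs_bound: "\<bar>fs k t\<bar> \<le> C"
  and Xc_borel: "Xc k \<in> borel_measurable borel"
proof -
  have s: "continuous_on UNIV (\<lambda>x. sin (\<omega> k * x))" "continuous_on UNIV (\<lambda>x. cos (\<omega> k * x))"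
    by (intro continuous_intros)+
  show "Ws k \<in> borel_measurable borel" "\<bar>Ws k t\<bar> \<le> C"
    unfolding Ws_def[abs_def] by (rule coefficient_bound[OF W_borel bounds(1) s(1)]; simp)+
  show "fs k \<in> borel_measurable borel" "\<bar>fs k t\<bar> \<le> C"
    unfolding fs_def[abs_def] by (rule coefficient_bound[OF f_borel bounds(3) s(1)]; simp)+
  show "Xc k \<in> borel_measurable borel"
    unfolding Xc_def[abs_def] by (rule coefficient_bound[OF X_borel bounds(2) s(2)]; simp)+
qed

lemma z_borel: "(\<lambda>(t, x). z t x) \<in> borel_measurable borel"
  by (rule borel_measurable_continuous_onI[OF z_cont])

lemma z_section: "continuous_on S (z t)"
  using continuous_on_compose2[OF z_cont, of S "\<lambda>x. (t, x)"] by (simp add: continuous_on_Pair continuous_on_const continuous_on_id)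

lemma zs_continuous: "continuous_on S (zs k)"
proof -
  have "continuous_on UNIV (\<lambda>t. integral (cbox 0 1) (\<lambda>x. z t x * sin (\<omega> k * x)))"
  proof (rule integral_continuous_on_param)
    show "continuous_on (UNIV \<times> cbox 0 1) (\<lambda>(t, x). z t x * sin (\<omega> k * x))"
      using continuous_on_subset[OF z_cont, of "UNIV \<times> cbox 0 1"]
      unfolding split_beta' by (intro continuous_intros) auto
  qed
  moreover have "zs k = (\<lambda>t. integral (cbox 0 1) (\<lambda>x. z t x * sin (\<omega> k * x)))"
    unfolding zs_def[abs_def] cbox_interval
    by (rule ext, rule set_integral_continuous_eq_integral(2)) (intro continuous_intros z_section)
  ultimately have "continuous_on UNIV (zs k)" by (simp only:)
  then show ?thesis by (rule continuous_on_subset) simp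
qed

lemma Xc_eq: "AE t in lborel. 0 < t \<longrightarrow> Xc k t = \<omega> k * zs k t"
  using space_deriv
proof eventually_elim
  case (elim t)
  show ?case
  proof
    assume "0 < t"
    then have z: "z t x = (LBINT y:{0..x}. X t y)" if "x \<in> {0..1}" for x using elim that by blast
    have Xi: "set_integrable lborel {0..1} (X t)"
      by (rule abs_set_integral_le(1)[OF borel_measurable_section(1)[OF X_borel] bounds(2)]) simp
    have "(LBINT x:{0..1}. z t x * (- \<omega> k * sin (\<omega> k * x))) = (LBINT x:{0..1}. (LBINT y:{0..x}. X t y) * (- \<omega> k * sin (\<omega> k * x)))"
      by (rule set_lebesgue_integral_cong) (auto simp: z)
    also have "\<dots> = (LBINT y:{0..1}. X t y * (cos (\<omega> k * 1) - cos (\<omega> k * y)))"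
      by (rule set_integral_by_parts[OF Xi]) (auto intro!: derivative_eq_intros continuous_intros)
    also have "\<dots> = (LBINT y:{0..1}. X t y * cos (\<omega> k) - X t y * cos (\<omega> k * y))"
      by (simp only: mult_1_right right_diff_distrib)
    also have "\<dots> = (LBINT y:{0..1}. X t y * cos (\<omega> k)) - Xc k t"
    proof -
      have m: "(\<lambda>(t, x). X t x * cos (\<omega> k * x)) \<in> borel_measurable borel"
        by (rule borel_pair_mult[OF X_borel]) (intro continuous_intros)
      have "\<bar>X t x * cos (\<omega> k * x)\<bar> \<le> C" for x
      proof -
        have "\<bar>X t x\<bar> * \<bar>cos (\<omega> k * x)\<bar> \<le> C * 1" using bounds(2) C_nonneg by (intro mult_mono) auto
        then show ?thesis by (simp add: abs_mult)
      qed
      then have "set_integrable lborel {0..1} (\<lambda>y. X t y * cos (\<omega> k * y))"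
        by (intro abs_set_integral_le(1)[OF borel_measurable_section(1)[OF m]]) auto
      then show ?thesis unfolding Xc_def by (intro set_integral_diff(2) set_integrable_mult_left Xi) auto
    qed
    also have "(LBINT y:{0..1}. X t y * cos (\<omega> k)) = z t 1 * cos (\<omega> k)" using z[of 1] by simp
    also have "\<dots> = 0" by (simp add: z_bdry)
    also have "(LBINT x:{0..1}. z t x * (- \<omega> k * sin (\<omega> k * x))) = - \<omega> k * zs k t"
    proof -
      have "(\<lambda>x. z t x * (- \<omega> k * sin (\<omega> k * x))) = (\<lambda>x. - \<omega> k * (z t x * sin (\<omega> k * x)))" by auto
      then show ?thesis unfolding zs_def by (simp only: set_integral_mult_right)
    qed
    finally show "Xc k t = \<omega> k * zs k t" by simp
  qed
qed


text \<open>The weak equation tested with \<open>sin (\<omega> k x)\<close>, which is not compactly supported in the open interval and is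
  reached by approximation.\<close>

lemma weak_eq_sine:
  assumes \<theta>: "test_fun UNIV \<theta> \<theta>'"
  shows "(LBINT t:{0<..}. \<theta>' t * Ws k t - \<theta> t * \<omega> k * Xc k t + \<theta> t * fs k t) + \<theta> 0 * z1s k = 0"
proof -
  have g: "continuous_on UNIV (\<lambda>x. \<omega> k * cos (\<omega> k * x))" by (intro continuous_intros)
  have gint: "integral {0..x} (\<lambda>x. \<omega> k * cos (\<omega> k * x)) = sin (\<omega> k * x)" if "0 \<le> x" for x
  proof -
    have "((\<lambda>x. \<omega> k * cos (\<omega> k * x)) has_integral sin (\<omega> k * x) - sin (\<omega> k * 0)) {0..x}"
      by (rule fundamental_theorem_of_calculus[OF that])
        (auto intro!: derivative_eq_intros simp: has_real_derivative_iff_has_vector_derivative[symmetric])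
    from integral_unique[OF this] show ?thesis by (simp only: mult_zero_right sin_zero diff_0_right)
  qed
  have "integral {0..1} (\<lambda>x. \<omega> k * cos (\<omega> k * x)) = 0" using gint[of 1] sin_\<omega> by simp
  from test_fun_approximation[OF g this] obtain \<psi> \<psi>' M where \<psi>: "\<And>n. test_fun {0<..<1} (\<psi> n) (\<psi>' n)"
    and M: "\<And>n x. x \<in> {0..1} \<Longrightarrow> \<bar>\<psi> n x\<bar> \<le> M" "\<And>n x. x \<in> {0..1} \<Longrightarrow> \<bar>\<psi>' n x\<bar> \<le> M"
    and lim0: "\<And>x. x \<in> {0..1} \<Longrightarrow> (\<lambda>n. \<psi> n x) \<longlonglongrightarrow> integral {0..x} (\<lambda>x. \<omega> k * cos (\<omega> k * x))"
    and lim': "\<And>x. x \<in> {0<..<1} \<Longrightarrow> (\<lambda>n. \<psi>' n x) \<longlonglongrightarrow> \<omega> k * cos (\<omega> k * x)"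
    by blast
  have lim: "(\<lambda>n. \<psi> n x) \<longlonglongrightarrow> sin (\<omega> k * x)" if "x \<in> {0..1}" for x
    using lim0[OF that] gint[of x] that by simp
  obtain T B where T: "0 < T" "\<And>t. \<bar>t\<bar> \<ge> T \<Longrightarrow> \<theta> t = 0 \<and> \<theta>' t = 0" and B: "\<And>t. \<bar>\<theta> t\<bar> \<le> B \<and> \<bar>\<theta>' t\<bar> \<le> B"
    using test_fun_support[OF \<theta>] by blast
  have B0: "0 \<le> B" using B[of 0] by linarith
  have M0: "0 \<le> M" using M(1)[of 0 0] by auto
  note \<theta>c = test_funD(2)[OF \<theta>, of UNIV] test_funD(3)[OF \<theta>, of UNIV]
  have [measurable]: "fst \<in> borel_measurable (borel :: (real \<times> real) measure)" "snd \<in> borel_measurable (borel :: (real \<times> real) measure)"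
    by (intro borel_measurable_continuous_onI continuous_intros)+
  have [measurable]: "\<theta> \<in> borel_measurable borel" "\<theta>' \<in> borel_measurable borel"
    by (intro borel_measurable_continuous_onI \<theta>c)+
  have \<psi>m[measurable]: "\<psi> n \<in> borel_measurable borel" "\<psi>' n \<in> borel_measurable borel" for n
    by (intro borel_measurable_continuous_onI test_funD[OF \<psi>])+
  have [measurable]: "(\<lambda>p. W (fst p) (snd p)) \<in> borel_measurable borel" "(\<lambda>p. X (fst p) (snd p)) \<in> borel_measurable borel"
    "(\<lambda>p. f (fst p) (snd p)) \<in> borel_measurable borel"
    using W_borel X_borel f_borel by (simp_all only: split_beta')
  have Qm[measurable]: "{0<..} \<times> {0<..<1::real} \<in> sets (borel :: (real \<times> real) measure)"
    by (intro borel_open open_Times) auto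
  define H where "H = (\<lambda>u u' p. indicator ({0<..} \<times> {0<..<1::real}) p * (W (fst p) (snd p) * (\<theta>' (fst p) * u (snd p))
          - X (fst p) (snd p) * (\<theta> (fst p) * u' (snd p)) + f (fst p) (snd p) * (\<theta> (fst p) * u (snd p))) :: real)"
  have Hm: "H u u' \<in> borel_measurable borel" if "u \<in> borel_measurable borel" "u' \<in> borel_measurable borel" for u u'
  proof -
    note [measurable] = that
    show ?thesis unfolding H_def by measurable
  qed
  have Hout: "H u u' p = 0" if "fst p \<notin> {-T..T} \<or> snd p \<notin> {0..1}" for u u' p
    using that T(2)[of "fst p"] by (auto simp: H_def indicator_def)
  have Hb: "\<bar>H u u' p\<bar> \<le> 3 * (C * (B * N))" if N: "\<And>x. x \<in> {0..1} \<Longrightarrow> \<bar>u x\<bar> \<le> N \<and> \<bar>u' x\<bar> \<le> N" for u u' p N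
  proof (cases "p \<in> {0<..} \<times> {0<..<1}")
    case True
    then have x: "snd p \<in> {0..1}" by auto
    have N0: "0 \<le> N" using N[of 0] by auto
    have *: "\<bar>a * (b * c)\<bar> \<le> C * (B * N)" if "\<bar>a\<bar> \<le> C" "\<bar>b\<bar> \<le> B" "\<bar>c\<bar> \<le> N" for a b c
      unfolding abs_mult using that C_nonneg B0 N0 by (intro mult_mono mult_nonneg_nonneg) auto
    have "\<bar>W (fst p) (snd p) * (\<theta>' (fst p) * u (snd p))\<bar> \<le> C * (B * N)"
      "\<bar>X (fst p) (snd p) * (\<theta> (fst p) * u' (snd p))\<bar> \<le> C * (B * N)"
      "\<bar>f (fst p) (snd p) * (\<theta> (fst p) * u (snd p))\<bar> \<le> C * (B * N)"
      using N[OF x] B bounds by (auto intro!: *)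
    then have "\<bar>W (fst p) (snd p) * (\<theta>' (fst p) * u (snd p)) - X (fst p) (snd p) * (\<theta> (fst p) * u' (snd p))
        + f (fst p) (snd p) * (\<theta> (fst p) * u (snd p))\<bar> \<le> 3 * (C * (B * N))" by linarith
    then show ?thesis using True by (simp add: H_def)
  next
    case False
    have "0 \<le> N" using N[of 0] by auto
    then have "0 \<le> C * (B * N)" using C_nonneg B0 by (intro mult_nonneg_nonneg) auto
    then show ?thesis using False by (simp add: H_def)
  qed
  let ?s = "\<lambda>x. sin (\<omega> k * x)" and ?c = "\<lambda>x. \<omega> k * cos (\<omega> k * x)"
  have scm: "?s \<in> borel_measurable borel" "?c \<in> borel_measurable borel"
    by (intro borel_measurable_continuous_onI continuous_intros)+
  have Hlim: "(\<lambda>n. \<integral>p. H (\<psi> n) (\<psi>' n) p \<partial>lborel) \<longlonglongrightarrow> (\<integral>p. H ?s ?c p \<partial>lborel)"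
  proof (rule integral_dominated_convergence)
    show "integrable lborel (\<lambda>p. indicat_real (cbox (-T, 0) (T, 1)) p *\<^sub>R (3 * (C * (B * M))))"
      by (rule borel_integrable_compact) auto
    show "AE p in lborel. norm (H (\<psi> n) (\<psi>' n) p) \<le> indicat_real (cbox (-T, 0) (T, 1)) p *\<^sub>R (3 * (C * (B * M)))" for n
    proof (rule AE_I2)
      fix p :: "real \<times> real"
      show "norm (H (\<psi> n) (\<psi>' n) p) \<le> indicat_real (cbox (-T, 0) (T, 1)) p *\<^sub>R (3 * (C * (B * M)))"
      proof (cases "p \<in> cbox (-T, 0) (T, 1)")
        case True
        then show ?thesis using Hb[of "\<psi> n" M "\<psi>' n" p] M by simp
      next
        case False
        then have "fst p \<notin> {-T..T} \<or> snd p \<notin> {0..1}" by (cases p) (auto simp: cbox_Pair_eq)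
        from Hout[OF this] show ?thesis using False by simp
      qed
    qed
    show "AE p in lborel. (\<lambda>n. H (\<psi> n) (\<psi>' n) p) \<longlonglongrightarrow> H ?s ?c p"
    proof (rule AE_I2)
      fix p :: "real \<times> real"
      show "(\<lambda>n. H (\<psi> n) (\<psi>' n) p) \<longlonglongrightarrow> H ?s ?c p"
      proof (cases "snd p \<in> {0<..<1}")
        case True
        then have "snd p \<in> {0..1}" by auto
        from lim[OF this] lim'[OF True] show ?thesis unfolding H_def by (intro tendsto_intros)
      next
        case False
        then have "H u u' p = 0" for u u' by (cases p) (auto simp: H_def)
        then show ?thesis by simp
      qed
    qed
  qed (use Hm \<psi>m scm in simp_all)
  have z1lim: "(\<lambda>n. LBINT x:{0<..<1}. z1 x * (\<theta> 0 * \<psi> n x)) \<longlonglongrightarrow> (LBINT x:{0<..<1}. z1 x * (\<theta> 0 * ?s x))"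
    unfolding set_integral_Icc_Ioo[symmetric] unfolding set_lebesgue_integral_def
  proof (rule integral_dominated_convergence)
    have "continuous_on {0..1} (\<lambda>x. \<bar>z1 x\<bar> * (B * M))" by (intro continuous_intros z1_cont)
    from set_integral_continuous_eq_integral(1)[OF this]
    show "integrable lborel (\<lambda>x. indicat_real {0..1} x *\<^sub>R (\<bar>z1 x\<bar> * (B * M)))"
      by (simp only: set_integrable_def)
    have m: "(\<lambda>x. indicat_real {0..1} x *\<^sub>R (z1 x * (\<theta> 0 * u x))) \<in> borel_measurable lborel"
      if "continuous_on UNIV u" for u :: "real \<Rightarrow> real"
    proof -
      have "continuous_on {0..1} (\<lambda>x. z1 x * (\<theta> 0 * u x))"
        by (intro continuous_intros z1_cont continuous_on_subset[OF that]) auto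
      from set_integral_continuous_eq_integral(1)[OF this] show ?thesis
        unfolding set_integrable_def by (rule borel_measurable_integrable)
    qed
    show "(\<lambda>x. indicat_real {0..1} x *\<^sub>R (z1 x * (\<theta> 0 * ?s x))) \<in> borel_measurable lborel"
      by (rule m) (intro continuous_intros)
    show "(\<lambda>x. indicat_real {0..1} x *\<^sub>R (z1 x * (\<theta> 0 * \<psi> n x))) \<in> borel_measurable lborel" for n
      by (rule m[OF test_funD(3)[OF \<psi>]])
    show "AE x in lborel. (\<lambda>n. indicat_real {0..1} x *\<^sub>R (z1 x * (\<theta> 0 * \<psi> n x)))
        \<longlonglongrightarrow> indicat_real {0..1} x *\<^sub>R (z1 x * (\<theta> 0 * ?s x))"
    proof (rule AE_I2)
      fix x :: real
      show "(\<lambda>n. indicat_real {0..1} x *\<^sub>R (z1 x * (\<theta> 0 * \<psi> n x))) \<longlonglongrightarrow> indicat_real {0..1} x *\<^sub>R (z1 x * (\<theta> 0 * ?s x))"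
      proof (cases "x \<in> {0..1}")
        case True
        from lim[OF True] show ?thesis by (intro tendsto_intros)
      qed simp
    qed
    show "AE x in lborel. norm (indicat_real {0..1} x *\<^sub>R (z1 x * (\<theta> 0 * \<psi> n x)))
        \<le> indicat_real {0..1} x *\<^sub>R (\<bar>z1 x\<bar> * (B * M))" for n
    proof (rule AE_I2)
      fix x :: real
      have "\<bar>z1 x\<bar> * (\<bar>\<theta> 0\<bar> * \<bar>\<psi> n x\<bar>) \<le> \<bar>z1 x\<bar> * (B * M)" if "x \<in> {0..1}"
        using B[of 0] M(1)[OF that, of n] B0 by (intro mult_left_mono mult_mono) auto
      then show "norm (indicat_real {0..1} x *\<^sub>R (z1 x * (\<theta> 0 * \<psi> n x))) \<le> indicat_real {0..1} x *\<^sub>R (\<bar>z1 x\<bar> * (B * M))"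
        by (cases "x \<in> {0..1}") (simp_all add: abs_mult)
    qed
  qed
  have "(\<integral>p. H (\<psi> n) (\<psi>' n) p \<partial>lborel) + (LBINT x:{0<..<1}. z1 x * (\<theta> 0 * \<psi> n x)) = 0" for n
    unfolding H_def by (rule weak_eq[OF \<theta> \<psi>])
  then have tot: "(\<integral>p. H ?s ?c p \<partial>lborel) + (LBINT x:{0<..<1}. z1 x * (\<theta> 0 * ?s x)) = 0"
    using tendsto_add[OF Hlim z1lim] by (simp add: LIMSEQ_const_iff)
  have Hint: "integrable lborel (H ?s ?c)"
  proof (rule bounded_box_integrable)
    show "H ?s ?c \<in> borel_measurable borel" by (rule Hm[OF scm])
    show "\<bar>H ?s ?c p\<bar> \<le> 3 * (C * (B * max 1 \<bar>\<omega> k\<bar>))" for p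
    proof (rule Hb)
      fix x :: real
      have "\<bar>\<omega> k\<bar> * \<bar>cos (\<omega> k * x)\<bar> \<le> \<bar>\<omega> k\<bar> * 1" by (intro mult_left_mono) auto
      then have "\<bar>?c x\<bar> \<le> max 1 \<bar>\<omega> k\<bar>" by (intro order_trans[OF _ max.cobounded2]) (simp add: abs_mult)
      moreover have "\<bar>?s x\<bar> \<le> max 1 \<bar>\<omega> k\<bar>" by (rule order_trans[OF abs_sin_le_one max.cobounded1])
      ultimately show "\<bar>?s x\<bar> \<le> max 1 \<bar>\<omega> k\<bar> \<and> \<bar>?c x\<bar> \<le> max 1 \<bar>\<omega> k\<bar>" by blast
    qed
    show "H ?s ?c (t, x) = 0" if "t \<notin> {-T..T} \<or> x \<notin> {0..1}" for t x
      by (rule Hout) (use that in simp)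
  qed
  have inner: "(\<integral>x. H ?s ?c (t, x) \<partial>lborel) = indicator {0<..} t *\<^sub>R (\<theta>' t * Ws k t - \<theta> t * \<omega> k * Xc k t + \<theta> t * fs k t)" for t
  proof -
    have si: "set_integrable lborel {0<..<1} (\<lambda>x. g t x * u x)"
      if "(\<lambda>(t, x). g t x) \<in> borel_measurable borel" "\<And>t x. \<bar>g t x\<bar> \<le> C" "continuous_on UNIV u" "\<And>x::real. \<bar>u x\<bar> \<le> 1"
      for g :: "real \<Rightarrow> real \<Rightarrow> real" and u :: "real \<Rightarrow> real"
      unfolding set_integrable_Icc_Ioo[symmetric]
    proof (rule abs_set_integral_le(1))
      show "(\<lambda>x. g t x * u x) \<in> borel_measurable borel"
        by (rule borel_measurable_section(1)[OF borel_pair_mult[OF that(1,3)]])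
      show "\<bar>g t x * u x\<bar> \<le> C * 1" for x
        unfolding abs_mult using that(2,4) C_nonneg by (intro mult_mono) auto
    qed simp
    have c: "continuous_on UNIV (\<lambda>x. sin (\<omega> k * x))" "continuous_on UNIV (\<lambda>x. cos (\<omega> k * x))"
      by (intro continuous_intros)+
    note i = si[OF W_borel bounds(1) c(1)] si[OF X_borel bounds(2) c(2)] si[OF f_borel bounds(3) c(1)]
    have "(\<integral>x. H ?s ?c (t, x) \<partial>lborel) = (\<integral>x. indicator {0<..} t * (indicator {0<..<1} x *\<^sub>R
        (\<theta>' t * (W t x * ?s x) - \<theta> t * \<omega> k * (X t x * cos (\<omega> k * x)) + \<theta> t * (f t x * ?s x))) \<partial>lborel)"
      by (rule Bochner_Integration.integral_cong) (auto simp: H_def indicator_def algebra_simps)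
    also have "\<dots> = indicator {0<..} t * (LBINT x:{0<..<1}.
        \<theta>' t * (W t x * ?s x) - \<theta> t * \<omega> k * (X t x * cos (\<omega> k * x)) + \<theta> t * (f t x * ?s x))"
      unfolding set_lebesgue_integral_def by (rule integral_mult_right_zero)
    also have "(LBINT x:{0<..<1}. \<theta>' t * (W t x * ?s x) - \<theta> t * \<omega> k * (X t x * cos (\<omega> k * x)) + \<theta> t * (f t x * ?s x))
        = \<theta>' t * Ws k t - \<theta> t * \<omega> k * Xc k t + \<theta> t * fs k t"
      unfolding Ws_def Xc_def fs_def set_integral_Icc_Ioo
      using i by (simp add: set_integral_add(2) set_integral_diff)
    finally show ?thesis by simp
  qed
  have "(\<integral>p. H ?s ?c p \<partial>lborel) = (LBINT t:{0<..}. \<theta>' t * Ws k t - \<theta> t * \<omega> k * Xc k t + \<theta> t * fs k t)"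
    unfolding LINT_lborel_pair(1)[OF Hint] inner set_lebesgue_integral_def ..
  moreover have "(LBINT x:{0<..<1}. z1 x * (\<theta> 0 * ?s x)) = \<theta> 0 * z1s k"
  proof -
    have "(\<lambda>x. z1 x * (\<theta> 0 * ?s x)) = (\<lambda>x. \<theta> 0 * (z1 x * ?s x))" by auto
    then show ?thesis unfolding z1s_def set_integral_Icc_Ioo by (simp only: set_integral_mult_right)
  qed
  ultimately show ?thesis using tot by simp
qed

end

lemma set_integral_half_line:
  fixes g :: "real \<Rightarrow> real"
  assumes "\<And>t. T \<le> t \<Longrightarrow> g t = 0"
  shows "(LBINT t:{0<..}. g t) = (LBINT t:{0..T}. g t)"
proof -
  have "(LBINT t:{0<..}. g t) = (LBINT t:{0<..<T}. g t)"
    unfolding set_lebesgue_integral_def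
    by (rule Bochner_Integration.integral_cong) (use assms in \<open>auto simp: indicator_def not_less\<close>)
  then show ?thesis by (simp only: set_integral_Icc_Ioo)
qed

lemma set_integrable_continuous_mult:
  fixes u v :: "real \<Rightarrow> real"
  assumes u: "set_integrable lborel {a..b} u" "u \<in> borel_measurable borel" and v: "continuous_on UNIV v"
  shows "set_integrable lborel {a..b} (\<lambda>x. u x * v x)"
proof -
  have [measurable]: "u \<in> borel_measurable borel" "v \<in> borel_measurable borel"
    using u v by (auto intro: borel_measurable_continuous_onI)
  have "bounded (v ` {a..b})"
    by (intro compact_imp_bounded compact_continuous_image continuous_on_subset[OF v]) auto
  then obtain M where "\<forall>y\<in>v ` {a..b}. norm y \<le> M" unfolding bounded_iff by blast
  then have M: "\<bar>v x\<bar> \<le> M" if "x \<in> {a..b}" for x using that by auto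
  have "set_integrable lborel {a..b} (\<lambda>x. M * u x)" using u(1) by (rule set_integrable_mult_right)
  then show ?thesis
  proof (rule set_integrable_bound)
    have "\<bar>u x * v x\<bar> \<le> \<bar>M * u x\<bar>" if "x \<in> {a..b}" for x
      using mult_right_mono[OF M[OF that], of "\<bar>u x\<bar>"] M[OF that] by (simp add: abs_mult mult.commute)
    then show "AE x in lborel. x \<in> {a..b} \<longrightarrow> norm (u x * v x) \<le> norm (M * u x)" by auto
  qed (auto simp: set_borel_measurable_def)
qed

lemma set_integral_by_parts_test:
  fixes u P :: "real \<Rightarrow> real"
  assumes u: "set_integrable lborel {0..T} u"
    and P: "\<And>t. t \<in> {0..T} \<Longrightarrow> P t = P0 + (LBINT s:{0..t}. u s)"
    and \<theta>: "\<And>x. (\<theta> has_real_derivative \<theta>' x) (at x)" "continuous_on UNIV \<theta>'" and T: "\<theta> T = 0" "0 \<le> T"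
  shows "(LBINT t:{0..T}. P t * \<theta>' t) = - P0 * \<theta> 0 - (LBINT t:{0..T}. u t * \<theta> t)"
proof -
  have \<theta>w: "(\<theta> has_real_derivative \<theta>' x) (at x within A)" for x A
    by (rule has_field_derivative_at_within[OF \<theta>(1)])
  have \<theta>'c: "continuous_on A \<theta>'" for A by (rule continuous_on_subset[OF \<theta>(2)]) simp
  have "(LBINT t:{0..T}. P t * \<theta>' t) = (LBINT t:{0..T}. P0 * \<theta>' t + (LBINT s:{0..t}. u s) * \<theta>' t)"
    by (rule set_lebesgue_integral_cong) (auto simp: P distrib_right)
  also have "\<dots> = (LBINT t:{0..T}. P0 * \<theta>' t) + (LBINT t:{0..T}. (LBINT s:{0..t}. u s) * \<theta>' t)"
    by (intro set_integral_add(2) set_integral_continuous_eq_integral(1) continuous_on_mult continuous_on_const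
        \<theta>'c continuous_on_set_integral_upto u)
  also have "(LBINT t:{0..T}. P0 * \<theta>' t) = P0 * (\<theta> T - \<theta> 0)"
  proof -
    have "(\<theta>' has_integral \<theta> T - \<theta> 0) {0..T}"
      by (rule fundamental_theorem_of_calculus[OF T(2)])
        (use \<theta>w in \<open>auto simp: has_real_derivative_iff_has_vector_derivative[symmetric]\<close>)
    then show ?thesis
      by (simp add: set_integral_continuous_eq_integral(2)[OF \<theta>'c] integral_unique)
  qed
  also have "(LBINT t:{0..T}. (LBINT s:{0..t}. u s) * \<theta>' t) = (LBINT s:{0..T}. u s * (\<theta> T - \<theta> s))"
    by (rule set_integral_by_parts[OF u \<theta>w \<theta>'c])
  also have "\<dots> = - (LBINT t:{0..T}. u t * \<theta> t)"
    by (simp add: T set_lebesgue_integral_def)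
  finally show ?thesis using T by simp
qed

context weak_wave begin

lemma Ws_integrable: "set_integrable lborel {a..b} (Ws k)"
proof (cases "a \<le> b")
  case True
  show ?thesis by (rule abs_set_integral_le(1)[OF Ws_borel _ True]) (rule Ws_bound)
qed (simp add: set_integrable_def)

lemma fs_integrable: "set_integrable lborel {a..b} (fs k)"
proof (cases "a \<le> b")
  case True
  show ?thesis by (rule abs_set_integral_le(1)[OF fs_borel _ True]) (rule fs_bound)
qed (simp add: set_integrable_def)

text \<open>Here \<open>\<theta>\<close> vanishes near time 0, so no boundary term appears.\<close>

lemma zs_weak:
  assumes \<theta>: "test_fun {0<..} \<theta> \<theta>'" and T: "0 < T" "\<And>t. T \<le> \<bar>t\<bar> \<Longrightarrow> \<theta> t = 0 \<and> \<theta>' t = 0"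
  shows "(LBINT t:{0..T}. zs k t * \<theta>' t) = - (LBINT t:{0..T}. Ws k t * \<theta> t)"
proof -
  let ?s = "\<lambda>x. sin (\<omega> k * x)"
  note \<theta>c = test_funD(2)[OF \<theta>, of UNIV] test_funD(3)[OF \<theta>, of UNIV]
  obtain T' B where "0 < T'" "\<And>t. T' \<le> \<bar>t\<bar> \<Longrightarrow> \<theta> t = 0 \<and> \<theta>' t = 0"
    and B: "\<And>t. \<bar>\<theta> t\<bar> \<le> B \<and> \<bar>\<theta>' t\<bar> \<le> B"
    using test_fun_support[OF \<theta>] by blast
  have B0: "0 \<le> B" using B[of 0] by linarith
  have pm: "(\<lambda>(t, x). g t x * (v t * ?s x)) \<in> borel_measurable borel"
    if g: "(\<lambda>(t, x). g t x) \<in> borel_measurable borel" and v: "continuous_on UNIV v" for g :: "real \<Rightarrow> real \<Rightarrow> real" and v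
  proof -
    have "continuous_on UNIV (\<lambda>p::real \<times> real. v (fst p) * ?s (snd p))"
      by (intro continuous_intros continuous_on_compose2[OF v]) auto
    then have [measurable]: "(\<lambda>p::real \<times> real. v (fst p) * ?s (snd p)) \<in> borel_measurable borel"
      by (rule borel_measurable_continuous_onI)
    have [measurable]: "(\<lambda>p. g (fst p) (snd p)) \<in> borel_measurable borel" using g by (simp only: split_beta')
    show ?thesis unfolding split_beta' by measurable
  qed
  have "bounded ((\<lambda>(t, x). z t x) ` ({0..T} \<times> {0..1}))"
    by (intro compact_imp_bounded compact_continuous_image continuous_on_subset[OF z_cont] compact_Times) auto
  then obtain N where "\<forall>y\<in>(\<lambda>(t, x). z t x) ` ({0..T} \<times> {0..1}). norm y \<le> N" unfolding bounded_iff by blast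
  then have N: "\<bar>z t x\<bar> \<le> N" if "t \<in> {0..T}" "x \<in> {0..1}" for t x using that by auto
  have N0: "0 \<le> N" using N[of 0 0] T by auto
  have sb: "\<bar>v t * ?s x\<bar> \<le> B" if "\<bar>v t\<bar> \<le> B" for v :: "real \<Rightarrow> real" and t x
  proof -
    have "\<bar>v t\<bar> * \<bar>?s x\<bar> \<le> B * 1" using that B0 by (intro mult_mono) auto
    then show ?thesis by (simp add: abs_mult)
  qed
  have pull: "(LBINT x:{0..1}. h x * (c * ?s x)) = (LBINT x:{0..1}. h x * ?s x) * c" for h :: "real \<Rightarrow> real" and c
  proof -
    have "(\<lambda>x. h x * (c * ?s x)) = (\<lambda>x. (h x * ?s x) * c)" by auto
    then show ?thesis by (simp only: set_integral_mult_left)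
  qed
  have pull': "(LBINT t:{0..T}. h t * (v t * c)) = c * (LBINT t:{0..T}. v t * h t)" for h v :: "real \<Rightarrow> real" and c
  proof -
    have "(\<lambda>t. h t * (v t * c)) = (\<lambda>t. c * (v t * h t))" by auto
    then show ?thesis by (simp only: set_integral_mult_right)
  qed
  have "(LBINT t:{0..T}. zs k t * \<theta>' t) = (LBINT t:{0..T}. LBINT x:{0..1}. z t x * (\<theta>' t * ?s x))"
    unfolding pull zs_def ..
  also have "\<dots> = (LBINT x:{0..1}. LBINT t:{0..T}. z t x * (\<theta>' t * ?s x))"
  proof (rule LBINT_rectangle_swap[OF pm[OF z_borel \<theta>c(1)]])
    show "\<bar>z t x * (\<theta>' t * ?s x)\<bar> \<le> N * B" if "t \<in> {0..T}" "x \<in> {0..1}" for t x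
      unfolding abs_mult[of "z t x"] using N[OF that] N0 sb[of \<theta>' t x] B by (intro mult_mono) auto
  qed
  also have "\<dots> = (LBINT x:{0..1}. - (LBINT t:{0..T}. W t x * (\<theta> t * ?s x)))"
    unfolding set_lebesgue_integral_def[of lborel "{0..1}"]
  proof (rule integral_cong_AE)
    have sw: "(\<lambda>(x, t). g t x) \<in> borel_measurable borel"
      if "(\<lambda>(t, x). g t x) \<in> borel_measurable borel" for g :: "real \<Rightarrow> real \<Rightarrow> real"
    proof -
      have m: "(\<lambda>p. g (fst p) (snd p)) \<in> borel_measurable borel" using that by (simp only: split_beta')
      have "(\<lambda>p::real \<times> real. (snd p, fst p)) \<in> borel_measurable borel"
        by (intro borel_measurable_continuous_onI continuous_intros)
      from measurable_compose[OF this m] show ?thesis by (simp add: split_beta')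
    qed
    note [measurable] = borel_measurable_partial_integral[OF sw[OF pm[OF z_borel \<theta>c(1)]], of 0 T]
      borel_measurable_partial_integral[OF sw[OF pm[OF W_borel \<theta>c(2)]], of 0 T]
    show "(\<lambda>x. indicat_real {0..1} x *\<^sub>R (LBINT t:{0..T}. z t x * (\<theta>' t * ?s x))) \<in> borel_measurable lborel"
      "(\<lambda>x. indicat_real {0..1} x *\<^sub>R - (LBINT t:{0..T}. W t x * (\<theta> t * ?s x))) \<in> borel_measurable lborel"
      by measurable
    show "AE x in lborel. indicat_real {0..1} x *\<^sub>R (LBINT t:{0..T}. z t x * (\<theta>' t * ?s x))
        = indicat_real {0..1} x *\<^sub>R - (LBINT t:{0..T}. W t x * (\<theta> t * ?s x))"
      using time_deriv[OF \<theta>] AE_lborel_singleton[of 0] AE_lborel_singleton[of 1]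
    proof eventually_elim
      case (elim x)
      show ?case
      proof (cases "x \<in> {0..1}")
        case True
        then have x: "x \<in> {0<..<1}" using elim by auto
        have "(LBINT t:{0..T}. \<theta>' t * z t x) = (LBINT t:{0<..}. \<theta>' t * z t x)"
          by (rule set_integral_half_line[symmetric]) (use T in auto)
        also have "\<dots> = - (LBINT t:{0<..}. \<theta> t * W t x)" using elim x by blast
        also have "(LBINT t:{0<..}. \<theta> t * W t x) = (LBINT t:{0..T}. \<theta> t * W t x)"
          by (rule set_integral_half_line) (use T in auto)
        finally show ?thesis unfolding pull' by simp
      qed simp
    qed
  qed
  also have "\<dots> = - (LBINT x:{0..1}. LBINT t:{0..T}. W t x * (\<theta> t * ?s x))"
    unfolding set_lebesgue_integral_def[of lborel "{0..1}"] by simp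
  also have "(LBINT x:{0..1}. LBINT t:{0..T}. W t x * (\<theta> t * ?s x)) = (LBINT t:{0..T}. LBINT x:{0..1}. W t x * (\<theta> t * ?s x))"
  proof (rule LBINT_rectangle_swap[symmetric, OF pm[OF W_borel \<theta>c(2)]])
    show "\<bar>W t x * (\<theta> t * ?s x)\<bar> \<le> C * B" if "t \<in> {0..T}" "x \<in> {0..1}" for t x
      unfolding abs_mult[of "W t x"] using bounds(1) C_nonneg sb[of \<theta> t x] B by (intro mult_mono) auto
  qed
  also have "\<dots> = (LBINT t:{0..T}. Ws k t * \<theta> t)"
    unfolding pull Ws_def ..
  finally show ?thesis .
qed

lemma zs_primitive:
  assumes "0 \<le> t"
  shows "zs k t = zs k 0 + (LBINT s:{0..t}. Ws k s)"
proof -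
  define P where "P = (\<lambda>t. LBINT s:{0..t}. Ws k s)"
  have Pc: "continuous_on {0..b} P" for b unfolding P_def by (rule continuous_on_set_integral_upto[OF Ws_integrable])
  have Pm: "P \<in> borel_measurable borel" unfolding P_def by (rule borel_measurable_set_integral_upto[OF Ws_borel])
  have zm: "zs k \<in> borel_measurable borel" by (rule borel_measurable_continuous_onI[OF zs_continuous])
  have P0: "P 0 = 0" unfolding P_def using set_integral_Icc_Ioo[of 0 0 "Ws k"] by (simp add: set_lebesgue_integral_def)
  have "\<exists>\<kappa>. AE t in lborel. t \<in> {0<..} \<longrightarrow> zs k t - P t = \<kappa>"
  proof (rule du_Bois_Reymond)
    show "(\<lambda>t. zs k t - P t) \<in> borel_measurable borel" using zm Pm by measurable
    show "set_integrable lborel {c..d} (\<lambda>t. zs k t - P t)" if cd: "{c..d} \<subseteq> {0<..}" for c d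
    proof -
      have i: "set_integrable lborel {0..d} (\<lambda>t. zs k t - P t)"
        by (intro set_integral_continuous_eq_integral(1) continuous_on_diff zs_continuous Pc)
      show ?thesis
      proof (cases "c \<le> d")
        case True
        with cd have "0 < c" by auto
        then show ?thesis by (intro set_integrable_subset[OF i]) auto
      qed (simp add: set_integrable_def)
    qed
    fix \<theta> \<theta>' assume \<theta>: "test_fun {0<..} \<theta> \<theta>'"
    obtain T M where T: "0 < T" "\<And>t. \<bar>t\<bar> \<ge> T \<Longrightarrow> \<theta> t = 0 \<and> \<theta>' t = 0"
      and "\<And>t. \<bar>\<theta> t\<bar> \<le> M \<and> \<bar>\<theta>' t\<bar> \<le> M"
      using test_fun_support[OF \<theta>] by blast
    have \<theta>'c: "continuous_on A \<theta>'" for A by (rule test_funD(2)[OF \<theta>])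
    have "(LBINT t:{0<..}. (zs k t - P t) * \<theta>' t) = (LBINT t:{0..T}. (zs k t - P t) * \<theta>' t)"
      by (rule set_integral_half_line) (use T in auto)
    also have "\<dots> = (LBINT t:{0..T}. zs k t * \<theta>' t - P t * \<theta>' t)" by (simp only: left_diff_distrib)
    also have "\<dots> = (LBINT t:{0..T}. zs k t * \<theta>' t) - (LBINT t:{0..T}. P t * \<theta>' t)"
      by (intro set_integral_diff(2) set_integral_continuous_eq_integral(1) continuous_on_mult zs_continuous Pc \<theta>'c)
    also have "(LBINT t:{0..T}. P t * \<theta>' t) = - 0 * \<theta> 0 - (LBINT t:{0..T}. Ws k t * \<theta> t)"
      by (rule set_integral_by_parts_test[OF Ws_integrable])
        (use T test_funD(1,2)[OF \<theta>] in \<open>auto simp: P_def Ws_borel\<close>)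
    also have "(LBINT t:{0..T}. zs k t * \<theta>' t) = - (LBINT t:{0..T}. Ws k t * \<theta> t)"
      by (rule zs_weak[OF \<theta> T])
    finally show "(LBINT t:{0<..}. (zs k t - P t) * \<theta>' t) = 0" by simp
  qed auto
  then obtain \<kappa> where \<kappa>: "AE t in lborel. t \<in> {0<..} \<longrightarrow> zs k t - P t = \<kappa>" by blast
  have "zs k s - P s = \<kappa>" if "s \<in> {0..t + 1}" for s
  proof (rule continuous_AE_eq[OF _ continuous_on_const _ _ that])
    show "continuous_on {0..t + 1} (\<lambda>s. zs k s - P s)" by (intro continuous_on_diff zs_continuous Pc)
    show "AE s in lborel. s \<in> {0<..<t + 1} \<longrightarrow> zs k s - P s = \<kappa>" using \<kappa> by eventually_elim auto
  qed (use assms in auto)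
  from this[of 0] this[of t] show ?thesis using assms P0 by (simp add: P_def)
qed

text \<open>The coefficients solve the oscillator \<open>zs'' + \<omega>\<^sup>2 zs = fs\<close>. The left-hand side is the combination of \<open>zs'\<close> and \<open>zs\<close>
  whose derivative involves \<open>fs\<close> only; since \<open>zs'\<close> is known just almost everywhere, the identity is derived
  from the lemma of du Bois-Reymond on the whole line. Test functions that do not vanish at 0 give the initial values.\<close>

lemma phase_identity:
  "AE t in lborel. 0 < t \<longrightarrow> cos (\<omega> k * t + \<alpha>) * Ws k t + \<omega> k * sin (\<omega> k * t + \<alpha>) * zs k t
     = cos \<alpha> * z1s k + \<omega> k * sin \<alpha> * zs k 0 + (LBINT s:{0..t}. fs k s * cos (\<omega> k * s + \<alpha>))"
proof -
  let ?c = "\<lambda>t. cos (\<omega> k * t + \<alpha>)" and ?s = "\<lambda>t. sin (\<omega> k * t + \<alpha>)"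
  define K where "K = cos \<alpha> * z1s k + \<omega> k * sin \<alpha> * zs k 0"
  define J where "J = (\<lambda>t. K + (LBINT s:{0..t}. fs k s * ?c s))"
  define L where "L = (\<lambda>t. ?c t * Ws k t + \<omega> k * ?s t * zs k t)"
  define D where "D = (\<lambda>t. if 0 < t then L t - J t else 0)"
  have cc: "continuous_on A ?c" "continuous_on A ?s" for A by (intro continuous_intros)+
  have [measurable]: "?c \<in> borel_measurable borel" "?s \<in> borel_measurable borel"
    by (intro borel_measurable_continuous_onI cc)+
  have [measurable]: "zs k \<in> borel_measurable borel" by (rule borel_measurable_continuous_onI[OF zs_continuous])
  note [measurable] = Ws_borel fs_borel
  have fcm[measurable]: "(\<lambda>s. fs k s * ?c s) \<in> borel_measurable borel" by measurable
  have fci: "set_integrable lborel {a..b} (\<lambda>s. fs k s * ?c s)" for a b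
    by (rule set_integrable_continuous_mult[OF fs_integrable fs_borel cc(1)])
  note [measurable] = borel_measurable_set_integral_upto[OF fcm, of 0]
  have Jm[measurable]: "J \<in> borel_measurable borel" unfolding J_def by measurable
  have Lm[measurable]: "L \<in> borel_measurable borel" unfolding L_def by measurable
  have Dm: "D \<in> borel_measurable borel" unfolding D_def by measurable
  have Jc: "continuous_on {0..b} J" for b
    unfolding J_def by (intro continuous_on_add continuous_on_const continuous_on_set_integral_upto fci)
  have Ji: "set_integrable lborel {0..b} J" for b by (rule set_integral_continuous_eq_integral(1)[OF Jc])
  have Wci: "set_integrable lborel {0..b} (\<lambda>t. Ws k t * v t)" if "continuous_on UNIV v" for b v
    by (rule set_integrable_continuous_mult[OF Ws_integrable Ws_borel that])
  have zci: "set_integrable lborel {0..b} (\<lambda>t. zs k t * v t)" if "continuous_on UNIV v" for b v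
    by (intro set_integral_continuous_eq_integral(1) continuous_on_mult zs_continuous continuous_on_subset[OF that]) auto
  have Li: "set_integrable lborel {0..b} L" for b
  proof -
    have "set_integrable lborel {0..b} (\<lambda>t. Ws k t * ?c t + zs k t * (\<omega> k * ?s t))"
      by (intro set_integral_add(1) Wci zci continuous_intros)
    then show ?thesis by (simp add: L_def mult_ac)
  qed
  have "\<exists>\<kappa>. AE t in lborel. t \<in> UNIV \<longrightarrow> D t = \<kappa>"
  proof (rule du_Bois_Reymond[OF _ _ Dm])
    fix c d :: real
    have "set_integrable lborel {0..d} (\<lambda>t. L t - J t)" by (intro set_integral_diff(1) Li Ji)
    then have "integrable lborel (\<lambda>t. indicat_real {c..d} t *\<^sub>R (indicat_real {0..d} t *\<^sub>R (L t - J t)))"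
      unfolding set_integrable_def by (rule integrable_mult_indicator[rotated]) simp
    then have "integrable lborel (\<lambda>t. indicat_real {0<..} t *\<^sub>R (indicat_real {c..d} t *\<^sub>R (indicat_real {0..d} t *\<^sub>R (L t - J t))))"
      by (rule integrable_mult_indicator[rotated]) simp
    then show "set_integrable lborel {c..d} D"
      unfolding set_integrable_def
      by (rule Bochner_Integration.integrable_cong[THEN iffD1, OF refl, rotated]) (auto simp: D_def indicator_def)
  next
    fix \<theta> \<theta>' assume \<theta>: "test_fun UNIV \<theta> \<theta>'"
    obtain T M where T: "0 < T" "\<And>t. \<bar>t\<bar> \<ge> T \<Longrightarrow> \<theta> t = 0 \<and> \<theta>' t = 0"
      and "\<And>t. \<bar>\<theta> t\<bar> \<le> M \<and> \<bar>\<theta>' t\<bar> \<le> M"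
      using test_fun_support[OF \<theta>] by blast
    have \<theta>d: "(\<theta> has_real_derivative \<theta>' x) (at x)" for x by (rule test_funD(1)[OF \<theta>])
    have \<theta>c: "continuous_on UNIV \<theta>'" "continuous_on UNIV \<theta>" by (rule test_funD[OF \<theta>])+
    define \<theta>1' where "\<theta>1' = (\<lambda>t. \<theta>' t * ?c t + \<theta> t * (- \<omega> k * ?s t))"
    define \<theta>2' where "\<theta>2' = (\<lambda>t. \<theta>' t * ?s t + \<theta> t * (\<omega> k * ?c t))"
    have cd: "(?c has_real_derivative - \<omega> k * ?s x) (at x)" "(?s has_real_derivative \<omega> k * ?c x) (at x)" for x
      by (auto intro!: derivative_eq_intros)
    have t1: "test_fun UNIV (\<lambda>t. \<theta> t * ?c t) \<theta>1'"
      unfolding \<theta>1'_def by (rule test_fun_mult[OF \<theta> cd(1)]) (intro continuous_intros)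
    have t2: "test_fun UNIV (\<lambda>t. \<theta> t * ?s t) \<theta>2'"
      unfolding \<theta>2'_def by (rule test_fun_mult[OF \<theta> cd(2)]) (intro continuous_intros)
    let ?E = "\<lambda>t. \<theta>1' t * Ws k t - \<theta> t * ?c t * \<omega> k * (\<omega> k * zs k t) + \<theta> t * ?c t * fs k t"
    \<comment> \<open>Equation for the velocity, with the space derivative eliminated.\<close>
    have eq1: "(LBINT t:{0..T}. ?E t) = - (\<theta> 0 * cos \<alpha> * z1s k)"
    proof -
      let ?G = "\<lambda>t. \<theta>1' t * Ws k t - \<theta> t * ?c t * \<omega> k * Xc k t + \<theta> t * ?c t * fs k t"
      have [measurable]: "\<theta> \<in> borel_measurable borel" "\<theta>1' \<in> borel_measurable borel"
        by (intro borel_measurable_continuous_onI \<theta>c test_funD(2)[OF t1])+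
      note [measurable] = Xc_borel
      have e1: "(LBINT t:{0..T}. ?E t) = (LBINT t:{0..T}. ?G t)"
        unfolding set_lebesgue_integral_def
      proof (rule integral_cong_AE)
        show "AE t in lborel. indicat_real {0..T} t *\<^sub>R ?E t = indicat_real {0..T} t *\<^sub>R ?G t"
          using Xc_eq[of k] AE_lborel_singleton[of 0] by eventually_elim (auto simp: indicator_def)
      qed measurable
      have e2: "(LBINT t:{0<..}. ?G t) = (LBINT t:{0..T}. ?G t)"
        by (rule set_integral_half_line) (use T in \<open>auto simp: \<theta>1'_def\<close>)
      have e3: "(LBINT t:{0<..}. ?G t) = - (\<theta> 0 * cos \<alpha> * z1s k)"
        using weak_eq_sine[OF t1, of k] by simp
      show ?thesis by (rule trans[OF e1 trans[OF e2[symmetric] e3]])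
    qed
    \<comment> \<open>The velocity is the time derivative of the position.\<close>
    have eq2: "(LBINT t:{0..T}. zs k t * \<theta>2' t) = - zs k 0 * (\<theta> 0 * sin \<alpha>) - (LBINT t:{0..T}. Ws k t * (\<theta> t * ?s t))"
      using set_integral_by_parts_test[OF Ws_integrable zs_primitive test_funD(1)[OF t2] test_funD(2)[OF t2], of T k] T
      by simp
    have eq3: "(LBINT t:{0..T}. J t * \<theta>' t) = - K * \<theta> 0 - (LBINT t:{0..T}. fs k t * ?c t * \<theta> t)"
      by (rule set_integral_by_parts_test[OF fci _ \<theta>d \<theta>c(1)]) (use T in \<open>auto simp: J_def\<close>)
    have "(LBINT t:UNIV. D t * \<theta>' t) = (LBINT t:{0<..}. (L t - J t) * \<theta>' t)"
      unfolding set_lebesgue_integral_def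
      by (rule Bochner_Integration.integral_cong) (auto simp: D_def indicator_def)
    also have "\<dots> = (LBINT t:{0..T}. (L t - J t) * \<theta>' t)"
      by (rule set_integral_half_line) (use T in auto)
    also have "\<dots> = (LBINT t:{0..T}. (?E t + \<omega> k * (zs k t * \<theta>2' t + Ws k t * (\<theta> t * ?s t)) - fs k t * ?c t * \<theta> t) - J t * \<theta>' t)"
      unfolding L_def \<theta>1'_def \<theta>2'_def by (simp add: algebra_simps)
    also have "\<dots> = ((LBINT t:{0..T}. ?E t) + \<omega> k * ((LBINT t:{0..T}. zs k t * \<theta>2' t) + (LBINT t:{0..T}. Ws k t * (\<theta> t * ?s t)))
        - (LBINT t:{0..T}. fs k t * ?c t * \<theta> t)) - (LBINT t:{0..T}. J t * \<theta>' t)"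
    proof -
      have c1: "continuous_on UNIV \<theta>1'" "continuous_on UNIV \<theta>2'" by (rule test_funD(2)[OF t1], rule test_funD(2)[OF t2])
      have c2: "continuous_on UNIV (\<lambda>t. \<theta> t * ?s t)" "continuous_on UNIV (\<lambda>t. \<theta> t * ?c t)"
        "continuous_on UNIV (\<lambda>t. \<theta> t * ?c t * \<omega> k * \<omega> k)" by (intro continuous_intros \<theta>c)+
      have i2: "set_integrable lborel {0..T} (\<lambda>t. zs k t * \<theta>2' t)" by (rule zci[OF c1(2)])
      have i3: "set_integrable lborel {0..T} (\<lambda>t. Ws k t * (\<theta> t * ?s t))" by (rule Wci[OF c2(1)])
      have i4: "set_integrable lborel {0..T} (\<lambda>t. fs k t * ?c t * \<theta> t)"
        by (rule set_integrable_continuous_mult[OF fci fcm \<theta>c(2)])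
      have i5: "set_integrable lborel {0..T} (\<lambda>t. J t * \<theta>' t)"
        by (rule set_integrable_continuous_mult[OF Ji Jm \<theta>c(1)])
      have i1: "set_integrable lborel {0..T} ?E"
      proof -
        have "set_integrable lborel {0..T} (\<lambda>t. Ws k t * \<theta>1' t - zs k t * (\<theta> t * ?c t * \<omega> k * \<omega> k) + fs k t * ?c t * \<theta> t)"
          by (intro set_integral_add(1) set_integral_diff(1) Wci[OF c1(1)] zci[OF c2(3)] i4)
        then show ?thesis by (simp add: mult_ac)
      qed
      note i23 = set_integral_add[OF i2 i3]
      note i23' = set_integrable_mult_right[OF i23(1), of "\<omega> k"]
      note i123 = set_integral_add[OF i1 i23']
      note i1234 = set_integral_diff[OF i123(1) i4]
      show ?thesis
        by (simp only: set_integral_diff(2)[OF i1234(1) i5] i1234(2) i123(2) set_integral_mult_right i23(2))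
    qed
    also have "\<dots> = 0"
      unfolding eq1 eq2 eq3 K_def by (simp add: algebra_simps)
    finally show "(LBINT t:UNIV. D t * \<theta>' t) = 0" .
  qed auto
  then obtain \<kappa> where \<kappa>: "AE t in lborel. D t = \<kappa>" by auto
  have "\<kappa> = 0"
  proof (rule ccontr)
    assume "\<kappa> \<noteq> 0"
    have "AE t in lborel. t \<notin> {-1..0::real}" using \<kappa> by eventually_elim (use \<open>\<kappa> \<noteq> 0\<close> in \<open>auto simp: D_def\<close>)
    then have "{-1..0::real} \<in> null_sets lborel" by (subst (asm) AE_iff_null_sets[symmetric]) auto
    then have "emeasure lborel {-1..0::real} = 0" by (rule null_setsD1)
    then show False by simp
  qed
  with \<kappa> show ?thesis
    by eventually_elim (use \<open>\<kappa> = 0\<close> in \<open>auto simp: D_def L_def J_def K_def\<close>)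
qed

text \<open>The phases \<open>\<alpha> = 0\<close> and \<open>\<alpha> = \<pi> / 2\<close> suffice to solve for the velocity coefficient.\<close>

proposition velocity_coefficient:
  "AE t in lborel. 0 < t \<longrightarrow> Ws k t
     = cos (\<omega> k * t) * z1s k - \<omega> k * sin (\<omega> k * t) * zs k 0 + (LBINT s:{0..t}. fs k s * cos (\<omega> k * (t - s)))"
  using phase_identity[of k 0] phase_identity[of k "pi / 2"]
proof eventually_elim
  case (elim t)
  show ?case
  proof
    assume t: "0 < t"
    let ?c = "cos (\<omega> k * t)" and ?s = "sin (\<omega> k * t)"
    let ?Ic = "LBINT s:{0..t}. fs k s * cos (\<omega> k * s)" and ?Is = "LBINT s:{0..t}. fs k s * sin (\<omega> k * s)"
    have e1: "?c * Ws k t + \<omega> k * ?s * zs k t = z1s k + ?Ic" using elim(1) t by simp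
    have e2: "- ?s * Ws k t + \<omega> k * ?c * zs k t = \<omega> k * zs k 0 - ?Is"
      using elim(2) t by (simp add: cos_add sin_add set_lebesgue_integral_def)
    have "?c * ?c + ?s * ?s = 1" by (rule sin_cos_squared_add3)
    then have "Ws k t = (?c * ?c + ?s * ?s) * Ws k t" by (simp only: mult_1)
    also have "\<dots> = ?c * (?c * Ws k t + \<omega> k * ?s * zs k t) - ?s * (- ?s * Ws k t + \<omega> k * ?c * zs k t)"
    proof -
      have "(c * c + s * s) * w = c * (c * w + o' * s * z') - s * (- s * w + o' * c * z')" for c s w o' z' :: real
        by (simp add: algebra_simps)
      then show ?thesis .
    qed
    also have "\<dots> = ?c * z1s k - \<omega> k * ?s * zs k 0 + (?c * ?Ic + ?s * ?Is)"
      unfolding e1 e2 by (simp add: algebra_simps)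
    also have "?c * ?Ic + ?s * ?Is = (LBINT s:{0..t}. fs k s * cos (\<omega> k * (t - s)))"
    proof -
      have i: "set_integrable lborel {0..t} (\<lambda>s. fs k s * cos (\<omega> k * s))" "set_integrable lborel {0..t} (\<lambda>s. fs k s * sin (\<omega> k * s))"
        by (rule set_integrable_continuous_mult[OF fs_integrable fs_borel]; intro continuous_intros)+
      have "(\<lambda>s. fs k s * cos (\<omega> k * (t - s))) = (\<lambda>s. ?c * (fs k s * cos (\<omega> k * s)) + ?s * (fs k s * sin (\<omega> k * s)))"
        by (simp add: right_diff_distrib cos_diff algebra_simps)
      then show ?thesis
        by (simp only: set_integral_add(2)[OF set_integrable_mult_right[OF i(1)] set_integrable_mult_right[OF i(2)]] set_integral_mult_right)
    qed
    finally show "Ws k t = ?c * z1s k - \<omega> k * ?s * zs k 0 + (LBINT s:{0..t}. fs k s * cos (\<omega> k * (t - s)))" .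
  qed
qed

end

section \<open>Reflection across the endpoints\<close>

text \<open>The reflections across 0 and 1 fold the real line onto \<open>[0, 1]\<close>; \<open>fold01 y\<close> is the image of \<open>y\<close>, and \<open>side y\<close> is \<open>1\<close>
  or \<open>-1\<close> according to the parity of the number of reflections, and \<open>0\<close> at the integers. Thus \<open>g (fold01 y)\<close> and
  \<open>side y * g (fold01 y)\<close> are the even and the odd 2-periodic extensions of \<open>g\<close>.\<close>

definition fold01 :: "real \<Rightarrow> real" where "fold01 y = arccos (cos (pi * y)) / pi"
definition side :: "real \<Rightarrow> real" where "side y = sgn (sin (pi * y))"

lemma fold01_range: "fold01 y \<in> {0..1}"
  using arccos_lbound[of "cos (pi * y)"] arccos_ubound[of "cos (pi * y)"]
  by (simp add: fold01_def)

lemma fold01_continuous: "continuous_on S fold01"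
  unfolding fold01_def by (intro continuous_intros) auto

lemma fold01_minus [simp]: "fold01 (- y) = fold01 y" and side_minus [simp]: "side (- y) = - side y"
  by (simp_all add: fold01_def side_def)

lemma fold01_periodic: "fold01 (y + 2) = fold01 y" and side_periodic: "side (y + 2) = side y"
proof -
  have eq: "pi * (y + 2) = pi * y + 2 * pi" by (simp add: algebra_simps)
  show "fold01 (y + 2) = fold01 y" unfolding fold01_def eq by simp
  show "side (y + 2) = side y" unfolding side_def eq by simp
qed

lemma fold01_id: "y \<in> {0..1} \<Longrightarrow> fold01 y = y"
  by (simp add: fold01_def arccos_cos mult_left_le)

lemma side_pos: "y \<in> {0<..<1} \<Longrightarrow> side y = 1"
proof -
  assume "y \<in> {0<..<1}"
  then have "0 < sin (pi * y)" by (intro sin_gt_zero) auto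
  then show "side y = 1" by (simp add: side_def)
qed

lemma abs_side_le: "\<bar>side y\<bar> \<le> 1"
  by (simp add: side_def sgn_if)

lemma odd_extension_continuous:
  assumes g: "continuous_on {0..1} g" and "g 0 = 0" "g 1 = 0"
  shows "continuous_on UNIV (\<lambda>y. side y * g (fold01 y) :: real)"
proof -
  have gf: "continuous_on UNIV (\<lambda>y. g (fold01 y))"
    by (rule continuous_on_compose2[OF g fold01_continuous]) (use fold01_range in auto)
  have "isCont (\<lambda>y. side y * g (fold01 y)) x" for x
  proof (cases "sin (pi * x) = 0")
    case False
    have "((\<lambda>y. sgn (sin (pi * y))) \<longlongrightarrow> sgn (sin (pi * x))) (at x)"
      by (rule tendsto_sgn[OF _ False]) (intro tendsto_intros)
    then have "isCont side x" by (simp add: isCont_def side_def[abs_def])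
    moreover have "isCont (\<lambda>y. g (fold01 y)) x" using gf by (simp add: continuous_on_eq_continuous_at)
    ultimately show ?thesis by (rule continuous_mult)
  next
    case True
    then have "cos (pi * x) = 1 \<or> cos (pi * x) = -1" using sin_zero_abs_cos_one[of "pi * x"] by linarith
    then have "fold01 x = 0 \<or> fold01 x = 1" by (auto simp: fold01_def)
    then have gx: "g (fold01 x) = 0" using assms by auto
    have "isCont (\<lambda>y. g (fold01 y)) x" using gf by (simp add: continuous_on_eq_continuous_at)
    then have "((\<lambda>y. g (fold01 y)) \<longlongrightarrow> 0) (at x)" unfolding isCont_def gx .
    then have "((\<lambda>y. \<bar>g (fold01 y)\<bar>) \<longlongrightarrow> 0) (at x)" by (simp add: tendsto_rabs_zero_iff)
    then have "((\<lambda>y. side y * g (fold01 y)) \<longlongrightarrow> 0) (at x)"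
    proof (rule Lim_null_comparison[rotated])
      have "\<bar>side y\<bar> * \<bar>g (fold01 y)\<bar> \<le> 1 * \<bar>g (fold01 y)\<bar>" for y
        by (rule mult_right_mono[OF abs_side_le]) simp
      then show "\<forall>\<^sub>F y in at x. norm (side y * g (fold01 y)) \<le> \<bar>g (fold01 y)\<bar>"
        by (intro always_eventually) (simp add: abs_mult)
    qed
    then show ?thesis by (simp add: isCont_def gx)
  qed
  then show ?thesis by (simp add: continuous_on_eq_continuous_at)
qed

lemma set_integral_shift:
  fixes f :: "real \<Rightarrow> real"
  shows "(LBINT x:{a..b}. f (x + c)) = (LBINT x:{a + c..b + c}. f x)"
proof -
  have "(LBINT x:{a + c..b + c}. f x) = (\<integral>x. indicat_real {a + c..b + c} (c + 1 * x) *\<^sub>R f (c + 1 * x) \<partial>lborel)"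
    unfolding set_lebesgue_integral_def using lborel_integral_real_affine[of 1 "\<lambda>x. indicat_real {a + c..b + c} x *\<^sub>R f x" c]
    by simp
  also have "\<dots> = (LBINT x:{a..b}. f (x + c))"
    unfolding set_lebesgue_integral_def
    by (rule Bochner_Integration.integral_cong) (auto simp: indicator_def add.commute)
  finally show ?thesis ..
qed

lemma set_integral_reflect:
  fixes f :: "real \<Rightarrow> real"
  shows "(LBINT x:{-a..0}. f x) = (LBINT x:{0..a}. f (- x))"
proof -
  have "(LBINT x:{-a..0}. f x) = (\<integral>x. indicat_real {-a..0} (0 + - 1 * x) *\<^sub>R f (0 + - 1 * x) \<partial>lborel)"
    unfolding set_lebesgue_integral_def using lborel_integral_real_affine[of "-1" "\<lambda>x. indicat_real {-a..0} x *\<^sub>R f x" 0]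
    by simp
  also have "\<dots> = (LBINT x:{0..a}. f (- x))"
    unfolding set_lebesgue_integral_def
    by (rule Bochner_Integration.integral_cong) (auto simp: indicator_def)
  finally show ?thesis .
qed

lemma set_integral_combine:
  fixes f :: "real \<Rightarrow> real"
  assumes f: "\<And>a b. set_integrable lborel {a..b} f" and "a \<le> b" "b \<le> c"
  shows "(LBINT x:{a..c}. f x) = (LBINT x:{a..b}. f x) + (LBINT x:{b..c}. f x)"
  using set_integral_upto_diff[OF f, of a b c c] assms by simp

lemma set_integral_symmetric:
  fixes f :: "real \<Rightarrow> real"
  assumes f: "\<And>a b. set_integrable lborel {a..b} f"
  shows "(LBINT x:{-1..1}. f x) = (LBINT x:{0..1}. f x) + (LBINT x:{0..1}. f (- x))"
  using set_integral_combine[OF f, of "-1" 0 1] by (simp add: set_integral_reflect)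

lemma set_integral_periodic_shift:
  fixes f :: "real \<Rightarrow> real"
  assumes f: "\<And>a b. set_integrable lborel {a..b} f" and per: "\<And>y. f (y + 2) = f y"
  shows "(LBINT x:{-1..1}. f (x + c)) = (LBINT x:{-1..1}. f x)"
proof -
  have base: "(LBINT x:{-1..1}. f (x + d)) = (LBINT x:{-1..1}. f x)" if d: "d \<in> {0..2}" for d
  proof -
    have "(LBINT x:{-1..1}. f (x + d)) = (LBINT x:{-1 + d..1 + d}. f x)" by (rule set_integral_shift)
    also have "\<dots> = (LBINT x:{-1 + d..1}. f x) + (LBINT x:{1..1 + d}. f x)"
      by (rule set_integral_combine[OF f]) (use d in auto)
    also have "(LBINT x:{1..1 + d}. f x) = (LBINT x:{-1..-1 + d}. f x)"
      using set_integral_shift[of "-1" "-1 + d" f 2] by (simp add: per)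
    also have "(LBINT x:{-1 + d..1}. f x) + (LBINT x:{-1..-1 + d}. f x) = (LBINT x:{-1..1}. f x)"
      using set_integral_combine[OF f, of "-1" "-1 + d" 1] d by simp
    finally show ?thesis .
  qed
  obtain k where k: "c + 2 * of_int k \<in> {0..0 + 2}" by (rule periodic_representative)
  have "f (x + c) = f (x + (c + 2 * of_int k))" for x
    using periodic_int[of f "x + c" k, OF per] by (simp add: add.assoc)
  then show ?thesis using base[of "c + 2 * of_int k"] k by simp
qed

text \<open>The solution of the transport equation with source \<open>h\<close>, along the characteristic starting at \<open>\<xi>\<close>.\<close>

definition transported :: "(real \<Rightarrow> real) \<Rightarrow> (real \<Rightarrow> real \<Rightarrow> real) \<Rightarrow> real \<Rightarrow> real \<Rightarrow> real" where
  "transported r0 h t \<xi> = r0 \<xi> + (LBINT s:{0..t}. h s (\<xi> - s))"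

lemma borel_shear:
  fixes h :: "real \<Rightarrow> real \<Rightarrow> real"
  assumes "(\<lambda>(s, y). h s y) \<in> borel_measurable borel"
  shows "(\<lambda>(y, s). h s (y + c - s)) \<in> borel_measurable borel"
    "(\<lambda>(s, y). h s (y + c - s)) \<in> borel_measurable borel"
    "(\<lambda>s. h s (c - s)) \<in> borel_measurable borel"
proof -
  have m: "(\<lambda>p. h (fst p) (snd p)) \<in> borel_measurable borel" using assms by (simp only: split_beta')
  have c: "(\<lambda>p::real \<times> real. (snd p, fst p + c - snd p)) \<in> borel_measurable borel"
    "(\<lambda>p::real \<times> real. (fst p, snd p + c - fst p)) \<in> borel_measurable borel"
    "(\<lambda>s::real. (s, c - s)) \<in> borel_measurable borel"
    by (intro borel_measurable_continuous_onI continuous_intros)+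
  show "(\<lambda>(y, s). h s (y + c - s)) \<in> borel_measurable borel"
    using measurable_compose[OF c(1) m] by (simp add: split_beta')
  show "(\<lambda>(s, y). h s (y + c - s)) \<in> borel_measurable borel"
    using measurable_compose[OF c(2) m] by (simp add: split_beta')
  show "(\<lambda>s. h s (c - s)) \<in> borel_measurable borel"
    using measurable_compose[OF c(3) m] by simp
qed

lemma bounded_borel_set_integrable:
  fixes f :: "real \<Rightarrow> real"
  assumes "f \<in> borel_measurable borel" "\<And>x. \<bar>f x\<bar> \<le> C"
  shows "set_integrable lborel {a..b} f"
proof (cases "a \<le> b")
  case True
  show ?thesis by (rule abs_set_integral_le(1)[OF assms True])
qed (simp add: set_integrable_def)

text \<open>Integrals over a full period do not see the shift along characteristics.\<close>

lemma transported_integral: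
  fixes h :: "real \<Rightarrow> real \<Rightarrow> real"
  assumes h: "(\<lambda>(s, y). h s y) \<in> borel_measurable borel" "\<And>s y. \<bar>h s y\<bar> \<le> C" "\<And>s y. h s (y + 2) = h s y"
    and u: "continuous_on UNIV u" "\<And>y. \<bar>u y\<bar> \<le> 1" "\<And>y. u (y + 2) = u y" and t: "0 \<le> t"
  shows "(LBINT y:{-1..1}. (LBINT s:{0..t}. h s (y + t - s)) * u y)
     = (LBINT s:{0..t}. LBINT y:{-1..1}. h s y * u (y - (t - s)))"
proof -
  have [measurable]: "(\<lambda>p::real \<times> real. u (fst p)) \<in> borel_measurable borel" "u \<in> borel_measurable borel"
    by (intro borel_measurable_continuous_onI continuous_on_compose2[OF u(1)] continuous_intros u(1); auto)+
  have m: "(\<lambda>p. h (snd p) (fst p + t - snd p)) \<in> borel_measurable borel"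
    using borel_shear(1)[OF h(1), of t] by (simp only: split_beta')
  have "(LBINT y:{-1..1}. (LBINT s:{0..t}. h s (y + t - s)) * u y) = (LBINT y:{-1..1}. LBINT s:{0..t}. h s (y + t - s) * u y)"
    by (simp only: set_integral_mult_left)
  also have "\<dots> = (LBINT s:{0..t}. LBINT y:{-1..1}. h s (y + t - s) * u y)"
  proof (rule LBINT_rectangle_swap)
    show "(\<lambda>(y, s). h s (y + t - s) * u y) \<in> borel_measurable borel"
      unfolding split_beta' by (rule borel_measurable_times[OF m]) measurable
    show "\<bar>h s (y + t - s) * u y\<bar> \<le> C * 1" for y s
      unfolding abs_mult using h(2)[of s "y + t - s"] u(2)[of y] by (intro mult_mono) auto
  qed
  also have "\<dots> = (LBINT s:{0..t}. LBINT y:{-1..1}. h s y * u (y - (t - s)))"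
  proof -
    have "(LBINT y:{-1..1}. h s (y + t - s) * u y) = (LBINT y:{-1..1}. h s y * u (y - (t - s)))" for s
    proof -
      let ?f = "\<lambda>y. h s y * u (y - (t - s))"
      have "(\<lambda>y. u (y - (t - s))) \<in> borel_measurable borel" by measurable
      then have fm: "?f \<in> borel_measurable borel"
        by (rule borel_measurable_times[OF borel_measurable_section(1)[OF h(1)]])
      have fb: "\<bar>?f y\<bar> \<le> C * 1" for y
        unfolding abs_mult using h(2)[of s y] u(2)[of "y - (t - s)"] by (intro mult_mono) auto
      have "(LBINT y:{-1..1}. ?f (y + (t - s))) = (LBINT y:{-1..1}. ?f y)"
      proof (rule set_integral_periodic_shift)
        show "set_integrable lborel {a..b} ?f" for a b by (rule bounded_borel_set_integrable[OF fm fb])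
        show "?f (y + 2) = ?f y" for y using h(3)[of s y] u(3)[of "y - (t - s)"] by (simp add: algebra_simps)
      qed
      then show ?thesis by (simp add: add_diff_eq)
    qed
    then show ?thesis by (simp only:)
  qed
  finally show ?thesis .
qed

section \<open>Identification of the velocity\<close>

lemma gronwall_zero:
  fixes V :: "real \<Rightarrow> real"
  assumes V: "continuous_on {0..T} V" and le: "\<And>t. t \<in> {0..T} \<Longrightarrow> V t \<le> K * integral {0..t} V"
    and K: "0 \<le> K" and t: "t \<in> {0..T}"
  shows "V t \<le> 0"
proof -
  define Y where "Y = (\<lambda>t. integral {0..t} V)"
  have Y: "(Y has_real_derivative V s) (at s within {0..T})" if "s \<in> {0..T}" for s
    unfolding Y_def by (rule integral_has_real_derivative[OF V that])
  define E where "E = (\<lambda>t. exp (- K * t) * Y t)"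
  have E: "(E has_real_derivative exp (- K * s) * (V s - K * Y s)) (at s within {0..T})" if "s \<in> {0..T}" for s
  proof -
    have "((\<lambda>t. exp (- K * t)) has_real_derivative exp (- K * s) * (- K)) (at s within {0..T})"
      by (auto intro!: derivative_eq_intros)
    from DERIV_mult[OF this Y[OF that]] show ?thesis unfolding E_def by (simp add: algebra_simps)
  qed
  have "E t \<le> E 0"
  proof (rule DERIV_nonpos_imp_decreasing_open[of 0 t E])
    show "0 \<le> t" using t by simp
    show "continuous_on {0..t} E"
      by (rule continuous_on_subset[OF DERIV_continuous_on[OF E]]) (use t in auto)
    fix s assume s: "0 < s" "s < t"
    then have "at s within {0..T} = at s" using t by (intro at_within_interior) auto
    moreover have "exp (- K * s) * (V s - K * Y s) \<le> 0"
      using le[of s] s t by (intro mult_nonneg_nonpos) (auto simp: Y_def)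
    ultimately show "\<exists>y. (E has_real_derivative y) (at s) \<and> y \<le> 0" using E[of s] s t by auto
  qed
  then have "Y t \<le> 0" by (simp add: E_def Y_def mult_le_0_iff not_le[symmetric])
  then have "K * Y t \<le> 0" using K by (rule mult_nonneg_nonpos[rotated])
  then show ?thesis using le[OF t] by (simp add: Y_def)
qed

text \<open>Gronwall's lemma for an inequality that holds almost everywhere only: it is applied to the primitive of \<open>n\<close>.\<close>

lemma AE_gronwall_zero:
  fixes n :: "real \<Rightarrow> real"
  assumes n: "n \<in> borel_measurable borel" "\<And>t. 0 \<le> n t" "\<And>t. n t \<le> N" and K: "0 \<le> K"
    and le: "AE t in lborel. 0 < t \<longrightarrow> n t \<le> K * (LBINT s:{0..t}. n s)"
  shows "AE t in lborel. 0 < t \<longrightarrow> n t = 0"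
proof -
  have ni: "set_integrable lborel {a..b} n" for a b
    by (rule bounded_borel_set_integrable[OF n(1), of N]) (use n in auto)
  define V where "V = (\<lambda>t. LBINT s:{0..t}. n s)"
  have Vc: "continuous_on {0..T} V" for T unfolding V_def by (rule continuous_on_set_integral_upto[OF ni])
  have Vle: "V t \<le> K * integral {0..t} V" if "0 \<le> t" for t
  proof -
    have V_eq: "V t = (LBINT s:{0..t}. n s)" by (simp add: V_def)
    have "(LBINT s:{0..t}. n s) \<le> (LBINT s:{0..t}. K * V s)"
      unfolding set_lebesgue_integral_def[of lborel "{0..t}"]
    proof (rule integral_mono_AE)
      show "integrable lborel (\<lambda>s. indicat_real {0..t} s *\<^sub>R n s)" using ni by (simp add: set_integrable_def)
      have "set_integrable lborel {0..t} (\<lambda>s. K * V s)"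
        by (intro set_integrable_mult_right set_integral_continuous_eq_integral(1) Vc)
      then show "integrable lborel (\<lambda>s. indicat_real {0..t} s *\<^sub>R (K * V s))" by (simp add: set_integrable_def)
      show "AE s in lborel. indicat_real {0..t} s *\<^sub>R n s \<le> indicat_real {0..t} s *\<^sub>R (K * V s)"
        using le AE_lborel_singleton[of 0] by eventually_elim (auto simp: indicator_def V_def)
    qed
    also have "\<dots> = K * integral {0..t} V"
      by (simp only: set_integral_mult_right set_integral_continuous_eq_integral(2)[OF Vc])
    finally show ?thesis by (simp only: V_eq)
  qed
  have "V t \<le> 0" if "0 \<le> t" for t
    by (rule gronwall_zero[OF Vc[of t] Vle K]) (use that in auto)
  then have "K * V t \<le> 0" if "0 \<le> t" for t using K that by (intro mult_nonneg_nonpos) auto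
  then have KV: "K * (LBINT s:{0..t}. n s) \<le> 0" if "0 \<le> t" for t using that by (simp only: V_def)
  show ?thesis using le
  proof eventually_elim
    case (elim t)
    show ?case
    proof
      assume t: "0 < t"
      then have "n t \<le> 0" using elim KV[of t] by simp
      then show "n t = 0" using n(2)[of t] by simp
    qed
  qed
qed

context weak_wave begin

lemma \<omega>_periodic: "sin (\<omega> k * (y + 2)) = sin (\<omega> k * y)" "cos (\<omega> k * (y + 2)) = cos (\<omega> k * y)"
proof -
  have s: "sin (2 * \<omega> k) = 0" by (simp add: sin_double sin_\<omega>)
  have c: "cos (2 * \<omega> k) = 1" by (simp add: cos_double_sin sin_\<omega>)
  have eq: "\<omega> k * (y + 2) = \<omega> k * y + 2 * \<omega> k" by (simp add: algebra_simps)
  show "sin (\<omega> k * (y + 2)) = sin (\<omega> k * y)" "cos (\<omega> k * (y + 2)) = cos (\<omega> k * y)"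
    unfolding eq sin_add cos_add s c by simp_all
qed

text \<open>The source term, extended as an odd 2-periodic function of space.\<close>

definition h :: "real \<Rightarrow> real \<Rightarrow> real" where "h s y = side y * f s (fold01 y)"

lemma h_minus: "h s (- y) = - h s y" by (simp add: h_def)
lemma h_periodic: "h s (y + 2) = h s y" by (simp add: h_def fold01_periodic side_periodic)
lemma h_bound: "\<bar>h s y\<bar> \<le> C"
proof -
  have "\<bar>side y\<bar> * \<bar>f s (fold01 y)\<bar> \<le> 1 * C" using abs_side_le bounds(3) by (intro mult_mono) auto
  then show ?thesis by (simp add: h_def abs_mult)
qed

lemma h_borel: "(\<lambda>(s, y). h s y) \<in> borel_measurable borel"
proof -
  have m: "(\<lambda>p. f (fst p) (snd p)) \<in> borel_measurable borel" using f_borel by (simp only: split_beta')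
  have "(\<lambda>p::real \<times> real. (fst p, fold01 (snd p))) \<in> borel_measurable borel"
    by (intro borel_measurable_continuous_onI continuous_intros continuous_on_compose2[OF fold01_continuous[of UNIV]]) auto
  from measurable_compose[OF this m] have 1: "(\<lambda>p::real \<times> real. f (fst p) (fold01 (snd p))) \<in> borel_measurable borel" by simp
  have "(\<lambda>p::real \<times> real. sin (pi * snd p)) \<in> borel_measurable borel"
    by (intro borel_measurable_continuous_onI continuous_intros)
  then have 2: "(\<lambda>p::real \<times> real. side (snd p)) \<in> borel_measurable borel"
    unfolding side_def sgn_if by measurable
  show ?thesis unfolding h_def split_beta' by (rule borel_measurable_times[OF 2 1])
qed

lemma h_section: "h s \<in> borel_measurable borel" by (rule borel_measurable_section(1)[OF h_borel])

lemma h_coefficient: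
  "(LBINT y:{-1..1}. h s y * sin (\<omega> k * (y - \<tau>))) = 2 * (fs k s * cos (\<omega> k * \<tau>))"
proof -
  have i: "set_integrable lborel {a..b} (\<lambda>y. h s y * u y)" if "continuous_on UNIV u" for u a b
    by (rule set_integrable_continuous_mult[OF bounded_borel_set_integrable[OF h_section h_bound] h_section that])
  have "(LBINT y:{-1..1}. h s y * sin (\<omega> k * (y - \<tau>))) = (LBINT y:{0..1}. h s y * sin (\<omega> k * (y - \<tau>)))
      + (LBINT y:{0..1}. h s (- y) * sin (\<omega> k * (- y - \<tau>)))"
    by (rule set_integral_symmetric[OF i]) (intro continuous_intros)
  also have "\<dots> = (LBINT y:{0..1}. h s y * sin (\<omega> k * (y - \<tau>)) + h s (- y) * sin (\<omega> k * (- y - \<tau>)))"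
  proof (rule set_integral_add(2)[symmetric])
    show "set_integrable lborel {0..1} (\<lambda>y. h s y * sin (\<omega> k * (y - \<tau>)))" by (rule i) (intro continuous_intros)
    have "set_integrable lborel {0..1} (\<lambda>y. h s y * (- sin (\<omega> k * (- y - \<tau>))))" by (rule i) (intro continuous_intros)
    then show "set_integrable lborel {0..1} (\<lambda>y. h s (- y) * sin (\<omega> k * (- y - \<tau>)))" by (simp add: h_minus)
  qed
  also have "\<dots> = (LBINT y:{0..1}. 2 * cos (\<omega> k * \<tau>) * (h s y * sin (\<omega> k * y)))"
  proof -
    have "h s y * sin (\<omega> k * (y - \<tau>)) + h s (- y) * sin (\<omega> k * (- y - \<tau>)) = 2 * cos (\<omega> k * \<tau>) * (h s y * sin (\<omega> k * y))" for y
    proof -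
      have "sin (\<omega> k * (y - \<tau>)) - sin (\<omega> k * (- y - \<tau>)) = 2 * (sin (\<omega> k * y) * cos (\<omega> k * \<tau>))"
        by (simp add: right_diff_distrib sin_diff)
      then have "h s y * (sin (\<omega> k * (y - \<tau>)) - sin (\<omega> k * (- y - \<tau>))) = h s y * (2 * (sin (\<omega> k * y) * cos (\<omega> k * \<tau>)))" by simp
      then show ?thesis by (simp add: h_minus algebra_simps)
    qed
    then show ?thesis by (simp only:)
  qed
  also have "\<dots> = 2 * cos (\<omega> k * \<tau>) * (LBINT y:{0..1}. h s y * sin (\<omega> k * y))" by (rule set_integral_mult_right)
  also have "(LBINT y:{0..1}. h s y * sin (\<omega> k * y)) = fs k s"
    unfolding fs_def set_integral_Icc_Ioo
    by (rule set_lebesgue_integral_cong) (auto simp: h_def side_pos fold01_id)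
  finally show ?thesis by simp
qed

end

text \<open>A weak solution whose source is \<open>- b s(z\<^sub>t)\<close>, together with the solution \<open>r\<close> of the corresponding transport
  equation. The initial value of \<open>r\<close> is the even extension of \<open>z\<^sub>x\<close> plus the odd extension of \<open>z\<^sub>t\<close> at time 0.\<close>

locale identified_wave = weak_wave +
  fixes p0 b :: "real \<Rightarrow> real" and s :: "real \<Rightarrow> real" and r :: "real \<Rightarrow> real \<Rightarrow> real" and A L B :: real
  assumes p0_cont: "continuous_on {0..1} p0"
    and z_init: "\<And>x. x \<in> {0..1} \<Longrightarrow> z 0 x = integral {0..x} p0"
    and b_cont: "continuous_on UNIV b" and b_even: "\<And>y. b (- y) = b y" and b_per: "\<And>y. b (y + 2) = b y"
    and b_bound: "\<And>y. \<bar>b y\<bar> \<le> A"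
    and s_lip: "L-lipschitz_on UNIV s" and s_odd: "\<And>d. s (- d) = - s d"
    and f_eq: "\<And>t x. x \<in> {0<..<1} \<Longrightarrow> f t x = - b x * s (W t x)"
    and r: "damped_transport b s r"
    and r_init: "r 0 = (\<lambda>y. p0 (fold01 y) + side y * z1 (fold01 y))"
    and r_bound: "\<And>t y. 0 \<le> t \<Longrightarrow> \<bar>r t y\<bar> \<le> B"
begin

lemma r0_cont: "continuous_on S (r 0)"
  by (rule continuous_on_subset[OF damped_transport_continuous[OF r]]) auto

lemma r0_per: "r 0 (y + 2) = r 0 y" by (rule damped_transportD(2)[OF r]) simp

text \<open>The part of the variation of constants formula that is due to the initial data.\<close>

lemma r0_coefficient:
  "(LBINT y:{-1..1}. r 0 (y + t) * sin (\<omega> k * y)) = 2 * (cos (\<omega> k * t) * z1s k - \<omega> k * sin (\<omega> k * t) * zs k 0)"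
proof -
  have "(LBINT y:{-1..1}. r 0 (y + t) * sin (\<omega> k * (y + t - t))) = (LBINT y:{-1..1}. r 0 y * sin (\<omega> k * (y - t)))"
  proof (rule set_integral_periodic_shift)
    show "set_integrable lborel {a..b} (\<lambda>y. r 0 y * sin (\<omega> k * (y - t)))" for a b
      by (intro set_integral_continuous_eq_integral(1) continuous_intros r0_cont)
    show "r 0 (y + 2) * sin (\<omega> k * (y + 2 - t)) = r 0 y * sin (\<omega> k * (y - t))" for y
      using \<omega>_periodic(1)[of k "y - t"] by (simp add: r0_per add_diff_eq diff_add_eq)
  qed
  then have "(LBINT y:{-1..1}. r 0 (y + t) * sin (\<omega> k * y)) = (LBINT y:{-1..1}. r 0 y * sin (\<omega> k * (y - t)))" by simp
  also have "\<dots> = (LBINT y:{0..1}. r 0 y * sin (\<omega> k * (y - t))) + (LBINT y:{0..1}. r 0 (- y) * sin (\<omega> k * (- y - t)))"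
    by (rule set_integral_symmetric) (intro set_integral_continuous_eq_integral(1) continuous_intros r0_cont)
  also have "\<dots> = (LBINT y:{0..1}. r 0 y * sin (\<omega> k * (y - t)) + r 0 (- y) * sin (\<omega> k * (- y - t)))"
  proof (rule set_integral_add(2)[symmetric])
    show "set_integrable lborel {0..1} (\<lambda>y. r 0 y * sin (\<omega> k * (y - t)))"
      by (intro set_integral_continuous_eq_integral(1) continuous_intros r0_cont)
    show "set_integrable lborel {0..1} (\<lambda>y. r 0 (- y) * sin (\<omega> k * (- y - t)))"
      by (intro set_integral_continuous_eq_integral(1) continuous_intros continuous_on_compose2[OF r0_cont[of UNIV]]) auto
  qed
  also have "\<dots> = (LBINT y:{0..1}. 2 * cos (\<omega> k * t) * (z1 y * sin (\<omega> k * y)) - 2 * sin (\<omega> k * t) * (p0 y * cos (\<omega> k * y)))"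
    unfolding set_integral_Icc_Ioo
  proof (rule set_lebesgue_integral_cong)
    show "\<forall>y. y \<in> {0<..<1} \<longrightarrow> r 0 y * sin (\<omega> k * (y - t)) + r 0 (- y) * sin (\<omega> k * (- y - t))
        = 2 * cos (\<omega> k * t) * (z1 y * sin (\<omega> k * y)) - 2 * sin (\<omega> k * t) * (p0 y * cos (\<omega> k * y))"
    proof (intro allI impI)
      fix y :: real assume y: "y \<in> {0<..<1}"
      have e: "r 0 y = p0 y + z1 y" "r 0 (- y) = p0 y - z1 y"
        using y by (simp_all add: r_init side_pos fold01_id)
      show "r 0 y * sin (\<omega> k * (y - t)) + r 0 (- y) * sin (\<omega> k * (- y - t))
        = 2 * cos (\<omega> k * t) * (z1 y * sin (\<omega> k * y)) - 2 * sin (\<omega> k * t) * (p0 y * cos (\<omega> k * y))"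
        unfolding e by (simp add: right_diff_distrib sin_diff algebra_simps)
    qed
  qed simp
  also have "\<dots> = (LBINT y:{0..1}. 2 * cos (\<omega> k * t) * (z1 y * sin (\<omega> k * y))) - (LBINT y:{0..1}. 2 * sin (\<omega> k * t) * (p0 y * cos (\<omega> k * y)))"
    by (intro set_integral_diff(2) set_integral_continuous_eq_integral(1) continuous_intros z1_cont p0_cont)
  also have "\<dots> = 2 * cos (\<omega> k * t) * z1s k - 2 * sin (\<omega> k * t) * (LBINT y:{0..1}. p0 y * cos (\<omega> k * y))"
    by (simp only: set_integral_mult_right z1s_def)
  also have "(LBINT y:{0..1}. p0 y * cos (\<omega> k * y)) = \<omega> k * zs k 0"
  proof -
    have p0i: "set_integrable lborel {0..1} p0" by (rule set_integral_continuous_eq_integral(1)[OF p0_cont])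
    have z0: "z 0 x = (LBINT y:{0..x}. p0 y)" if "x \<in> {0..1}" for x
      using z_init[OF that] set_integral_continuous_eq_integral(2)[OF continuous_on_subset[OF p0_cont], of 0 x] that by auto
    have "(LBINT x:{0..1}. z 0 x * (- \<omega> k * sin (\<omega> k * x))) = (LBINT x:{0..1}. (LBINT y:{0..x}. p0 y) * (- \<omega> k * sin (\<omega> k * x)))"
      by (rule set_lebesgue_integral_cong) (auto simp: z0)
    also have "\<dots> = (LBINT y:{0..1}. p0 y * (cos (\<omega> k * 1) - cos (\<omega> k * y)))"
      by (rule set_integral_by_parts[OF p0i]) (auto intro!: derivative_eq_intros continuous_intros)
    also have "\<dots> = (LBINT y:{0..1}. p0 y * cos (\<omega> k) - p0 y * cos (\<omega> k * y))"
      by (simp only: mult_1_right right_diff_distrib)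
    also have "\<dots> = (LBINT y:{0..1}. p0 y * cos (\<omega> k)) - (LBINT y:{0..1}. p0 y * cos (\<omega> k * y))"
      by (intro set_integral_diff(2) set_integral_continuous_eq_integral(1) continuous_intros p0_cont)
    also have "(LBINT y:{0..1}. p0 y * cos (\<omega> k)) = 0"
      using z0[of 1] z_bdry(2)[of 0] by simp
    also have "(LBINT x:{0..1}. z 0 x * (- \<omega> k * sin (\<omega> k * x))) = - \<omega> k * zs k 0"
    proof -
      have "(\<lambda>x. z 0 x * (- \<omega> k * sin (\<omega> k * x))) = (\<lambda>x. - \<omega> k * (z 0 x * sin (\<omega> k * x)))" by auto
      then show ?thesis unfolding zs_def by (simp only: set_integral_mult_right)
    qed
    finally show ?thesis by simp
  qed
  finally show ?thesis by (simp add: algebra_simps)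
qed

end

lemma abs_half_diff_le:
  fixes u v :: real
  assumes "\<bar>u\<bar> \<le> M" "\<bar>v\<bar> \<le> M"
  shows "\<bar>(u - v) / 2\<bar> \<le> M"
proof -
  have "\<bar>u - v\<bar> \<le> 2 * M" using assms by linarith
  then show ?thesis by simp
qed

context identified_wave begin

lemma constants_nonneg: "0 \<le> A" "0 \<le> L" "0 \<le> B" "s 0 = 0"
  using b_bound[of 0] lipschitz_on_nonneg[OF s_lip] r_bound[of 0 0] s_odd[of 0] by auto

text \<open>The velocity predicted by \<open>r\<close> and the source that it produces. Freezing \<open>r\<close> at time 0 for negative times makes
  both continuous on the plane.\<close>

definition vel :: "real \<Rightarrow> real \<Rightarrow> real" where "vel t y = (r (max 0 t) y - r (max 0 t) (- y)) / 2"
definition src :: "real \<Rightarrow> real \<Rightarrow> real" where "src t y = - b y * s (vel t y)"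

lemma r_cont: "continuous_on UNIV (\<lambda>p. r (max 0 (fst p)) (snd p))"
proof -
  have "continuous_on UNIV (\<lambda>p::real \<times> real. (max 0 (fst p), snd p))" by (intro continuous_intros)
  moreover have "(\<lambda>p::real \<times> real. (max 0 (fst p), snd p)) ` UNIV \<subseteq> {0..} \<times> UNIV" by auto
  ultimately show ?thesis using continuous_on_compose2[OF damped_transportD(1)[OF r]] by fastforce
qed

lemma vel_cont: "continuous_on UNIV (\<lambda>p. vel (fst p) (snd p))"
proof -
  have "continuous_on UNIV (\<lambda>p::real \<times> real. (fst p, - snd p))" by (intro continuous_intros)
  from continuous_on_compose2[OF r_cont this] have "continuous_on UNIV (\<lambda>p. r (max 0 (fst p)) (- snd p))" by simp
  then show ?thesis unfolding vel_def by (intro continuous_intros r_cont) auto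
qed

lemma src_cont: "continuous_on UNIV (\<lambda>p. src (fst p) (snd p))"
proof -
  have sc: "continuous_on UNIV s" by (rule lipschitz_on_continuous_on[OF s_lip])
  show ?thesis unfolding src_def
    by (intro continuous_on_mult continuous_on_minus continuous_on_compose2[OF b_cont] continuous_on_compose2[OF sc vel_cont]
        continuous_intros) auto
qed

lemma vel_borel: "(\<lambda>(t, y). vel t y) \<in> borel_measurable borel"
  using borel_measurable_continuous_onI[OF vel_cont] by (simp only: split_beta')

lemma src_borel: "(\<lambda>(t, y). src t y) \<in> borel_measurable borel"
  using borel_measurable_continuous_onI[OF src_cont] by (simp only: split_beta')

lemma vel_section: "continuous_on Y (vel t)" and vel_section': "continuous_on Y (\<lambda>t. vel t y)"
  and src_section: "continuous_on Y (src t)" and src_shear: "continuous_on Y (\<lambda>t. src t (\<xi> - t))"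
proof -
  have c: "continuous_on Y (\<lambda>y. (t, y))" "continuous_on Y (\<lambda>t. (t, y))" "continuous_on Y (\<lambda>t. (t, \<xi> - t))" for Y and t y \<xi> :: real
    by (intro continuous_intros)+
  show "continuous_on Y (vel t)" using continuous_on_compose2[OF vel_cont c(1)] by simp
  show "continuous_on Y (\<lambda>t. vel t y)" using continuous_on_compose2[OF vel_cont c(2)] by simp
  show "continuous_on Y (src t)" using continuous_on_compose2[OF src_cont c(1)] by simp
  show "continuous_on Y (\<lambda>t. src t (\<xi> - t))" using continuous_on_compose2[OF src_cont c(3)] by simp
qed

lemma vel_bound: "\<bar>vel t y\<bar> \<le> B"
proof -
  have "\<bar>r (max 0 t) y\<bar> \<le> B" "\<bar>r (max 0 t) (- y)\<bar> \<le> B" by (rule r_bound, simp)+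
  then show ?thesis unfolding vel_def by (rule abs_half_diff_le)
qed

lemma s_bound: "\<bar>s d\<bar> \<le> L * \<bar>d\<bar>"
  using lipschitz_onD[OF s_lip, of d 0] by (simp add: dist_real_def constants_nonneg)

lemma src_bound: "\<bar>src t y\<bar> \<le> A * (L * B)"
proof -
  have "\<bar>b y\<bar> * \<bar>s (vel t y)\<bar> \<le> A * (L * \<bar>vel t y\<bar>)"
    by (intro mult_mono b_bound s_bound constants_nonneg) auto
  also have "\<dots> \<le> A * (L * B)" by (intro mult_left_mono vel_bound constants_nonneg)
  finally show ?thesis by (simp add: src_def abs_mult)
qed

lemma src_minus: "src t (- y) = - src t y"
proof -
  have "vel t (- y) = - vel t y" by (simp add: vel_def diff_divide_distrib)
  then show ?thesis by (simp add: src_def b_even s_odd)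
qed

lemma src_periodic: "src t (y + 2) = src t y"
proof -
  have "r (max 0 t) (y + 2) = r (max 0 t) y" by (rule damped_transportD(2)[OF r]) simp
  moreover have "r (max 0 t) (- y - 2 + 2) = r (max 0 t) (- y - 2)" by (rule damped_transportD(2)[OF r]) simp
  then have "r (max 0 t) (- (y + 2)) = r (max 0 t) (- y)" by simp
  ultimately have "vel t (y + 2) = vel t y" by (simp add: vel_def)
  then show ?thesis by (simp add: src_def b_per)
qed

lemma r_transported:
  assumes t: "0 \<le> t"
  shows "r t y = transported (r 0) src t (y + t)"
proof -
  define \<xi> where "\<xi> = y + t"
  have "((\<lambda>\<tau>. src \<tau> (\<xi> - \<tau>)) has_integral r t (\<xi> - t) - r 0 (\<xi> - 0)) {0..t}"
  proof (rule fundamental_theorem_of_calculus[OF t])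
    fix \<tau> assume \<tau>: "\<tau> \<in> {0..t}"
    have "((\<lambda>t. r t (\<xi> - t)) has_real_derivative - b (\<xi> - \<tau>) * s ((r \<tau> (\<xi> - \<tau>) - r \<tau> (\<tau> - \<xi>)) / 2)) (at \<tau> within {0..t})"
      by (rule DERIV_subset[OF damped_transportD(3)[OF r]]) (use \<tau> in auto)
    moreover have "- b (\<xi> - \<tau>) * s ((r \<tau> (\<xi> - \<tau>) - r \<tau> (\<tau> - \<xi>)) / 2) = src \<tau> (\<xi> - \<tau>)"
      using \<tau> by (simp add: src_def vel_def)
    ultimately show "((\<lambda>t. r t (\<xi> - t)) has_vector_derivative src \<tau> (\<xi> - \<tau>)) (at \<tau> within {0..t})"
      by (simp only: has_real_derivative_iff_has_vector_derivative)
  qed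
  then have "integral {0..t} (\<lambda>\<tau>. src \<tau> (\<xi> - \<tau>)) = r t y - r 0 \<xi>"
    by (simp add: \<xi>_def integral_unique)
  moreover have "(LBINT \<tau>:{0..t}. src \<tau> (\<xi> - \<tau>)) = integral {0..t} (\<lambda>\<tau>. src \<tau> (\<xi> - \<tau>))"
    by (rule set_integral_continuous_eq_integral(2)[OF src_shear])
  ultimately show ?thesis by (simp add: transported_def \<xi>_def)
qed

lemma cone_integral:
  fixes g :: "real \<Rightarrow> real \<Rightarrow> real"
  assumes g: "(\<lambda>(\<tau>, y). g \<tau> y) \<in> borel_measurable borel" "\<And>\<tau> y. \<bar>g \<tau> y\<bar> \<le> N" and t: "0 \<le> t"
  shows "(\<lambda>y. LBINT \<tau>:{0..t}. g \<tau> (y + t - \<tau>)) \<in> borel_measurable borel"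
    "\<bar>LBINT \<tau>:{0..t}. g \<tau> (y + t - \<tau>)\<bar> \<le> N * t"
    "set_integrable lborel {0..t} (\<lambda>\<tau>. g \<tau> (y + t - \<tau>))"
proof -
  show "(\<lambda>y. LBINT \<tau>:{0..t}. g \<tau> (y + t - \<tau>)) \<in> borel_measurable borel"
    by (rule borel_measurable_partial_integral[OF borel_shear(1)[OF g(1)]])
  show "\<bar>LBINT \<tau>:{0..t}. g \<tau> (y + t - \<tau>)\<bar> \<le> N * t"
    using abs_set_integral_le(2)[OF borel_shear(3)[OF g(1)] g(2) t] by simp
  show "set_integrable lborel {0..t} (\<lambda>\<tau>. g \<tau> (y + t - \<tau>))"
    by (rule abs_set_integral_le(1)[OF borel_shear(3)[OF g(1)] g(2) t])
qed

text \<open>D'Alembert's formula for the velocity of the weak solution, with its own source \<open>h\<close>.\<close>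

lemma velocity_formula:
  "AE t in lborel. 0 < t \<longrightarrow> (AE x in lborel. x \<in> {0..1} \<longrightarrow>
     W t x = (transported (r 0) h t (x + t) - transported (r 0) h t (- x + t)) / 2)"
proof -
  have "AE t in lborel. \<forall>k. 0 < t \<longrightarrow> Ws k t
     = cos (\<omega> k * t) * z1s k - \<omega> k * sin (\<omega> k * t) * zs k 0 + (LBINT \<tau>:{0..t}. fs k \<tau> * cos (\<omega> k * (t - \<tau>)))"
    by (subst AE_all_countable) (intro allI velocity_coefficient)
  then show ?thesis
  proof eventually_elim
    case (elim t)
    show ?case
    proof
      assume t: "0 < t"
      define I where "I = (\<lambda>y. LBINT \<tau>:{0..t}. h \<tau> (y + t - \<tau>))"
      define G where "G = (\<lambda>y. r 0 (y + t) + I y)"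
      have trG: "transported (r 0) h t (y + t) = G y" for y by (simp add: G_def I_def transported_def)
      have Im: "I \<in> borel_measurable borel" unfolding I_def by (rule cone_integral(1)[OF h_borel h_bound]) (use t in simp)
      have Ib: "\<bar>I y\<bar> \<le> C * t" for y unfolding I_def by (rule cone_integral(2)[OF h_borel h_bound]) (use t in simp)
      have r0c: "continuous_on UNIV (\<lambda>y. r 0 (y + t))"
        by (rule continuous_on_compose2[OF r0_cont[of UNIV]]) (auto intro!: continuous_intros)
      have Gm: "G \<in> borel_measurable borel"
        unfolding G_def by (rule borel_measurable_add[OF borel_measurable_continuous_onI[OF r0c] Im])
      have Gb: "\<bar>G y\<bar> \<le> B + C * t" for y
        using r_bound[of 0 "y + t"] Ib[of y] by (simp add: G_def)
      have Gi: "set_integrable lborel {a..c} (\<lambda>y. G y * sin (\<omega> k * y))" for a c k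
        by (rule set_integrable_continuous_mult[OF bounded_borel_set_integrable[OF Gm Gb] Gm]) (intro continuous_intros)
      have Gm': "(\<lambda>y. G (- y)) \<in> borel_measurable borel" using Gm by measurable
      have Gi': "set_integrable lborel {a..c} (\<lambda>y. G (- y) * sin (\<omega> k * y))" for a c k
        by (rule set_integrable_continuous_mult[OF bounded_borel_set_integrable[OF Gm' Gb] Gm']) (intro continuous_intros)
      have Ii: "set_integrable lborel {a..c} (\<lambda>y. I y * sin (\<omega> k * y))" for a c k
        by (rule set_integrable_continuous_mult[OF bounded_borel_set_integrable[OF Im Ib] Im]) (intro continuous_intros)
      have Wm: "W t \<in> borel_measurable borel" by (rule borel_measurable_section(1)[OF W_borel])
      have Wi: "set_integrable lborel {a..c} (\<lambda>y. W t y * sin (\<omega> k * y))" for a c k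
        by (rule set_integrable_continuous_mult[OF bounded_borel_set_integrable[OF Wm bounds(1)] Wm]) (intro continuous_intros)
      have mom: "(LBINT x:{0..1}. (W t x - (G x - G (- x)) / 2) * sin (\<omega> k * x)) = 0" for k
      proof -
        have "(LBINT y:{-1..1}. G y * sin (\<omega> k * y)) = (LBINT y:{0..1}. G y * sin (\<omega> k * y)) + (LBINT y:{0..1}. G (- y) * sin (\<omega> k * - y))"
          by (rule set_integral_symmetric[OF Gi])
        also have "(LBINT y:{0..1}. G (- y) * sin (\<omega> k * - y)) = - (LBINT y:{0..1}. G (- y) * sin (\<omega> k * y))"
          by (simp add: set_lebesgue_integral_def)
        finally have g1: "(LBINT y:{-1..1}. G y * sin (\<omega> k * y))
          = (LBINT y:{0..1}. G y * sin (\<omega> k * y)) - (LBINT y:{0..1}. G (- y) * sin (\<omega> k * y))" by simp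
        have "(LBINT y:{-1..1}. G y * sin (\<omega> k * y)) = (LBINT y:{-1..1}. r 0 (y + t) * sin (\<omega> k * y)) + (LBINT y:{-1..1}. I y * sin (\<omega> k * y))"
          unfolding G_def distrib_right
          by (intro set_integral_add(2) Ii set_integral_continuous_eq_integral(1) continuous_on_mult continuous_on_subset[OF r0c] subset_UNIV)
            (intro continuous_intros)
        also have "(LBINT y:{-1..1}. I y * sin (\<omega> k * y)) = (LBINT \<tau>:{0..t}. LBINT y:{-1..1}. h \<tau> y * sin (\<omega> k * (y - (t - \<tau>))))"
          unfolding I_def
          by (rule transported_integral[OF h_borel h_bound h_periodic]) (use t \<omega>_periodic in \<open>auto intro!: continuous_intros\<close>)
        also have "\<dots> = 2 * (LBINT \<tau>:{0..t}. fs k \<tau> * cos (\<omega> k * (t - \<tau>)))"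
          by (simp only: h_coefficient set_integral_mult_right)
        finally have g2: "(LBINT y:{-1..1}. G y * sin (\<omega> k * y)) = 2 * Ws k t"
          using spec[OF elim, of k] t unfolding r0_coefficient by (simp add: algebra_simps)
        have "(LBINT x:{0..1}. (W t x - (G x - G (- x)) / 2) * sin (\<omega> k * x))
          = (LBINT x:{0..1}. W t x * sin (\<omega> k * x) - (1 / 2) * (G x * sin (\<omega> k * x) - G (- x) * sin (\<omega> k * x)))"
          by (simp add: algebra_simps diff_divide_distrib)
        also have "\<dots> = (LBINT x:{0..1}. W t x * sin (\<omega> k * x)) - (1 / 2) * ((LBINT x:{0..1}. G x * sin (\<omega> k * x)) - (LBINT x:{0..1}. G (- x) * sin (\<omega> k * x)))"
          by (simp only: set_integral_diff[OF Wi set_integrable_mult_right[OF set_integral_diff(1)[OF Gi Gi']]] set_integral_mult_right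
              set_integral_diff(2)[OF Gi Gi'])
        also have "\<dots> = 0" using g1 g2 by (simp add: Ws_def)
        finally show ?thesis .
      qed
      have m: "(\<lambda>x. W t x - (G x - G (- x)) / 2) \<in> borel_measurable borel" using Wm Gm Gm' by measurable
      have "AE x in lborel. x \<in> {0..1} \<longrightarrow> W t x - (G x - G (- x)) / 2 = 0"
      proof (rule sine_complete)
        have "\<bar>W t x - (G x - G (- x)) / 2\<bar> \<le> C + (B + C * t)" for x
          using bounds(1)[of t x] abs_half_diff_le[OF Gb[of x] Gb[of "- x"]] by linarith
        then show "set_integrable lborel {0..1} (\<lambda>x. W t x - (G x - G (- x)) / 2)"
          by (rule bounded_borel_set_integrable[OF m])
        show "(LBINT x:{0..1}. (W t x - (G x - G (- x)) / 2) * sin (real (Suc k) * pi * x)) = 0" for k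
          using mom[of k] by (simp only: \<omega>_def)
      qed
      then show "AE x in lborel. x \<in> {0..1} \<longrightarrow>
          W t x = (transported (r 0) h t (x + t) - transported (r 0) h t (- x + t)) / 2"
        unfolding trG by eventually_elim auto
    qed
  qed
qed

text \<open>Distance in \<open>L\<^sup>1(0,1)\<close> between the velocity of the weak solution and the velocity predicted by \<open>r\<close>.\<close>

definition gap :: "real \<Rightarrow> real" where "gap t = (LBINT x:{0..1}. \<bar>W t x - vel t x\<bar>)"

lemma gap_pair: "(\<lambda>(t, x). \<bar>W t x - vel t x\<bar>) \<in> borel_measurable borel"
proof -
  have [measurable]: "(\<lambda>p. W (fst p) (snd p)) \<in> borel_measurable borel" "(\<lambda>p. vel (fst p) (snd p)) \<in> borel_measurable borel"
    using W_borel vel_borel by (simp_all only: split_beta')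
  show ?thesis unfolding split_beta' by measurable
qed

lemma gap_pair_bound: "\<bar>\<bar>W t x - vel t x\<bar>\<bar> \<le> C + B"
  using bounds(1)[of t x] vel_bound[of t x] by linarith

lemma gap_borel: "gap \<in> borel_measurable borel" and gap_nonneg: "0 \<le> gap t" and gap_le: "gap t \<le> C + B"
proof -
  show "gap \<in> borel_measurable borel" unfolding gap_def[abs_def] by (rule borel_measurable_partial_integral[OF gap_pair])
  show "0 \<le> gap t" unfolding gap_def set_lebesgue_integral_def by (rule Bochner_Integration.integral_nonneg) auto
  show "gap t \<le> C + B"
    using abs_set_integral_le(2)[OF borel_measurable_section(1)[OF gap_pair] gap_pair_bound, of 0 1 t] unfolding gap_def by simp
qed

text \<open>Both velocities are given by d'Alembert's formula with the same initial data, and their sources differ by at most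
  \<open>A L\<close> times the difference of the velocities.\<close>

lemma gap_gronwall: "AE t in lborel. 0 < t \<longrightarrow> gap t \<le> A * L * (LBINT \<tau>:{0..t}. gap \<tau>)"
  using velocity_formula
proof eventually_elim
  case (elim t)
  show ?case
  proof
    assume t: "0 < t"
    then have t0: "0 \<le> t" by simp
    define E where "E = (\<lambda>\<tau> y. \<bar>h \<tau> y - src \<tau> y\<bar>)"
    define N where "N = C + A * (L * B)"
    have N0: "0 \<le> N" unfolding N_def using C_nonneg constants_nonneg by (intro add_nonneg_nonneg mult_nonneg_nonneg)
    have [measurable]: "(\<lambda>p. h (fst p) (snd p)) \<in> borel_measurable borel" "(\<lambda>p. src (fst p) (snd p)) \<in> borel_measurable borel"
      using h_borel src_borel by (simp_all only: split_beta')
    have E: "(\<lambda>(\<tau>, y). E \<tau> y) \<in> borel_measurable borel" unfolding E_def split_beta' by measurable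
    have Eb: "\<bar>E \<tau> y\<bar> \<le> N" for \<tau> y using h_bound[of \<tau> y] src_bound[of \<tau> y] by (simp add: E_def N_def)
    have Eper: "E \<tau> (y + 2) = E \<tau> y" for \<tau> y by (simp add: E_def h_periodic src_periodic)
    have Eeven: "E \<tau> (- y) = E \<tau> y" for \<tau> y by (simp add: E_def h_minus src_minus)
    have Es: "E \<tau> \<in> borel_measurable borel" for \<tau> by (rule borel_measurable_section(1)[OF E])
    have Ei: "set_integrable lborel {a..c} (E \<tau>)" for a c \<tau> by (rule bounded_borel_set_integrable[OF Es Eb])
    define K where "K = (\<lambda>y. LBINT \<tau>:{0..t}. E \<tau> (y + t - \<tau>))"
    have Km: "K \<in> borel_measurable borel" unfolding K_def by (rule cone_integral(1)[OF E Eb t0])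
    have Kb: "\<bar>K y\<bar> \<le> N * t" for y unfolding K_def by (rule cone_integral(2)[OF E Eb t0])
    have Ki: "set_integrable lborel {a..c} K" for a c by (rule bounded_borel_set_integrable[OF Km Kb])
    have Km': "(\<lambda>y. K (- y)) \<in> borel_measurable borel" using Km by measurable
    have Ki': "set_integrable lborel {a..c} (\<lambda>y. K (- y))" for a c by (rule bounded_borel_set_integrable[OF Km' Kb])
    have diff: "\<bar>transported (r 0) h t (y + t) - r t y\<bar> \<le> K y" for y
    proof -
      have ih: "set_integrable lborel {0..t} (\<lambda>\<tau>. h \<tau> (y + t - \<tau>))" by (rule cone_integral(3)[OF h_borel h_bound t0])
      have i2: "set_integrable lborel {0..t} (\<lambda>\<tau>. src \<tau> (y + t - \<tau>))" by (rule cone_integral(3)[OF src_borel src_bound t0])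
      have "transported (r 0) h t (y + t) - r t y = (LBINT \<tau>:{0..t}. h \<tau> (y + t - \<tau>) - src \<tau> (y + t - \<tau>))"
        unfolding r_transported[OF t0] transported_def set_integral_diff(2)[OF ih i2] by simp
      also have "\<bar>\<dots>\<bar> \<le> K y"
        using set_integral_norm_bound[OF set_integral_diff(1)[OF ih i2]] by (simp add: K_def E_def)
      finally show ?thesis .
    qed
    have "gap t \<le> (LBINT x:{0..1}. (K x + K (- x)) / 2)"
      unfolding gap_def set_lebesgue_integral_def
    proof (rule integral_mono_AE)
      show "integrable lborel (\<lambda>x. indicat_real {0..1} x *\<^sub>R \<bar>W t x - vel t x\<bar>)"
        using bounded_borel_set_integrable[OF borel_measurable_section(1)[OF gap_pair] gap_pair_bound, of 0 1 t] by (simp add: set_integrable_def)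
      have "set_integrable lborel {0..1} (\<lambda>x. (K x + K (- x)) / 2)"
        by (intro set_integrable_divide set_integral_add(1) Ki Ki')
      then show "integrable lborel (\<lambda>x. indicat_real {0..1} x *\<^sub>R ((K x + K (- x)) / 2))" by (simp add: set_integrable_def)
      have "AE x in lborel. x \<in> {0..1} \<longrightarrow> W t x = (transported (r 0) h t (x + t) - transported (r 0) h t (- x + t)) / 2"
        using elim t by blast
      then show "AE x in lborel. indicat_real {0..1} x *\<^sub>R \<bar>W t x - vel t x\<bar> \<le> indicat_real {0..1} x *\<^sub>R ((K x + K (- x)) / 2)"
      proof eventually_elim
        case (elim x)
        show ?case
        proof (cases "x \<in> {0..1}")
          case True
          then have "W t x = (transported (r 0) h t (x + t) - transported (r 0) h t (- x + t)) / 2" using elim by blast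
          moreover have "vel t x = (r t x - r t (- x)) / 2" using t0 by (simp add: vel_def)
          ultimately have e: "W t x - vel t x = ((transported (r 0) h t (x + t) - r t x) - (transported (r 0) h t (- x + t) - r t (- x))) / 2"
            by (simp add: diff_divide_distrib)
          have "\<bar>(transported (r 0) h t (x + t) - r t x) - (transported (r 0) h t (- x + t) - r t (- x))\<bar> \<le> K x + K (- x)"
            by (rule order_trans[OF abs_triangle_ineq4 add_mono[OF diff diff]])
          then have "\<bar>W t x - vel t x\<bar> \<le> (K x + K (- x)) / 2"
            unfolding e abs_divide abs_numeral by (rule divide_right_mono) simp
          then show ?thesis using True by simp
        qed simp
      qed
    qed
    also have "\<dots> = ((LBINT x:{0..1}. K x) + (LBINT x:{0..1}. K (- x))) / 2"
      by (simp only: set_integral_divide_zero set_integral_add(2)[OF Ki Ki'])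
    also have "\<dots> = (LBINT y:{-1..1}. K y) / 2" by (simp only: set_integral_symmetric[OF Ki])
    finally have gap1: "gap t \<le> (LBINT y:{-1..1}. K y) / 2" .
    have "(LBINT y:{-1..1}. K y) = (LBINT y:{-1..1}. (LBINT \<tau>:{0..t}. E \<tau> (y + t - \<tau>)) * 1)" by (simp add: K_def)
    also have "\<dots> = (LBINT \<tau>:{0..t}. LBINT y:{-1..1}. E \<tau> y * 1)"
      by (rule transported_integral[OF E Eb Eper, of "\<lambda>_. 1"]) (use t0 in auto)
    also have "\<dots> = (LBINT \<tau>:{0..t}. 2 * (LBINT x:{0..1}. E \<tau> x))"
      by (simp only: mult_1_right set_integral_symmetric[OF Ei] Eeven mult_2)
    also have "\<dots> = 2 * (LBINT \<tau>:{0..t}. LBINT x:{0..1}. E \<tau> x)" by (rule set_integral_mult_right)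
    finally have gap2: "(LBINT y:{-1..1}. K y) = 2 * (LBINT \<tau>:{0..t}. LBINT x:{0..1}. E \<tau> x)" .
    have gap3: "(LBINT \<tau>:{0..t}. LBINT x:{0..1}. E \<tau> x) \<le> (LBINT \<tau>:{0..t}. A * L * gap \<tau>)"
    proof (rule set_integral_mono)
      have "\<bar>LBINT x:{0..1}. E \<tau> x\<bar> \<le> N" for \<tau> using abs_set_integral_le(2)[OF Es Eb, of 0 1 \<tau>] by simp
      then show "set_integrable lborel {0..t} (\<lambda>\<tau>. LBINT x:{0..1}. E \<tau> x)"
        by (rule bounded_borel_set_integrable[OF borel_measurable_partial_integral[OF E]])
      have "\<bar>gap \<tau>\<bar> \<le> C + B" for \<tau> using gap_nonneg gap_le by simp
      then show "set_integrable lborel {0..t} (\<lambda>\<tau>. A * L * gap \<tau>)"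
        by (intro set_integrable_mult_right bounded_borel_set_integrable[OF gap_borel])
      fix \<tau>
      have "(LBINT x:{0..1}. E \<tau> x) \<le> (LBINT x:{0..1}. A * L * \<bar>W \<tau> x - vel \<tau> x\<bar>)"
        unfolding set_integral_Icc_Ioo
      proof (rule set_integral_mono)
        show "set_integrable lborel {0<..<1} (E \<tau>)" using Ei[of 0 1 \<tau>] unfolding set_integrable_Icc_Ioo .
        show "set_integrable lborel {0<..<1} (\<lambda>x. A * L * \<bar>W \<tau> x - vel \<tau> x\<bar>)"
          unfolding set_integrable_Icc_Ioo[symmetric]
          by (intro set_integrable_mult_right bounded_borel_set_integrable[OF borel_measurable_section(1)[OF gap_pair] gap_pair_bound])
        fix x :: real assume x: "x \<in> {0<..<1}"
        have "h \<tau> x - src \<tau> x = - b x * (s (W \<tau> x) - s (vel \<tau> x))"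
          using x by (simp add: h_def side_pos fold01_id f_eq src_def algebra_simps)
        then have "E \<tau> x = \<bar>b x\<bar> * \<bar>s (W \<tau> x) - s (vel \<tau> x)\<bar>" by (simp add: E_def abs_mult)
        also have "\<dots> \<le> A * (L * \<bar>W \<tau> x - vel \<tau> x\<bar>)"
          using lipschitz_onD[OF s_lip, of "W \<tau> x" "vel \<tau> x"]
          by (intro mult_mono b_bound constants_nonneg) (auto simp: dist_real_def)
        finally show "E \<tau> x \<le> A * L * \<bar>W \<tau> x - vel \<tau> x\<bar>" by (simp only: mult.assoc)
      qed
      also have "\<dots> = A * L * gap \<tau>" unfolding gap_def by (rule set_integral_mult_right)
      finally show "(LBINT x:{0..1}. E \<tau> x) \<le> A * L * gap \<tau>" .
    qed
    have gap4: "(LBINT \<tau>:{0..t}. A * L * gap \<tau>) = A * L * (LBINT \<tau>:{0..t}. gap \<tau>)" by (rule set_integral_mult_right)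
    show "gap t \<le> A * L * (LBINT \<tau>:{0..t}. gap \<tau>)"
      using gap1 gap3 unfolding gap2 gap4 by simp
  qed
qed

lemma gap_zero: "AE t in lborel. 0 < t \<longrightarrow> gap t = 0"
  by (rule AE_gronwall_zero[OF gap_borel gap_nonneg gap_le mult_nonneg_nonneg[OF constants_nonneg(1,2)] gap_gronwall])

lemma Ws_vel: "AE t in lborel. 0 < t \<longrightarrow> Ws k t = (LBINT x:{0..1}. vel t x * sin (\<omega> k * x))"
  using gap_zero
proof eventually_elim
  case (elim t)
  show ?case
  proof
    assume t: "0 < t"
    have Wm: "W t \<in> borel_measurable borel" by (rule borel_measurable_section(1)[OF W_borel])
    have Wi: "set_integrable lborel {0..1} (\<lambda>y. W t y * sin (\<omega> k * y))"
      by (rule set_integrable_continuous_mult[OF bounded_borel_set_integrable[OF Wm bounds(1)] Wm]) (intro continuous_intros)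
    have vi: "set_integrable lborel {0..1} (\<lambda>y. vel t y * sin (\<omega> k * y))"
      by (intro set_integral_continuous_eq_integral(1) continuous_intros vel_section)
    have gi: "set_integrable lborel {0..1} (\<lambda>x. \<bar>W t x - vel t x\<bar>)"
      by (rule bounded_borel_set_integrable[OF borel_measurable_section(1)[OF gap_pair] gap_pair_bound])
    have d1: "Ws k t - (LBINT x:{0..1}. vel t x * sin (\<omega> k * x)) = (LBINT x:{0..1}. W t x * sin (\<omega> k * x) - vel t x * sin (\<omega> k * x))"
      unfolding Ws_def by (rule set_integral_diff(2)[symmetric, OF Wi vi])
    have d2: "\<bar>LBINT x:{0..1}. W t x * sin (\<omega> k * x) - vel t x * sin (\<omega> k * x)\<bar> \<le> (LBINT x:{0..1}. \<bar>W t x * sin (\<omega> k * x) - vel t x * sin (\<omega> k * x)\<bar>)"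
      using set_integral_norm_bound[OF set_integral_diff(1)[OF Wi vi]] by simp
    have d3: "(LBINT x:{0..1}. \<bar>W t x * sin (\<omega> k * x) - vel t x * sin (\<omega> k * x)\<bar>) \<le> gap t"
      unfolding gap_def
    proof (rule set_integral_mono[OF _ gi])
      show "set_integrable lborel {0..1} (\<lambda>x. \<bar>W t x * sin (\<omega> k * x) - vel t x * sin (\<omega> k * x)\<bar>)"
        by (rule set_integrable_abs[OF set_integral_diff(1)[OF Wi vi]])
      fix x
      have "\<bar>W t x - vel t x\<bar> * \<bar>sin (\<omega> k * x)\<bar> \<le> \<bar>W t x - vel t x\<bar> * 1" by (intro mult_left_mono) auto
      then show "\<bar>W t x * sin (\<omega> k * x) - vel t x * sin (\<omega> k * x)\<bar> \<le> \<bar>W t x - vel t x\<bar>"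
        unfolding left_diff_distrib[symmetric] abs_mult mult_1_right .
    qed
    have d4: "gap t = 0" using elim t by (rule mp)
    show "Ws k t = (LBINT x:{0..1}. vel t x * sin (\<omega> k * x))" using d1 d2 d3 d4 by linarith
  qed
qed

proposition z_eq:
  assumes t: "0 \<le> t" and x: "x \<in> {0..1}"
  shows "z t x = z 0 x + integral {0..t} (\<lambda>\<tau>. vel \<tau> x)"
proof -
  define P where "P = (\<lambda>x. integral {0..t} (\<lambda>\<tau>. vel \<tau> x))"
  have Pc: "continuous_on S P" for S
  proof -
    have "continuous_on UNIV (\<lambda>p::real \<times> real. (snd p, fst p))" by (intro continuous_intros)
    from continuous_on_compose2[OF vel_cont this]
    have "continuous_on (UNIV \<times> cbox 0 t) (\<lambda>(x, \<tau>). vel \<tau> x)" by (auto simp: split_beta' intro: continuous_on_subset)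
    from integral_continuous_on_param[OF this] have "continuous_on UNIV P" by (simp add: P_def)
    then show ?thesis by (rule continuous_on_subset) simp
  qed
  define g where "g = (\<lambda>x. z t x - z 0 x - P x)"
  have gc: "continuous_on S g" for S unfolding g_def by (intro continuous_intros z_section Pc)
  have "AE x in lborel. x \<in> {0..1} \<longrightarrow> g x = 0"
  proof (rule sine_complete)
    show "set_integrable lborel {0..1} g" by (rule set_integral_continuous_eq_integral(1)[OF gc])
    fix k
    have sc: "continuous_on S (\<lambda>x. sin (\<omega> k * x))" for S by (intro continuous_intros)
    have ic: "set_integrable lborel {0..1} (\<lambda>x. u x * sin (\<omega> k * x))" if "continuous_on {0..1} u" for u
      by (intro set_integral_continuous_eq_integral(1) continuous_on_mult that sc)
    have Pl: "P x = (LBINT \<tau>:{0..t}. vel \<tau> x)" for x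
      unfolding P_def by (rule set_integral_continuous_eq_integral(2)[symmetric, OF vel_section'])
    have vm: "(\<lambda>(\<tau>, x). vel \<tau> x * sin (\<omega> k * x)) \<in> borel_measurable borel"
      by (rule borel_pair_mult[OF vel_borel sc])
    have vb: "\<bar>vel \<tau> x * sin (\<omega> k * x)\<bar> \<le> B * 1" for \<tau> x
      unfolding abs_mult using vel_bound constants_nonneg by (intro mult_mono) auto
    have "(LBINT x:{0..1}. P x * sin (\<omega> k * x)) = (LBINT x:{0..1}. LBINT \<tau>:{0..t}. vel \<tau> x * sin (\<omega> k * x))"
      unfolding Pl by (simp only: set_integral_mult_left)
    also have "\<dots> = (LBINT \<tau>:{0..t}. LBINT x:{0..1}. vel \<tau> x * sin (\<omega> k * x))"
      by (rule LBINT_rectangle_swap[symmetric, OF vm vb])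
    also have "\<dots> = (LBINT \<tau>:{0..t}. Ws k \<tau>)"
      unfolding set_lebesgue_integral_def[of lborel "{0..t}"]
    proof (rule integral_cong_AE)
      note [measurable] = borel_measurable_partial_integral[OF vm, of 0 1] Ws_borel
      show "(\<lambda>\<tau>. indicat_real {0..t} \<tau> *\<^sub>R (LBINT x:{0..1}. vel \<tau> x * sin (\<omega> k * x))) \<in> borel_measurable lborel"
        "(\<lambda>\<tau>. indicat_real {0..t} \<tau> *\<^sub>R Ws k \<tau>) \<in> borel_measurable lborel" by measurable
      show "AE \<tau> in lborel. indicat_real {0..t} \<tau> *\<^sub>R (LBINT x:{0..1}. vel \<tau> x * sin (\<omega> k * x)) = indicat_real {0..t} \<tau> *\<^sub>R Ws k \<tau>"
        using Ws_vel[of k] AE_lborel_singleton[of 0] by eventually_elim (auto simp: indicator_def)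
    qed
    also have "\<dots> = zs k t - zs k 0" using zs_primitive[OF t, of k] by simp
    finally have P: "(LBINT x:{0..1}. P x * sin (\<omega> k * x)) = zs k t - zs k 0" .
    have "(LBINT x:{0..1}. g x * sin (\<omega> k * x)) = (LBINT x:{0..1}. z t x * sin (\<omega> k * x) - z 0 x * sin (\<omega> k * x) - P x * sin (\<omega> k * x))"
      by (simp only: g_def left_diff_distrib)
    also have "\<dots> = zs k t - zs k 0 - (LBINT x:{0..1}. P x * sin (\<omega> k * x))"
      by (simp only: zs_def set_integral_diff(2)[OF ic[OF z_section] ic[OF z_section]]
          set_integral_diff(2)[OF set_integral_diff(1)[OF ic[OF z_section] ic[OF z_section]] ic[OF Pc]])
    also have "\<dots> = 0" unfolding P by simp
    finally show "(LBINT x:{0..1}. g x * sin (real (Suc k) * pi * x)) = 0" by (simp add: \<omega>_def)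
  qed
  then have ae: "AE x in lborel. x \<in> {0<..<1} \<longrightarrow> g x = 0" by eventually_elim auto
  have "g x = 0" by (rule continuous_AE_eq[OF gc continuous_on_const _ ae x]) simp
  then show ?thesis by (simp add: g_def P_def)
qed

end

section \<open>Recovery of the position\<close>

text \<open>Both sides are alternating sums of the values of a primitive of \<open>f\<close> at \<open>x + d\<close>, \<open>x\<close>, \<open>-x + d\<close> and \<open>-x\<close>.\<close>

lemma set_integral_four_points:
  fixes f :: "real \<Rightarrow> real"
  assumes f: "\<And>a b. set_integrable lborel {a..b} f" and x: "0 \<le> x" and d: "0 \<le> d"
  shows "(LBINT y:{x..x + d}. f y) - (LBINT y:{-x..-x + d}. f y) = (LBINT y:{-x + d..x + d}. f y) - (LBINT y:{-x..x}. f y)"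
proof -
  let ?P = "\<lambda>c. LBINT y:{-x..c}. f y"
  have e: "?P v - ?P u = (LBINT y:{u..v}. f y)" if "- x \<le> u" "u \<le> v" for u v
    by (rule set_integral_upto_diff[OF f that order_refl])
  have p0: "?P (- x) = 0" using e[of "- x" "- x"] set_integral_Icc_Ioo[of "-x" "-x" f] by (simp add: set_lebesgue_integral_def)
  show ?thesis using e[of x "x + d"] e[of "- x" "- x + d"] e[of "- x + d" "x + d"] x d by simp
qed

context identified_wave begin

lemma r_expanded: "0 \<le> t \<Longrightarrow> r t y = r 0 (y + t) + (LBINT \<sigma>:{0..t}. src \<sigma> (y + t - \<sigma>))"
  unfolding transported_def[symmetric] by (rule r_transported)

lemma r_time_integral:
  assumes t: "0 \<le> t"
  shows "(LBINT \<tau>:{0..t}. r \<tau> x) = (LBINT y:{x..x + t}. r 0 y) + (LBINT \<sigma>:{0..t}. LBINT y:{x..x + (t - \<sigma>)}. src \<sigma> y)"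
proof -
  define g where "g = (\<lambda>\<tau> \<sigma>. if \<sigma> \<le> \<tau> then src \<sigma> (x + \<tau> - \<sigma>) else 0)"
  have gm: "(\<lambda>(\<tau>, \<sigma>). g \<tau> \<sigma>) \<in> borel_measurable borel"
  proof -
    have "(\<lambda>p::real \<times> real. (snd p, x + fst p - snd p)) \<in> borel_measurable borel"
      by (intro borel_measurable_continuous_onI continuous_intros)
    from measurable_compose[OF this borel_measurable_continuous_onI[OF src_cont]]
    have [measurable]: "(\<lambda>p::real \<times> real. src (snd p) (x + fst p - snd p)) \<in> borel_measurable borel" by simp
    have [measurable]: "fst \<in> borel_measurable (borel :: (real \<times> real) measure)" "snd \<in> borel_measurable (borel :: (real \<times> real) measure)"
      by (intro borel_measurable_continuous_onI continuous_intros)+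
    show ?thesis unfolding g_def split_beta' by measurable
  qed
  have N0: "0 \<le> A * (L * B)" using constants_nonneg by simp
  have gb: "\<bar>g \<tau> \<sigma>\<bar> \<le> A * (L * B)" for \<tau> \<sigma> using src_bound N0 by (simp add: g_def)
  have inner: "(LBINT \<sigma>:{0..t}. g \<tau> \<sigma>) = (LBINT \<sigma>:{0..\<tau>}. src \<sigma> (x + \<tau> - \<sigma>))" if "\<tau> \<in> {0..t}" for \<tau>
    unfolding set_lebesgue_integral_def
    by (rule Bochner_Integration.integral_cong) (use that in \<open>auto simp: g_def indicator_def\<close>)
  have inner': "(LBINT \<tau>:{0..t}. g \<tau> \<sigma>) = (LBINT y:{x..x + (t - \<sigma>)}. src \<sigma> y)" if "\<sigma> \<in> {0..t}" for \<sigma>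
  proof -
    have "(LBINT \<tau>:{0..t}. g \<tau> \<sigma>) = (LBINT \<tau>:{\<sigma>..t}. src \<sigma> (\<tau> + (x - \<sigma>)))"
      unfolding set_lebesgue_integral_def
      by (rule Bochner_Integration.integral_cong) (use that in \<open>auto simp: g_def indicator_def algebra_simps\<close>)
    also have "\<dots> = (LBINT y:{x..x + (t - \<sigma>)}. src \<sigma> y)"
      using set_integral_shift[of \<sigma> t "src \<sigma>" "x - \<sigma>"] by (simp add: algebra_simps)
    finally show ?thesis .
  qed
  have r0s: "continuous_on Y (\<lambda>\<tau>. r 0 (x + \<tau>))" for Y
    by (rule continuous_on_compose2[OF r0_cont[of UNIV]]) (auto intro!: continuous_intros)
  have gi: "set_integrable lborel {0..t} (\<lambda>\<tau>. LBINT \<sigma>:{0..t}. g \<tau> \<sigma>)"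
    using abs_set_integral_le(2)[OF borel_measurable_section(1)[OF gm] gb t]
    by (rule bounded_borel_set_integrable[OF borel_measurable_partial_integral[OF gm]])
  have "(LBINT \<tau>:{0..t}. r \<tau> x) = (LBINT \<tau>:{0..t}. r 0 (x + \<tau>) + (LBINT \<sigma>:{0..t}. g \<tau> \<sigma>))"
  proof (rule set_lebesgue_integral_cong)
    show "\<forall>\<tau>. \<tau> \<in> {0..t} \<longrightarrow> r \<tau> x = r 0 (x + \<tau>) + (LBINT \<sigma>:{0..t}. g \<tau> \<sigma>)"
    proof (intro allI impI)
      fix \<tau> assume \<tau>: "\<tau> \<in> {0..t}"
      then have "0 \<le> \<tau>" by simp
      then show "r \<tau> x = r 0 (x + \<tau>) + (LBINT \<sigma>:{0..t}. g \<tau> \<sigma>)" unfolding inner[OF \<tau>] by (rule r_expanded)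
    qed
  qed simp
  also have "\<dots> = (LBINT \<tau>:{0..t}. r 0 (x + \<tau>)) + (LBINT \<tau>:{0..t}. LBINT \<sigma>:{0..t}. g \<tau> \<sigma>)"
    by (intro set_integral_add(2) set_integral_continuous_eq_integral(1) r0s gi)
  also have "(LBINT \<tau>:{0..t}. r 0 (x + \<tau>)) = (LBINT y:{x..x + t}. r 0 y)"
    using set_integral_shift[of 0 t "r 0" x] by (simp add: add.commute)
  also have "(LBINT \<tau>:{0..t}. LBINT \<sigma>:{0..t}. g \<tau> \<sigma>) = (LBINT \<sigma>:{0..t}. LBINT \<tau>:{0..t}. g \<tau> \<sigma>)"
    by (rule LBINT_rectangle_swap[OF gm gb])
  also have "\<dots> = (LBINT \<sigma>:{0..t}. LBINT y:{x..x + (t - \<sigma>)}. src \<sigma> y)"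
    by (rule set_lebesgue_integral_cong) (auto simp: inner')
  finally show ?thesis .
qed

lemma r_space_integral:
  assumes t: "0 \<le> t"
  shows "(LBINT y:{-x..x}. r t y) = (LBINT y:{-x + t..x + t}. r 0 y) + (LBINT \<sigma>:{0..t}. LBINT y:{-x + (t - \<sigma>)..x + (t - \<sigma>)}. src \<sigma> y)"
proof -
  have r0s: "continuous_on Y (\<lambda>y. r 0 (y + t))" for Y
    by (rule continuous_on_compose2[OF r0_cont[of UNIV]]) (auto intro!: continuous_intros)
  have ci: "set_integrable lborel {-x..x} (\<lambda>y. LBINT \<tau>:{0..t}. src \<tau> (y + t - \<tau>))"
    by (rule bounded_borel_set_integrable[OF cone_integral(1)[OF src_borel src_bound t] cone_integral(2)[OF src_borel src_bound t]])
  have "(LBINT y:{-x..x}. r t y) = (LBINT y:{-x..x}. r 0 (y + t) + (LBINT \<tau>:{0..t}. src \<tau> (y + t - \<tau>)))"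
    by (rule set_lebesgue_integral_cong) (simp_all add: r_expanded[OF t, symmetric])
  also have "\<dots> = (LBINT y:{-x..x}. r 0 (y + t)) + (LBINT y:{-x..x}. LBINT \<tau>:{0..t}. src \<tau> (y + t - \<tau>))"
    by (intro set_integral_add(2) set_integral_continuous_eq_integral(1) r0s ci)
  also have "(LBINT y:{-x..x}. r 0 (y + t)) = (LBINT y:{-x + t..x + t}. r 0 y)" by (rule set_integral_shift)
  also have "(LBINT y:{-x..x}. LBINT \<tau>:{0..t}. src \<tau> (y + t - \<tau>)) = (LBINT \<tau>:{0..t}. LBINT y:{-x..x}. src \<tau> (y + t - \<tau>))"
    by (rule LBINT_rectangle_swap[OF borel_shear(1)[OF src_borel] src_bound])
  also have "\<dots> = (LBINT \<sigma>:{0..t}. LBINT y:{-x + (t - \<sigma>)..x + (t - \<sigma>)}. src \<sigma> y)"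
  proof (rule set_lebesgue_integral_cong)
    have "(LBINT y:{-x..x}. src \<sigma> (y + t - \<sigma>)) = (LBINT y:{-x + (t - \<sigma>)..x + (t - \<sigma>)}. src \<sigma> y)" for \<sigma>
      unfolding add_diff_eq[symmetric, of _ t \<sigma>] by (rule set_integral_shift)
    then show "\<forall>\<sigma>. \<sigma> \<in> {0..t} \<longrightarrow> (LBINT y:{-x..x}. src \<sigma> (y + t - \<sigma>)) = (LBINT y:{-x + (t - \<sigma>)..x + (t - \<sigma>)}. src \<sigma> y)"
      by blast
  qed simp
  finally show ?thesis .
qed

text \<open>Equivalently, \<open>z\<^sub>x(t, x) = (r(t, x) + r(t, -x)) / 2\<close>. By \<open>z_eq\<close> the difference \<open>z t x - z 0 x\<close> is an integral over
  time of \<open>r\<close> along two vertical lines; it is compared with the integral of \<open>r t\<close> over \<open>[-x, x]\<close> after both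
  are expressed through the initial value and the source.\<close>

proposition z_space:
  assumes t: "0 \<le> t" and x: "x \<in> {0..1}"
  shows "z t x = (LBINT y:{-x..x}. r t y) / 2"
proof -
  have si: "set_integrable lborel {a..c} (src \<sigma>)" for a c \<sigma>
    by (rule set_integral_continuous_eq_integral(1)[OF src_section])
  have ri: "set_integrable lborel {a..c} (r 0)" for a c
    by (rule set_integral_continuous_eq_integral(1)[OF r0_cont])
  have rt: "continuous_on {0..t} (\<lambda>\<tau>. r \<tau> y)" for y
  proof -
    have "continuous_on {0..t} (\<lambda>\<tau>. (\<tau>, y))" by (intro continuous_intros)
    from continuous_on_compose2[OF r_cont this] have "continuous_on {0..t} (\<lambda>\<tau>. r (max 0 \<tau>) y)" by simp
    then show ?thesis by (rule continuous_on_eq) auto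
  qed
  have rti: "set_integrable lborel {0..t} (\<lambda>\<tau>. r \<tau> y)" for y by (rule set_integral_continuous_eq_integral(1)[OF rt])
  have odd: "(LBINT y:{-x..x}. src \<sigma> y) = 0" for \<sigma>
  proof -
    have "(LBINT y:{-x..x}. src \<sigma> y) = (LBINT y:{-x..0}. src \<sigma> y) + (LBINT y:{0..x}. src \<sigma> y)"
      by (rule set_integral_combine[OF si]) (use x in auto)
    moreover have "(LBINT y:{-x..0}. src \<sigma> y) = - (LBINT y:{0..x}. src \<sigma> y)"
      unfolding set_integral_reflect src_minus by (simp add: set_lebesgue_integral_def)
    ultimately show ?thesis by linarith
  qed

  have bI: "set_integrable lborel {0..t} (\<lambda>\<sigma>. LBINT y:{u..u + (t - \<sigma>)}. src \<sigma> y)" for u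
  proof -
    have eq: "(LBINT y:{u..u + (t - \<sigma>)}. src \<sigma> y) = (LBINT y:{0..t}. if y \<le> t - \<sigma> then src \<sigma> (y + u) else 0)" if "\<sigma> \<in> {0..t}" for \<sigma>
    proof -
      have "(LBINT y:{0..t}. if y \<le> t - \<sigma> then src \<sigma> (y + u) else 0) = (LBINT y:{0..t - \<sigma>}. src \<sigma> (y + u))"
        unfolding set_lebesgue_integral_def
        by (rule Bochner_Integration.integral_cong) (use that in \<open>auto simp: indicator_def\<close>)
      then show ?thesis using set_integral_shift[of 0 "t - \<sigma>" "src \<sigma>" u] by (simp add: add.commute)
    qed
    define g where "g = (\<lambda>\<sigma> y. if y \<le> t - \<sigma> then src \<sigma> (y + u) else 0)"
    have gm: "(\<lambda>(\<sigma>, y). g \<sigma> y) \<in> borel_measurable borel"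
    proof -
      have "(\<lambda>p::real \<times> real. (fst p, snd p + u)) \<in> borel_measurable borel"
        by (intro borel_measurable_continuous_onI continuous_intros)
      from measurable_compose[OF this borel_measurable_continuous_onI[OF src_cont]]
      have [measurable]: "(\<lambda>p::real \<times> real. src (fst p) (snd p + u)) \<in> borel_measurable borel" by simp
      have [measurable]: "fst \<in> borel_measurable (borel :: (real \<times> real) measure)" "snd \<in> borel_measurable (borel :: (real \<times> real) measure)"
        by (intro borel_measurable_continuous_onI continuous_intros)+
      show ?thesis unfolding g_def split_beta' by measurable
    qed
    have N0: "0 \<le> A * (L * B)" using constants_nonneg by simp
    have gb: "\<bar>g \<tau> \<sigma>\<bar> \<le> A * (L * B)" for \<tau> \<sigma> using src_bound N0 by (simp add: g_def)
    have "set_integrable lborel {0..t} (\<lambda>\<sigma>. LBINT y:{0..t}. g \<sigma> y)"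
      using abs_set_integral_le(2)[OF borel_measurable_section(1)[OF gm] gb t]
      by (rule bounded_borel_set_integrable[OF borel_measurable_partial_integral[OF gm]])
    then show ?thesis
      unfolding set_integrable_def
      by (rule Bochner_Integration.integrable_cong[THEN iffD1, OF refl, rotated])
        (use eq in \<open>auto simp: g_def indicator_def\<close>)
  qed
  have four: "(LBINT y:{x..x + (t - \<sigma>)}. src \<sigma> y) - (LBINT y:{-x..-x + (t - \<sigma>)}. src \<sigma> y) = (LBINT y:{-x + (t - \<sigma>)..x + (t - \<sigma>)}. src \<sigma> y)"
    if "\<sigma> \<in> {0..t}" for \<sigma>
    using set_integral_four_points[OF si, of x "t - \<sigma>" \<sigma>] x that by (simp add: odd)
  have "2 * integral {0..t} (\<lambda>\<tau>. vel \<tau> x) = (LBINT \<tau>:{0..t}. r \<tau> x) - (LBINT \<tau>:{0..t}. r \<tau> (- x))"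
  proof -
    have "integral {0..t} (\<lambda>\<tau>. vel \<tau> x) = (LBINT \<tau>:{0..t}. vel \<tau> x)"
      by (rule set_integral_continuous_eq_integral(2)[symmetric, OF vel_section'])
    also have "\<dots> = (LBINT \<tau>:{0..t}. (r \<tau> x - r \<tau> (- x)) / 2)"
      by (rule set_lebesgue_integral_cong) (auto simp: vel_def)
    also have "\<dots> = ((LBINT \<tau>:{0..t}. r \<tau> x) - (LBINT \<tau>:{0..t}. r \<tau> (- x))) / 2"
      by (simp only: set_integral_divide_zero set_integral_diff(2)[OF rti rti])
    finally show ?thesis by simp
  qed
  also have "\<dots> = ((LBINT y:{x..x + t}. r 0 y) - (LBINT y:{-x..-x + t}. r 0 y))
      + ((LBINT \<sigma>:{0..t}. LBINT y:{x..x + (t - \<sigma>)}. src \<sigma> y) - (LBINT \<sigma>:{0..t}. LBINT y:{-x..-x + (t - \<sigma>)}. src \<sigma> y))"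
    unfolding r_time_integral[OF t] by simp
  also have "(LBINT y:{x..x + t}. r 0 y) - (LBINT y:{-x..-x + t}. r 0 y) = (LBINT y:{-x + t..x + t}. r 0 y) - (LBINT y:{-x..x}. r 0 y)"
    by (rule set_integral_four_points[OF ri]) (use x t in auto)
  also have "(LBINT \<sigma>:{0..t}. LBINT y:{x..x + (t - \<sigma>)}. src \<sigma> y) - (LBINT \<sigma>:{0..t}. LBINT y:{-x..-x + (t - \<sigma>)}. src \<sigma> y)
      = (LBINT \<sigma>:{0..t}. LBINT y:{-x + (t - \<sigma>)..x + (t - \<sigma>)}. src \<sigma> y)"
    unfolding set_integral_diff(2)[symmetric, OF bI bI]
    by (rule set_lebesgue_integral_cong) (simp, use four in blast)
  finally have time: "2 * integral {0..t} (\<lambda>\<tau>. vel \<tau> x) = (LBINT y:{-x..x}. r t y) - (LBINT y:{-x..x}. r 0 y)"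
    unfolding r_space_integral[OF t] by simp
  have "(LBINT y:{-x..x}. r 0 y) = (LBINT y:{-x..0}. r 0 y) + (LBINT y:{0..x}. r 0 y)"
    by (rule set_integral_combine[OF ri]) (use x in auto)
  also have "(LBINT y:{-x..0}. r 0 y) = (LBINT y:{0..x}. r 0 (- y))" by (rule set_integral_reflect)
  also have "(LBINT y:{0..x}. r 0 (- y)) + (LBINT y:{0..x}. r 0 y) = (LBINT y:{0..x}. r 0 (- y) + r 0 y)"
    by (intro set_integral_add(2)[symmetric] set_integral_continuous_eq_integral(1) r0_cont continuous_on_compose2[OF r0_cont[of UNIV]] continuous_intros) auto
  also have "\<dots> = (LBINT y:{0..x}. 2 * p0 y)"
    by (rule set_lebesgue_integral_cong) (use x in \<open>auto simp: r_init fold01_id\<close>)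
  also have "\<dots> = 2 * integral {0..x} p0"
    using set_integral_continuous_eq_integral(2)[OF continuous_on_subset[OF p0_cont], of 0 x] x by simp
  also have "integral {0..x} p0 = z 0 x" by (rule z_init[symmetric, OF x])
  finally show ?thesis using time z_eq[OF t x] by simp
qed

text \<open>This is where the boundary condition at \<open>x = 1\<close> is used.\<close>

lemma r_mean_zero: "0 \<le> t \<Longrightarrow> integral {-1..1} (r t) = 0"
  using z_space[of t 1] z_bdry(2)[of t]
    set_integral_continuous_eq_integral(2)[OF continuous_on_subset[OF damped_transport_continuous[OF r]], of t "-1" 1] by simp

end

section \<open>Borel representatives of a weak solution\<close>

lemma AE_lborel_sections:
  fixes P :: "real \<times> real \<Rightarrow> bool"
  assumes "AE p in lborel. P p"
  shows "AE t in lborel. AE x in lborel. P (t, x)" "AE x in lborel. AE t in lborel. P (t, x)"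
proof -
  have pair: "AE t in lborel. AE x in lborel. Q (t, x)" if "AE p in lborel. Q p" for Q :: "real \<times> real \<Rightarrow> bool"
    by (rule lborel_pair.AE_pair) (use that in \<open>simp only: lborel_prod\<close>)
  show "AE t in lborel. AE x in lborel. P (t, x)" by (rule pair[OF assms])
  obtain N where N: "N \<in> null_sets lborel" "{p. \<not> P p} \<subseteq> N"
    using assms unfolding eventually_ae_filter by auto
  have "AE t in lborel. AE x in lborel. (t, x) \<notin> N" by (rule pair[OF AE_not_in[OF N(1)]])
  moreover have "{p \<in> space (lborel \<Otimes>\<^sub>M lborel). (fst p, snd p) \<notin> N} \<in> sets (lborel \<Otimes>\<^sub>M lborel)"
  proof -
    have "{p \<in> space (lborel \<Otimes>\<^sub>M lborel). (fst p, snd p) \<notin> N} = - N" by (auto simp: space_pair_measure)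
    moreover have "- N \<in> sets lborel" using N(1) by (auto simp: null_sets_def)
    ultimately show ?thesis by (simp only: lborel_prod)
  qed
  ultimately have "AE x in lborel. AE t in lborel. (t, x) \<notin> N"
    using lborel_pair.AE_commute[of "\<lambda>t x. (t, x) \<notin> N"] by blast
  then show "AE x in lborel. AE t in lborel. P (t, x)"
  proof eventually_elim
    case (elim x)
    then show ?case by eventually_elim (use N(2) in blast)
  qed
qed

text \<open>No measurability of \<open>f\<close> is assumed; it follows by completeness of the Lebesgue measure.\<close>

lemma LINT_lebesgue_on_AE_eq:
  fixes f g :: "'a::euclidean_space \<Rightarrow> real"
  assumes S: "S \<in> sets borel" and g: "g \<in> borel_measurable borel" and ae: "AE x in lborel. x \<in> S \<longrightarrow> f x = g x"
  shows "(LINT x|lebesgue_on S. f x) = (LBINT x:S. g x)"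
proof -
  have "(\<lambda>x. if x \<in> S then g x else 0) \<in> borel_measurable lborel" using S g by measurable
  then have "(\<lambda>x. if x \<in> S then g x else 0) \<in> borel_measurable lebesgue" by (rule measurable_completion)
  moreover have "AE x in lebesgue. (if x \<in> S then g x else 0) = (if x \<in> S then f x else 0)"
    by (rule AE_completion) (use ae in \<open>auto elim: eventually_mono\<close>)
  ultimately have "(\<lambda>x. if x \<in> S then f x else 0) \<in> borel_measurable lebesgue" by (rule borel_measurable_AE)
  then have "f \<in> borel_measurable (lebesgue_on S)" by (rule borel_measurable_if_D)
  then show ?thesis by (rule integral_lebesgue_on_representative[OF _ S g ae])
qed

text \<open>The extension of \<open>z\<close> to the plane is obtained by projecting onto the half-strip. Outside the half-strip
  the representatives \<open>W\<close> and \<open>X\<close> are irrelevant. The function \<open>b\<close> is any continuous extension of \<open>a\<close>.\<close>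

proposition wave_solution_representative:
  fixes z :: "real \<Rightarrow> real \<Rightarrow> real"
  assumes sol: "wave_solution a \<sigma> z0 z1 z" and z1: "continuous_on {0..1} z1"
    and \<sigma>: "continuous_on UNIV \<sigma>" "\<And>d. \<bar>\<sigma> d\<bar> \<le> m * \<bar>d\<bar>" "0 \<le> m"
    and b: "continuous_on UNIV b" "\<And>y. \<bar>b y\<bar> \<le> A" "\<And>x. x \<in> {0<..<1} \<Longrightarrow> b x = a x"
  obtains W X C where "\<And>t x. \<bar>W t x\<bar> \<le> C"
    "weak_wave (\<lambda>t x. z (max 0 t) (max 0 (min 1 x))) W X (\<lambda>t x. - b x * \<sigma> (W t x)) z1 (max C (A * (m * C)))"
proof -
  let ?S = "{0<..} \<times> {0<..<1} :: (real \<times> real) set"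
  have S: "?S \<in> sets borel" by (intro borel_open open_Times) auto
  have T: "{0<..} \<in> sets (borel :: real measure)" and I: "{0<..<1} \<in> sets (borel :: real measure)" by auto
  have zc: "continuous_on ({0..} \<times> {0..1}) (\<lambda>(t, x). z t x)" and zb: "\<And>t. 0 \<le> t \<Longrightarrow> z t 0 = 0 \<and> z t 1 = 0"
    using sol unfolding wave_solution_def by blast+
  obtain zx zt where zx: "Linf_W1inf z zx" and zt: "W1inf_Linf z zt"
    and eq: "\<And>\<phi> \<phi>t \<phi>x. space_time_test_fun \<phi> \<phi>t \<phi>x \<Longrightarrow>
           (LINT (t, x)|Q01. zt t x * \<phi>t t x - zx t x * \<phi>x t x - a x * \<sigma> (zt t x) * \<phi> t x)
           + (LINT x|I01. z1 x * \<phi> 0 x) = 0"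
    using sol unfolding wave_solution_def by blast
  obtain Cx Ct where Cx: "AE (t, x) in Q01. \<bar>zx t x\<bar> \<le> Cx" and Ct: "AE (t, x) in Q01. \<bar>zt t x\<bar> \<le> Ct"
    using zx zt unfolding Linf_W1inf_def W1inf_Linf_def Linf_Linf_def by blast
  have mx: "case_prod zx \<in> borel_measurable Q01" and mt: "case_prod zt \<in> borel_measurable Q01"
    using zx zt unfolding Linf_W1inf_def W1inf_Linf_def Linf_Linf_def by blast+
  define C where "C = max \<bar>Cx\<bar> \<bar>Ct\<bar>"
  have C0: "0 \<le> C" by (simp add: C_def)
  have bx: "AE p in Q01. \<bar>case_prod zx p\<bar> \<le> C" using Cx by eventually_elim (auto simp: C_def)
  have bt: "AE p in Q01. \<bar>case_prod zt p\<bar> \<le> C" using Ct by eventually_elim (auto simp: C_def)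
  obtain Wp where Wp: "Wp \<in> borel_measurable borel" "AE p in lborel. p \<in> ?S \<longrightarrow> case_prod zt p = Wp p" "\<And>p. p \<notin> ?S \<Longrightarrow> Wp p = 0" "\<And>p. \<bar>Wp p\<bar> \<le> C"
    using bounded_borel_representative[OF mt S bt C0] by blast
  obtain Xp where Xp: "Xp \<in> borel_measurable borel" "AE p in lborel. p \<in> ?S \<longrightarrow> case_prod zx p = Xp p" "\<And>p. p \<notin> ?S \<Longrightarrow> Xp p = 0" "\<And>p. \<bar>Xp p\<bar> \<le> C"
    using bounded_borel_representative[OF mx S bx C0] by blast
  define W where "W = (\<lambda>t x. Wp (t, x))"
  define X where "X = (\<lambda>t x. Xp (t, x))"
  define Z where "Z = (\<lambda>t x. z (max 0 t) (max 0 (min 1 x)))"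
  have Wb: "(\<lambda>(t, x). W t x) \<in> borel_measurable borel" and Xb: "(\<lambda>(t, x). X t x) \<in> borel_measurable borel"
    using Wp(1) Xp(1) by (simp_all add: W_def X_def)
  have WC: "\<bar>W t x\<bar> \<le> C" for t x by (simp add: W_def Wp(4))
  have Zc: "continuous_on UNIV (\<lambda>(t, x). Z t x)"
  proof -
    have "continuous_on UNIV (\<lambda>p::real \<times> real. (max 0 (fst p), max 0 (min 1 (snd p))))" by (intro continuous_intros)
    then have "continuous_on UNIV (\<lambda>p. (\<lambda>(t, x). z t x) (max 0 (fst p), max 0 (min 1 (snd p))))"
      by (rule continuous_on_compose2[OF zc]) auto
    then show ?thesis by (simp add: Z_def split_beta')
  qed
  have ZI: "Z t x = z t x" if "0 \<le> t" "x \<in> {0..1}" for t x using that by (simp add: Z_def)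
  have fb: "(\<lambda>(t, x). - b x * \<sigma> (W t x)) \<in> borel_measurable borel"
  proof -
    have [measurable]: "b \<in> borel_measurable borel" "\<sigma> \<in> borel_measurable borel"
      using b(1) \<sigma>(1) by (auto intro: borel_measurable_continuous_onI)
    have [measurable]: "snd \<in> borel_measurable (borel :: (real \<times> real) measure)"
      by (intro borel_measurable_continuous_onI continuous_intros)
    have [measurable]: "(\<lambda>p. W (fst p) (snd p)) \<in> borel_measurable borel" using Wb by (simp add: split_beta')
    show ?thesis unfolding split_beta' by measurable
  qed
  have fC: "\<bar>- b x * \<sigma> (W t x)\<bar> \<le> A * (m * C)" for t x
  proof -
    have "\<bar>\<sigma> (W t x)\<bar> \<le> m * C" using \<sigma>(2)[of "W t x"] mult_left_mono[OF WC[of t x] \<sigma>(3)] by (rule order_trans)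
    then show ?thesis unfolding abs_mult abs_minus_cancel
      by (intro mult_mono b(2)) (use b(2)[of 0] in auto)
  qed
  have "weak_wave Z W X (\<lambda>t x. - b x * \<sigma> (W t x)) z1 (max C (A * (m * C)))"
  proof
    show "continuous_on UNIV (\<lambda>(t, x). Z t x)" by (rule Zc)
    show "Z t 0 = 0" "Z t 1 = 0" for t using zb[of "max 0 t"] by (simp_all add: Z_def)
    show "continuous_on {0..1} z1" by (rule z1)
    show "\<bar>W t x\<bar> \<le> max C (A * (m * C))" for t x by (rule order_trans[OF WC max.cobounded1])
    show "\<bar>X t x\<bar> \<le> max C (A * (m * C))" for t x unfolding X_def by (rule order_trans[OF Xp(4) max.cobounded1])
    show "\<bar>- b x * \<sigma> (W t x)\<bar> \<le> max C (A * (m * C))" for t x by (rule order_trans[OF fC max.cobounded2])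
    have "AE t in lborel. t \<in> {0<..} \<longrightarrow> is_weak_deriv (z t) (zx t)"
      using zx unfolding Linf_W1inf_def AE_lebesgue_on_iff[OF T] by blast
    then show "AE t in lborel. 0 < t \<longrightarrow> (\<forall>x\<in>{0..1}. Z t x = (LBINT y:{0..x}. X t y))"
      using AE_lborel_sections(1)[OF Xp(2)]
    proof eventually_elim
      case (elim t)
      show ?case
      proof (intro impI ballI)
        fix x :: real assume t: "0 < t" and x: "x \<in> {0..1}"
        have "continuous_on {0..1} (\<lambda>x. (t, x))" by (intro continuous_intros)
        then have "continuous_on {0..1} (\<lambda>x. (\<lambda>(t, x). z t x) (t, x))"
          by (rule continuous_on_compose2[OF zc]) (use t in auto)
        then have ct: "continuous_on {0..1} (z t)" by simp
        have wd: "is_weak_deriv (z t) (zx t)" using elim(1) t by simp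
        obtain g where g: "g \<in> borel_measurable borel" "set_integrable lborel {0..1} g"
          "AE x in lborel. x \<in> {0<..<1} \<longrightarrow> zx t x = g x"
          "\<And>x. x \<in> {0..1} \<Longrightarrow> z t x = z t 0 + (LBINT y:{0..x}. g y)"
          using weak_deriv_continuous_primitive[OF wd ct] by blast
        have "(LBINT y:{0..x}. g y) = (LBINT y:{0..x}. X t y)"
          unfolding set_lebesgue_integral_def
        proof (rule integral_cong_AE)
          have "X t \<in> borel_measurable borel" by (rule borel_measurable_section(1)[OF Xb])
          then show "(\<lambda>y. indicat_real {0..x} y *\<^sub>R X t y) \<in> borel_measurable lborel" by measurable
          show "(\<lambda>y. indicat_real {0..x} y *\<^sub>R g y) \<in> borel_measurable lborel" using g(1) by measurable
          show "AE y in lborel. indicat_real {0..x} y *\<^sub>R g y = indicat_real {0..x} y *\<^sub>R X t y"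
            using g(3) elim(2) AE_lborel_singleton[of 0] AE_lborel_singleton[of 1]
            by eventually_elim (use t x in \<open>auto simp: indicator_def X_def\<close>)
        qed
        then show "Z t x = (LBINT y:{0..x}. X t y)" using g(4)[OF x] zb[of t] t ZI[of t x] x by simp
      qed
    qed
  next
    fix \<theta> \<theta>' assume \<theta>: "test_fun {0<..} \<theta> \<theta>'"
    have "continuous_on UNIV \<theta>'" using \<theta> unfolding test_fun_def by blast
    moreover have "continuous_on UNIV \<theta>"
      using \<theta> unfolding test_fun_def by (intro DERIV_continuous_on) (blast intro: has_field_derivative_at_within)
    ultimately have [measurable]: "\<theta> \<in> borel_measurable borel" "\<theta>' \<in> borel_measurable borel"
      by (auto intro: borel_measurable_continuous_onI)
    have "AE x in lborel. x \<in> {0<..<1} \<longrightarrow> (LINT t|lebesgue_on {0<..}. \<theta>' t * z t x)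
                      = - (LINT t|lebesgue_on {0<..}. \<theta> t * zt t x)"
      using zt \<theta> unfolding W1inf_Linf_def AE_lebesgue_on_iff[OF I] by blast
    then show "AE x in lborel. x \<in> {0<..<1} \<longrightarrow> (LBINT t:{0<..}. \<theta>' t * Z t x) = - (LBINT t:{0<..}. \<theta> t * W t x)"
      using AE_lborel_sections(2)[OF Wp(2)]
    proof eventually_elim
      case (elim x)
      show ?case
      proof
        assume x: "x \<in> {0<..<1}"
        have [measurable]: "(\<lambda>t. W t x) \<in> borel_measurable borel" by (rule borel_measurable_section(2)[OF Wb])
        have [measurable]: "(\<lambda>t. Z t x) \<in> borel_measurable borel"
        proof -
          have "continuous_on UNIV (\<lambda>t::real. (t, x))" by (intro continuous_intros)
          from continuous_on_compose2[OF Zc this] show ?thesis by (auto intro: borel_measurable_continuous_onI)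
        qed
        have 1: "(LINT t|lebesgue_on {0<..}. \<theta>' t * z t x) = (LBINT t:{0<..}. \<theta>' t * Z t x)"
          by (rule LINT_lebesgue_on_AE_eq) (use x in \<open>auto simp: ZI\<close>)
        have 2: "(LINT t|lebesgue_on {0<..}. \<theta> t * zt t x) = (LBINT t:{0<..}. \<theta> t * W t x)"
        proof (rule LINT_lebesgue_on_AE_eq[OF T])
          show "AE t in lborel. t \<in> {0<..} \<longrightarrow> \<theta> t * zt t x = \<theta> t * W t x"
            using elim(2) by eventually_elim (use x in \<open>auto simp: W_def\<close>)
        qed simp
        show "(LBINT t:{0<..}. \<theta>' t * Z t x) = - (LBINT t:{0<..}. \<theta> t * W t x)"
          using elim(1) x unfolding 1 2 by blast
      qed
    qed
  next
    fix \<theta> \<theta>' \<psi> \<psi>' assume \<theta>: "test_fun UNIV \<theta> \<theta>'" and \<psi>: "test_fun {0<..<1} \<psi> \<psi>'"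
    have "continuous_on UNIV \<theta>'" "continuous_on UNIV \<psi>'" using \<theta> \<psi> unfolding test_fun_def by blast+
    moreover have "continuous_on UNIV \<theta>" "continuous_on UNIV \<psi>"
      using \<theta> \<psi> unfolding test_fun_def by (intro DERIV_continuous_on; blast intro: has_field_derivative_at_within)+
    ultimately have [measurable]: "\<theta> \<in> borel_measurable borel" "\<theta>' \<in> borel_measurable borel"
      "\<psi> \<in> borel_measurable borel" "\<psi>' \<in> borel_measurable borel"
      by (auto intro: borel_measurable_continuous_onI)
    have [measurable]: "fst \<in> borel_measurable (borel :: (real \<times> real) measure)" "snd \<in> borel_measurable (borel :: (real \<times> real) measure)"
      by (intro borel_measurable_continuous_onI continuous_intros)+
    have [measurable]: "(\<lambda>p. W (fst p) (snd p)) \<in> borel_measurable borel" "(\<lambda>p. X (fst p) (snd p)) \<in> borel_measurable borel"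
      "(\<lambda>p. - b (snd p) * \<sigma> (W (fst p) (snd p))) \<in> borel_measurable borel"
      using Wb Xb fb by (simp_all only: split_beta')
    define G where "G = (\<lambda>p::real \<times> real. W (fst p) (snd p) * (\<theta>' (fst p) * \<psi> (snd p))
          - X (fst p) (snd p) * (\<theta> (fst p) * \<psi>' (snd p)) + - b (snd p) * \<sigma> (W (fst p) (snd p)) * (\<theta> (fst p) * \<psi> (snd p)))"
    have Gm: "G \<in> borel_measurable borel" unfolding G_def by measurable
    have 1: "(LINT (t, x)|Q01. zt t x * (\<theta>' t * \<psi> x) - zx t x * (\<theta> t * \<psi>' x) - a x * \<sigma> (zt t x) * (\<theta> t * \<psi> x)) = (LBINT p:?S. G p)"
    proof (rule LINT_lebesgue_on_AE_eq[OF S Gm])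
      show "AE p in lborel. p \<in> ?S \<longrightarrow> (case p of (t, x) \<Rightarrow> zt t x * (\<theta>' t * \<psi> x) - zx t x * (\<theta> t * \<psi>' x) - a x * \<sigma> (zt t x) * (\<theta> t * \<psi> x)) = G p"
        using Wp(2) Xp(2)
      proof eventually_elim
        case (elim p)
        show ?case
        proof
          assume p: "p \<in> ?S"
          obtain t x where tx: "p = (t, x)" by (cases p)
          have "zt t x = W t x" "zx t x = X t x" using elim p by (simp_all add: tx W_def X_def)
          moreover have "b x = a x" by (rule b(3)) (use p tx in auto)
          ultimately show "(case p of (t, x) \<Rightarrow> zt t x * (\<theta>' t * \<psi> x) - zx t x * (\<theta> t * \<psi>' x) - a x * \<sigma> (zt t x) * (\<theta> t * \<psi> x)) = G p"
            by (simp add: tx G_def)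
        qed
      qed
    qed
    have zi: "(\<lambda>x. indicat_real {0..1} x *\<^sub>R z1 x) \<in> borel_measurable borel"
      by (rule borel_measurable_continuous_on_indicator[OF _ z1]) simp
    have "(LINT x|I01. z1 x * (\<theta> 0 * \<psi> x)) = (LBINT x:{0<..<1}. (indicat_real {0..1} x *\<^sub>R z1 x) * (\<theta> 0 * \<psi> x))"
    proof (rule LINT_lebesgue_on_AE_eq[OF I])
      show "(\<lambda>x. (indicat_real {0..1} x *\<^sub>R z1 x) * (\<theta> 0 * \<psi> x)) \<in> borel_measurable borel"
        by (rule borel_measurable_times[OF zi]) measurable
    qed auto
    also have "\<dots> = (LBINT x:{0<..<1}. z1 x * (\<theta> 0 * \<psi> x))"
      by (rule set_lebesgue_integral_cong) auto
    finally have 2: "(LINT x|I01. z1 x * (\<theta> 0 * \<psi> x)) = (LBINT x:{0<..<1}. z1 x * (\<theta> 0 * \<psi> x))" .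
    have "(LBINT p:?S. G p) + (LBINT x:{0<..<1}. z1 x * (\<theta> 0 * \<psi> x)) = 0"
      using eq[OF space_time_test_fun_product[OF \<theta> \<psi>]] unfolding 1 2 .
    then show "(\<integral>p. indicator ?S p * (W (fst p) (snd p) * (\<theta>' (fst p) * \<psi> (snd p))
          - X (fst p) (snd p) * (\<theta> (fst p) * \<psi>' (snd p)) + - b (snd p) * \<sigma> (W (fst p) (snd p)) * (\<theta> (fst p) * \<psi> (snd p))) \<partial>lborel)
       + (LBINT x:{0<..<1}. z1 x * (\<theta> 0 * \<psi> x)) = 0"
      by (simp add: G_def set_lebesgue_integral_def)
  qed (rule Wb Xb fb)+
  with WC show ?thesis unfolding Z_def by (rule that)
qed

section \<open>Norms of the state\<close>

lemma continuous_Lp_inf: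
  assumes g: "continuous_on {0..1} g"
  shows "g \<in> Lp \<infinity>" and "(\<And>x. x \<in> {0..1} \<Longrightarrow> \<bar>g x\<bar> \<le> M) \<Longrightarrow> Lp_norm \<infinity> g \<le> M"
proof -
  have I: "{0<..<1} \<in> sets (borel :: real measure)" by simp
  have ae: "AE x in I01. \<bar>g x\<bar> \<le> N" if "\<And>x. x \<in> {0..1} \<Longrightarrow> \<bar>g x\<bar> \<le> N" for N
    unfolding AE_lebesgue_on_iff[OF I] using that by auto
  have "compact (g ` {0..1})" by (rule compact_continuous_image[OF g]) simp
  then obtain N where "\<And>x. x \<in> {0..1} \<Longrightarrow> \<bar>g x\<bar> \<le> N"
    using compact_imp_bounded bounded_iff by (metis image_eqI real_norm_def)
  from ae[OF this] show Lp: "g \<in> Lp \<infinity>" unfolding Lp_inf_iff using continuous_I01(1)[OF g] by blast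
  show "Lp_norm \<infinity> g \<le> M" if "\<And>x. x \<in> {0..1} \<Longrightarrow> \<bar>g x\<bar> \<le> M" by (rule Lp_norm_inf(3)[OF Lp ae[OF that]])
qed

text \<open>Uniform continuity of \<open>v\<close> on a compact rectangle makes the difference quotients converge uniformly in \<open>x\<close>.\<close>

lemma has_time_deriv_of_integral:
  fixes z v :: "real \<Rightarrow> real \<Rightarrow> real"
  assumes z: "\<And>t x. 0 \<le> t \<Longrightarrow> x \<in> {0..1} \<Longrightarrow> z t x = z 0 x + integral {0..t} (\<lambda>\<tau>. v \<tau> x)"
    and zc: "\<And>t. 0 \<le> t \<Longrightarrow> continuous_on {0..1} (z t)"
    and v: "continuous_on UNIV (\<lambda>p. v (fst p) (snd p))" and t: "0 \<le> t"
  shows "has_time_deriv z t (v t)"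
proof -
  have vx: "continuous_on Y (v \<tau>)" and vt: "continuous_on Y (\<lambda>\<tau>. v \<tau> x)" for Y \<tau> x
  proof -
    have c: "continuous_on Y (\<lambda>x. (\<tau>, x))" "continuous_on Y (\<lambda>\<tau>. (\<tau>, x))" by (intro continuous_intros)+
    show "continuous_on Y (v \<tau>)" using continuous_on_compose2[OF v c(1)] by simp
    show "continuous_on Y (\<lambda>\<tau>. v \<tau> x)" using continuous_on_compose2[OF v c(2)] by simp
  qed
  define q where "q = (\<lambda>s x. (z s x - z t x) / (s - t) - v t x)"
  have qc: "continuous_on {0..1} (q s)" if "0 \<le> s" for s
  proof -
    have "continuous_on {0..1} (\<lambda>x. (1 / (s - t)) * (z s x - z t x) - v t x)"
      by (intro continuous_on_mult continuous_on_const continuous_on_diff zc that t vx)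
    then show ?thesis by (simp add: q_def)
  qed
  have "((\<lambda>s. Lp_norm \<infinity> (q s)) \<longlongrightarrow> 0) (at t within {0..})"
    unfolding tendsto_iff
  proof (intro allI impI)
    fix \<epsilon> :: real assume \<epsilon>: "0 < \<epsilon>"
    define e where "e = \<epsilon> / 2"
    have e: "0 < e" "e < \<epsilon>" using \<epsilon> by (simp_all add: e_def)
    have "uniformly_continuous_on ({0..t + 1} \<times> {0..1}) (\<lambda>p. v (fst p) (snd p))"
      by (intro compact_uniformly_continuous continuous_on_subset[OF v] compact_Times) auto
    from this[unfolded uniformly_continuous_on_def] e(1) obtain d where d: "0 < d"
      "\<forall>p\<in>{0..t + 1} \<times> {0..1}. \<forall>p'\<in>{0..t + 1} \<times> {0..1}. dist p' p < d \<longrightarrow> dist (v (fst p') (snd p')) (v (fst p) (snd p)) < e"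
      by meson
    have vd: "\<bar>v \<tau> x - v t x\<bar> \<le> e" if "\<tau> \<in> {0..t + 1}" "\<bar>\<tau> - t\<bar> < d" "x \<in> {0..1}" for \<tau> x
    proof -
      have "dist (\<tau>, x) (t, x) < d" using that(2) by (simp add: dist_Pair_Pair dist_real_def)
      then have "dist (v \<tau> x) (v t x) < e" using d(2)[rule_format, of "(t, x)" "(\<tau>, x)"] that t by simp
      then show ?thesis by (simp add: dist_real_def)
    qed
    have qb: "\<bar>q s x\<bar> \<le> e" if s: "0 \<le> s" "s \<noteq> t" "\<bar>s - t\<bar> < min d 1" and x: "x \<in> {0..1}" for s x
    proof -
      let ?S = "{0..t + 1} \<inter> ball t d"
      have tS: "t \<in> ?S" and sS: "s \<in> ?S" using s t d(1) by (auto simp: dist_real_def abs_minus_commute)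
      have "norm ((z s x - s * v t x) - (z t x - t * v t x)) \<le> e * norm (s - t)"
      proof (rule field_differentiable_bound[OF _ _ _ sS tS])
        show "convex ?S" by (intro convex_Int convex_ball) auto
        fix \<tau> assume \<tau>: "\<tau> \<in> ?S"
        have \<tau>0: "\<tau> \<in> {0..t + 1}" using \<tau> by simp
        have "((\<lambda>\<tau>. integral {0..\<tau>} (\<lambda>\<tau>. v \<tau> x)) has_real_derivative v \<tau> x) (at \<tau> within {0..t + 1})"
          by (rule integral_has_real_derivative[OF vt \<tau>0])
        then have "((\<lambda>\<tau>. z 0 x + integral {0..\<tau>} (\<lambda>\<tau>. v \<tau> x)) has_real_derivative v \<tau> x) (at \<tau> within {0..t + 1})"
          using DERIV_add[OF DERIV_const] by fastforce
        then have "((\<lambda>\<tau>. z \<tau> x) has_real_derivative v \<tau> x) (at \<tau> within {0..t + 1})"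
          by (rule has_field_derivative_transform_within[of _ _ _ _ 1])
            (use \<tau>0 x in \<open>auto simp only: z[symmetric] atLeastAtMost_iff\<close>)
        then have "((\<lambda>\<tau>. z \<tau> x) has_real_derivative v \<tau> x) (at \<tau> within ?S)" by (rule DERIV_subset) simp
        then show "((\<lambda>\<tau>. z \<tau> x - \<tau> * v t x) has_real_derivative v \<tau> x - v t x) (at \<tau> within ?S)"
          by (rule DERIV_diff) (auto intro!: derivative_eq_intros)
        show "norm (v \<tau> x - v t x) \<le> e"
          unfolding real_norm_def by (rule vd[OF \<tau>0 _ x]) (use \<tau> in \<open>simp add: dist_real_def abs_minus_commute\<close>)
      qed
      moreover have "(z s x - s * v t x) - (z t x - t * v t x) = q s x * (s - t)"
        using s(2) by (simp add: q_def field_simps)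
      ultimately have "\<bar>q s x\<bar> * \<bar>s - t\<bar> \<le> e * \<bar>s - t\<bar>" by (simp add: abs_mult)
      then show ?thesis using s(2) by (simp add: mult_le_cancel_right)
    qed
    have "\<forall>\<^sub>F s in at t within {0..}. dist s t < min d 1 \<and> s \<in> {0..} \<and> s \<noteq> t"
    proof (intro eventually_conj)
      show "\<forall>\<^sub>F s in at t within {0..}. dist s t < min d 1"
        unfolding eventually_at using d(1) by (intro exI[of _ "min d 1"]) auto
      show "\<forall>\<^sub>F s in at t within {0..}. s \<in> {0..}" "\<forall>\<^sub>F s in at t within {0..}. s \<noteq> t"
        unfolding eventually_at by (intro exI[of _ 1]; simp)+
    qed
    then show "\<forall>\<^sub>F s in at t within {0..}. dist (Lp_norm \<infinity> (q s)) 0 < \<epsilon>"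
    proof eventually_elim
      case (elim s)
      have s: "0 \<le> s" "s \<noteq> t" "\<bar>s - t\<bar> < min d 1" using elim by (simp_all add: dist_real_def)
      have "0 \<le> Lp_norm \<infinity> (q s)" by (rule Lp_norm_inf(1)[OF continuous_Lp_inf(1)[OF qc[OF s(1)]]])
      moreover have "Lp_norm \<infinity> (q s) \<le> e" by (rule continuous_Lp_inf(2)[OF qc[OF s(1)] qb[OF s]])
      ultimately show ?case using e(2) by (simp add: dist_real_def)
    qed
  qed
  then show ?thesis unfolding has_time_deriv_def q_def using continuous_Lp_inf(1)[OF vx] by blast
qed

text \<open>The space derivative of \<open>z\<close> is the even part of \<open>r\<close>, the velocity is its odd part.\<close>

lemma state_estimate:
  assumes r: "continuous_on UNIV r" "\<And>y. \<bar>r y\<bar> \<le> N"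
    and z: "\<And>x. x \<in> {0..1} \<Longrightarrow> z x = (LBINT y:{-x..x}. r y) / 2" "z 1 = 0"
    and v: "v = (\<lambda>x. (r x - r (- x)) / 2)"
  shows "(z, v) \<in> H_space \<infinity>" "H_norm \<infinity> (z, v) \<le> 2 * N"
proof -
  have I: "{0<..<1} \<in> sets (borel :: real measure)" by simp
  have rc: "continuous_on Y r" "continuous_on Y (\<lambda>y. r (- y))" for Y
    by (rule continuous_on_subset[OF r(1)], simp) (rule continuous_on_compose2[OF r(1)], auto intro!: continuous_intros)
  define g where "g = (\<lambda>y. (r y + r (- y)) / 2)"
  have gc: "continuous_on Y g" and vc: "continuous_on Y v" for Y unfolding g_def v by (intro continuous_intros rc; simp)+
  have vb: "\<bar>v x\<bar> \<le> N" for x unfolding v by (rule abs_half_diff_le[OF r(2) r(2)])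
  have gb: "\<bar>g x\<bar> \<le> N" for x
    using abs_half_diff_le[of "r x" N "- r (- x)"] r(2)[of x] r(2)[of "- x"] by (simp add: g_def)
  have ri: "set_integrable lborel {u..w} r" "set_integrable lborel {u..w} (\<lambda>y. r (- y))" for u w
    by (rule set_integral_continuous_eq_integral(1)[OF rc(1)], rule set_integral_continuous_eq_integral(1)[OF rc(2)])
  have zg: "z x = integral {0..x} g" if x: "x \<in> {0..1}" for x
  proof -
    have "(LBINT y:{-x..x}. r y) = (LBINT y:{-x..0}. r y) + (LBINT y:{0..x}. r y)"
      by (rule set_integral_combine[OF ri(1)]) (use x in auto)
    also have "\<dots> = (LBINT y:{0..x}. r y + r (- y))"
      unfolding set_integral_reflect set_integral_add(2)[OF ri] by simp
    finally have "z x = (LBINT y:{0..x}. g y)"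
      unfolding z(1)[OF x] g_def by (simp only: set_integral_divide_zero)
    then show ?thesis by (simp only: set_integral_continuous_eq_integral(2)[OF gc])
  qed
  have z0: "z 0 = 0" using zg[of 0] by simp
  have zc: "continuous_on {0..1} z"
  proof -
    have "continuous_on {0..1} (\<lambda>x. integral {0..x} g)"
      by (rule indefinite_integral_continuous_1[OF integrable_continuous_real[OF gc]])
    then show ?thesis by (rule continuous_on_eq) (simp only: zg)
  qed
  have wd: "is_weak_deriv z g" by (rule weak_derivI[OF gc]) (simp add: zg[symmetric] z0)
  have zW: "z \<in> W1 \<infinity>" unfolding W1_def using wd continuous_Lp_inf(1)[OF zc] continuous_Lp_inf(1)[OF gc] by blast
  then show "(z, v) \<in> H_space \<infinity>"
    unfolding H_space_def W10_def using zc z0 z(2) continuous_Lp_inf(1)[OF vc] by blast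
  have "AE x in I01. \<bar>wderiv z x\<bar> \<le> N"
    unfolding AE_lebesgue_on_iff[OF I] using weak_deriv_unique[OF W1_inf_wderiv(1)[OF zW] wd]
    by eventually_elim (simp add: gb)
  then have "Lp_norm \<infinity> (wderiv z) \<le> N" by (rule Lp_norm_inf(3)[OF W1_inf_wderiv(2)[OF zW]])
  moreover have "Lp_norm \<infinity> v \<le> N" by (rule continuous_Lp_inf(2)[OF vc vb])
  ultimately show "H_norm \<infinity> (z, v) \<le> 2 * N" by (simp add: H_norm_def)
qed

text \<open>The quotient \<open>\<sigma> d / d\<close>, extended by \<open>\<sigma>'(0)\<close> at \<open>d = 0\<close>, is continuous and positive on \<open>[0, R]\<close>.\<close>

lemma damping_lower_bound:
  assumes \<sigma>: "nonlinear_damping \<sigma>" "continuous_on UNIV \<sigma>" and R: "0 < R"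
  obtains c where "0 < c" "\<And>d. d \<in> {0..R} \<Longrightarrow> c * d \<le> \<sigma> d"
proof -
  obtain C1 where C1: "0 < C1" "(\<sigma> has_real_derivative C1) (at 0)" and pos: "\<And>d. d \<noteq> 0 \<Longrightarrow> 0 < \<sigma> d * d"
    and odd: "\<And>d. \<sigma> (- d) = - \<sigma> d"
    using \<sigma>(1) unfolding nonlinear_damping_def by blast
  have s0: "\<sigma> 0 = 0" using odd[of 0] by simp
  define q where "q = (\<lambda>d. if d = 0 then C1 else \<sigma> d / d)"
  have "isCont q d" for d
  proof (cases "d = 0")
    case True
    have "((\<lambda>h. \<sigma> h / h) \<longlongrightarrow> C1) (at 0)" using C1(2) by (simp add: DERIV_def s0)
    then have "(q \<longlongrightarrow> C1) (at 0)"
      by (rule filterlim_cong[THEN iffD1, rotated 3]) (auto simp: q_def eventually_at intro!: exI[of _ 1])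
    then show ?thesis using True by (simp add: isCont_def q_def)
  next
    case False
    have "isCont \<sigma> d" using \<sigma>(2) by (simp add: continuous_on_eq_continuous_at)
    then have "isCont (\<lambda>d. \<sigma> d / d) d" using False by (intro continuous_intros)
    moreover have "\<forall>\<^sub>F x in nhds d. q x = \<sigma> x / x"
      using t1_space_nhds[OF False] by eventually_elim (simp add: q_def)
    ultimately show ?thesis by (subst isCont_cong)
  qed
  then have qc: "continuous_on {0..R} q" by (simp add: continuous_at_imp_continuous_on)
  obtain d0 where d0: "d0 \<in> {0..R}" "\<And>d. d \<in> {0..R} \<Longrightarrow> q d0 \<le> q d"
    using continuous_attains_inf[OF compact_Icc _ qc] R by auto
  show ?thesis
  proof (rule that)
    show "0 < q d0"
    proof (cases "d0 = 0")
      case False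
      then have "0 < \<sigma> d0 * d0" "0 < d0" using pos d0(1) by auto
      then show ?thesis using False by (simp add: q_def zero_less_mult_iff)
    qed (simp add: q_def C1)
    fix d assume d: "d \<in> {0..R}"
    show "q d0 * d \<le> \<sigma> d"
    proof (cases "d = 0")
      case False
      then have "0 < d" using d by simp
      moreover have "q d0 \<le> \<sigma> d / d" using d0(2)[OF d] False by (simp add: q_def)
      ultimately show ?thesis by (simp add: field_simps)
    qed (simp add: s0)
  qed
qed

text \<open>Freezing \<open>\<sigma>\<close> outside \<open>[-M, M]\<close> makes it globally Lipschitz and keeps the bounds that the decay estimate needs.\<close>

lemma truncated_damping:
  fixes \<sigma> :: "real \<Rightarrow> real"
  assumes D: "\<And>d. (\<sigma> has_real_derivative \<sigma>' d) (at d)" "continuous_on UNIV \<sigma>'"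
    and odd: "\<And>d. \<sigma> (- d) = - \<sigma> d" and pos: "\<And>d. d \<noteq> 0 \<Longrightarrow> 0 < \<sigma> d * d" and m: "0 \<le> m" "\<And>d. \<bar>\<sigma> d\<bar> \<le> m * \<bar>d\<bar>"
    and c: "c \<le> m" "\<And>d. d \<in> {0..R} \<Longrightarrow> c * d \<le> \<sigma> d" and M: "R \<le> M" "0 \<le> M"
  obtains s L where "L-lipschitz_on UNIV s" "\<And>d. s (- d) = - s d" "\<And>d. \<bar>d\<bar> \<le> M \<Longrightarrow> s d = \<sigma> d"
    "sector_on UNIV 0 m s" "sector_on {-R..R} c m s"
proof -
  define k where "k = (\<lambda>d. max (- M) (min M d))"
  define s where "s = (\<lambda>d. \<sigma> (k d))"
  have k: "k d \<in> {-M..M}" for d using M by (auto simp: k_def)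
  have s0: "\<sigma> 0 = 0" using odd[of 0] by simp
  have kodd: "k (- d) = - k d" for d using M(2) by (auto simp: k_def max_def min_def)
  have sodd: "s (- d) = - s d" for d by (simp add: s_def kodd odd)
  have "compact (\<sigma>' ` {-M..M})" by (rule compact_continuous_image[OF continuous_on_subset[OF D(2)]]) auto
  then obtain L where L: "\<And>d. d \<in> {-M..M} \<Longrightarrow> \<bar>\<sigma>' d\<bar> \<le> L"
    using compact_imp_bounded bounded_iff by (metis image_eqI real_norm_def)
  have L0: "0 \<le> L" using L[of 0] M(2) by simp
  have "L-lipschitz_on UNIV s"
  proof (rule lipschitz_onI[OF _ L0])
    fix x y
    have "norm (\<sigma> (k x) - \<sigma> (k y)) \<le> L * norm (k x - k y)"
      by (rule field_differentiable_bound[of "{-M..M}" \<sigma> \<sigma>'])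
        (use L k D(1) in \<open>auto intro: has_field_derivative_at_within\<close>)
    moreover have "\<bar>k x - k y\<bar> \<le> \<bar>x - y\<bar>" using M(2) by (simp add: k_def max_def min_def)
    ultimately show "dist (s x) (s y) \<le> L * dist x y"
      using mult_left_mono[OF _ L0] unfolding dist_real_def s_def real_norm_def by (meson order_trans)
  qed
  moreover have eq: "s d = \<sigma> d" if "\<bar>d\<bar> \<le> M" for d
  proof -
    have "k d = d" using that unfolding k_def by linarith
    then show ?thesis by (simp add: s_def)
  qed
  moreover have up: "0 \<le> s d \<and> s d \<le> m * d" if d: "0 \<le> d" for d
  proof -
    have kd: "0 \<le> k d" "k d \<le> d" using d M(2) by (auto simp: k_def)
    have "0 \<le> \<sigma> (k d)"
    proof (cases "k d = 0")
      case False
      then have "0 < k d" using kd by simp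
      then show ?thesis using pos[of "k d"] by (simp add: zero_less_mult_iff)
    qed (simp add: s0)
    moreover have "\<sigma> (k d) \<le> m * k d" using m(2)[of "k d"] kd(1) by simp
    moreover have "m * k d \<le> m * d" by (rule mult_left_mono[OF kd(2) m(1)])
    ultimately show ?thesis by (simp add: s_def)
  qed
  have "sector_on UNIV 0 m s"
    unfolding sector_on_def
  proof (intro ballI conjI impI)
    fix d :: real
    show "0 * d \<le> s d" "s d \<le> m * d" if "0 \<le> d" using up[OF that] by simp_all
    show "m * d \<le> s d" "s d \<le> 0 * d" if "d \<le> 0" using up[of "- d"] that sodd[of d] by simp_all
  qed
  moreover have "sector_on {-R..R} c m s"
    unfolding sector_on_def
  proof (intro ballI conjI impI)
    have low: "c * d \<le> s d" if "0 \<le> d" "d \<le> R" for d using c(2)[of d] eq[of d] that M by simp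
    fix d :: real assume d: "d \<in> {-R..R}"
    show "c * d \<le> s d" "s d \<le> m * d" if "0 \<le> d" using up[OF that] low[of d] d that by simp_all
    show "m * d \<le> s d" "s d \<le> c * d" if "d \<le> 0" using up[of "- d"] low[of "- d"] d that sodd[of d] by simp_all
  qed
  ultimately show ?thesis by (intro that[of L s] sodd)
qed

section \<open>Exponential decay of the wave equation\<close>

lemma positive_on_interval:
  fixes a :: "real \<Rightarrow> real"
  assumes a: "continuous_on {0..1} a" and x0: "x0 \<in> {0..1}" "0 < a x0"
  obtains \<alpha> \<beta> where "0 \<le> \<alpha>" "\<alpha> < \<beta>" "\<beta> \<le> 1" "\<And>x. x \<in> {\<alpha>..\<beta>} \<Longrightarrow> a x0 / 2 \<le> a x"
proof -
  have "0 < a x0 / 2" using x0(2) by simp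
  then obtain d where d: "0 < d" "\<And>x. x \<in> {0..1} \<Longrightarrow> dist x x0 < d \<Longrightarrow> dist (a x) (a x0) < a x0 / 2"
    using a x0(1) unfolding continuous_on_iff by blast
  define \<alpha> where "\<alpha> = max 0 (x0 - d / 2)"
  define \<beta> where "\<beta> = min 1 (x0 + d / 2)"
  have ab: "0 \<le> \<alpha>" "\<beta> \<le> 1" "\<alpha> < \<beta>" using d(1) x0(1) by (auto simp: \<alpha>_def \<beta>_def)
  moreover have "a x0 / 2 \<le> a x" if x: "x \<in> {\<alpha>..\<beta>}" for x
  proof -
    have "x \<in> {0..1}" using x ab by simp
    moreover have "dist x x0 < d" using x d(1) by (auto simp: \<alpha>_def \<beta>_def dist_real_def)
    ultimately have "\<bar>a x - a x0\<bar> < a x0 / 2" using d(2) by (simp add: dist_real_def)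
    then show ?thesis by linarith
  qed
  ultimately show ?thesis by (intro that)
qed

theorem theorem3:
  fixes a a' \<sigma> \<sigma>' :: "real \<Rightarrow> real" and a_inf a_1 m R :: real
  assumes "continuous_on {0..1} a"
    and "\<And>x. x \<in> {0..1} \<Longrightarrow> 0 \<le> a x"
    and "\<exists>x\<in>{0..1}. a x \<noteq> 0"
    and "a_inf > 0"
    and "\<And>x. x \<in> {0..1} \<Longrightarrow> a x \<le> a_inf"
    and "nonlinear_damping \<sigma>"
    and "\<And>s. (\<sigma> has_real_derivative \<sigma>' s) (at s)"
    and "continuous_on UNIV \<sigma>'"
    and "\<And>x. x \<in> {0..1} \<Longrightarrow> (a has_real_derivative a' x) (at x within {0..1})"
    and "continuous_on {0..1} a'"
    and "a_1 > 0"
    and "AE x in lebesgue_on {0..1}. \<bar>a' x\<bar> \<le> a_1"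
    and "m > 0"
    and "\<And>s. \<bar>\<sigma> s\<bar> \<le> m * \<bar>s\<bar>"
    and "R > 0"
  shows "\<exists>K>0. \<exists>\<beta>>0. \<forall>z0 z1.
     (z0, z1) \<in> D_space \<infinity> \<and>
     (\<forall>x\<in>{0, 1}. has_trace (wderiv z0) x 0 \<and> has_trace (wderiv z1) x 0) \<and>
     D_norm \<infinity> (z0, z1) \<le> R \<longrightarrow>
     (\<forall>z. wave_solution a \<sigma> z0 z1 z \<longrightarrow>
        (\<forall>t\<ge>0. \<exists>zt. has_time_deriv z t zt \<and> (z t, zt) \<in> H_space \<infinity> \<and>
           H_norm \<infinity> (z t, zt) \<le> K * exp (- \<beta> * t) * D_norm 2 (z0, z1)))"
proof -
  have odd: "\<sigma> (- d) = - \<sigma> d" and pos: "d \<noteq> 0 \<Longrightarrow> 0 < \<sigma> d * d" for d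
    using assms(6) unfolding nonlinear_damping_def by blast+
  have \<sigma>c: "continuous_on UNIV \<sigma>"
    by (rule DERIV_continuous_on) (rule has_field_derivative_at_within[OF assms(7)])
  obtain c1 where c1: "0 < c1" "\<And>d. d \<in> {0..R} \<Longrightarrow> c1 * d \<le> \<sigma> d"
    using damping_lower_bound[OF assms(6) \<sigma>c assms(15)] by blast
  define c where "c = min c1 m"
  have c: "0 < c" "c \<le> m" using c1(1) assms(13) by (simp_all add: c_def)
  have cd: "c * d \<le> \<sigma> d" if "d \<in> {0..R}" for d
    using mult_right_mono[of c c1 d] c1(2)[OF that] that by (simp add: c_def)
  define b where "b = (\<lambda>y. a (fold01 y))"
  have b: "0 \<le> b y" "b y \<le> a_inf" "continuous_on UNIV b" "b (y + 2) = b y" "b (- y) = b y" for y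
    unfolding b_def
    by (rule assms(2)[OF fold01_range], rule assms(5)[OF fold01_range],
        rule continuous_on_compose2[OF assms(1) fold01_continuous], use fold01_range in blast,
        simp add: fold01_periodic, simp)
  have bA: "\<bar>b y\<bar> \<le> a_inf" for y using b(1)[of y] b(2)[of y] by simp
  obtain x0 where x0: "x0 \<in> {0..1}" "0 < a x0" using assms(2,3) by (metis order_le_less)
  obtain \<alpha> \<beta> where ab: "0 \<le> \<alpha>" "\<alpha> < \<beta>" "\<beta> \<le> 1" "\<And>x. x \<in> {\<alpha>..\<beta>} \<Longrightarrow> a x0 / 2 \<le> a x"
    using positive_on_interval[OF assms(1) x0] by blast
  have a0: "0 < a x0 / 2" "\<beta> \<le> \<alpha> + 2" using x0(2) ab by simp_all
  have ba: "a x0 / 2 \<le> b y" if "y \<in> {\<alpha>..\<beta>}" for y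
    using ab(4)[OF that] fold01_id[of y] ab that by (simp add: b_def)
  show ?thesis
  proof (rule damped_transport_decay[OF b(1,2,3,4) a0(1) ba ab(2) a0(2) c, where R = R])
    fix K \<gamma> :: real
    assume K: "0 < K" "0 < \<gamma>"
      "\<And>r s B t y. \<lbrakk>damped_transport b s r; \<And>d. s (- d) = - s d; sector_on UNIV 0 m s; sector_on {-R..R} c m s;
        \<And>t. 0 \<le> t \<Longrightarrow> integral {-1..1} (r t) = 0; \<And>y. \<bar>r 0 y\<bar> \<le> B; B \<le> R; 0 \<le> t\<rbrakk>
        \<Longrightarrow> \<bar>r t y\<bar> \<le> K * exp (- \<gamma> * t) * B"
    show ?thesis
    proof (rule exI[of _ "2 * K"], intro conjI exI[of _ \<gamma>] allI impI)
      show "0 < 2 * K" "0 < \<gamma>" using K(1,2) by simp_all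
      fix z0 z1 z and t :: real
      assume dat: "(z0, z1) \<in> D_space \<infinity> \<and>
        (\<forall>x\<in>{0, 1}. has_trace (wderiv z0) x 0 \<and> has_trace (wderiv z1) x 0) \<and> D_norm \<infinity> (z0, z1) \<le> R"
        and sol: "wave_solution a \<sigma> z0 z1 z" and t: "0 \<le> t"
      have D: "(z0, z1) \<in> D_space \<infinity>" and DR: "D_norm \<infinity> (z0, z1) \<le> R" using dat by blast+
      obtain p0 where p0: "continuous_on {0..1} p0" "\<And>x. x \<in> {0..1} \<Longrightarrow> z0 x = integral {0..x} p0"
        and z1: "continuous_on {0..1} z1" "z1 0 = 0" "z1 1 = 0"
        and D1: "\<And>x y. x \<in> {0..1} \<Longrightarrow> y \<in> {0..1} \<Longrightarrow> \<bar>p0 x\<bar> + \<bar>z1 y\<bar> \<le> D_norm \<infinity> (z0, z1)"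
        and D2: "\<And>x y. x \<in> {0..1} \<Longrightarrow> y \<in> {0..1} \<Longrightarrow> \<bar>p0 x\<bar> + \<bar>z1 y\<bar> \<le> D_norm 2 (z0, z1)"
        using initial_data[OF D] by blast
      \<comment> \<open>The decay estimate needs a bound of the initial value below \<open>R\<close>, the conclusion one by the norm in \<open>D\<^sub>2\<close>.\<close>
      define B0 where "B0 = min (D_norm \<infinity> (z0, z1)) (D_norm 2 (z0, z1))"
      have B0: "B0 \<le> R" "B0 \<le> D_norm 2 (z0, z1)" using DR by (simp_all add: B0_def)
      define r0 where "r0 = (\<lambda>y. p0 (fold01 y) + side y * z1 (fold01 y))"
      have r0c: "continuous_on UNIV r0"
        unfolding r0_def
        by (intro continuous_on_add odd_extension_continuous z1 continuous_on_compose2[OF p0(1) fold01_continuous])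
          (use fold01_range in blast)
      have r0p: "r0 (y + 2) = r0 y" for y by (simp add: r0_def fold01_periodic side_periodic)
      have r0b: "\<bar>r0 y\<bar> \<le> B0" for y
      proof -
        have "\<bar>side y\<bar> * \<bar>z1 (fold01 y)\<bar> \<le> 1 * \<bar>z1 (fold01 y)\<bar>" by (rule mult_right_mono[OF abs_side_le]) simp
        then have "\<bar>r0 y\<bar> \<le> \<bar>p0 (fold01 y)\<bar> + \<bar>z1 (fold01 y)\<bar>"
          unfolding r0_def using abs_triangle_ineq[of "p0 (fold01 y)" "side y * z1 (fold01 y)"] by (simp add: abs_mult)
        then show ?thesis
          using D1[OF fold01_range fold01_range, of y y] D2[OF fold01_range fold01_range, of y y] by (simp add: B0_def)
      qed
      have m0: "0 \<le> m" using assms(13) by simp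
      have ba': "b x = a x" if "x \<in> {0<..<1}" for x using fold01_id[of x] that by (simp add: b_def)
      obtain W X C where WC: "\<And>t x. \<bar>W t x\<bar> \<le> C" and
        ww: "weak_wave (\<lambda>t x. z (max 0 t) (max 0 (min 1 x))) W X (\<lambda>t x. - b x * \<sigma> (W t x)) z1 (max C (a_inf * (m * C)))"
      proof (rule wave_solution_representative[OF sol z1(1) \<sigma>c assms(14) m0 b(3) bA ba'])
        fix W X C assume "\<And>t x. \<bar>W t x\<bar> \<le> C"
          "weak_wave (\<lambda>t x. z (max 0 t) (max 0 (min 1 x))) W X (\<lambda>t x. - b x * \<sigma> (W t x)) z1 (max C (a_inf * (m * C)))"
        then show thesis by (rule that)
      qed
      \<comment> \<open>Truncation at \<open>M\<close> changes neither \<open>\<sigma> (W t x)\<close> nor the values of \<open>\<sigma>\<close> on \<open>[-R, R]\<close>.\<close>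
      define M where "M = max C R"
      have M: "R \<le> M" "0 \<le> M" "C \<le> M" using assms(15) by (simp_all add: M_def)
      obtain s L where s: "L-lipschitz_on UNIV s" "\<And>d. s (- d) = - s d" "\<And>d. \<bar>d\<bar> \<le> M \<Longrightarrow> s d = \<sigma> d"
        "sector_on UNIV 0 m s" "sector_on {-R..R} c m s"
      proof (rule truncated_damping[OF assms(7,8) odd pos m0 assms(14) c(2) cd M(1,2)])
        fix s L assume "L-lipschitz_on UNIV s" "\<And>d. s (- d) = - s d" "\<And>d. \<bar>d\<bar> \<le> M \<Longrightarrow> s d = \<sigma> d"
          "sector_on UNIV 0 m s" "sector_on {-R..R} c m s"
        then show thesis by (rule that)
      qed
      have s0: "s 0 = 0" using s(2)[of 0] by simp
      obtain r where dt: "damped_transport b s r" "r 0 = r0"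
        using damped_transport_exists[OF b(3) bA b(4) s(1) s0 r0c r0b r0p] by blast
      have rb: "\<bar>r t y\<bar> \<le> B0" if "0 \<le> t" for t y
        by (rule damped_transport_bounded[OF dt(1) b(1,2) s(4,2) m0 _ that]) (simp add: dt(2) r0b)
      have zI: "z (max 0 t) (max 0 (min 1 x)) = z t x" if "0 \<le> t" "x \<in> {0..1}" for t x using that by simp
      have init: "z 0 x = z0 x" if "x \<in> {0..1}" for x using sol that unfolding wave_solution_def by blast
      interpret identified_wave "\<lambda>t x. z (max 0 t) (max 0 (min 1 x))" W X "\<lambda>t x. - b x * \<sigma> (W t x)" z1
        "max C (a_inf * (m * C))" p0 b s r a_inf L B0
      proof (intro identified_wave.intro ww identified_wave_axioms.intro)
        show "z (max 0 0) (max 0 (min 1 x)) = integral {0..x} p0" if "x \<in> {0..1}" for x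
          using zI[of 0 x] init[OF that] p0(2)[OF that] that by simp
        have "s (W t x) = \<sigma> (W t x)" for t x by (rule s(3)[OF order_trans[OF WC M(3)]])
        then show "- b x * \<sigma> (W t x) = - b x * s (W t x)" for t x by simp
        show "r 0 = (\<lambda>y. p0 (fold01 y) + side y * z1 (fold01 y))" by (simp only: dt(2) r0_def)
      qed (rule p0 z1 b bA s dt rb; assumption?)+
      have decay: "\<bar>r t y\<bar> \<le> K * exp (- \<gamma> * t) * B0" for y
        by (rule K(3)[OF dt(1) s(2) s(4) s(5) r_mean_zero _ B0(1) t]) (simp_all add: dt(2) r0b)
      have v: "vel t = (\<lambda>x. (r t x - r t (- x)) / 2)" using t by (simp add: vel_def fun_eq_iff)
      have zt: "z t x = (LBINT y:{-x..x}. r t y) / 2" if "x \<in> {0..1}" for x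
        using z_space[OF t that] zI[OF t that] by simp
      have z1t: "z t 1 = 0" using z_bdry(2)[of t] zI[OF t, of 1] by simp
      have zs: "continuous_on {0..1} (z t)" if "0 \<le> t" for t
        using continuous_on_eq[OF z_section[of "{0..1}" t]] zI[OF that] by blast
      have zv: "z t x = z 0 x + integral {0..t} (\<lambda>\<tau>. vel \<tau> x)" if "0 \<le> t" "x \<in> {0..1}" for t x
        using z_eq[OF that] zI[OF that] zI[OF order_refl that(2)] by simp
      note state = state_estimate[OF damped_transport_continuous[OF dt(1) t] decay zt z1t v]
      have "H_norm \<infinity> (z t, vel t) \<le> 2 * (K * exp (- \<gamma> * t) * B0)" by (rule state(2))
      also have "\<dots> \<le> 2 * (K * exp (- \<gamma> * t) * D_norm 2 (z0, z1))"
        using K(1) B0(2) by (intro mult_left_mono) auto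
      also have "\<dots> = 2 * K * exp (- \<gamma> * t) * D_norm 2 (z0, z1)" by (simp only: mult.assoc)
      finally have "H_norm \<infinity> (z t, vel t) \<le> 2 * K * exp (- \<gamma> * t) * D_norm 2 (z0, z1)" .
      moreover have "has_time_deriv z t (vel t)" by (rule has_time_deriv_of_integral[OF zv zs vel_cont t])
      ultimately show "\<exists>zt. has_time_deriv z t zt \<and> (z t, zt) \<in> H_space \<infinity> \<and>
             H_norm \<infinity> (z t, zt) \<le> 2 * K * exp (- \<gamma> * t) * D_norm 2 (z0, z1)"
        using state(1) by blast
    qed
  qed
qed

end
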